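(* (a) If $W_{1,m}$ and $W_{2,m}$ are representations of $\mathfrak S_m$, then $$w(W_{1,m}\otimes W_{2,m})\le w(W_{1,m})+w(W_{2,m}).$$ (b) Let $N\in\mathbb N$. If $\mathcal W_1=\{W_{1,m}\}_m$ and $\mathcal W_2=\{W_{2,m}\}_m$ are $\mathrm{FB}$-modules which are $\mathrm{PC}_{m\ge N}$, then $$w(W_{1,m}\otimes W_{2,m})=w(W_{1,m})+w(W_{2,m})$$ for all $m\ge 2\,(w(W_{1,m})+w(W_{2,m}))$. In particular, $$w((\mathcal W_1\otimes\mathcal W_2)_{\ge N})=w((\mathcal W_1)_{\ge N})+w((\mathcal W_2)_{\ge N}).$$ (c) For all partitions $\lambda,\mu$, one has $w(V_{\lambda[m]}\otimes V_{\mu[m]})=|\lambda|+|\mu|$ for all $m\ge 2(|\lambda|+|\mu|)$.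
   Context: $\mathbb N=\{0,1,2,\dots\}$. $\mathfrak S_m$ is the symmetric group on $\{1,\dots,m\}$; representations (= $\mathfrak S_m$-modules) are finite dimensional over $\mathbb Q$. For a partition $\nu\vdash m$, $V_\nu$ is the associated simple $\mathfrak S_m$-module ($V_{(m)}$ is trivial). For a partition $\lambda=(\lambda_1\ge\dots\ge\lambda_\ell)$ (possibly empty) and $m\ge|\lambda|+\lambda_1$, $\lambda[m]:=(m-|\lambda|,\lambda_1,\dots,\lambda_\ell)\vdash m$. Weights: for $\lambda=(\lambda_1\ge\dots\ge\lambda_\ell>0)$, $w(\lambda)=\lambda_2+\dots+\lambda_\ell$ (and $w(\emptyset)=0$). For an $\mathfrak S_m$-module $W_m\cong\bigoplus_{\mu\vdash m}V_\mu^{\,n_\mu}$, $w(W_m)=\sup\{w(\mu):n_\mu\ne0\}$ ($-\infty$ if $W_m=0$). An $\mathrm{FB}$-module is a family $\mathcal W=\{W_m\}_{m\in\mathbb N}$ with $W_m$ an $\mathfrak S_m$-module; its weight is $w(\mathcal W)=\sup_m w(W_m)$. The tensor product is termwise: $(\mathcal W_1\otimes\mathcal W_2)_m=W_{1,m}\otimes W_{2,m}$ with diagonal action. The truncation $(\mathcal W)_{\ge N}$ is obtained by replacing $W_n$ by $0$ for all $n<N$. $\mathcal W$ is $\mathrm{PC}_{m\ge N}$ (polynomial character for $m\ge N$) if there is a polynomial $P_{\mathcal W}\in\mathbb Q[X_1,X_2,\dots]$ such that, for all $m\ge N$ and $g\in\mathfrak S_m$, the character of $W_m$ at $g$ equals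 $P_{\mathcal W}(X_1(g),X_2(g),\dots)$, where $X_i(g)$ is the number of $i$-cycles in the disjoint cycle decomposition of $g$ in $\mathfrak S_m$ (fixed points are $1$-cycles). *)

theory Defs
  imports
    "HOL-Library.Extended_Real"
    "HOL-Library.Function_Algebras"
    "HOL-Library.Poly_Mapping"
    "HOL-Combinatorics.Permutations"
    "HOL-Combinatorics.Orbits"
    "Jordan_Normal_Form.Matrix"
begin

section \<open>Partitions\<close>

definition is_partition :: "nat list \<Rightarrow> bool" where
  "is_partition \<nu> \<longleftrightarrow> sorted_wrt (\<ge>) \<nu> \<and> 0 \<notin> set \<nu>"

definition partition_of :: "nat \<Rightarrow> nat list \<Rightarrow> bool" where
  "partition_of m \<nu> \<longleftrightarrow> is_partition \<nu> \<and> sum_list \<nu> = m"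

definition partition_weight :: "nat list \<Rightarrow> nat" where
  "partition_weight \<nu> = sum_list (tl \<nu>)"

text \<open>The partition \<open>\<nu>[m] = (m - |\<nu>|, \<nu>\<^sub>1, \<dots>, \<nu>\<^sub>\<ell>)\<close>, meant for \<open>m \<ge> |\<nu>| + \<nu>\<^sub>1\<close>. In that range the
  first part vanishes only for \<open>\<nu> = \<emptyset>\<close> and \<open>m = 0\<close>, where \<open>\<nu>[0] = (0)\<close> is the empty partition.\<close>

definition padded :: "nat list \<Rightarrow> nat \<Rightarrow> nat list" where
  "padded \<nu> m = removeAll 0 ((m - sum_list \<nu>) # \<nu>)"

lemma partition_of_padded:
  assumes "is_partition \<nu>" and "m \<ge> sum_list \<nu> + (if \<nu> = [] then 0 else hd \<nu>)"
  shows "partition_of m (padded \<nu> m)"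
proof (cases "m = sum_list \<nu>")
  case True
  with assms have "\<nu> = []"
    by (cases \<nu>) (auto simp: is_partition_def)
  with True show ?thesis
    by (simp add: partition_of_def padded_def is_partition_def)
next
  case False
  have "removeAll 0 \<nu> = \<nu>"
    using assms(1) by (auto simp: is_partition_def removeAll_id)
  moreover have "x \<le> m - sum_list \<nu>" if "x \<in> set \<nu>" for x
    using that assms by (cases \<nu>) (auto simp: is_partition_def)
  moreover have "sum_list \<nu> \<le> m"
    using assms(2) by simp
  ultimately show ?thesis
    using False assms(1) by (auto simp: partition_of_def padded_def is_partition_def)
qed

lemma partition_weight_padded:
  assumes "is_partition \<nu>" and "m \<ge> sum_list \<nu> + (if \<nu> = [] then 0 else hd \<nu>)"
  shows "partition_weight (padded \<nu> m) = sum_list \<nu>"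
proof (cases "m = sum_list \<nu>")
  case True
  with assms have "\<nu> = []"
    by (cases \<nu>) (auto simp: is_partition_def)
  with True show ?thesis
    by (simp add: partition_weight_def padded_def)
next
  case False
  have "removeAll 0 \<nu> = \<nu>"
    using assms(1) by (auto simp: is_partition_def removeAll_id)
  with False assms(2) show ?thesis
    by (auto simp: partition_weight_def padded_def)
qed

section \<open>Matrix representations of symmetric groups\<close>

text \<open>\<open>\<SS>\<^sub>m\<close> is the set of \<open>g\<close> with \<open>g permutes {1..m}\<close>, under composition. A finite-dimensional
  rational \<open>\<SS>\<^sub>m\<close>-module is given, in coordinates, as a homomorphism to \<open>GL\<^sub>d(\<rat>)\<close>; \<open>d = 0\<close> is the zero
  module. Values outside \<open>\<SS>\<^sub>m\<close> are irrelevant.\<close>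

type_synonym rep = "(nat \<Rightarrow> nat) \<Rightarrow> rat mat"

definition is_rep :: "nat \<Rightarrow> rep \<Rightarrow> bool" where
  "is_rep m \<rho> \<longleftrightarrow> (\<exists>d.
     (\<forall>g. g permutes {1..m} \<longrightarrow> \<rho> g \<in> carrier_mat d d) \<and>
     \<rho> id = 1\<^sub>m d \<and>
     (\<forall>g h. g permutes {1..m} \<longrightarrow> h permutes {1..m} \<longrightarrow> \<rho> (g \<circ> h) = \<rho> g * \<rho> h))"

text \<open>Isomorphism: one base change conjugates all the matrices simultaneously.\<close>

definition rep_iso :: "nat \<Rightarrow> rep \<Rightarrow> rep \<Rightarrow> bool" where
  "rep_iso m \<rho> \<sigma> \<longleftrightarrow> (\<exists>P Q. \<forall>g. g permutes {1..m} \<longrightarrow> similar_mat_wit (\<rho> g) (\<sigma> g) P Q)"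

definition zero_rep :: rep where
  "zero_rep = (\<lambda>g. 0\<^sub>m 0 0)"

definition direct_sum :: "rep list \<Rightarrow> rep" where
  "direct_sum \<rho>s = (\<lambda>g. diag_block_mat (map (\<lambda>\<rho>. \<rho> g) \<rho>s))"

definition kronecker :: "'a :: times mat \<Rightarrow> 'a mat \<Rightarrow> 'a mat" where
  "kronecker A B = mat (dim_row A * dim_row B) (dim_col A * dim_col B)
     (\<lambda>(i, j). A $$ (i div dim_row B, j div dim_col B) * B $$ (i mod dim_row B, j mod dim_col B))"

definition tensor :: "rep \<Rightarrow> rep \<Rightarrow> rep" where
  "tensor \<rho> \<sigma> = (\<lambda>g. kronecker (\<rho> g) (\<sigma> g))"

definition character :: "rep \<Rightarrow> (nat \<Rightarrow> nat) \<Rightarrow> rat" where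
  "character \<rho> g = (\<Sum>i < dim_row (\<rho> g). \<rho> g $$ (i, i))"

lemma is_rep_zero_rep: "is_rep m zero_rep"
  by (auto simp: is_rep_def zero_rep_def intro!: exI[of _ 0])

lemma kronecker_mult:
  fixes A B C D :: "'a :: comm_semiring_1 mat"
  assumes "A \<in> carrier_mat a b" "C \<in> carrier_mat b c"
    and "B \<in> carrier_mat p q" "D \<in> carrier_mat q r"
  shows "kronecker (A * C) (B * D) = kronecker A B * kronecker C D"
proof (rule eq_matI; (use assms in \<open>simp add: kronecker_def; fail\<close>)?)
  fix i j
  assume "i < dim_row (kronecker A B * kronecker C D)" "j < dim_col (kronecker A B * kronecker C D)"
  with assms have ij: "i < a * p" "j < c * r"
    by (auto simp: kronecker_def)
  then have pos: "p > 0" "r > 0"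
    by (metis mult_0_right neq0_conv not_less_zero)+
  with ij have lt: "i div p < a" "j div r < c" "i mod p < p" "j mod r < r"
    by (auto simp: less_mult_imp_div_less)
  let ?f = "\<lambda>k l. (A $$ (i div p, k) * C $$ (k, j div r)) * (B $$ (i mod p, l) * D $$ (l, j mod r))"
  have "kronecker (A * C) (B * D) $$ (i, j) =
      (\<Sum>k < b. A $$ (i div p, k) * C $$ (k, j div r)) * (\<Sum>l < q. B $$ (i mod p, l) * D $$ (l, j mod r))"
    using assms ij lt by (simp add: kronecker_def scalar_prod_def atLeast0LessThan)
  also have "\<dots> = (\<Sum>(k, l) \<in> {..<b} \<times> {..<q}. ?f k l)"
    by (simp add: sum_product sum.cartesian_product)
  also have "\<dots> = (\<Sum>n < b * q. ?f (n div q) (n mod q))"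
  proof (rule sum.reindex_bij_witness[of _ "\<lambda>n. (n div q, n mod q)" "\<lambda>(k, l). k * q + l"])
    fix n assume "n \<in> {..<b * q}"
    moreover from this have "q > 0" by (cases q) auto
    ultimately show "(n div q, n mod q) \<in> {..<b} \<times> {..<q}"
      by (auto simp: less_mult_imp_div_less)
  next
    fix x assume x: "x \<in> {..<b} \<times> {..<q}"
    then obtain k l where kl: "x = (k, l)" "k < b" "l < q" by auto
    then have "k * q + l < Suc k * q" by simp
    also have "\<dots> \<le> b * q" using kl by (intro mult_right_mono) auto
    finally show "(case x of (k, l) \<Rightarrow> k * q + l) \<in> {..<b * q}" using kl by simp
  qed auto
  also have "\<dots> = (kronecker A B * kronecker C D) $$ (i, j)"
    using assms ij lt
    by (auto simp: kronecker_def scalar_prod_def atLeast0LessThan mult_ac intro!: sum.cong)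
  finally show "kronecker (A * C) (B * D) $$ (i, j) = (kronecker A B * kronecker C D) $$ (i, j)" .
qed

lemma kronecker_one:
  "kronecker (1\<^sub>m a) (1\<^sub>m b) = (1\<^sub>m (a * b) :: 'a :: comm_semiring_1 mat)"
proof (rule eq_matI; (simp add: kronecker_def; fail)?)
  fix i j
  assume "i < dim_row (1\<^sub>m (a * b) :: 'a mat)" "j < dim_col (1\<^sub>m (a * b) :: 'a mat)"
  then have ij: "i < a * b" "j < a * b" by simp_all
  then have "b > 0" by (cases b) auto
  moreover have "i = j \<longleftrightarrow> i div b = j div b \<and> i mod b = j mod b"
    by (metis div_mult_mod_eq)
  ultimately show "kronecker (1\<^sub>m a) (1\<^sub>m b) $$ (i, j) = (1\<^sub>m (a * b) :: 'a mat) $$ (i, j)"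
    using ij by (auto simp: kronecker_def less_mult_imp_div_less)
qed

lemma is_rep_tensor:
  assumes "is_rep m \<rho>" "is_rep m \<sigma>"
  shows "is_rep m (tensor \<rho> \<sigma>)"
proof -
  obtain d where d: "\<And>g. g permutes {1..m} \<Longrightarrow> \<rho> g \<in> carrier_mat d d" "\<rho> id = 1\<^sub>m d"
    "\<And>g h. g permutes {1..m} \<Longrightarrow> h permutes {1..m} \<Longrightarrow> \<rho> (g \<circ> h) = \<rho> g * \<rho> h"
    using assms(1) unfolding is_rep_def by blast
  obtain e where e: "\<And>g. g permutes {1..m} \<Longrightarrow> \<sigma> g \<in> carrier_mat e e" "\<sigma> id = 1\<^sub>m e"
    "\<And>g h. g permutes {1..m} \<Longrightarrow> h permutes {1..m} \<Longrightarrow> \<sigma> (g \<circ> h) = \<sigma> g * \<sigma> h"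
    using assms(2) unfolding is_rep_def by blast
  have "tensor \<rho> \<sigma> g \<in> carrier_mat (d * e) (d * e)" if "g permutes {1..m}" for g
    using d(1)[OF that] e(1)[OF that] by (simp add: tensor_def kronecker_def)
  moreover have "tensor \<rho> \<sigma> (g \<circ> h) = tensor \<rho> \<sigma> g * tensor \<rho> \<sigma> h"
    if "g permutes {1..m}" "h permutes {1..m}" for g h
    using that d e by (simp add: tensor_def kronecker_mult[where a = d and b = d and c = d and p = e and q = e and r = e])
  ultimately show ?thesis
    unfolding is_rep_def by (intro exI[of _ "d * e"]) (simp add: tensor_def d(2) e(2) kronecker_one)
qed

section \<open>The simple modules \<open>V\<^sub>\<nu>\<close>\<close>

text \<open>Elements of the rational group algebra of \<open>\<SS>\<^sub>m\<close> are functions supported on \<open>\<SS>\<^sub>m\<close>; the function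
  \<open>x\<close> stands for the formal sum of the terms \<open>x(h) h\<close>.\<close>

type_synonym galg = "(nat \<Rightarrow> nat) \<Rightarrow> rat"

definition gscale :: "rat \<Rightarrow> galg \<Rightarrow> galg" where
  "gscale c x = (\<lambda>h. c * x h)"

global_interpretation galg: vector_space gscale
  defines galg_span = galg.span
    and galg_representation = galg.representation
  by unfold_locales (auto simp: gscale_def algebra_simps)

text \<open>Left multiplication by \<open>g\<close>.\<close>

definition translate :: "(nat \<Rightarrow> nat) \<Rightarrow> galg \<Rightarrow> galg" where
  "translate g x = (\<lambda>h. x (inv_into UNIV g \<circ> h))"

text \<open>The canonical tableau of shape \<open>\<nu>\<close> has the entries \<open>1, \<dots>, \<nu>\<^sub>1\<close> in its first row, the next \<open>\<nu>\<^sub>2\<close>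
  integers in its second row, and so on. Rows are counted from 0, columns from 1.\<close>

definition tab_row :: "nat list \<Rightarrow> nat \<Rightarrow> nat" where
  "tab_row \<nu> k = (LEAST r. k \<le> sum_list (take (Suc r) \<nu>))"

definition tab_col :: "nat list \<Rightarrow> nat \<Rightarrow> nat" where
  "tab_col \<nu> k = k - sum_list (take (tab_row \<nu> k) \<nu>)"

definition row_stabilizer :: "nat list \<Rightarrow> (nat \<Rightarrow> nat) set" where
  "row_stabilizer \<nu> = {p. p permutes {1..sum_list \<nu>} \<and>
     (\<forall>k \<in> {1..sum_list \<nu>}. tab_row \<nu> (p k) = tab_row \<nu> k)}"

definition col_stabilizer :: "nat list \<Rightarrow> (nat \<Rightarrow> nat) set" where
  "col_stabilizer \<nu> = {q. q permutes {1..sum_list \<nu>} \<and>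
     (\<forall>k \<in> {1..sum_list \<nu>}. tab_col \<nu> (q k) = tab_col \<nu> k)}"

text \<open>The Young symmetrizer \<open>c\<^sub>\<nu> = (\<Sum>p. p) (\<Sum>q. sign(q) q)\<close>, with \<open>p\<close> in the row stabilizer and \<open>q\<close> in
  the column stabilizer.\<close>

definition young_symmetrizer :: "nat list \<Rightarrow> galg" where
  "young_symmetrizer \<nu> = (\<lambda>h.
     \<Sum>(p, q) \<in> {(p, q) \<in> row_stabilizer \<nu> \<times> col_stabilizer \<nu>. p \<circ> q = h}. of_int (sign q))"

text \<open>\<open>V\<^sub>\<nu>\<close> is the left ideal generated by \<open>c\<^sub>\<nu>\<close>. In this convention \<open>V\<^bsub>(m)\<^esub>\<close> is the trivial module.\<close>

definition specht_module :: "nat list \<Rightarrow> galg set" where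
  "specht_module \<nu> = galg_span {translate g (young_symmetrizer \<nu>) | g. g permutes {1..sum_list \<nu>}}"

definition specht_basis :: "nat list \<Rightarrow> galg list" where
  "specht_basis \<nu> = (SOME bs. distinct bs \<and> galg.independent (set bs) \<and>
     galg_span (set bs) = specht_module \<nu>)"

text \<open>The module \<open>V\<^sub>\<nu>\<close> in coordinates: column \<open>j\<close> of the matrix of \<open>g\<close> consists of the coordinates of the
  image under \<open>g\<close> of the \<open>j\<close>-th basis vector.\<close>

definition specht :: "nat list \<Rightarrow> rep" where
  "specht \<nu> g = (let bs = specht_basis \<nu>; n = length bs in
     mat n n (\<lambda>(i, j). galg_representation (set bs) (translate g (bs ! j)) (bs ! i)))"

lemma specht_basis:
  "distinct (specht_basis \<nu>)" "galg.independent (set (specht_basis \<nu>))"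
  "galg_span (set (specht_basis \<nu>)) = specht_module \<nu>"
proof -
  let ?S = "{translate g (young_symmetrizer \<nu>) | g. g permutes {1..sum_list \<nu>}}"
  have fin: "finite ?S"
    using finite_permutations[of "{1..sum_list \<nu>}"] by auto
  obtain B where B: "B \<subseteq> ?S" "galg.independent B" "?S \<subseteq> galg.span B"
    by (rule galg.maximal_independent_subset)
  have "galg.span B = galg.span ?S"
    using B galg.span_mono[of B ?S] galg.span_minimal[OF B(3)] by (simp add: subset_antisym)
  moreover obtain bs where "set bs = B" "distinct bs"
    using finite_distinct_list[of B] finite_subset[OF B(1) fin] by blast
  ultimately have "\<exists>bs. distinct bs \<and> galg.independent (set bs) \<and>
      galg_span (set bs) = specht_module \<nu>"
    using B(2) by (auto simp: specht_module_def)
  from someI_ex[OF this]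
  show "distinct (specht_basis \<nu>)" "galg.independent (set (specht_basis \<nu>))"
    "galg_span (set (specht_basis \<nu>)) = specht_module \<nu>"
    unfolding specht_basis_def by blast+
qed

lemma translate_simps:
  "translate g (x + y) = translate g x + translate g y"
  "translate g (gscale c x) = gscale c (translate g x)"
  "translate g 0 = 0"
  "translate id x = x"
  by (auto simp: translate_def gscale_def fun_eq_iff)

lemma translate_comp:
  assumes "bij g" "bij h"
  shows "translate (g \<circ> h) x = translate g (translate h x)"
  using assms by (simp add: translate_def o_inv_distrib o_assoc)

lemma translate_sum: "translate g (\<Sum>i \<in> I. f i) = (\<Sum>i \<in> I. translate g (f i))"
  by (induction I rule: infinite_finite_induct) (simp_all only: sum.infinite sum.empty sum.insert translate_simps simp_thms)

lemma translate_specht_module: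
  assumes g: "g permutes {1..sum_list \<nu>}" and x: "x \<in> specht_module \<nu>"
  shows "translate g x \<in> specht_module \<nu>"
  using x unfolding specht_module_def
proof (induction rule: galg.span_induct_alt)
  case base
  show ?case by (simp only: translate_simps galg.span_zero)
next
  case (step c x y)
  then obtain h where h: "h permutes {1..sum_list \<nu>}" "x = translate h (young_symmetrizer \<nu>)"
    by auto
  then have "translate g x = translate (g \<circ> h) (young_symmetrizer \<nu>)"
    using g by (simp add: translate_comp permutes_bij)
  moreover have "(g \<circ> h) permutes {1..sum_list \<nu>}"
    using permutes_compose[OF h(1) g] .
  ultimately have "translate g x \<in>
      galg_span {translate g (young_symmetrizer \<nu>) | g. g permutes {1..sum_list \<nu>}}"
    by (intro galg.span_base) auto
  with step.IH show ?case
    by (simp only: translate_simps galg.span_add galg.span_scale)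
qed

lemma is_rep_specht:
  assumes "sum_list \<nu> = m"
  shows "is_rep m (specht \<nu>)"
proof -
  define bs where "bs = specht_basis \<nu>"
  define n where "n = length bs"
  let ?R = "galg_representation (set bs)"
  have bs: "distinct bs" "galg.independent (set bs)" "galg_span (set bs) = specht_module \<nu>"
    unfolding bs_def by (rule specht_basis)+
  have specht: "specht \<nu> g = mat n n (\<lambda>(i, j). ?R (translate g (bs ! j)) (bs ! i))" for g
    by (simp add: specht_def bs_def n_def Let_def)
  have in_span: "translate g (bs ! j) \<in> galg_span (set bs)"
    if "g permutes {1..m}" "j < n" for g j
    using that assms bs(3) translate_specht_module[of g \<nu>] galg.span_base[of "bs ! j" "set bs"]
    by (simp add: n_def)
  have expand: "translate g (bs ! j) = (\<Sum>k < n. gscale (?R (translate g (bs ! j)) (bs ! k)) (bs ! k))"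
    if "g permutes {1..m}" "j < n" for g j
  proof -
    have "translate g (bs ! j) = (\<Sum>b \<in> set bs. gscale (?R (translate g (bs ! j)) b) b)"
      using galg.sum_representation_eq[OF bs(2) in_span[OF that]] by simp
    also have "\<dots> = (\<Sum>k < n. gscale (?R (translate g (bs ! j)) (bs ! k)) (bs ! k))"
      using bs(1) by (intro sum.reindex_bij_betw[symmetric] bij_betw_nth) (auto simp: n_def)
    finally show ?thesis .
  qed
  have "specht \<nu> (g \<circ> h) = specht \<nu> g * specht \<nu> h"
    if g: "g permutes {1..m}" and h: "h permutes {1..m}" for g h
  proof (rule eq_matI; (simp add: specht; fail)?)
    fix i j assume "i < dim_row (specht \<nu> g * specht \<nu> h)" "j < dim_col (specht \<nu> g * specht \<nu> h)"
    then have ij: "i < n" "j < n" by (simp_all add: specht)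
    let ?c = "\<lambda>k. ?R (translate h (bs ! j)) (bs ! k)"
    have "translate (g \<circ> h) (bs ! j) = translate g (\<Sum>k < n. gscale (?c k) (bs ! k))"
      using expand[OF h ij(2)] g h by (simp add: translate_comp permutes_bij)
    also have "\<dots> = (\<Sum>k < n. gscale (?c k) (translate g (bs ! k)))"
      by (simp add: translate_sum translate_simps)
    finally have "?R (translate (g \<circ> h) (bs ! j)) =
        ?R (\<Sum>k < n. gscale (?c k) (translate g (bs ! k)))" by simp
    also have "\<dots> = (\<lambda>b. \<Sum>k < n. ?R (gscale (?c k) (translate g (bs ! k))) b)"
      using bs(2) in_span[OF g] by (intro galg.representation_sum) (auto intro: galg.span_scale)
    also have "\<dots> = (\<lambda>b. \<Sum>k < n. ?c k * ?R (translate g (bs ! k)) b)"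
      using bs(2) in_span[OF g] by (intro ext sum.cong) (auto simp: galg.representation_scale)
    finally show "specht \<nu> (g \<circ> h) $$ (i, j) = (specht \<nu> g * specht \<nu> h) $$ (i, j)"
      using ij by (simp add: specht scalar_prod_def atLeast0LessThan mult_ac)
  qed
  moreover have "specht \<nu> id = 1\<^sub>m n"
    using bs by (intro eq_matI)
      (auto simp: specht translate_simps galg.representation_basis n_def nth_eq_iff_index_eq)
  ultimately show ?thesis
    unfolding is_rep_def by (intro exI[of _ n]) (simp add: specht)
qed

lemma tableau_entry_determined:
  assumes "k \<in> {1..sum_list \<nu>}"
  shows "k = sum_list (take (tab_row \<nu> k) \<nu>) + tab_col \<nu> k"
proof -
  have "sum_list (take (tab_row \<nu> k) \<nu>) \<le> k"
  proof (cases "tab_row \<nu> k")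
    case (Suc r)
    then have "r < tab_row \<nu> k" by simp
    then have "\<not> k \<le> sum_list (take (Suc r) \<nu>)"
      unfolding tab_row_def by (rule not_less_Least)
    with Suc show ?thesis by simp
  qed simp
  then show ?thesis by (simp add: tab_col_def)
qed

lemma young_symmetrizer_id: "young_symmetrizer \<nu> id = 1"
proof -
  have "p = id \<and> q = id"
    if p: "p \<in> row_stabilizer \<nu>" and q: "q \<in> col_stabilizer \<nu>" and pq: "p \<circ> q = id" for p q
  proof -
    let ?A = "{1..sum_list \<nu>}"
    have qA: "q permutes ?A" using q by (simp add: col_stabilizer_def)
    have "q k = k" for k
    proof (cases "k \<in> ?A")
      case True
      then have qk: "q k \<in> ?A" using permutes_in_image[OF qA] by blast
      have "tab_row \<nu> (p (q k)) = tab_row \<nu> (q k)" using p qk by (simp add: row_stabilizer_def)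
      then have "tab_row \<nu> (q k) = tab_row \<nu> k" using pq by (simp add: fun_eq_iff)
      moreover have "tab_col \<nu> (q k) = tab_col \<nu> k" using q True by (simp add: col_stabilizer_def)
      ultimately show ?thesis
        using tableau_entry_determined[OF True] tableau_entry_determined[OF qk] by simp
    next
      case False
      then show ?thesis using permutes_not_in[OF qA] by simp
    qed
    then have "q = id" by auto
    with pq show ?thesis by simp
  qed
  moreover have "id \<in> row_stabilizer \<nu>" "id \<in> col_stabilizer \<nu>"
    by (simp_all add: row_stabilizer_def col_stabilizer_def permutes_id)
  ultimately have "{(p, q) \<in> row_stabilizer \<nu> \<times> col_stabilizer \<nu>. p \<circ> q = id} = {(id, id)}"
    by auto
  then show ?thesis by (simp add: young_symmetrizer_def sign_id)
qed

section \<open>Weights\<close>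

text \<open>\<open>multiplicities m \<rho> n\<close> says that \<open>\<rho>\<close> is isomorphic to the direct sum of the \<open>V\<^sub>\<mu>\<close>, each taken
  \<open>n \<mu>\<close> times, for \<open>\<mu>\<close> ranging over the partitions of \<open>m\<close>.\<close>

definition multiplicities :: "nat \<Rightarrow> rep \<Rightarrow> (nat list \<Rightarrow> nat) \<Rightarrow> bool" where
  "multiplicities m \<rho> n \<longleftrightarrow> (\<exists>\<mu>s. (\<forall>\<mu> \<in> set \<mu>s. partition_of m \<mu>) \<and> n = count_list \<mu>s \<and>
     rep_iso m \<rho> (direct_sum (map specht \<mu>s)))"

text \<open>The supremum is taken in the extended reals, so that the zero module has weight \<open>- \<infinity>\<close>.\<close>

definition rep_weight :: "nat \<Rightarrow> rep \<Rightarrow> ereal" where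
  "rep_weight m \<rho> = Sup {ereal (real (partition_weight \<mu>)) | \<mu> n. multiplicities m \<rho> n \<and> n \<mu> \<noteq> 0}"

section \<open>FB-modules\<close>

definition is_FB_module :: "(nat \<Rightarrow> rep) \<Rightarrow> bool" where
  "is_FB_module W \<longleftrightarrow> (\<forall>m. is_rep m (W m))"

definition FB_weight :: "(nat \<Rightarrow> rep) \<Rightarrow> ereal" where
  "FB_weight W = (SUP m. rep_weight m (W m))"

definition FB_tensor :: "(nat \<Rightarrow> rep) \<Rightarrow> (nat \<Rightarrow> rep) \<Rightarrow> (nat \<Rightarrow> rep)" where
  "FB_tensor W1 W2 = (\<lambda>m. tensor (W1 m) (W2 m))"

definition FB_truncate :: "nat \<Rightarrow> (nat \<Rightarrow> rep) \<Rightarrow> (nat \<Rightarrow> rep)" where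
  "FB_truncate N W = (\<lambda>m. if m < N then zero_rep else W m)"

text \<open>On \<open>{1..m}\<close>, the supports of the disjoint cycles of \<open>g\<close>, fixed points included, are the orbits.\<close>

definition cycle_count :: "nat \<Rightarrow> (nat \<Rightarrow> nat) \<Rightarrow> nat \<Rightarrow> nat" where
  "cycle_count m g i = card {C \<in> orbit g ` {1..m}. card C = i}"

text \<open>Polynomials over \<open>\<rat>\<close> in the variables \<open>X\<^sub>1, X\<^sub>2, \<dots>\<close>. A monomial is a finitely supported family of
  exponents, and index \<open>i\<close> refers to \<open>X\<^bsub>i+1\<^esub>\<close>.\<close>

type_synonym cpoly = "(nat \<Rightarrow>\<^sub>0 nat) \<Rightarrow>\<^sub>0 rat"

definition eval_cpoly :: "cpoly \<Rightarrow> (nat \<Rightarrow> rat) \<Rightarrow> rat" where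
  "eval_cpoly P x = (\<Sum>t \<in> Poly_Mapping.keys P. Poly_Mapping.lookup P t *
     (\<Prod>i \<in> Poly_Mapping.keys t. x i ^ Poly_Mapping.lookup t i))"

definition poly_character_from :: "nat \<Rightarrow> (nat \<Rightarrow> rep) \<Rightarrow> bool" where
  "poly_character_from N W \<longleftrightarrow> (\<exists>P :: cpoly. \<forall>m \<ge> N. \<forall>g. g permutes {1..m} \<longrightarrow>
     character (W m) g = eval_cpoly P (\<lambda>i. of_nat (cycle_count m g (Suc i))))"

end

theory Submission
  imports Defs "Jordan_Normal_Form.Determinant"
begin

text \<open>The weight of \<open>V\<^sub>\<nu>\<close> is \<open>m - \<nu>\<^sub>1\<close>, and it can be read off from vectors fixed by large symmetric
  subgroups. Write \<open>S\<^sub>K\<close> for the group of permutations of \<open>K \<subseteq> {1..m}\<close>. The ideal \<open>V\<^sub>\<nu>\<close> is spanned by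
  the translates of the Young symmetrizer \<open>c\<^sub>\<nu>\<close>, each of which is fixed by \<open>S\<^sub>K\<close> for \<open>K\<close> the first row of
  the translated tableau. If \<open>|K| > \<nu>\<^sub>1\<close>, then two points of \<open>K\<close> lie in one column of any given tableau,
  and a vector fixed by \<open>S\<^sub>K\<close> must vanish because the transposition of these points also changes a
  sign. Hence a representation has weight at most \<open>w\<close> iff it is spanned by vectors that are fixed by
  some \<open>S\<^sub>K\<close> with \<open>|K| \<ge> m - w\<close> (lemmas \<open>fixed_spanned_specht\<close> and \<open>rep_weight_le_iff\<close>). Part (a) follows:
  if \<open>v\<close> is fixed by \<open>S\<^sub>K\<close> and \<open>w\<close> by \<open>S\<^sub>L\<close>, then \<open>v \<otimes> w\<close> is fixed by \<open>S\<^sub>K \<inter> S\<^sub>L\<close>, the group of permutations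
  of \<open>K \<inter> L\<close> (\<open>fixed_spanned_tensor\<close>).

  For the lower bound (\<open>tensor_lower_bound\<close>), let \<open>V\<^sub>\<nu>\<close> and \<open>V\<^sub>\<mu>\<close> be constituents of maximal weight of the
  two factors. The columns of length at least 2 in a tableau of shape \<open>\<nu>\<close> cover at most \<open>2 w(\<nu>)\<close>
  points, so for \<open>m \<ge> 2 (w(\<nu>) + w(\<mu>))\<close> there are tableaux of shapes \<open>\<nu>\<close> and \<open>\<mu>\<close> for which these point sets
  are disjoint. Let \<open>b\<^sub>1\<close> and \<open>b\<^sub>2\<close> be their column antisymmetrizers. By the pigeonhole principle a set
  \<open>K\<close> with more than \<open>m - w(\<nu>) - w(\<mu>)\<close> points contains two points of one column, so \<open>b\<^sub>1 b\<^sub>2\<close> kills all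
  vectors fixed by \<open>S\<^sub>K\<close>; it acts as 0 on any representation of weight below \<open>w(\<nu>) + w(\<mu>)\<close>. On
  the other hand \<open>b\<^sub>2\<close> only permutes points in the first row for \<open>\<nu>\<close>, and \<open>b\<^sub>1\<close> only points in the first
  row for \<open>\<mu>\<close>, whence \<open>b\<^sub>1 b\<^sub>2\<close> maps the product of the Young symmetrizers \<open>c\<^sub>\<nu> \<otimes> c\<^sub>\<mu>\<close> of the two tableaux to
  \<open>b\<^sub>1 c\<^sub>\<nu> \<otimes> b\<^sub>2 c\<^sub>\<mu>\<close>, which is not 0. This gives the equality in (b) for fixed \<open>m\<close> and the formula in (c).

  The statement on truncated families is where polynomial characters enter: the weights of the
  two families have to reach their suprema at a common large \<open>m\<close>. Let \<open>X\<^sub>i\<close> have degree \<open>i\<close> and let \<open>D\<close> be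
  the degree of a nonzero character polynomial. The weight is at most \<open>D\<close> for all \<open>m \<ge> N\<close> and equal to
  \<open>D\<close> for all large \<open>m\<close> (\<open>poly_character_upper\<close>, \<open>poly_character_lower\<close>). Both bounds start from
  the observation that a monomial in the cycle counts of \<open>g\<close> is a sum of indicator functions of
  the condition that \<open>g\<close> takes prescribed values on at most \<open>D\<close> points. If \<open>w(\<nu>) > D\<close>, such a condition
  leaves two points of a column free, so that \<open>c\<^sub>\<nu>\<close> has trace 0, which is impossible if \<open>V\<^sub>\<nu>\<close> occurs.
  Conversely, if the weight is below \<open>D\<close>, then the product of \<open>1 - t\<close> over \<open>D\<close> disjoint transpositions \<open>t\<close>
  acts as 0, and the trace of its product with a suitable permutation is a nonzero multiple of a
  coefficient of degree \<open>D\<close>. If the polynomial is 0, then the modules are 0 from \<open>N\<close> on.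

  All this presupposes that every representation is a sum of modules \<open>V\<^sub>\<nu>\<close>
  (\<open>complete_reducibility\<close>). Products \<open>c\<^sub>\<nu> x c\<^sub>\<mu>\<close> vanish for \<open>\<nu> \<noteq> \<mu>\<close> and are multiples of \<open>c\<^sub>\<nu>\<close> for \<open>\<nu> = \<mu>\<close>; here the
  sum of the column indices of a diagram replaces the dominance order. What must not vanish is
  controlled by the positivity of the identity coefficient of \<open>x\<^sup>* x\<close>. The sums of the conjugates of
  \<open>c\<^sub>\<nu> c\<^sub>\<nu>\<^sup>*\<close> are linearly independent class functions, as many as there are conjugacy classes; therefore 1
  is a combination of them, and on every nonzero representation some \<open>c\<^sub>\<nu>\<close> acts nontrivially. An
  invariant inner product then splits off the modules \<open>V\<^sub>\<nu>\<close> one after the other.\<close>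

section \<open>Permutations of an initial segment\<close>

abbreviation pinv :: "('a \<Rightarrow> 'a) \<Rightarrow> 'a \<Rightarrow> 'a" where
  "pinv \<equiv> inv_into UNIV"

definition perms :: "nat \<Rightarrow> (nat \<Rightarrow> nat) set" where
  "perms m = {g. g permutes {1..m}}"

lemma perms_permutes: "g \<in> perms m \<Longrightarrow> g permutes {1..m}"
  by (simp add: perms_def)

lemma finite_perms [simp]: "finite (perms m)"
  by (simp add: perms_def finite_permutations)

lemma perms_comp [simp]: "g \<in> perms m \<Longrightarrow> h \<in> perms m \<Longrightarrow> g \<circ> h \<in> perms m"
  by (simp add: perms_def permutes_compose)

lemma perms_inv [simp]: "g \<in> perms m \<Longrightarrow> pinv g \<in> perms m"
  by (simp add: perms_def permutes_inv)

lemma perms_id [simp]: "id \<in> perms m"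
  by (simp add: perms_def permutes_id)

lemma perms_bij: "g \<in> perms m \<Longrightarrow> bij g"
  by (auto simp: perms_def intro: permutes_bij)

lemma perms_inverses [simp]: "g \<in> perms m \<Longrightarrow> pinv g (g x) = x" "g \<in> perms m \<Longrightarrow> g (pinv g x) = x"
  by (auto simp: perms_def permutes_inverses)

lemma perms_cancel [simp]:
  assumes "g \<in> perms m"
  shows "pinv g \<circ> g = id" "g \<circ> pinv g = id" "pinv g \<circ> (g \<circ> h) = h" "g \<circ> (pinv g \<circ> h) = h"
    "h \<circ> g \<circ> pinv g = h" "h \<circ> pinv g \<circ> g = h" "pinv (pinv g) = g"
  using assms by (auto simp: fun_eq_iff inv_inv_eq perms_bij)

lemma perms_inv_comp [simp]: "g \<in> perms m \<Longrightarrow> h \<in> perms m \<Longrightarrow> pinv (g \<circ> h) = pinv h \<circ> pinv g"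
  by (simp add: o_inv_distrib perms_bij)

lemma perms_comp_iff:
  assumes "g \<in> perms m"
  shows "g \<circ> h \<in> perms m \<longleftrightarrow> h \<in> perms m" "h \<circ> g \<in> perms m \<longleftrightarrow> h \<in> perms m"
  using perms_comp[OF assms, of h] perms_comp[OF perms_inv[OF assms], of "g \<circ> h"]
    perms_comp[OF _ assms, of h] perms_comp[OF _ perms_inv[OF assms], of "h \<circ> g"] assms
  by (metis perms_cancel(3), metis perms_cancel(5))

lemma sum_perms_left:
  "g \<in> perms m \<Longrightarrow> (\<Sum>k\<in>perms m. f (g \<circ> k)) = (\<Sum>k\<in>perms m. f k)"
  by (rule sum.reindex_bij_witness[of _ "\<lambda>k. pinv g \<circ> k" "\<lambda>k. g \<circ> k"])
    (auto simp: perms_comp_iff)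

lemma sum_perms_right:
  "g \<in> perms m \<Longrightarrow> (\<Sum>k\<in>perms m. f (k \<circ> g)) = (\<Sum>k\<in>perms m. f k)"
  by (rule sum.reindex_bij_witness[of _ "\<lambda>k. k \<circ> pinv g" "\<lambda>k. k \<circ> g"])
    (auto simp: perms_comp_iff)

lemma sum_perms_inv:
  "(\<Sum>k\<in>perms m. f (pinv k)) = (\<Sum>k\<in>perms m. f k)"
  by (rule sum.reindex_bij_witness[of _ pinv pinv])
    auto

lemma sign_perms_comp: "g \<in> perms m \<Longrightarrow> h \<in> perms m \<Longrightarrow> sign (g \<circ> h) = sign g * sign h"
  by (metis finite_atLeastAtMost perms_permutes permutation_permutes sign_compose)

lemma sign_perms_inv: "g \<in> perms m \<Longrightarrow> sign (pinv g) = sign g"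
  by (metis finite_atLeastAtMost perms_permutes permutation_permutes sign_inverse)

section \<open>Convolution\<close>

text \<open>The product of the group algebra: it sends \<open>delta g\<close>, \<open>delta h\<close> to \<open>delta (g \<circ> h)\<close> for \<open>g, h \<in> \<SS>\<^sub>m\<close>.\<close>

definition conv :: "nat \<Rightarrow> galg \<Rightarrow> galg \<Rightarrow> galg" where
  "conv m x y = (\<lambda>h. \<Sum>g\<in>perms m. x g * y (pinv g \<circ> h))"

definition delta :: "(nat \<Rightarrow> nat) \<Rightarrow> galg" where
  "delta g = (\<lambda>h. if h = g then 1 else 0)"

text \<open>The linear extension of \<open>g \<mapsto> g\<^sup>-\<^sup>1\<close>, an anti-automorphism of the group algebra.\<close>

definition star :: "nat \<Rightarrow> galg \<Rightarrow> galg" where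
  "star m x = (\<lambda>g. if g \<in> perms m then x (pinv g) else 0)"

definition group_algebra :: "nat \<Rightarrow> galg set" where
  "group_algebra m = {x. \<forall>h. h \<notin> perms m \<longrightarrow> x h = 0}"

lemma galg_sum_apply: "(\<Sum>i\<in>I. f i) h = (\<Sum>i\<in>I. (f i h :: rat))"
  by (induction I rule: infinite_finite_induct) auto

lemma group_algebra_eqI:
  assumes "x \<in> group_algebra m" "y \<in> group_algebra m" "\<And>h. h \<in> perms m \<Longrightarrow> x h = y h"
  shows "x = y"
  using assms unfolding group_algebra_def by (auto simp: fun_eq_iff) metis

lemma conv_assoc: "conv m (conv m x y) z = conv m x (conv m y z)"
proof
  fix h
  have "conv m (conv m x y) z h =
      (\<Sum>l\<in>perms m. \<Sum>g\<in>perms m. x g * y (pinv g \<circ> l) * z (pinv l \<circ> h))"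
    by (simp add: conv_def sum_distrib_right)
  also have "\<dots> = (\<Sum>g\<in>perms m. \<Sum>l\<in>perms m. x g * y (pinv g \<circ> l) * z (pinv l \<circ> h))"
    by (rule sum.swap)
  also have "\<dots> = (\<Sum>g\<in>perms m. \<Sum>k\<in>perms m. x g * y k * z (pinv k \<circ> (pinv g \<circ> h)))"
  proof (rule sum.cong[OF refl])
    fix g assume g: "g \<in> perms m"
    have "(\<Sum>l\<in>perms m. x g * y (pinv g \<circ> l) * z (pinv l \<circ> h)) =
        (\<Sum>k\<in>perms m. x g * y (pinv g \<circ> (g \<circ> k)) * z (pinv (g \<circ> k) \<circ> h))"
      by (rule sum_perms_left[OF g, symmetric])
    also have "\<dots> = (\<Sum>k\<in>perms m. x g * y k * z (pinv k \<circ> (pinv g \<circ> h)))"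
      using g by (intro sum.cong refl) (simp add: perms_inv_comp[of g m] o_assoc)
    finally show "(\<Sum>l\<in>perms m. x g * y (pinv g \<circ> l) * z (pinv l \<circ> h)) =
      (\<Sum>k\<in>perms m. x g * y k * z (pinv k \<circ> (pinv g \<circ> h)))" .
  qed
  also have "\<dots> = conv m x (conv m y z) h"
    by (simp add: conv_def sum_distrib_left mult.assoc)
  finally show "conv m (conv m x y) z h = conv m x (conv m y z) h" .
qed

lemma conv_expand: "conv m x y = (\<Sum>g\<in>perms m. gscale (x g) (translate g y))"
  by (rule ext) (simp add: conv_def galg_sum_apply gscale_def translate_def)

lemma conv_delta_left:
  assumes "g \<in> perms m"
  shows "conv m (delta g) x = translate g x"
proof
  fix h
  have "conv m (delta g) x h = (\<Sum>k\<in>perms m. if k = g then x (pinv g \<circ> h) else 0)"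
    unfolding conv_def delta_def by (rule sum.cong) auto
  then show "conv m (delta g) x h = translate g x h"
    using assms by (simp add: translate_def)
qed

lemma conv_delta_id [simp]: "conv m (delta id) x = x"
  by (simp add: conv_delta_left translate_simps)

lemma conv_delta_right:
  assumes "g \<in> perms m" "x \<in> group_algebra m"
  shows "conv m x (delta g) h = x (h \<circ> pinv g)"
proof -
  have "pinv k \<circ> h = g \<longleftrightarrow> k = h \<circ> pinv g" if k: "k \<in> perms m" for k
  proof
    assume "pinv k \<circ> h = g"
    then have "h = k \<circ> g" using perms_cancel(4)[OF k, of h] by simp
    then show "k = h \<circ> pinv g" using assms(1) by simp
  next
    assume "k = h \<circ> pinv g"
    then have "h = k \<circ> g" using perms_cancel(6)[OF assms(1), of h] by simp
    then show "pinv k \<circ> h = g" using k by simp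
  qed
  then have "conv m x (delta g) h = (\<Sum>k\<in>perms m. if k = h \<circ> pinv g then x (h \<circ> pinv g) else 0)"
    unfolding conv_def delta_def by (intro sum.cong) auto
  then show ?thesis
    using assms by (auto simp: group_algebra_def)
qed

lemma conv_linear:
  "conv m (x + y) z = conv m x z + conv m y z"
  "conv m z (x + y) = conv m z x + conv m z y"
  "conv m (gscale c x) z = gscale c (conv m x z)"
  "conv m z (gscale c x) = gscale c (conv m z x)"
  "conv m 0 z = 0" "conv m z 0 = 0"
  by (auto simp: conv_def gscale_def fun_eq_iff algebra_simps sum.distrib sum_distrib_left)

lemma conv_sum:
  "conv m (\<Sum>i\<in>I. f i) z = (\<Sum>i\<in>I. conv m (f i) z)"
  "conv m z (\<Sum>i\<in>I. f i) = (\<Sum>i\<in>I. conv m z (f i))"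
  by (induction I rule: infinite_finite_induct) (simp_all only: sum.infinite sum.empty sum.insert conv_linear simp_thms)

lemma group_algebra_closed:
  "0 \<in> group_algebra m"
  "x \<in> group_algebra m \<Longrightarrow> y \<in> group_algebra m \<Longrightarrow> x + y \<in> group_algebra m"
  "x \<in> group_algebra m \<Longrightarrow> gscale c x \<in> group_algebra m"
  "y \<in> group_algebra m \<Longrightarrow> conv m x y \<in> group_algebra m"
  "g \<in> perms m \<Longrightarrow> delta g \<in> group_algebra m"
  "star m z \<in> group_algebra m"
proof -
  show "conv m x y \<in> group_algebra m" if "y \<in> group_algebra m"
  proof -
    have "y (pinv g \<circ> h) = 0" if "h \<notin> perms m" "g \<in> perms m" for g h
      using that \<open>y \<in> group_algebra m\<close> perms_comp_iff(1)[OF perms_inv[OF that(2)], of h]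
      by (auto simp: group_algebra_def)
    then show ?thesis by (auto simp: group_algebra_def conv_def intro!: sum.neutral)
  qed
qed (auto simp: group_algebra_def gscale_def delta_def star_def)

lemma conv_delta_delta:
  assumes "g \<in> perms m" "h \<in> perms m"
  shows "conv m (delta g) (delta h) = delta (g \<circ> h)"
proof -
  have "pinv g \<circ> k = h \<longleftrightarrow> k = g \<circ> h" for k
    using perms_cancel(3)[OF assms(1), of h] perms_cancel(4)[OF assms(1), of k] by auto
  then show ?thesis
    using assms by (simp add: conv_delta_left translate_def) (simp add: delta_def)
qed

lemma star_conv: "star m (conv m x y) = conv m (star m y) (star m x)"
proof (rule group_algebra_eqI[of _ m])
  fix h assume h: "h \<in> perms m"
  have "star m (conv m x y) h = (\<Sum>g\<in>perms m. x g * y (pinv g \<circ> pinv h))"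
    using h by (simp add: star_def conv_def)
  also have "\<dots> = (\<Sum>k\<in>perms m. x (pinv h \<circ> k) * y (pinv (pinv h \<circ> k) \<circ> pinv h))"
    by (rule sum_perms_left[OF perms_inv[OF h], symmetric])
  also have "\<dots> = (\<Sum>k\<in>perms m. star m y k * star m x (pinv k \<circ> h))"
  proof (rule sum.cong[OF refl])
    fix k assume k: "k \<in> perms m"
    have "pinv (pinv h \<circ> k) \<circ> pinv h = pinv k" "pinv (pinv k \<circ> h) = pinv h \<circ> k"
      using h k by (simp_all add: perms_inv_comp[OF perms_inv[OF h] k] perms_inv_comp[OF perms_inv[OF k] h])
    then show "x (pinv h \<circ> k) * y (pinv (pinv h \<circ> k) \<circ> pinv h) = star m y k * star m x (pinv k \<circ> h)"
      using h k perms_comp[OF perms_inv[OF k] h] by (simp add: star_def)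
  qed
  finally show "star m (conv m x y) h = conv m (star m y) (star m x) h"
    by (simp add: conv_def)
qed (simp_all add: group_algebra_closed)

lemma star_star: "x \<in> group_algebra m \<Longrightarrow> star m (star m x) = x"
  by (rule group_algebra_eqI[of _ m]) (simp_all add: group_algebra_closed, simp add: star_def)

lemma conv_star_self_id: "conv m (star m x) x id = (\<Sum>g\<in>perms m. (x g)\<^sup>2)"
proof -
  have "conv m (star m x) x id = (\<Sum>g\<in>perms m. (x (pinv g))\<^sup>2)"
    by (simp add: conv_def star_def power2_eq_square)
  then show ?thesis using sum_perms_inv[of "\<lambda>g. (x g)\<^sup>2" m] by simp
qed

text \<open>The coefficient of \<open>x\<^sup>* x\<close> at the identity is the sum of the squares of the coefficients of \<open>x\<close>.
  All nonvanishing results below rest on this.\<close>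

lemma conv_star_self_eq_0:
  assumes "x \<in> group_algebra m" "conv m (star m x) x = 0"
  shows "x = 0"
proof (rule group_algebra_eqI[OF assms(1) group_algebra_closed(1)])
  fix h assume "h \<in> perms m"
  moreover have "(\<Sum>g\<in>perms m. (x g)\<^sup>2) = 0"
    using assms(2) conv_star_self_id[of m x] by simp
  ultimately show "x h = 0 h"
    by (subst (asm) sum_nonneg_eq_0_iff) auto
qed

section \<open>Stabilizers of labellings\<close>

text \<open>Row groups, column groups and groups generated by disjoint transpositions are all of this form:
  the permutations that preserve a labelling of the points.\<close>

definition label_stabilizer :: "nat \<Rightarrow> (nat \<Rightarrow> 'a) \<Rightarrow> (nat \<Rightarrow> nat) set" where
  "label_stabilizer m k = {q \<in> perms m. \<forall>i\<in>{1..m}. k (q i) = k i}"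

definition symz :: "nat \<Rightarrow> (nat \<Rightarrow> 'a) \<Rightarrow> galg" where
  "symz m k = (\<lambda>g. if g \<in> label_stabilizer m k then 1 else 0)"

definition antisymz :: "nat \<Rightarrow> (nat \<Rightarrow> 'a) \<Rightarrow> galg" where
  "antisymz m k = (\<lambda>g. if g \<in> label_stabilizer m k then of_int (sign g) else 0)"

lemma label_stabilizer_perms: "q \<in> label_stabilizer m k \<Longrightarrow> q \<in> perms m"
  by (simp add: label_stabilizer_def)

lemma perms_image: "q \<in> perms m \<Longrightarrow> i \<in> {1..m} \<Longrightarrow> q i \<in> {1..m}"
  by (metis perms_permutes permutes_in_image)

lemma label_stabilizer_comp:
  assumes "p \<in> label_stabilizer m k" "q \<in> label_stabilizer m k"
  shows "p \<circ> q \<in> label_stabilizer m k"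
  using assms perms_image[of q m] unfolding label_stabilizer_def
  by (auto simp del: atLeastAtMost_iff)

lemma label_stabilizer_inv:
  assumes "p \<in> label_stabilizer m k"
  shows "pinv p \<in> label_stabilizer m k"
proof -
  have p: "p \<in> perms m" using assms by (rule label_stabilizer_perms)
  have "k (pinv p i) = k i" if i: "i \<in> {1..m}" for i
  proof -
    have "k (p (pinv p i)) = k (pinv p i)"
      using assms perms_image[OF perms_inv[OF p] i] by (simp add: label_stabilizer_def)
    then show ?thesis using p by simp
  qed
  then show ?thesis using perms_inv[OF p] by (simp add: label_stabilizer_def)
qed

lemma label_stabilizer_id: "id \<in> label_stabilizer m k"
  by (simp add: label_stabilizer_def)

lemma label_stabilizer_comp_iff:
  assumes "p \<in> label_stabilizer m k"
  shows "p \<circ> q \<in> label_stabilizer m k \<longleftrightarrow> q \<in> label_stabilizer m k"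
    "q \<circ> p \<in> label_stabilizer m k \<longleftrightarrow> q \<in> label_stabilizer m k"
  using label_stabilizer_comp[OF assms, of q] label_stabilizer_comp[OF label_stabilizer_inv[OF assms], of "p \<circ> q"]
    label_stabilizer_comp[OF _ assms, of q] label_stabilizer_comp[OF _ label_stabilizer_inv[OF assms], of "q \<circ> p"]
    label_stabilizer_perms[OF assms]
  by (metis perms_cancel(3), metis perms_cancel(5))

lemma label_stabilizer_inv_iff:
  "p \<in> perms m \<Longrightarrow> pinv p \<in> label_stabilizer m k \<longleftrightarrow> p \<in> label_stabilizer m k"
  using label_stabilizer_inv[of p m k] label_stabilizer_inv[of "pinv p" m k] by (metis perms_cancel(7))

lemma transpose_in_label_stabilizer:
  assumes "u \<in> {1..m}" "v \<in> {1..m}" "k u = k v"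
  shows "transpose u v \<in> label_stabilizer m k"
  using assms by (auto simp: label_stabilizer_def perms_def permutes_swap_id transpose_def)

lemma symz_in: "symz m k \<in> group_algebra m" and antisymz_in: "antisymz m k \<in> group_algebra m"
  by (auto simp: group_algebra_def symz_def antisymz_def label_stabilizer_def)

lemma symz_absorb:
  assumes "p \<in> label_stabilizer m k"
  shows "conv m (delta p) (symz m k) = symz m k" "conv m (symz m k) (delta p) = symz m k"
proof -
  have p: "p \<in> perms m" using assms by (rule label_stabilizer_perms)
  show "conv m (delta p) (symz m k) = symz m k"
    using label_stabilizer_comp_iff(1)[OF label_stabilizer_inv[OF assms]]
    by (simp add: conv_delta_left[OF p] translate_def symz_def)
  show "conv m (symz m k) (delta p) = symz m k"
    using label_stabilizer_comp_iff(2)[OF label_stabilizer_inv[OF assms]]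
    by (intro ext) (simp add: conv_delta_right[OF p symz_in], simp add: symz_def)
qed

lemma antisymz_absorb:
  assumes "p \<in> label_stabilizer m k"
  shows "conv m (delta p) (antisymz m k) = gscale (of_int (sign p)) (antisymz m k)"
    "conv m (antisymz m k) (delta p) = gscale (of_int (sign p)) (antisymz m k)"
proof -
  have p: "p \<in> perms m" using assms by (rule label_stabilizer_perms)
  show "conv m (delta p) (antisymz m k) = gscale (of_int (sign p)) (antisymz m k)"
    using label_stabilizer_comp_iff(1)[OF label_stabilizer_inv[OF assms]] p
    by (intro ext) (auto simp: conv_delta_left[OF p] translate_def antisymz_def gscale_def sign_perms_comp[OF perms_inv[OF p]] sign_perms_inv[OF p] dest: label_stabilizer_perms)
  show "conv m (antisymz m k) (delta p) = gscale (of_int (sign p)) (antisymz m k)"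
  proof
    fix h
    have "conv m (antisymz m k) (delta p) h = antisymz m k (h \<circ> pinv p)"
      by (rule conv_delta_right[OF p antisymz_in])
    also have "\<dots> = of_int (sign p) * antisymz m k h"
    proof (cases "h \<in> label_stabilizer m k")
      case True
      then have "sign (h \<circ> pinv p) = sign h * sign p"
        using p by (simp add: sign_perms_comp[of h m] sign_perms_inv label_stabilizer_perms)
      with True show ?thesis
        using label_stabilizer_comp_iff(2)[OF label_stabilizer_inv[OF assms], of h]
        by (simp add: antisymz_def)
    next
      case False
      then show ?thesis
        using label_stabilizer_comp_iff(2)[OF label_stabilizer_inv[OF assms], of h]
        by (simp add: antisymz_def)
    qed
    finally show "conv m (antisymz m k) (delta p) h = gscale (of_int (sign p)) (antisymz m k) h"
      by (simp add: gscale_def)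
  qed
qed

lemma star_symz: "star m (symz m k) = symz m k"
  by (rule ext) (auto simp: star_def symz_def label_stabilizer_inv_iff dest: label_stabilizer_perms)

lemma star_antisymz: "star m (antisymz m k) = antisymz m k"
  by (rule ext) (auto simp: star_def antisymz_def label_stabilizer_inv_iff sign_perms_inv dest: label_stabilizer_perms)

lemma symz_conv_absorbed:
  assumes "\<And>p. p \<in> label_stabilizer m k \<Longrightarrow> conv m (delta p) x = x"
  shows "conv m (symz m k) x = gscale (of_nat (card (label_stabilizer m k))) x"
proof
  fix h
  have sub: "label_stabilizer m k \<subseteq> perms m" by (auto simp: label_stabilizer_def)
  have "conv m (symz m k) x h = (\<Sum>g\<in>perms m. if g \<in> label_stabilizer m k then x (pinv g \<circ> h) else 0)"
    unfolding conv_def symz_def by (rule sum.cong) auto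
  also have "\<dots> = (\<Sum>g\<in>label_stabilizer m k. x (pinv g \<circ> h))"
    using sub by (simp add: sum.inter_restrict[symmetric] Int_absorb1)
  also have "\<dots> = (\<Sum>g\<in>label_stabilizer m k. x h)"
  proof (rule sum.cong[OF refl])
    fix g assume g: "g \<in> label_stabilizer m k"
    then have "translate g x = x" using assms[OF g] conv_delta_left[of g m x] sub by auto
    then show "x (pinv g \<circ> h) = x h" by (simp add: translate_def fun_eq_iff)
  qed
  finally show "conv m (symz m k) x h = gscale (of_nat (card (label_stabilizer m k))) x h"
    by (simp add: gscale_def)
qed

text \<open>Each summand \<open>sign(q) q\<close> of the antisymmetrizer acts on \<open>x\<close> as 1.\<close>

lemma antisymz_conv_absorbed:
  assumes "\<And>p. p \<in> label_stabilizer m k \<Longrightarrow> conv m (delta p) x = gscale (of_int (sign p)) x"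
  shows "conv m (antisymz m k) x = gscale (of_nat (card (label_stabilizer m k))) x"
proof
  fix h
  have sub: "label_stabilizer m k \<subseteq> perms m" by (auto simp: label_stabilizer_def)
  have "conv m (antisymz m k) x h = (\<Sum>g\<in>perms m. if g \<in> label_stabilizer m k then of_int (sign g) * x (pinv g \<circ> h) else 0)"
    unfolding conv_def antisymz_def by (rule sum.cong) auto
  also have "\<dots> = (\<Sum>g\<in>label_stabilizer m k. of_int (sign g) * x (pinv g \<circ> h))"
    using sub by (simp add: sum.inter_restrict[symmetric] Int_absorb1)
  also have "\<dots> = (\<Sum>g\<in>label_stabilizer m k. x h)"
  proof (rule sum.cong[OF refl])
    fix g assume g: "g \<in> label_stabilizer m k"
    then have "translate g x = gscale (of_int (sign g)) x" using assms[OF g] conv_delta_left[of g m x] sub by auto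
    then have "x (pinv g \<circ> h) = of_int (sign g) * x h" by (simp add: translate_def gscale_def fun_eq_iff)
    then show "of_int (sign g) * x (pinv g \<circ> h) = x h"
      by (simp flip: of_int_mult mult.assoc)
  qed
  finally show "conv m (antisymz m k) x h = gscale (of_nat (card (label_stabilizer m k))) x h"
    by (simp add: gscale_def)
qed

lemma symz_symz: "conv m (symz m k) (symz m k) = gscale (of_nat (card (label_stabilizer m k))) (symz m k)"
  by (rule symz_conv_absorbed) (rule symz_absorb)

lemma antisymz_antisymz: "conv m (antisymz m k) (antisymz m k) = gscale (of_nat (card (label_stabilizer m k))) (antisymz m k)"
  by (rule antisymz_conv_absorbed) (rule antisymz_absorb)

lemma antisymz_conv_transpose:
  assumes "u \<in> {1..m}" "v \<in> {1..m}" "u \<noteq> v" "k u = k v"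
  shows "conv m (antisymz m k) (delta (transpose u v)) = gscale (-1) (antisymz m k)"
    "conv m (delta (transpose u v)) (antisymz m k) = gscale (-1) (antisymz m k)"
  using antisymz_absorb[OF transpose_in_label_stabilizer[of u m v k]] assms by (simp_all add: sign_swap_id)

lemma gscale_simps:
  "gscale a (gscale b x) = gscale (a * b) x" "gscale 1 x = x" "gscale 0 x = 0" "gscale c 0 = 0"
  "c \<noteq> 0 \<Longrightarrow> gscale c x = 0 \<longleftrightarrow> x = 0"
  by (auto simp: gscale_def fun_eq_iff)

text \<open>If \<open>u\<close> and \<open>v\<close> share an \<open>r\<close>-label and their preimages under \<open>g\<close> share a \<open>c\<close>-label, then the
  transposition of \<open>u\<close> and \<open>v\<close> is absorbed by the symmetrizer on the left, while moved through \<open>g\<close> it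
  becomes a transposition that changes the sign of the antisymmetrizer on the right.\<close>

lemma symz_delta_antisymz_zero:
  assumes g: "g \<in> perms m" and uv: "u \<in> {1..m}" "v \<in> {1..m}" "u \<noteq> v"
    and "r u = r v" "c (pinv g u) = c (pinv g v)"
  shows "conv m (symz m r) (conv m (delta g) (antisymz m c)) = 0" (is "?X = 0")
proof -
  let ?t = "transpose u v" and ?t' = "transpose (pinv g u) (pinv g v)"
  have t: "?t \<in> perms m" using uv by (simp add: perms_def permutes_swap_id)
  have uv': "pinv g u \<in> {1..m}" "pinv g v \<in> {1..m}"
    using perms_image[OF perms_inv[OF g]] uv by blast+
  have ne: "pinv g u \<noteq> pinv g v" using uv(3) g by (metis perms_inverses(2))
  have t': "?t' \<in> perms m" using uv' by (simp add: perms_def permutes_swap_id)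
  have "?t \<circ> g = g \<circ> ?t'"
    using g by (auto simp: fun_eq_iff transpose_def)
  then have swap: "conv m (delta ?t) (delta g) = conv m (delta g) (delta ?t')"
    using g t t' by (simp add: conv_delta_delta)
  have "?X = conv m (conv m (symz m r) (delta ?t)) (conv m (delta g) (antisymz m c))"
    using symz_absorb(2)[OF transpose_in_label_stabilizer[of u m v r]] uv assms(5) by simp
  also have "\<dots> = conv m (symz m r) (conv m (conv m (delta ?t) (delta g)) (antisymz m c))"
    by (simp only: conv_assoc)
  also have "\<dots> = conv m (symz m r) (conv m (delta g) (conv m (delta ?t') (antisymz m c)))"
    by (simp only: swap conv_assoc)
  also have "\<dots> = gscale (-1) ?X"
    by (simp only: conv_linear antisymz_conv_transpose(2)[OF uv' ne assms(6)])
  finally have "?X h = - ?X h" for h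
    by (auto simp: gscale_def fun_eq_iff)
  then show ?thesis by (auto simp: fun_eq_iff)
qed

section \<open>Tableaux\<close>

lemma sum_list_take_Suc: "r < length \<nu> \<Longrightarrow> sum_list (take (Suc r) \<nu>) = sum_list (take r \<nu>) + \<nu> ! r"
  by (simp add: take_Suc_conv_app_nth)

lemma sum_list_take_mono: "r \<le> s \<Longrightarrow> sum_list (take r \<nu>) \<le> (sum_list (take s \<nu>) :: nat)"
  by (metis le_add1 le_add_diff_inverse sum_list_append take_add)

lemma tab_row_col_bounds:
  assumes "k \<in> {1..sum_list \<nu>}"
  shows "tab_row \<nu> k < length \<nu>" "tab_col \<nu> k \<in> {1..\<nu> ! tab_row \<nu> k}"
proof -
  have ne: "\<nu> \<noteq> []" using assms by auto
  have "k \<le> sum_list (take (Suc (length \<nu> - 1)) \<nu>)" using ne assms by simp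
  then have le: "k \<le> sum_list (take (Suc (tab_row \<nu> k)) \<nu>)" "tab_row \<nu> k \<le> length \<nu> - 1"
    unfolding tab_row_def by (rule LeastI, rule Least_le)
  show r: "tab_row \<nu> k < length \<nu>" using le(2) ne by (cases \<nu>) auto
  have "sum_list (take (tab_row \<nu> k) \<nu>) < k"
  proof (cases "tab_row \<nu> k")
    case (Suc r)
    then have "\<not> k \<le> sum_list (take (Suc r) \<nu>)"
      unfolding tab_row_def by (intro not_less_Least) simp
    with Suc show ?thesis by simp
  qed (use assms in simp)
  then show "tab_col \<nu> k \<in> {1..\<nu> ! tab_row \<nu> k}"
    using le(1) sum_list_take_Suc[OF r] by (auto simp: tab_col_def)
qed

lemma tab_entry:
  assumes "r < length \<nu>" "j \<in> {1..\<nu> ! r}"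
  defines "k \<equiv> sum_list (take r \<nu>) + j"
  shows "k \<in> {1..sum_list \<nu>}" "tab_row \<nu> k = r" "tab_col \<nu> k = j"
proof -
  have k: "k \<le> sum_list (take (Suc r) \<nu>)"
    using assms by (simp add: sum_list_take_Suc)
  then show "k \<in> {1..sum_list \<nu>}"
    using sum_list_take_mono[of "Suc r" "length \<nu>" \<nu>] assms by auto
  show row: "tab_row \<nu> k = r"
    unfolding tab_row_def
  proof (rule Least_equality)
    fix s assume s: "k \<le> sum_list (take (Suc s) \<nu>)"
    show "r \<le> s"
    proof (rule ccontr)
      assume "\<not> r \<le> s"
      then have "sum_list (take (Suc s) \<nu>) \<le> sum_list (take r \<nu>)"
        by (intro sum_list_take_mono) simp
      with s assms show False by auto
    qed
  qed (rule k)
  show "tab_col \<nu> k = j" unfolding tab_col_def row by (simp add: k_def)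
qed

definition diagram :: "nat list \<Rightarrow> (nat \<times> nat) set" where
  "diagram \<nu> = (SIGMA r:{..<length \<nu>}. {1..\<nu> ! r})"

lemma diagram_row: "r < length \<nu> \<Longrightarrow> {j. (r, j) \<in> diagram \<nu>} = {1..\<nu> ! r}"
  by (auto simp: diagram_def)

lemma tab_bij: "bij_betw (\<lambda>k. (tab_row \<nu> k, tab_col \<nu> k)) {1..sum_list \<nu>} (diagram \<nu>)"
proof (rule bij_betw_byWitness[where f' = "\<lambda>(r, j). sum_list (take r \<nu>) + j"])
  show "\<forall>k\<in>{1..sum_list \<nu>}. (case (tab_row \<nu> k, tab_col \<nu> k) of (r, j) \<Rightarrow> sum_list (take r \<nu>) + j) = k"
    using tableau_entry_determined by (metis case_prod_conv)
qed (use tab_row_col_bounds tab_entry in \<open>auto simp: diagram_def\<close>)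

text \<open>Induction on the cardinality, removing the maximum: the maximum of a set of \<open>n\<close> positive
  numbers is at least \<open>n\<close>.\<close>

lemma sum_ge_initial_segment:
  assumes "finite A" "0 \<notin> A"
  shows "\<Sum>{1..card A} \<le> \<Sum>A" "\<Sum>{1..card A} = \<Sum>A \<Longrightarrow> A = {1..card A}"
proof -
  have "\<Sum>{1..card A} \<le> \<Sum>A \<and> (\<Sum>{1..card A} = \<Sum>A \<longrightarrow> A = {1..card A})"
    using assms
  proof (induction "card A" arbitrary: A)
    case 0
    then show ?case by simp
  next
    case (Suc n)
    define x where "x = Max A"
    have x: "x \<in> A" using Suc.hyps(2) Suc.prems(1) by (auto simp: x_def intro!: Max_in)
    have "A \<subseteq> {1..x}"
      using Suc.prems by (auto simp: x_def Suc_le_eq intro!: gr0I)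
    then have "Suc n \<le> x" using card_mono[of "{1..x}" A] Suc.hyps(2) by simp
    have card: "n = card (A - {x})" using Suc.hyps(2) x Suc.prems(1) by simp
    have IH: "\<Sum>{1..n} \<le> \<Sum>(A - {x})" "\<Sum>{1..n} = \<Sum>(A - {x}) \<Longrightarrow> A - {x} = {1..n}"
      using Suc.hyps(1)[OF card] Suc.prems card by auto
    have sumA: "\<Sum>A = x + \<Sum>(A - {x})" using x Suc.prems(1) by (simp add: sum.remove)
    have eq: "A = {1..Suc n}" if "\<Sum>{1..Suc n} = \<Sum>A"
    proof -
      have "x = Suc n" "\<Sum>{1..n} = \<Sum>(A - {x})"
        using that sumA IH(1) \<open>Suc n \<le> x\<close> by auto
      then have "A - {Suc n} = {1..n}" "Suc n \<in> A" using IH(2) x by simp_all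
      then have "A = insert (Suc n) {1..n}" by blast
      then show ?thesis by auto
    qed
    show ?case
      using sumA IH(1) \<open>Suc n \<le> x\<close> eq by (simp flip: Suc.hyps(2))
  qed
  then show "\<Sum>{1..card A} \<le> \<Sum>A" "\<Sum>{1..card A} = \<Sum>A \<Longrightarrow> A = {1..card A}" by blast+
qed

text \<open>Comparing shapes by this number replaces the dominance order: it is all that the combinatorial
  lemma on tableaux needs, and any two shapes are comparable.\<close>

definition column_sum :: "nat list \<Rightarrow> nat" where
  "column_sum \<nu> = (\<Sum>k\<in>{1..sum_list \<nu>}. tab_col \<nu> k)"

lemma row_cells: "bij_betw (tab_col \<nu>) {k\<in>{1..sum_list \<nu>}. tab_row \<nu> k = r} {j. (r, j) \<in> diagram \<nu>}"
proof -
  have "{j. (r, j) \<in> diagram \<nu>} = tab_col \<nu> ` {k\<in>{1..sum_list \<nu>}. tab_row \<nu> k = r}"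
    using bij_betw_imp_surj_on[OF tab_bij[of \<nu>]] by (auto simp: image_iff set_eq_iff Bex_def) metis+
  moreover have "inj_on (tab_col \<nu>) {k\<in>{1..sum_list \<nu>}. tab_row \<nu> k = r}"
    using bij_betw_imp_inj_on[OF tab_bij[of \<nu>]] by (auto simp: inj_on_def)
  ultimately show ?thesis by (simp add: bij_betw_def)
qed

lemma sum_rows:
  "(\<Sum>k\<in>{1..sum_list \<nu>}. f k) = (\<Sum>r<length \<nu>. \<Sum>k\<in>{k\<in>{1..sum_list \<nu>}. tab_row \<nu> k = r}. (f k :: nat))"
  by (rule sum.group[symmetric]) (use tab_row_col_bounds in auto)

text \<open>Within a row the values of \<open>f\<close> are distinct positive integers, and the smallest possible sum of
  such integers is the one of the column indices.\<close>

lemma row_transversal_sum: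
  assumes pos: "\<And>k. k \<in> {1..sum_list \<nu>} \<Longrightarrow> f k \<noteq> 0"
    and inj: "inj_on (\<lambda>k. (tab_row \<nu> k, f k)) {1..sum_list \<nu>}"
  shows "column_sum \<nu> \<le> (\<Sum>k\<in>{1..sum_list \<nu>}. f k)"
    "column_sum \<nu> = (\<Sum>k\<in>{1..sum_list \<nu>}. f k) \<Longrightarrow>
       bij_betw (\<lambda>k. (tab_row \<nu> k, f k)) {1..sum_list \<nu>} (diagram \<nu>)"
proof -
  define R where "R r = {k\<in>{1..sum_list \<nu>}. tab_row \<nu> k = r}" for r
  have fin: "finite (R r)" for r by (simp add: R_def)
  have inj_row: "inj_on f (R r)" for r using inj by (auto simp: R_def inj_on_def)
  have card: "card (f ` R r) = \<nu> ! r" if "r < length \<nu>" for r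
    using bij_betw_same_card[OF row_cells[of \<nu> r]] card_image[OF inj_row[of r]]
    unfolding R_def diagram_row[OF that] by simp
  have row_sum: "(\<Sum>k\<in>R r. f k) = \<Sum>(f ` R r)" for r
    using sum.reindex[OF inj_row[of r], of id] by simp
  have col_row: "(\<Sum>k\<in>R r. tab_col \<nu> k) = \<Sum>{1..\<nu> ! r}" if "r < length \<nu>" for r
    using sum.reindex_bij_betw[OF row_cells[of \<nu> r], of id]
    unfolding R_def diagram_row[OF that] by simp
  have z: "0 \<notin> f ` R r" for r using pos by (force simp: R_def simp del: atLeastAtMost_iff)
  have le: "(\<Sum>k\<in>R r. tab_col \<nu> k) \<le> (\<Sum>k\<in>R r. f k)" if "r < length \<nu>" for r
    using sum_ge_initial_segment(1)[of "f ` R r"] fin z card[OF that] col_row[OF that] row_sum by simp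
  have cs: "column_sum \<nu> = (\<Sum>r<length \<nu>. \<Sum>k\<in>R r. tab_col \<nu> k)"
    "(\<Sum>k\<in>{1..sum_list \<nu>}. f k) = (\<Sum>r<length \<nu>. \<Sum>k\<in>R r. f k)"
    unfolding column_sum_def R_def by (rule sum_rows)+
  show "column_sum \<nu> \<le> (\<Sum>k\<in>{1..sum_list \<nu>}. f k)"
    unfolding cs by (rule sum_mono) (use le in simp)
  assume eq: "column_sum \<nu> = (\<Sum>k\<in>{1..sum_list \<nu>}. f k)"
  have "f ` R r = {1..\<nu> ! r}" if r: "r < length \<nu>" for r
  proof -
    have "(\<Sum>k\<in>R r. tab_col \<nu> k) = (\<Sum>k\<in>R r. f k)"
    proof (rule ccontr)
      assume "\<not> ?thesis"
      then have "(\<Sum>k\<in>R r. tab_col \<nu> k) < (\<Sum>k\<in>R r. f k)" using le[OF r] by simp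
      then have "(\<Sum>r<length \<nu>. \<Sum>k\<in>R r. tab_col \<nu> k) < (\<Sum>r<length \<nu>. \<Sum>k\<in>R r. f k)"
        using r le by (intro sum_strict_mono_ex1) auto
      with eq cs show False by simp
    qed
    then have "\<Sum>{1..card (f ` R r)} = \<Sum>(f ` R r)"
      using card[OF r] col_row[OF r] row_sum[of r] by simp
    then have "f ` R r = {1..card (f ` R r)}"
      by (rule sum_ge_initial_segment(2)[OF finite_imageI[OF fin] z])
    then show ?thesis unfolding card[OF r] .
  qed
  then have "(\<lambda>k. (tab_row \<nu> k, f k)) ` {1..sum_list \<nu>} = diagram \<nu>"
    using tab_row_col_bounds(1)[of _ \<nu>] unfolding diagram_def R_def
    by (auto simp: image_iff set_eq_iff Bex_def simp del: atLeastAtMost_iff)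
  with inj show "bij_betw (\<lambda>k. (tab_row \<nu> k, f k)) {1..sum_list \<nu>} (diagram \<nu>)"
    by (simp add: bij_betw_def)
qed

text \<open>A partition is determined by its column lengths, since the number of parts equal to \<open>j\<close> is the
  difference of the lengths of the columns \<open>j\<close> and \<open>j + 1\<close>.\<close>

lemma partition_eqI:
  assumes "is_partition \<nu>" "is_partition \<mu>"
    and count: "\<And>j. 1 \<le> j \<Longrightarrow> card {r. r < length \<nu> \<and> j \<le> \<nu> ! r} = card {r. r < length \<mu> \<and> j \<le> \<mu> ! r}"
  shows "\<nu> = \<mu>"
proof -
  have ge: "card {r. r < length xs \<and> j \<le> xs ! r} = size (filter_mset (\<lambda>p. j \<le> p) (mset xs))" for j and xs :: "nat list"
    by (metis length_filter_conv_card mset_filter size_mset)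
  have split: "size (filter_mset (\<lambda>p. j \<le> p) M) = count M j + size (filter_mset (\<lambda>p. Suc j \<le> p) M)" for j and M :: "nat multiset"
    by (induction M) auto
  have "count (mset \<nu>) j = count (mset \<mu>) j" for j
  proof (cases "j = 0")
    case True
    have zero: "count (mset \<nu>) 0 = 0" "count (mset \<mu>) 0 = 0"
      using assms(1,2) by (simp_all add: is_partition_def count_eq_zero_iff)
    show ?thesis unfolding True by (simp only: zero)
  next
    case False
    then show ?thesis
      using count[of j] count[of "Suc j"] split[of j "mset \<nu>"] split[of j "mset \<mu>"] by (simp add: ge)
  qed
  then have m: "mset \<nu> = mset \<mu>" by (rule multiset_eqI)
  have "sorted (rev \<nu>)" "sorted (rev \<mu>)"
    using assms(1,2) by (simp_all add: is_partition_def sorted_wrt_rev)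
  moreover have "mset (rev \<nu>) = mset (rev \<mu>)" using m by simp
  ultimately have "rev \<nu> = rev \<mu>" by (metis properties_for_sort)
  then show ?thesis by simp
qed

lemma card_column:
  assumes "bij_betw (\<lambda>k. (tab_row \<nu> k, f k)) {1..sum_list \<nu>} (diagram \<nu>)" "1 \<le> j"
  shows "card {k\<in>{1..sum_list \<nu>}. f k = j} = card {r. r < length \<nu> \<and> j \<le> \<nu> ! r}"
proof -
  have "bij_betw (tab_row \<nu>) {k\<in>{1..sum_list \<nu>}. f k = j} {r. (r, j) \<in> diagram \<nu>}"
  proof -
    have "{r. (r, j) \<in> diagram \<nu>} = tab_row \<nu> ` {k\<in>{1..sum_list \<nu>}. f k = j}"
      using bij_betw_imp_surj_on[OF assms(1)] by (auto simp: image_iff set_eq_iff Bex_def) metis+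
    moreover have "inj_on (tab_row \<nu>) {k\<in>{1..sum_list \<nu>}. f k = j}"
      using bij_betw_imp_inj_on[OF assms(1)] by (auto simp: inj_on_def)
    ultimately show ?thesis by (simp add: bij_betw_def)
  qed
  then show ?thesis
    using bij_betw_same_card[of "tab_row \<nu>"] assms(2) by (simp add: diagram_def)
qed

lemma permuted_column_sum:
  assumes "g \<in> perms m" "sum_list \<mu> = m"
  shows "(\<Sum>k\<in>{1..m}. tab_col \<mu> (pinv g k)) = column_sum \<mu>"
  unfolding column_sum_def assms(2)
  by (rule sum.reindex_bij_betw, rule permutes_imp_bij, rule perms_permutes, rule perms_inv, rule assms(1))

text \<open>The combinatorial lemma behind the theory of Young symmetrizers: suppose that every row of the
  tableau of \<open>\<nu>\<close> meets every column of the \<open>g\<close>-translated tableau of \<open>\<mu>\<close> in at most one point. If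
  moreover the column sum of \<open>\<mu>\<close> does not exceed the one of \<open>\<nu>\<close>, then the shapes are equal, and the
  first tableau can be rearranged within its rows so as to have the columns of the second.\<close>

lemma transversal_tableaux:
  assumes \<nu>: "partition_of m \<nu>" and \<mu>: "partition_of m \<mu>" and g: "g \<in> perms m"
    and le: "column_sum \<mu> \<le> column_sum \<nu>"
    and inj: "inj_on (\<lambda>k. (tab_row \<nu> k, tab_col \<mu> (pinv g k))) {1..m}"
  shows "\<nu> = \<mu>" "bij_betw (\<lambda>k. (tab_row \<nu> k, tab_col \<mu> (pinv g k))) {1..m} (diagram \<nu>)"
proof -
  have sums: "sum_list \<nu> = m" "sum_list \<mu> = m" using \<nu> \<mu> by (simp_all add: partition_of_def)
  have pos: "tab_col \<mu> (pinv g k) \<noteq> 0" if "k \<in> {1..m}" for k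
    using tab_row_col_bounds(2)[of "pinv g k" \<mu>] perms_image[OF perms_inv[OF g] that] sums by force
  note * = row_transversal_sum[of \<nu> "\<lambda>k. tab_col \<mu> (pinv g k)", unfolded sums(1), OF pos inj,
      unfolded permuted_column_sum[OF g sums(2)]]
  have eq: "column_sum \<nu> = column_sum \<mu>" using *(1) le by simp
  show bij: "bij_betw (\<lambda>k. (tab_row \<nu> k, tab_col \<mu> (pinv g k))) {1..m} (diagram \<nu>)"
    by (rule *(2)[OF _ eq])
  show "\<nu> = \<mu>"
  proof (rule partition_eqI)
    fix j :: nat assume j: "1 \<le> j"
    have "card {r. r < length \<nu> \<and> j \<le> \<nu> ! r} = card {k\<in>{1..m}. tab_col \<mu> (pinv g k) = j}"
      using card_column[of \<nu> "\<lambda>k. tab_col \<mu> (pinv g k)" j] bij j sums by simp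
    also have "\<dots> = card {k\<in>{1..m}. tab_col \<mu> k = j}"
    proof (rule bij_betw_same_card[of "pinv g"], rule bij_betw_byWitness[of _ g])
      show "pinv g ` {k \<in> {1..m}. tab_col \<mu> (pinv g k) = j} \<subseteq> {k \<in> {1..m}. tab_col \<mu> k = j}"
        using perms_image[OF perms_inv[OF g]] by blast
      show "g ` {k \<in> {1..m}. tab_col \<mu> k = j} \<subseteq> {k \<in> {1..m}. tab_col \<mu> (pinv g k) = j}"
        using perms_image[OF g] perms_inverses(1)[OF g] by auto
    qed (use g in auto)
    also have "\<dots> = card {r. r < length \<mu> \<and> j \<le> \<mu> ! r}"
      using card_column[OF tab_bij j, of \<mu>] sums by simp
    finally show "card {r. r < length \<nu> \<and> j \<le> \<nu> ! r} = card {r. r < length \<mu> \<and> j \<le> \<mu> ! r}" .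
  qed (use \<nu> \<mu> in \<open>simp_all add: partition_of_def\<close>)
qed

abbreviation row_sym :: "nat list \<Rightarrow> galg" where
  "row_sym \<nu> \<equiv> symz (sum_list \<nu>) (tab_row \<nu>)"

abbreviation col_antisym :: "nat list \<Rightarrow> galg" where
  "col_antisym \<nu> \<equiv> antisymz (sum_list \<nu>) (tab_col \<nu>)"

lemma young_symmetrizer_conv:
  "young_symmetrizer \<nu> = conv (sum_list \<nu>) (row_sym \<nu>) (col_antisym \<nu>)"
proof
  fix h
  let ?m = "sum_list \<nu>"
  let ?R = "label_stabilizer ?m (tab_row \<nu>)" and ?C = "label_stabilizer ?m (tab_col \<nu>)"
  have RC: "row_stabilizer \<nu> = ?R" "col_stabilizer \<nu> = ?C"
    by (simp_all add: row_stabilizer_def col_stabilizer_def label_stabilizer_def perms_def)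
  have "conv ?m (row_sym \<nu>) (col_antisym \<nu>) h =
      (\<Sum>g\<in>perms ?m. if g \<in> ?R \<and> pinv g \<circ> h \<in> ?C then of_int (sign (pinv g \<circ> h)) else 0)"
    unfolding conv_def symz_def antisymz_def by (rule sum.cong) auto
  also have "\<dots> = (\<Sum>g\<in>{g\<in>perms ?m. g \<in> ?R \<and> pinv g \<circ> h \<in> ?C}. of_int (sign (pinv g \<circ> h)))"
    by (rule sum.inter_filter[symmetric]) simp
  also have "\<dots> = (\<Sum>(p, q)\<in>{(p, q) \<in> ?R \<times> ?C. p \<circ> q = h}. of_int (sign q))"
    by (rule sum.reindex_bij_witness[of _ fst "\<lambda>g. (g, pinv g \<circ> h)"])
      (auto dest: label_stabilizer_perms)
  finally show "young_symmetrizer \<nu> h = conv ?m (row_sym \<nu>) (col_antisym \<nu>) h"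
    by (simp add: young_symmetrizer_def RC)
qed

lemma sandwich_delta_zero:
  assumes "partition_of m \<nu>" "partition_of m \<mu>" "g \<in> perms m"
    and "\<not> inj_on (\<lambda>k. (tab_row \<nu> k, tab_col \<mu> (pinv g k))) {1..m}"
  shows "conv m (row_sym \<nu>) (conv m (delta g) (col_antisym \<mu>)) = 0"
proof -
  have sums: "sum_list \<nu> = m" "sum_list \<mu> = m" using assms by (simp_all add: partition_of_def)
  from assms(4) obtain u v where "u \<in> {1..m}" "v \<in> {1..m}" "u \<noteq> v"
    "tab_row \<nu> u = tab_row \<nu> v" "tab_col \<mu> (pinv g u) = tab_col \<mu> (pinv g v)"
    unfolding inj_on_def by blast
  then show ?thesis unfolding sums by (intro symz_delta_antisymz_zero assms)
qed

lemma conv_middle_expand: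
  "conv m a (conv m x b) = (\<Sum>g\<in>perms m. gscale (x g) (conv m a (conv m (delta g) b)))"
  by (simp add: conv_expand[of m x b] conv_sum conv_linear conv_delta_left)

lemma sandwich_diff:
  assumes "partition_of m \<nu>" "partition_of m \<mu>" "\<nu> \<noteq> \<mu>" "column_sum \<mu> \<le> column_sum \<nu>"
  shows "conv m (row_sym \<nu>) (conv m x (col_antisym \<mu>)) = 0"
proof -
  have "conv m (row_sym \<nu>) (conv m (delta g) (col_antisym \<mu>)) = 0" if g: "g \<in> perms m" for g
    using sandwich_delta_zero[OF assms(1,2) g] transversal_tableaux(1)[OF assms(1,2) g assms(4)] assms(3) by blast
  then show ?thesis unfolding conv_middle_expand[of m _ x] by (simp add: gscale_simps)
qed

text \<open>A permutation \<open>g\<close> contributes only if the rows of the tableau \<open>T\<close> meet the columns of \<open>g T\<close> in at most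
  one point. In that case \<open>g = p q\<close> with \<open>p\<close> in the row group and \<open>q\<close> in the column group, and both factors
  are absorbed.\<close>

lemma sandwich_same:
  assumes \<nu>: "partition_of m \<nu>"
  shows "\<exists>s. conv m (row_sym \<nu>) (conv m x (col_antisym \<nu>)) = gscale s (young_symmetrizer \<nu>)"
proof -
  have m: "sum_list \<nu> = m" using \<nu> by (simp add: partition_of_def)
  let ?R = "label_stabilizer m (tab_row \<nu>)" and ?C = "label_stabilizer m (tab_col \<nu>)"
  have "\<exists>s. conv m (row_sym \<nu>) (conv m (delta g) (col_antisym \<nu>)) = gscale s (young_symmetrizer \<nu>)"
    if g: "g \<in> perms m" for g
  proof (cases "inj_on (\<lambda>k. (tab_row \<nu> k, tab_col \<nu> (pinv g k))) {1..m}")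
    case False
    then show ?thesis using sandwich_delta_zero[OF \<nu> \<nu> g] by (intro exI[of _ 0]) (simp add: gscale_simps)
  next
    case True
    let ?\<theta> = "\<lambda>k. (tab_row \<nu> k, tab_col \<nu> (pinv g k))" and ?\<phi> = "\<lambda>k. (tab_row \<nu> k, tab_col \<nu> k)"
    have \<theta>: "bij_betw ?\<theta> {1..m} (diagram \<nu>)"
      by (rule transversal_tableaux(2)[OF \<nu> \<nu> g order_refl True])
    have \<phi>: "bij_betw ?\<phi> {1..m} (diagram \<nu>)" using tab_bij[of \<nu>] m by simp
    \<comment> \<open>\<open>p y\<close> is the point in the row of \<open>y\<close> that lies in that column of the translated tableau whose
      index is the column index of \<open>y\<close>.\<close>
    define p where "p y = (if y \<in> {1..m} then the_inv_into {1..m} ?\<theta> (?\<phi> y) else y)" for y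
    have "bij_betw (the_inv_into {1..m} ?\<theta> \<circ> ?\<phi>) {1..m} {1..m}"
      by (rule bij_betw_trans[OF \<phi> bij_betw_the_inv_into[OF \<theta>]])
    then have "bij_betw p {1..m} {1..m}"
      by (rule bij_betw_cong[THEN iffD1, rotated]) (simp add: p_def)
    then have p: "p \<in> perms m"
      unfolding perms_def by (auto intro!: bij_imp_permutes simp: p_def simp del: atLeastAtMost_iff)
    have \<theta>p: "?\<theta> (p y) = ?\<phi> y" if "y \<in> {1..m}" for y
    proof -
      have "?\<phi> y \<in> ?\<theta> ` {1..m}"
        using bij_betw_imp_surj_on[OF \<theta>] bij_betw_imp_surj_on[OF \<phi>] that by blast
      with f_the_inv_into_f[OF bij_betw_imp_inj_on[OF \<theta>]] that show ?thesis by (simp add: p_def)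
    qed
    have pR: "p \<in> ?R" using p \<theta>p by (simp add: label_stabilizer_def)
    define q where "q = pinv p \<circ> g"
    have q: "q \<in> perms m" using p g by (simp add: q_def)
    have "tab_col \<nu> (q z) = tab_col \<nu> z" if "z \<in> {1..m}" for z
      using \<theta>p[OF perms_image[OF q that]] p g by (simp add: q_def)
    then have qC: "q \<in> ?C" using q by (simp add: label_stabilizer_def)
    have "conv m (delta g) (col_antisym \<nu>) = conv m (delta p) (conv m (delta q) (col_antisym \<nu>))"
      using p q conv_delta_delta[OF p q] by (simp add: q_def flip: conv_assoc)
    then have "conv m (row_sym \<nu>) (conv m (delta g) (col_antisym \<nu>)) =
        conv m (conv m (row_sym \<nu>) (delta p)) (conv m (delta q) (col_antisym \<nu>))"
      by (simp add: conv_assoc)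
    also have "\<dots> = gscale (of_int (sign q)) (young_symmetrizer \<nu>)"
      using symz_absorb(2)[OF pR] antisymz_absorb(1)[OF qC] m
      by (simp add: conv_linear young_symmetrizer_conv)
    finally show ?thesis by blast
  qed
  then obtain s where s: "\<And>g. g \<in> perms m \<Longrightarrow>
      conv m (row_sym \<nu>) (conv m (delta g) (col_antisym \<nu>)) = gscale (s g) (young_symmetrizer \<nu>)"
    by metis
  have "conv m (row_sym \<nu>) (conv m x (col_antisym \<nu>)) =
      (\<Sum>g\<in>perms m. gscale (x g * s g) (young_symmetrizer \<nu>))"
    unfolding conv_middle_expand[of m _ x] by (rule sum.cong) (simp_all add: s gscale_simps)
  also have "\<dots> = gscale (\<Sum>g\<in>perms m. x g * s g) (young_symmetrizer \<nu>)"
    by (simp add: galg.scale_sum_left)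
  finally show ?thesis by blast
qed

section \<open>Specht modules\<close>

lemma specht_module_iff: "x \<in> specht_module \<nu> \<longleftrightarrow> (\<exists>y. x = conv (sum_list \<nu>) y (young_symmetrizer \<nu>))"
proof
  let ?m = "sum_list \<nu>" and ?c = "young_symmetrizer \<nu>"
  assume "x \<in> specht_module \<nu>"
  then show "\<exists>y. x = conv ?m y ?c"
    unfolding specht_module_def
  proof (induction rule: galg.span_induct_alt)
    case base
    show ?case by (rule exI[of _ 0]) (simp only: conv_linear)
  next
    case (step a x y)
    then obtain g z where "g \<in> perms ?m" "x = conv ?m (delta g) ?c" "y = conv ?m z ?c"
      by (auto simp: conv_delta_left perms_def)
    then show ?case
      by (intro exI[of _ "gscale a (delta g) + z"]) (simp only: conv_linear)
  qed
next
  assume "\<exists>y. x = conv (sum_list \<nu>) y (young_symmetrizer \<nu>)"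
  then obtain y where
    "x = (\<Sum>g\<in>perms (sum_list \<nu>). gscale (y g) (translate g (young_symmetrizer \<nu>)))"
    unfolding conv_expand by blast
  then show "x \<in> specht_module \<nu>"
    unfolding specht_module_def perms_def
    by (simp only:) (intro galg.span_sum galg.span_scale galg.span_base, blast)
qed

lemma young_in_specht: "young_symmetrizer \<nu> \<in> specht_module \<nu>"
  unfolding specht_module_iff by (rule exI[of _ "delta id"]) simp

lemma specht_left_ideal: "x \<in> specht_module \<nu> \<Longrightarrow> conv (sum_list \<nu>) y x \<in> specht_module \<nu>"
  unfolding specht_module_iff by (metis conv_assoc)

lemma young_group_algebra: "young_symmetrizer \<nu> \<in> group_algebra (sum_list \<nu>)"
  by (simp add: young_symmetrizer_conv group_algebra_closed antisymz_in)

lemma specht_group_algebra: "x \<in> specht_module \<nu> \<Longrightarrow> x \<in> group_algebra (sum_list \<nu>)"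
  unfolding specht_module_iff using group_algebra_closed(4)[OF young_group_algebra] by blast

lemma young_nonzero: "young_symmetrizer \<nu> \<noteq> 0"
  using young_symmetrizer_id[of \<nu>] by auto

lemma young_row_invariant:
  "p \<in> label_stabilizer (sum_list \<nu>) (tab_row \<nu>) \<Longrightarrow>
    conv (sum_list \<nu>) (delta p) (young_symmetrizer \<nu>) = young_symmetrizer \<nu>"
  by (simp add: young_symmetrizer_conv symz_absorb flip: conv_assoc)

lemma young_col_alternating:
  "q \<in> label_stabilizer (sum_list \<nu>) (tab_col \<nu>) \<Longrightarrow>
    conv (sum_list \<nu>) (young_symmetrizer \<nu>) (delta q) = gscale (of_int (sign q)) (young_symmetrizer \<nu>)"
  by (simp add: young_symmetrizer_conv conv_assoc antisymz_absorb conv_linear)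

lemma young_conv_young:
  assumes "partition_of m \<nu>"
  shows "\<exists>s. conv m (young_symmetrizer \<nu>) (conv m y (young_symmetrizer \<nu>)) = gscale s (young_symmetrizer \<nu>)"
proof -
  have m: "sum_list \<nu> = m" using assms by (simp add: partition_of_def)
  let ?y = "conv m (col_antisym \<nu>) (conv m y (row_sym \<nu>))"
  have "conv m (young_symmetrizer \<nu>) (conv m y (young_symmetrizer \<nu>)) =
      conv m (row_sym \<nu>) (conv m ?y (col_antisym \<nu>))"
    by (simp add: young_symmetrizer_conv m conv_assoc)
  then show ?thesis using sandwich_same[OF assms, of ?y] by simp
qed

text \<open>The middle part \<open>a\<^sub>\<nu> x b\<^sub>\<mu>\<close> vanishes if \<open>\<mu>\<close> has the smaller column sum. Otherwise the roles of \<open>\<nu>\<close> and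
  \<open>\<mu>\<close> are exchanged by the involution, which shows that \<open>b\<^sub>\<nu> y a\<^sub>\<mu>\<close> vanishes.\<close>

lemma young_conv_diff:
  assumes "partition_of m \<nu>" "partition_of m \<mu>" "\<nu> \<noteq> \<mu>"
  shows "conv m (young_symmetrizer \<nu>) (conv m y (young_symmetrizer \<mu>)) = 0"
proof (cases "column_sum \<mu> \<le> column_sum \<nu>")
  case True
  have m: "sum_list \<nu> = m" "sum_list \<mu> = m" using assms by (simp_all add: partition_of_def)
  let ?y = "conv m (col_antisym \<nu>) (conv m y (row_sym \<mu>))"
  have "conv m (young_symmetrizer \<nu>) (conv m y (young_symmetrizer \<mu>)) =
      conv m (row_sym \<nu>) (conv m ?y (col_antisym \<mu>))"
    by (simp add: young_symmetrizer_conv m conv_assoc)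
  then show ?thesis using sandwich_diff[OF assms(1,2,3) True, of ?y] by simp
next
  case False
  have m: "sum_list \<nu> = m" "sum_list \<mu> = m" using assms by (simp_all add: partition_of_def)
  have "conv m (row_sym \<mu>) (conv m (star m y) (col_antisym \<nu>)) = 0"
    using sandwich_diff[of m \<mu> \<nu> "star m y"] assms False by simp
  then have "star m (conv m (row_sym \<mu>) (conv m (star m y) (col_antisym \<nu>))) = 0"
    by (simp add: star_def fun_eq_iff)
  then have "conv m (conv m (col_antisym \<nu>) (star m (star m y))) (row_sym \<mu>) = 0"
    using star_symz[of m "tab_row \<mu>"] star_antisymz[of m "tab_col \<nu>"] m by (simp add: star_conv)
  moreover have "conv m (star m (star m y)) z = conv m y z" for z
    by (rule ext) (simp add: conv_def star_def)
  ultimately have zero: "conv m (col_antisym \<nu>) (conv m y (row_sym \<mu>)) = 0"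
    by (simp add: conv_assoc)
  have "conv m (young_symmetrizer \<nu>) (conv m y (young_symmetrizer \<mu>)) =
      conv m (row_sym \<nu>) (conv m (conv m (col_antisym \<nu>) (conv m y (row_sym \<mu>))) (col_antisym \<mu>))"
    by (simp add: young_symmetrizer_conv m conv_assoc)
  then show ?thesis using zero by (simp add: conv_linear)
qed

lemma star_young: "star (sum_list \<nu>) (young_symmetrizer \<nu>) = conv (sum_list \<nu>) (col_antisym \<nu>) (row_sym \<nu>)"
  by (simp add: young_symmetrizer_conv star_conv star_symz star_antisymz)

text \<open>Up to a positive factor \<open>b a b\<close> is \<open>c\<^sup>* c\<close> for \<open>c = a b\<close>, because \<open>a a\<close> is a multiple of \<open>a\<close>.\<close>

lemma col_row_col_nonzero: "conv (sum_list \<nu>) (col_antisym \<nu>) (young_symmetrizer \<nu>) \<noteq> 0"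
proof
  let ?m = "sum_list \<nu>"
  assume z: "conv ?m (col_antisym \<nu>) (young_symmetrizer \<nu>) = 0"
  have "conv ?m (star ?m (young_symmetrizer \<nu>)) (young_symmetrizer \<nu>) =
      conv ?m (col_antisym \<nu>) (conv ?m (conv ?m (row_sym \<nu>) (row_sym \<nu>)) (col_antisym \<nu>))"
    by (simp add: star_young conv_assoc) (simp add: young_symmetrizer_conv conv_assoc)
  also have "\<dots> = 0"
    using z by (simp add: symz_symz conv_linear young_symmetrizer_conv gscale_simps)
  finally show False
    using conv_star_self_eq_0[OF young_group_algebra] young_nonzero by blast
qed

text \<open>If \<open>c c = 0\<close>, then the self-adjoint element \<open>b c = b a b\<close> would have square 0, since its square is
  a multiple of \<open>b c c\<close>.\<close>

lemma young_square:
  assumes "partition_of m \<nu>"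
  shows "\<exists>s. s \<noteq> 0 \<and> conv m (young_symmetrizer \<nu>) (young_symmetrizer \<nu>) = gscale s (young_symmetrizer \<nu>)"
proof -
  have m: "sum_list \<nu> = m" using assms by (simp add: partition_of_def)
  let ?c = "young_symmetrizer \<nu>" and ?b = "col_antisym \<nu>"
  obtain s where s: "conv m ?c ?c = gscale s ?c"
    using young_conv_young[OF assms, of "delta id"] by auto
  have "s \<noteq> 0"
  proof
    assume "s = 0"
    then have cc: "conv m ?c ?c = 0" using s by (simp add: gscale_simps)
    let ?x = "conv m ?b ?c"
    have star: "star m ?x = ?x"
      by (simp only: young_symmetrizer_conv m star_conv star_symz star_antisymz conv_assoc)
    have "conv m (star m ?x) ?x = conv m ?b (conv m ?c (conv m ?b ?c))"
      unfolding star by (simp add: conv_assoc)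
    also have "conv m ?c (conv m ?b ?c) = conv m (conv m ?c ?b) ?c" by (simp add: conv_assoc)
    also have "conv m ?c ?b = gscale (of_nat (card (label_stabilizer m (tab_col \<nu>)))) ?c"
      using m by (simp add: young_symmetrizer_conv conv_assoc antisymz_antisymz conv_linear)
    finally have "conv m (star m ?x) ?x = 0" by (simp only: cc conv_linear gscale_simps)
    then have "?x = 0"
      using conv_star_self_eq_0[of ?x m] group_algebra_closed(4) young_group_algebra[of \<nu>] m by metis
    then show False using col_row_col_nonzero[of \<nu>] m by simp
  qed
  with s show ?thesis by blast
qed

text \<open>Every element of \<open>c U\<close> is a multiple of \<open>c\<close> that lies in \<open>U\<close>, so \<open>c U = 0\<close>. For \<open>x \<in> U\<close> the self-adjoint
  element \<open>x\<^sup>* x\<close> of \<open>U\<close> is of the form \<open>y c\<close>, whence its square is 0.\<close>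

lemma specht_irreducible:
  assumes \<nu>: "partition_of m \<nu>" and U: "U \<subseteq> specht_module \<nu>"
    and ideal: "\<And>x y. x \<in> U \<Longrightarrow> conv m y x \<in> U" and c: "young_symmetrizer \<nu> \<notin> U"
    and x: "x \<in> U"
  shows "x = 0"
proof -
  have m: "sum_list \<nu> = m" using \<nu> by (simp add: partition_of_def)
  let ?c = "young_symmetrizer \<nu>"
  have kill: "conv m ?c x = 0" if x: "x \<in> U" for x
  proof -
    obtain y where y: "x = conv m y ?c" using U x specht_module_iff[of x \<nu>] m by auto
    obtain s where s: "conv m ?c x = gscale s ?c" using young_conv_young[OF \<nu>, of y] y by auto
    have "s = 0"
    proof (rule ccontr)
      assume "s \<noteq> 0"
      have "conv m (gscale (1 / s) (delta id)) (conv m ?c x) \<in> U" by (intro ideal x)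
      moreover have "conv m (gscale (1 / s) (delta id)) (conv m ?c x) = ?c"
        using \<open>s \<noteq> 0\<close> by (simp add: s conv_linear gscale_simps)
      ultimately show False using c by simp
    qed
    with s show ?thesis by (simp add: gscale_simps)
  qed
  define w where "w = conv m (star m x) x"
  have wU: "w \<in> U" unfolding w_def by (intro ideal x)
  have ga: "x \<in> group_algebra m" using x U specht_group_algebra m by auto
  have star: "star m w = w" by (simp add: w_def star_conv star_star[OF ga])
  obtain y where y: "w = conv m y ?c" using U wU specht_module_iff[of w \<nu>] m by auto
  have "conv m (star m w) w = conv m y (conv m ?c w)"
    unfolding star using y by (simp flip: conv_assoc)
  then have "conv m (star m w) w = 0" using kill[OF wU] by (simp add: conv_linear)
  then have "w = 0"
    using conv_star_self_eq_0[of w m] group_algebra_closed(4)[OF ga] by (simp add: w_def)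
  then show "x = 0" using conv_star_self_eq_0[OF ga] by (simp add: w_def)
qed

section \<open>Conjugacy classes\<close>

lemma orbit_enum:
  assumes "x \<in> orbit f x"
  shows "bij_betw (\<lambda>n. (f ^^ n) x) {..<card (orbit f x)} (orbit f x)" "(f ^^ card (orbit f x)) x = x"
proof -
  let ?d = "funpow_dist1 f x x"
  have "inj_on (\<lambda>n. (f ^^ n) x) {0..<?d}" by (rule inj_on_funpow_dist1[OF assms])
  moreover have *: "orbit f x = (\<lambda>n. (f ^^ n) x) ` {0..<?d}" by (rule orbit_conv_funpow_dist1[OF assms])
  ultimately have d: "card (orbit f x) = ?d" by (simp add: card_image)
  show "bij_betw (\<lambda>n. (f ^^ n) x) {..<card (orbit f x)} (orbit f x)"
    unfolding d bij_betw_def using \<open>inj_on _ _\<close> * by (simp add: atLeast0LessThan del: funpow.simps)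
  show "(f ^^ card (orbit f x)) x = x" unfolding d by (rule funpow_dist1_prop[OF assms])
qed

lemma perms_self_in_orbit: "g \<in> perms m \<Longrightarrow> x \<in> orbit g x"
  by (metis finite_atLeastAtMost permutation_permutes permutation_self_in_orbit perms_permutes)

lemma perms_orbit_subset: "g \<in> perms m \<Longrightarrow> x \<in> {1..m} \<Longrightarrow> orbit g x \<subseteq> {1..m}"
  using permutes_orbit_subset perms_permutes by metis

lemma perms_orbit_eq: "g \<in> perms m \<Longrightarrow> y \<in> orbit g x \<Longrightarrow> orbit g y = orbit g x"
  by (metis orbit_swap orbit_trans perms_self_in_orbit subsetI subset_antisym)

text \<open>Used to match the cycles of two permutations according to their lengths.\<close>

lemma ex_bij_of_image_mset_eq:
  assumes "finite A" "finite B" "image_mset f (mset_set A) = image_mset f' (mset_set B)"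
  shows "\<exists>\<phi>. bij_betw \<phi> A B \<and> (\<forall>a\<in>A. f' (\<phi> a) = f a)"
  using assms
proof (induction A arbitrary: B rule: finite_induct)
  case empty
  then have "B = {}" by (auto simp: mset_set_empty_iff)
  then show ?case by (auto simp: bij_betw_def)
next
  case (insert a A)
  have eq: "add_mset (f a) (image_mset f (mset_set A)) = image_mset f' (mset_set B)"
    using insert by simp
  then have "f a \<in># image_mset f' (mset_set B)" by (metis union_single_eq_member)
  then obtain b where b: "b \<in> B" "f' b = f a" using insert.prems(1) by auto
  then have "mset_set B = add_mset b (mset_set (B - {b}))"
    using insert.prems(1) by (simp add: mset_set.remove)
  with eq b have "image_mset f (mset_set A) = image_mset f' (mset_set (B - {b}))" by simp
  with insert.IH[of "B - {b}"] insert.prems(1) obtain \<phi> where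
    \<phi>: "bij_betw \<phi> A (B - {b})" "\<forall>a\<in>A. f' (\<phi> a) = f a" by auto
  have "bij_betw (\<phi>(a := b)) A (B - {b})"
    using \<phi>(1) by (rule bij_betw_cong[THEN iffD1, rotated]) (use insert.hyps in auto)
  moreover have "bij_betw (\<phi>(a := b)) {a} {b}" by (simp add: bij_betw_def)
  ultimately have "bij_betw (\<phi>(a := b)) (A \<union> {a}) ((B - {b}) \<union> {b})"
    by (rule bij_betw_combine) auto
  then have "bij_betw (\<phi>(a := b)) (insert a A) B" using b(1) by (simp add: insert_absorb)
  moreover have "\<forall>x\<in>insert a A. f' ((\<phi>(a := b)) x) = f x" using \<phi>(2) b(2) by auto
  ultimately show ?case by blast
qed

definition orbit_sizes :: "nat \<Rightarrow> (nat \<Rightarrow> nat) \<Rightarrow> nat multiset" where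
  "orbit_sizes m g = image_mset card (mset_set (orbit g ` {1..m}))"

text \<open>Match the cycles of \<open>g\<close> with cycles of \<open>g'\<close> of the same length, choose a starting point in each
  cycle, and send the \<open>k\<close>-th iterate of one starting point to the \<open>k\<close>-th iterate of the other.\<close>

lemma conjugate_if_orbit_sizes_eq:
  assumes g: "g \<in> perms m" and g': "g' \<in> perms m" and eq: "orbit_sizes m g = orbit_sizes m g'"
  shows "\<exists>h\<in>perms m. h \<circ> g = g' \<circ> h"
proof -
  obtain \<phi> where \<phi>: "bij_betw \<phi> (orbit g ` {1..m}) (orbit g' ` {1..m})"
    "\<And>C. C \<in> orbit g ` {1..m} \<Longrightarrow> card (\<phi> C) = card C"
    using ex_bij_of_image_mset_eq[of "orbit g ` {1..m}" "orbit g' ` {1..m}" card card] eq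
    unfolding orbit_sizes_def by auto
  have "\<exists>x. x \<in> {1..m} \<and> C = orbit g x" if "C \<in> orbit g ` {1..m}" for C using that by auto
  then obtain x where x: "\<And>C. C \<in> orbit g ` {1..m} \<Longrightarrow> x C \<in> {1..m} \<and> C = orbit g (x C)" by metis
  have "\<exists>y. y \<in> {1..m} \<and> \<phi> C = orbit g' y" if "C \<in> orbit g ` {1..m}" for C
    using bij_betw_imp_surj_on[OF \<phi>(1)] that by blast
  then obtain y where y: "\<And>C. C \<in> orbit g ` {1..m} \<Longrightarrow> y C \<in> {1..m} \<and> \<phi> C = orbit g' (y C)" by metis
  \<comment> \<open>The starting points are \<open>x C\<close> and \<open>y C\<close>; the exponent of \<open>z\<close> on its cycle is found by inverting the
    enumeration of the cycle.\<close>
  define h where "h z = (if z \<in> {1..m} then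
      (g' ^^ the_inv_into {..<card (orbit g z)} (\<lambda>n. (g ^^ n) (x (orbit g z))) z) (y (orbit g z)) else z)" for z
  have enum: "bij_betw (\<lambda>n. (g ^^ n) (x C)) {..<card C} C" "(g ^^ card C) (x C) = x C"
    "bij_betw (\<lambda>n. (g' ^^ n) (y C)) {..<card C} (\<phi> C)" "(g' ^^ card C) (y C) = y C"
    if C: "C \<in> orbit g ` {1..m}" for C
    using orbit_enum[OF perms_self_in_orbit[OF g, of "x C"]] orbit_enum[OF perms_self_in_orbit[OF g', of "y C"]]
      x[OF C] y[OF C] \<phi>(2)[OF C] by metis+
  have h: "h ((g ^^ k) (x C)) = (g' ^^ k) (y C)" if C: "C \<in> orbit g ` {1..m}" and k: "k < card C" for C k
  proof -
    let ?z = "(g ^^ k) (x C)"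
    have z: "?z \<in> C" using bij_betwE[OF enum(1)[OF C]] k by simp
    then have "orbit g ?z = C" using x[OF C] perms_orbit_eq[OF g] by metis
    moreover have "?z \<in> {1..m}" using z x[OF C] perms_orbit_subset[OF g] by blast
    ultimately show ?thesis
      using the_inv_into_f_f[OF bij_betw_imp_inj_on[OF enum(1)[OF C]], of k] k by (simp add: h_def)
  qed
  have decomp: "\<exists>C k. C \<in> orbit g ` {1..m} \<and> k < card C \<and> z = (g ^^ k) (x C)" if z: "z \<in> {1..m}" for z
  proof -
    let ?C = "orbit g z"
    have C: "?C \<in> orbit g ` {1..m}" using z by blast
    have "z \<in> ?C" by (rule perms_self_in_orbit[OF g])
    then obtain k where "k < card ?C" "z = (g ^^ k) (x ?C)"
      using bij_betw_imp_surj_on[OF enum(1)[OF C]] by auto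
    with C show ?thesis by blast
  qed
  have comm: "h (g z) = g' (h z)" if z: "z \<in> {1..m}" for z
  proof -
    obtain C k where C: "C \<in> orbit g ` {1..m}" and k: "k < card C" "z = (g ^^ k) (x C)"
      using decomp[OF z] by blast
    show ?thesis
    proof (cases "Suc k < card C")
      case True
      then show ?thesis using h[OF C True] h[OF C k(1)] k(2) by simp
    next
      case False
      then have "Suc k = card C" using k(1) by simp
      then have "g z = (g ^^ 0) (x C)" "g' (h z) = (g' ^^ 0) (y C)"
        using enum(2,4)[OF C] h[OF C k(1)] k(2) by (metis funpow.simps o_apply id_apply)+
      then show ?thesis using h[OF C, of 0] k(1) by simp
    qed
  qed
  have "{1..m} \<subseteq> h ` {1..m}"
  proof
    fix z' assume z': "z' \<in> {1..m}"
    then have "orbit g' z' \<in> \<phi> ` orbit g ` {1..m}" using bij_betw_imp_surj_on[OF \<phi>(1)] by blast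
    then obtain C where C: "C \<in> orbit g ` {1..m}" "orbit g' z' = \<phi> C" by blast
    then have "z' \<in> \<phi> C" using perms_self_in_orbit[OF g', of z'] by simp
    then obtain k where k: "k < card C" "z' = (g' ^^ k) (y C)"
      using bij_betw_imp_surj_on[OF enum(3)[OF C(1)]] by auto
    have "(g ^^ k) (x C) \<in> C" using bij_betwE[OF enum(1)[OF C(1)]] k(1) by simp
    then have "(g ^^ k) (x C) \<in> {1..m}" using x[OF C(1)] perms_orbit_subset[OF g] by blast
    then show "z' \<in> h ` {1..m}" using h[OF C(1) k(1)] k(2) by force
  qed
  moreover have "h ` {1..m} \<subseteq> {1..m}"
  proof
    fix w assume "w \<in> h ` {1..m}"
    then obtain z where z: "z \<in> {1..m}" "w = h z" by blast
    obtain C k where C: "C \<in> orbit g ` {1..m}" and k: "k < card C" "z = (g ^^ k) (x C)"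
      using decomp[OF z(1)] by blast
    then have "w \<in> \<phi> C" using h[OF C k(1)] z(2) bij_betwE[OF enum(3)[OF C]] by simp
    then show "w \<in> {1..m}" using y[OF C] perms_orbit_subset[OF g'] by blast
  qed
  ultimately have surj: "h ` {1..m} = {1..m}" by blast
  have "bij_betw h {1..m} {1..m}"
    unfolding bij_betw_def using surj eq_card_imp_inj_on[of "{1..m}" h] by simp
  then have hp: "h \<in> perms m"
    unfolding perms_def by (auto intro!: bij_imp_permutes simp: h_def simp del: atLeastAtMost_iff)
  have "h (g z) = g' (h z)" for z
  proof (cases "z \<in> {1..m}")
    case False
    then have "g z = z" "g' z = z" "h z = z"
      using g g' hp by (auto simp: perms_def permutes_not_in simp del: atLeastAtMost_iff)
    then show ?thesis by simp
  qed (rule comm)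
  with hp show ?thesis by (auto simp: fun_eq_iff)
qed

section \<open>Completeness of the Young symmetrizers\<close>

definition cycle_type :: "nat \<Rightarrow> (nat \<Rightarrow> nat) \<Rightarrow> nat list" where
  "cycle_type m g = rev (sorted_list_of_multiset (orbit_sizes m g))"

lemma cycle_type_partition:
  assumes g: "g \<in> perms m"
  shows "partition_of m (cycle_type m g)"
proof -
  have mset: "mset (cycle_type m g) = orbit_sizes m g" by (simp add: cycle_type_def)
  have "sum_list (cycle_type m g) = (\<Sum>C\<in>orbit g ` {1..m}. card C)"
    unfolding sum_mset_sum_list[symmetric] mset orbit_sizes_def sum_unfold_sum_mset ..
  also have "\<dots> = card (\<Union>(orbit g ` {1..m}))"
  proof (rule card_Union_disjoint[symmetric])
    show "pairwise disjnt (orbit g ` {1..m})"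
      using perms_orbit_eq[OF g] by (auto simp: pairwise_def disjnt_def) metis+
    show "finite C" if "C \<in> orbit g ` {1..m}" for C
      using that perms_orbit_subset[OF g] finite_subset by blast
  qed
  also have "\<Union>(orbit g ` {1..m}) = {1..m}"
    using perms_orbit_subset[OF g] perms_self_in_orbit[OF g] by blast
  finally have sum: "sum_list (cycle_type m g) = m" by simp
  have "0 \<notin># orbit_sizes m g"
    using orbit_nonempty[of g] finite_subset[OF perms_orbit_subset[OF g]]
    by (auto simp: orbit_sizes_def card_eq_0_iff simp del: atLeastAtMost_iff)
  then have "0 \<notin> set (cycle_type m g)" by (metis mset set_mset_mset)
  moreover have "sorted_wrt (\<ge>) (cycle_type m g)"
    by (simp add: cycle_type_def sorted_wrt_rev)
  ultimately show ?thesis using sum by (simp add: partition_of_def is_partition_def)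
qed

lemma conjugate_if_cycle_type_eq:
  assumes "g \<in> perms m" "g' \<in> perms m" "cycle_type m g = cycle_type m g'"
  shows "\<exists>h\<in>perms m. h \<circ> g = g' \<circ> h"
proof -
  have "mset (cycle_type m g) = mset (cycle_type m g')" using assms(3) by simp
  then show ?thesis
    using conjugate_if_orbit_sizes_eq[OF assms(1,2)] by (simp add: cycle_type_def)
qed

lemma finite_partitions: "finite {\<nu>. partition_of m \<nu>}"
proof (rule finite_subset)
  show "{\<nu>. partition_of m \<nu>} \<subseteq> {xs. set xs \<subseteq> {..m} \<and> length xs \<le> m}"
  proof safe
    fix \<nu> assume \<nu>: "partition_of m \<nu>"
    show "x \<le> m" if "x \<in> set \<nu>" for x
      using member_le_sum_list[OF that] \<nu> by (simp add: partition_of_def)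
    have "0 \<notin> set \<nu> \<Longrightarrow> length \<nu> \<le> sum_list \<nu>" by (induction \<nu>) auto
    then show "length \<nu> \<le> m" using \<nu> by (simp add: partition_of_def is_partition_def)
  qed
qed (rule finite_lists_length_le, simp)

text \<open>A central element that separates \<open>V\<^sub>\<nu>\<close> from the other \<open>V\<^sub>\<mu>\<close>. Starting from \<open>c c\<^sup>*\<close> instead of \<open>c\<close> makes it
  evident from positivity that it does not annihilate \<open>c\<close>.\<close>

definition central_young :: "nat \<Rightarrow> nat list \<Rightarrow> galg" where
  "central_young m \<nu> = (\<Sum>g\<in>perms m. conv m (delta g) (conv m (young_symmetrizer \<nu>)
     (conv m (star m (young_symmetrizer \<nu>)) (delta (pinv g)))))"

lemma central_young_central:
  assumes h: "h \<in> perms m"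
  shows "conv m (delta h) (conv m (central_young m \<nu>) (delta (pinv h))) = central_young m \<nu>"
proof -
  let ?f = "\<lambda>g. conv m (delta g) (conv m (young_symmetrizer \<nu>)
     (conv m (star m (young_symmetrizer \<nu>)) (delta (pinv g))))"
  have "conv m (delta h) (conv m (central_young m \<nu>) (delta (pinv h))) =
      (\<Sum>g\<in>perms m. conv m (delta h) (conv m (?f g) (delta (pinv h))))"
    by (simp add: central_young_def conv_sum)
  also have "\<dots> = (\<Sum>g\<in>perms m. ?f (h \<circ> g))"
  proof (rule sum.cong[OF refl])
    fix g assume g: "g \<in> perms m"
    have "conv m (delta h) (conv m (?f g) (delta (pinv h))) =
        conv m (conv m (delta h) (delta g)) (conv m (young_symmetrizer \<nu>)
          (conv m (star m (young_symmetrizer \<nu>)) (conv m (delta (pinv g)) (delta (pinv h)))))"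
      by (simp only: conv_assoc)
    then show "conv m (delta h) (conv m (?f g) (delta (pinv h))) = ?f (h \<circ> g)"
      using g h by (simp add: conv_delta_delta)
  qed
  also have "\<dots> = central_young m \<nu>" unfolding central_young_def by (rule sum_perms_left[OF h])
  finally show ?thesis .
qed

lemma group_algebra_sum: "(\<And>i. i \<in> I \<Longrightarrow> f i \<in> group_algebra m) \<Longrightarrow> sum f I \<in> group_algebra m"
  by (auto simp: group_algebra_def galg_sum_apply intro!: sum.neutral)

lemma central_young_group_algebra: "central_young m \<nu> \<in> group_algebra m"
  unfolding central_young_def by (intro group_algebra_sum group_algebra_closed(4,5) perms_inv)

lemma central_young_conj:
  assumes "h \<in> perms m" "h \<circ> g = g' \<circ> h"
  shows "central_young m \<nu> g = central_young m \<nu> g'"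
proof -
  have "central_young m \<nu> g' = conv m (central_young m \<nu>) (delta (pinv h)) (pinv h \<circ> g')"
    using arg_cong[OF central_young_central[OF assms(1), of \<nu>], of "\<lambda>x. x g'"] assms(1)
    by (simp add: conv_delta_left translate_def)
  also have "\<dots> = central_young m \<nu> (pinv h \<circ> g' \<circ> h)"
    using assms(1) by (simp add: conv_delta_right central_young_group_algebra)
  also have "pinv h \<circ> g' \<circ> h = g" using assms by (metis comp_assoc perms_cancel(3))
  finally show ?thesis by simp
qed

lemma central_young_conv_diff:
  assumes "partition_of m \<nu>" "partition_of m \<mu>" "\<nu> \<noteq> \<mu>"
  shows "conv m (central_young m \<nu>) (young_symmetrizer \<mu>) = 0"
proof -
  let ?c = "young_symmetrizer \<nu>"
  have "conv m (conv m (delta g) (conv m ?c (conv m (star m ?c) (delta (pinv g))))) (young_symmetrizer \<mu>) =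
      conv m (delta g) (conv m ?c (conv m (conv m (star m ?c) (delta (pinv g))) (young_symmetrizer \<mu>)))" for g
    by (simp only: conv_assoc)
  then show ?thesis
    by (simp add: central_young_def conv_sum young_conv_diff[OF assms] conv_linear)
qed

text \<open>With \<open>u\<^sub>g = c\<^sup>* g\<^sup>-\<^sup>1 c\<close>, multiplication of the product by \<open>c\<^sup>*\<close> from the left gives the sum of all
  \<open>u\<^sub>g\<^sup>* u\<^sub>g\<close>. The identity coefficient of this sum is a sum of squares, and it is positive because of the
  term of \<open>u\<^sub>1 = c\<^sup>* c\<close>.\<close>

lemma central_young_conv_same:
  assumes "partition_of m \<nu>"
  shows "conv m (central_young m \<nu>) (young_symmetrizer \<nu>) \<noteq> 0"
proof
  let ?c = "young_symmetrizer \<nu>"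
  have m: "sum_list \<nu> = m" using assms by (simp add: partition_of_def)
  have c: "?c \<in> group_algebra m" using young_group_algebra[of \<nu>] m by simp
  define u where "u g = conv m (star m ?c) (conv m (delta (pinv g)) ?c)" for g
  have u: "u g \<in> group_algebra m" for g
    unfolding u_def by (intro group_algebra_closed(4) c)
  have star_delta: "star m (delta (pinv g)) = delta g" if g: "g \<in> perms m" for g
  proof (rule ext)
    fix h
    have "pinv h = pinv g \<longleftrightarrow> h = g" if "h \<in> perms m" using that g by (metis perms_cancel(7))
    then show "star m (delta (pinv g)) h = delta g h" using g by (auto simp: star_def delta_def)
  qed
  assume "conv m (central_young m \<nu>) ?c = 0"
  then have "conv m (star m ?c) (conv m (central_young m \<nu>) ?c) = 0" by (simp add: conv_linear)
  also have "conv m (star m ?c) (conv m (central_young m \<nu>) ?c) = (\<Sum>g\<in>perms m. conv m (star m (u g)) (u g))"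
    unfolding central_young_def conv_sum
    by (rule sum.cong[OF refl]) (simp add: u_def star_conv star_star[OF c] star_delta conv_assoc)
  finally have "(\<Sum>g\<in>perms m. conv m (star m (u g)) (u g) id) = 0"
    by (metis galg_sum_apply zero_fun_apply)
  then have "(\<Sum>g\<in>perms m. \<Sum>k\<in>perms m. (u g k)\<^sup>2) = 0" by (simp add: conv_star_self_id)
  then have "\<forall>g\<in>perms m. (\<Sum>k\<in>perms m. (u g k)\<^sup>2) = 0"
    by (subst (asm) sum_nonneg_eq_0_iff) (auto intro: sum_nonneg)
  then have "(\<Sum>k\<in>perms m. (u id k)\<^sup>2) = 0" by simp
  then have "\<forall>k\<in>perms m. u id k = 0"
    by (subst (asm) sum_nonneg_eq_0_iff) auto
  then have "u id = 0" by (intro group_algebra_eqI[OF u group_algebra_closed(1)]) simp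
  then have "conv m (star m ?c) ?c = 0" by (simp add: u_def)
  then show False using conv_star_self_eq_0[OF c] young_nonzero by blast
qed

lemma central_young_independent:
  assumes "(\<Sum>\<nu>\<in>{\<nu>. partition_of m \<nu>}. gscale (\<alpha> \<nu>) (central_young m \<nu>)) = 0" "partition_of m \<mu>"
  shows "\<alpha> \<mu> = 0"
proof -
  have "0 = (\<Sum>\<nu>\<in>{\<nu>. partition_of m \<nu>}. gscale (\<alpha> \<nu>) (conv m (central_young m \<nu>) (young_symmetrizer \<mu>)))"
    using arg_cong[OF assms(1), of "\<lambda>x. conv m x (young_symmetrizer \<mu>)"]
    by (simp add: conv_sum conv_linear)
  also have "\<dots> = (\<Sum>\<nu>\<in>{\<nu>. partition_of m \<nu>}. if \<nu> = \<mu> then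
      gscale (\<alpha> \<mu>) (conv m (central_young m \<mu>) (young_symmetrizer \<mu>)) else 0)"
    using central_young_conv_diff[OF _ assms(2)] by (intro sum.cong) (auto simp: gscale_simps)
  also have "\<dots> = gscale (\<alpha> \<mu>) (conv m (central_young m \<mu>) (young_symmetrizer \<mu>))"
    using finite_partitions[of m] assms(2) by simp
  finally show ?thesis
    using central_young_conv_same[OF assms(2)] gscale_simps(5) by metis
qed

text \<open>The central elements belong to the space of class functions, whose dimension is at most the
  number of cycle types. They are linearly independent and equally many, hence they span it; and
  the identity of the group algebra is a class function.\<close>

lemma one_in_span_central_young:
  "\<exists>\<alpha>. delta id = (\<Sum>\<nu>\<in>{\<nu>. partition_of m \<nu>}. gscale (\<alpha> \<nu>) (central_young m \<nu>))"
proof -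
  let ?P = "{\<nu>. partition_of m \<nu>}"
  let ?Z = "central_young m ` ?P"
  define ind :: "nat list \<Rightarrow> galg" where
    "ind \<tau> = (\<lambda>h. if h \<in> perms m \<and> cycle_type m h = \<tau> then 1 else 0)" for \<tau>
  have span: "x \<in> galg.span (ind ` ?P)"
    if x: "x \<in> group_algebra m"
      and class_fun: "\<And>g g' h. h \<in> perms m \<Longrightarrow> h \<circ> g = g' \<circ> h \<Longrightarrow> x g = x g'" for x
  proof -
    define v where "v \<tau> = x (SOME g. g \<in> perms m \<and> cycle_type m g = \<tau>)" for \<tau>
    have "x = (\<Sum>\<tau>\<in>?P. gscale (v \<tau>) (ind \<tau>))"
    proof (rule group_algebra_eqI[OF x])
      show "(\<Sum>\<tau>\<in>?P. gscale (v \<tau>) (ind \<tau>)) \<in> group_algebra m"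
        by (intro group_algebra_sum group_algebra_closed) (simp add: group_algebra_def ind_def)
      fix h assume h: "h \<in> perms m"
      let ?\<tau> = "cycle_type m h"
      let ?g = "SOME g. g \<in> perms m \<and> cycle_type m g = ?\<tau>"
      have "?g \<in> perms m \<and> cycle_type m ?g = ?\<tau>" by (rule someI[of _ h]) (simp add: h)
      then have "x ?g = x h"
        using conjugate_if_cycle_type_eq[of ?g m h] h class_fun by blast
      moreover have "(\<Sum>\<tau>\<in>?P. gscale (v \<tau>) (ind \<tau>)) h = (\<Sum>\<tau>\<in>?P. if \<tau> = ?\<tau> then v ?\<tau> else 0)"
        unfolding galg_sum_apply using h by (intro sum.cong) (auto simp: gscale_def ind_def)
      ultimately show "x h = (\<Sum>\<tau>\<in>?P. gscale (v \<tau>) (ind \<tau>)) h"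
        using cycle_type_partition[OF h] finite_partitions[of m] by (simp add: v_def)
    qed
    then show ?thesis
      by (metis (no_types, lifting) galg.span_base galg.span_scale galg.span_sum imageI)
  qed
  have inj: "inj_on (central_young m) ?P"
  proof (rule inj_onI, rule ccontr)
    fix \<nu> \<mu> assume as: "\<nu> \<in> ?P" "\<mu> \<in> ?P" "central_young m \<nu> = central_young m \<mu>" "\<nu> \<noteq> \<mu>"
    then have "conv m (central_young m \<nu>) (young_symmetrizer \<nu>) = 0"
      using central_young_conv_diff[of m \<mu> \<nu>] by simp
    with as central_young_conv_same show False by blast
  qed
  have ind: "galg.independent ?Z"
  proof (rule galg.independent_if_scalars_zero)
    fix f z assume f: "(\<Sum>z\<in>?Z. gscale (f z) z) = 0" and z: "z \<in> ?Z"
    from f have "(\<Sum>\<nu>\<in>?P. gscale (f (central_young m \<nu>)) (central_young m \<nu>)) = 0"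
      by (simp add: sum.reindex[OF inj])
    then show "f z = 0" using central_young_independent[of "\<lambda>\<nu>. f (central_young m \<nu>)" m] z by blast
  qed (simp add: finite_partitions)
  have Zspan: "?Z \<subseteq> galg.span (ind ` ?P)"
    by (rule image_subsetI, rule span[OF central_young_group_algebra], rule central_young_conj)
  have dspan: "delta id \<in> galg.span (ind ` ?P)"
  proof (rule span)
    fix g g' h :: "nat \<Rightarrow> nat" assume h: "h \<in> perms m" "h \<circ> g = g' \<circ> h"
    have "g = id \<longleftrightarrow> g' = id"
      using h by (metis comp_id id_comp perms_cancel(3) perms_cancel(5))
    then show "delta id g = delta id g'" by (simp add: delta_def)
  qed (simp add: group_algebra_closed)
  have "delta id \<in> galg.span ?Z"
  proof (rule ccontr)
    assume n: "delta id \<notin> galg.span ?Z"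
    then have notin: "delta id \<notin> ?Z" using galg.span_base[of "delta id" ?Z] by metis
    then have "galg.independent (insert (delta id) ?Z)"
      using n ind by (simp only: galg.independent_insert) simp
    then have "finite (insert (delta id) ?Z) \<and> card (insert (delta id) ?Z) \<le> card (ind ` ?P)"
      by (rule galg.independent_span_bound[rotated])
        (use finite_partitions[of m] Zspan dspan in \<open>simp_all only: finite_imageI insert_subset simp_thms\<close>)
    then have "card (insert (delta id) ?Z) \<le> card (ind ` ?P)" by (rule conjunct2)
    also have "\<dots> \<le> card ?P" by (rule card_image_le[OF finite_partitions])
    also have "\<dots> = card ?Z" using card_image[OF inj] by simp
    finally show False using notin finite_partitions[of m] by simp
  qed
  then obtain u where "delta id = (\<Sum>z\<in>?Z. gscale (u z) z)"
    using galg.span_finite[of ?Z] finite_partitions[of m] by auto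
  then have "delta id = (\<Sum>\<nu>\<in>?P. gscale (u (central_young m \<nu>)) (central_young m \<nu>))"
    by (simp add: sum.reindex[OF inj])
  then show ?thesis by (rule exI[of _ "\<lambda>\<nu>. u (central_young m \<nu>)"])
qed

section \<open>Representations\<close>

definition rep_of_dim :: "nat \<Rightarrow> nat \<Rightarrow> rep \<Rightarrow> bool" where
  "rep_of_dim m d \<rho> \<longleftrightarrow> (\<forall>g\<in>perms m. \<rho> g \<in> carrier_mat d d) \<and> \<rho> id = 1\<^sub>m d \<and>
     (\<forall>g\<in>perms m. \<forall>h\<in>perms m. \<rho> (g \<circ> h) = \<rho> g * \<rho> h)"

lemma is_rep_iff: "is_rep m \<rho> \<longleftrightarrow> (\<exists>d. rep_of_dim m d \<rho>)"
  by (auto simp: is_rep_def rep_of_dim_def perms_def)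

lemma rep_of_dimD:
  assumes "rep_of_dim m d \<rho>"
  shows "g \<in> perms m \<Longrightarrow> \<rho> g \<in> carrier_mat d d" "\<rho> id = 1\<^sub>m d"
    "g \<in> perms m \<Longrightarrow> h \<in> perms m \<Longrightarrow> \<rho> (g \<circ> h) = \<rho> g * \<rho> h"
  using assms by (auto simp: rep_of_dim_def)

text \<open>The action of the group algebra by matrices.\<close>

definition act :: "nat \<Rightarrow> nat \<Rightarrow> rep \<Rightarrow> galg \<Rightarrow> rat mat" where
  "act m d \<rho> x = mat d d (\<lambda>(i, j). \<Sum>g\<in>perms m. x g * \<rho> g $$ (i, j))"

lemma act_carrier [simp]: "act m d \<rho> x \<in> carrier_mat d d"
  by (simp add: act_def)

lemma act_dim [simp]: "dim_row (act m d \<rho> x) = d" "dim_col (act m d \<rho> x) = d"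
  by (simp_all add: act_def)

lemma act_linear:
  "act m d \<rho> (x + y) = act m d \<rho> x + act m d \<rho> y"
  "act m d \<rho> (gscale c x) = c \<cdot>\<^sub>m act m d \<rho> x"
  "act m d \<rho> 0 = 0\<^sub>m d d"
  by (rule eq_matI; simp add: act_def gscale_def algebra_simps sum.distrib sum_distrib_left)+

lemma act_delta:
  assumes "rep_of_dim m d \<rho>" "g \<in> perms m"
  shows "act m d \<rho> (delta g) = \<rho> g"
proof (rule eq_matI)
  fix i j assume "i < dim_row (\<rho> g)" "j < dim_col (\<rho> g)"
  then have ij: "i < d" "j < d" using rep_of_dimD(1)[OF assms] by auto
  have "(\<Sum>h\<in>perms m. delta g h * \<rho> h $$ (i, j)) = (\<Sum>h\<in>perms m. if h = g then \<rho> g $$ (i, j) else 0)"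
    by (rule sum.cong) (auto simp: delta_def)
  then show "act m d \<rho> (delta g) $$ (i, j) = \<rho> g $$ (i, j)"
    using ij assms(2) by (simp add: act_def)
qed (use rep_of_dimD(1)[OF assms] in auto)

lemma mult_act_vec:
  assumes R: "rep_of_dim m d \<rho>" and A: "A \<in> carrier_mat k d" and v: "v \<in> carrier_vec d" and i: "i < k"
  shows "(A *\<^sub>v (act m d \<rho> x *\<^sub>v v)) $ i = (\<Sum>g\<in>perms m. x g * (A *\<^sub>v (\<rho> g *\<^sub>v v)) $ i)"
proof -
  have "(A *\<^sub>v (act m d \<rho> x *\<^sub>v v)) $ i =
      (\<Sum>a\<in>{0..<d}. \<Sum>b\<in>{0..<d}. \<Sum>g\<in>perms m. x g * (A $$ (i, a) * \<rho> g $$ (a, b) * v $ b))"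
    using A v i by (simp add: scalar_prod_def act_def sum_distrib_left sum_distrib_right mult_ac)
  also have "\<dots> = (\<Sum>a\<in>{0..<d}. \<Sum>g\<in>perms m. \<Sum>b\<in>{0..<d}. x g * (A $$ (i, a) * \<rho> g $$ (a, b) * v $ b))"
    by (rule sum.cong[OF refl], rule sum.swap)
  also have "\<dots> = (\<Sum>g\<in>perms m. \<Sum>a\<in>{0..<d}. \<Sum>b\<in>{0..<d}. x g * (A $$ (i, a) * \<rho> g $$ (a, b) * v $ b))"
    by (rule sum.swap)
  also have "\<dots> = (\<Sum>g\<in>perms m. x g * (A *\<^sub>v (\<rho> g *\<^sub>v v)) $ i)"
  proof (rule sum.cong[OF refl])
    fix g assume "g \<in> perms m"
    then have "\<rho> g \<in> carrier_mat d d" by (rule rep_of_dimD(1)[OF R])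
    then show "(\<Sum>a\<in>{0..<d}. \<Sum>b\<in>{0..<d}. x g * (A $$ (i, a) * \<rho> g $$ (a, b) * v $ b)) =
        x g * (A *\<^sub>v (\<rho> g *\<^sub>v v)) $ i"
      using A v i by (simp add: scalar_prod_def sum_distrib_left sum_distrib_right mult_ac)
  qed
  finally show ?thesis .
qed

lemma act_vec:
  assumes R: "rep_of_dim m d \<rho>" and v: "v \<in> carrier_vec d" and i: "i < d"
  shows "(act m d \<rho> x *\<^sub>v v) $ i = (\<Sum>g\<in>perms m. x g * (\<rho> g *\<^sub>v v) $ i)"
proof -
  have "(1\<^sub>m d *\<^sub>v (act m d \<rho> x *\<^sub>v v)) $ i = (\<Sum>g\<in>perms m. x g * (1\<^sub>m d *\<^sub>v (\<rho> g *\<^sub>v v)) $ i)"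
    by (rule mult_act_vec[OF R one_carrier_mat v i])
  also have "\<dots> = (\<Sum>g\<in>perms m. x g * (\<rho> g *\<^sub>v v) $ i)"
  proof (rule sum.cong[OF refl])
    fix g assume "g \<in> perms m"
    then have "\<rho> g *\<^sub>v v \<in> carrier_vec d"
      by (rule mult_mat_vec_carrier[OF rep_of_dimD(1)[OF R] v])
    then show "x g * (1\<^sub>m d *\<^sub>v (\<rho> g *\<^sub>v v)) $ i = x g * (\<rho> g *\<^sub>v v) $ i" by simp
  qed
  moreover have "1\<^sub>m d *\<^sub>v (act m d \<rho> x *\<^sub>v v) = act m d \<rho> x *\<^sub>v v"
    by (intro one_mult_mat_vec mult_mat_vec_carrier[OF act_carrier v])
  ultimately show ?thesis by simp
qed

lemma mult_zero_vec: "A \<in> carrier_mat k n \<Longrightarrow> A *\<^sub>v 0\<^sub>v n = (0\<^sub>v k :: rat vec)"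
  by (rule eq_vecI) (auto simp: scalar_prod_def)

lemma zero_mat_mult_vec: "v \<in> carrier_vec n \<Longrightarrow> 0\<^sub>m k n *\<^sub>v v = (0\<^sub>v k :: rat vec)"
  by (rule eq_vecI) (auto simp: scalar_prod_def)

lemma mult_mat_index:
  assumes "A \<in> carrier_mat k n" "B \<in> carrier_mat n c" "i < k" "j < c"
  shows "(A * B) $$ (i, j) = (\<Sum>a<n. A $$ (i, a) * (B $$ (a, j) :: rat))"
  using assms by (simp add: scalar_prod_def atLeast0LessThan)

lemma eq_mat_of_vecs:
  assumes "A \<in> carrier_mat k n" "B \<in> carrier_mat k n"
    and "\<And>v. v \<in> carrier_vec n \<Longrightarrow> A *\<^sub>v v = B *\<^sub>v v"
  shows "A = (B :: rat mat)"
proof (rule eq_matI)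
  fix i j assume "i < dim_row B" "j < dim_col B"
  then have ij: "i < k" "j < n" using assms by auto
  have "(A *\<^sub>v unit_vec n j) $ i = (B *\<^sub>v unit_vec n j) $ i" using assms(3)[of "unit_vec n j"] by simp
  then show "A $$ (i, j) = B $$ (i, j)" using ij assms(1,2) by (simp add: row_def)
qed (use assms in auto)

lemma act_conv:
  assumes R: "rep_of_dim m d \<rho>"
  shows "act m d \<rho> (conv m x y) = act m d \<rho> x * act m d \<rho> y"
proof (rule eq_mat_of_vecs)
  fix v :: "rat vec" assume v: "v \<in> carrier_vec d"
  have "act m d \<rho> (conv m x y) *\<^sub>v v = act m d \<rho> x *\<^sub>v (act m d \<rho> y *\<^sub>v v)"
  proof (rule eq_vecI)
    fix i assume "i < dim_vec (act m d \<rho> x *\<^sub>v (act m d \<rho> y *\<^sub>v v))"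
    then have i: "i < d" by simp
    have "(act m d \<rho> (conv m x y) *\<^sub>v v) $ i =
        (\<Sum>h\<in>perms m. \<Sum>g\<in>perms m. x g * y (pinv g \<circ> h) * (\<rho> h *\<^sub>v v) $ i)"
      using act_vec[OF R v i] by (simp add: conv_def sum_distrib_right)
    also have "\<dots> = (\<Sum>g\<in>perms m. \<Sum>h\<in>perms m. x g * y (pinv g \<circ> h) * (\<rho> h *\<^sub>v v) $ i)"
      by (rule sum.swap)
    also have "\<dots> = (\<Sum>g\<in>perms m. x g * (\<rho> g *\<^sub>v (act m d \<rho> y *\<^sub>v v)) $ i)"
    proof (rule sum.cong[OF refl])
      fix g assume g: "g \<in> perms m"
      have "(\<Sum>h\<in>perms m. x g * y (pinv g \<circ> h) * (\<rho> h *\<^sub>v v) $ i) =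
          (\<Sum>h\<in>perms m. x g * y (pinv g \<circ> (g \<circ> h)) * (\<rho> (g \<circ> h) *\<^sub>v v) $ i)"
        by (rule sum_perms_left[OF g, symmetric])
      also have "\<dots> = x g * (\<Sum>h\<in>perms m. y h * (\<rho> g *\<^sub>v (\<rho> h *\<^sub>v v)) $ i)"
        unfolding sum_distrib_left
        using g rep_of_dimD[OF R] v
        by (intro sum.cong refl) (simp add: assoc_mult_mat_vec[of _ d d _ d])
      also have "\<dots> = x g * (\<rho> g *\<^sub>v (act m d \<rho> y *\<^sub>v v)) $ i"
        using mult_act_vec[OF R rep_of_dimD(1)[OF R g] v i] by simp
      finally show "(\<Sum>h\<in>perms m. x g * y (pinv g \<circ> h) * (\<rho> h *\<^sub>v v) $ i) =
        x g * (\<rho> g *\<^sub>v (act m d \<rho> y *\<^sub>v v)) $ i" .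
    qed
    also have "\<dots> = (act m d \<rho> x *\<^sub>v (act m d \<rho> y *\<^sub>v v)) $ i"
      by (rule act_vec[OF R mult_mat_vec_carrier[OF act_carrier v] i, symmetric])
    finally show "(act m d \<rho> (conv m x y) *\<^sub>v v) $ i = (act m d \<rho> x *\<^sub>v (act m d \<rho> y *\<^sub>v v)) $ i" .
  qed simp
  then show "act m d \<rho> (conv m x y) *\<^sub>v v = (act m d \<rho> x * act m d \<rho> y) *\<^sub>v v"
    using v by (simp add: assoc_mult_mat_vec[of _ d d _ d])
qed (use mult_carrier_mat in auto)

lemma act_conv_vec:
  assumes "rep_of_dim m d \<rho>" "v \<in> carrier_vec d"
  shows "act m d \<rho> (conv m x y) *\<^sub>v v = act m d \<rho> x *\<^sub>v (act m d \<rho> y *\<^sub>v v)"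
  using assms by (simp add: act_conv assoc_mult_mat_vec[of _ d d _ d])

lemma act_sum_vec_zero:
  assumes "v \<in> carrier_vec d" "\<And>i. i \<in> I \<Longrightarrow> act m d \<rho> (f i) *\<^sub>v v = 0\<^sub>v d"
  shows "act m d \<rho> (sum f I) *\<^sub>v v = 0\<^sub>v d"
  using assms(2)
proof (induction I rule: infinite_finite_induct)
  case (insert i I)
  then have eq: "act m d \<rho> (sum f (insert i I)) = act m d \<rho> (f i) + act m d \<rho> (sum f I)"
    by (simp only: sum.insert act_linear simp_thms)
  show ?case
    unfolding eq using insert assms(1) by (simp add: add_mult_distrib_mat_vec[of _ d d])
qed (simp_all only: sum.infinite sum.empty act_linear simp_thms zero_mat_mult_vec[OF assms(1)])

lemma smult_mat_vec: "v \<in> carrier_vec n \<Longrightarrow> A \<in> carrier_mat k n \<Longrightarrow> (c \<cdot>\<^sub>m A) *\<^sub>v v = c \<cdot>\<^sub>v (A *\<^sub>v (v :: rat vec))"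
  by (rule eq_vecI) (auto simp: scalar_prod_def sum_distrib_left mult.assoc)

section \<open>Coordinates of Specht modules\<close>

definition specht_dim :: "nat list \<Rightarrow> nat" where
  "specht_dim \<nu> = length (specht_basis \<nu>)"

text \<open>\<open>coord\<close> and \<open>comb\<close> translate between the left ideal \<open>V\<^sub>\<nu>\<close> and the coordinate vectors on which the
  matrices \<open>specht \<nu> g\<close> act.\<close>

definition coord :: "nat list \<Rightarrow> galg \<Rightarrow> rat vec" where
  "coord \<nu> x = vec (specht_dim \<nu>) (\<lambda>i. galg_representation (set (specht_basis \<nu>)) x (specht_basis \<nu> ! i))"

definition comb :: "nat list \<Rightarrow> rat vec \<Rightarrow> galg" where
  "comb \<nu> v = (\<Sum>i<specht_dim \<nu>. gscale (v $ i) (specht_basis \<nu> ! i))"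

lemma coord_carrier [simp]: "coord \<nu> x \<in> carrier_vec (specht_dim \<nu>)"
  by (simp add: coord_def)

lemma specht_basis_nth: "i < specht_dim \<nu> \<Longrightarrow> specht_basis \<nu> ! i \<in> specht_module \<nu>"
  unfolding specht_basis(3)[symmetric] specht_dim_def by (rule galg.span_base) simp

lemma specht_module_subspace:
  "x \<in> specht_module \<nu> \<Longrightarrow> y \<in> specht_module \<nu> \<Longrightarrow> x + y \<in> specht_module \<nu>"
  "x \<in> specht_module \<nu> \<Longrightarrow> gscale c x \<in> specht_module \<nu>"
  "0 \<in> specht_module \<nu>"
  "(\<And>i. i \<in> I \<Longrightarrow> f i \<in> specht_module \<nu>) \<Longrightarrow> sum f I \<in> specht_module \<nu>"
  unfolding specht_module_def
  by (fact galg.span_add galg.span_scale galg.span_zero galg.span_sum)+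

lemma comb_in: "comb \<nu> v \<in> specht_module \<nu>"
  unfolding comb_def by (intro specht_module_subspace specht_basis_nth) simp

lemma comb_coord:
  assumes "x \<in> specht_module \<nu>"
  shows "comb \<nu> (coord \<nu> x) = x"
proof -
  let ?bs = "specht_basis \<nu>"
  have "x = (\<Sum>b\<in>set ?bs. gscale (galg_representation (set ?bs) x b) b)"
    using galg.sum_representation_eq[OF specht_basis(2)[of \<nu>], of x "set ?bs"] assms specht_basis(3)[of \<nu>] by simp
  also have "\<dots> = (\<Sum>k<length ?bs. gscale (galg_representation (set ?bs) x (?bs ! k)) (?bs ! k))"
    using specht_basis(1)[of \<nu>] by (intro sum.reindex_bij_betw[symmetric] bij_betw_nth) auto
  finally show ?thesis by (simp add: comb_def coord_def specht_dim_def)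
qed

lemma coord_linear:
  assumes "x \<in> specht_module \<nu>" "y \<in> specht_module \<nu>"
  shows "coord \<nu> (x + y) = coord \<nu> x + coord \<nu> y" "coord \<nu> (gscale c x) = c \<cdot>\<^sub>v coord \<nu> x"
  using assms specht_basis[of \<nu>]
  by (auto simp: coord_def galg.representation_add galg.representation_scale)

lemma coord_zero: "coord \<nu> 0 = 0\<^sub>v (specht_dim \<nu>)"
  by (rule eq_vecI) (simp_all add: coord_def galg.representation_zero)

lemma coord_sum_index:
  assumes "\<And>k. k \<in> I \<Longrightarrow> f k \<in> specht_module \<nu>" "i < specht_dim \<nu>"
  shows "coord \<nu> (\<Sum>k\<in>I. gscale (a k) (f k)) $ i = (\<Sum>k\<in>I. a k * coord \<nu> (f k) $ i)"
  using assms(1)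
proof (induction I rule: infinite_finite_induct)
  case (insert k I)
  then have "(\<Sum>k\<in>I. gscale (a k) (f k)) \<in> specht_module \<nu>" "gscale (a k) (f k) \<in> specht_module \<nu>"
    by (auto intro!: specht_module_subspace)
  then have "coord \<nu> (\<Sum>k\<in>insert k I. gscale (a k) (f k)) =
      a k \<cdot>\<^sub>v coord \<nu> (f k) + coord \<nu> (\<Sum>k\<in>I. gscale (a k) (f k))"
    using insert by (simp only: sum.insert coord_linear insertI1 simp_thms)
  then show ?case using insert assms(2)
    by (simp add: carrier_vecD[OF coord_carrier] del: sum.insert) simp
qed (use assms(2) in \<open>simp_all add: coord_zero\<close>)

lemma coord_comb:
  assumes "v \<in> carrier_vec (specht_dim \<nu>)"
  shows "coord \<nu> (comb \<nu> v) = v"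
proof (rule eq_vecI)
  fix i assume "i < dim_vec v"
  then have i: "i < specht_dim \<nu>" using assms by simp
  have rep: "coord \<nu> (specht_basis \<nu> ! k) $ i = (if k = i then 1 else 0)" if "k < specht_dim \<nu>" for k
    using i that specht_basis[of \<nu>]
    by (auto simp: coord_def galg.representation_basis specht_dim_def nth_eq_iff_index_eq)
  have "coord \<nu> (comb \<nu> v) $ i = (\<Sum>k<specht_dim \<nu>. v $ k * coord \<nu> (specht_basis \<nu> ! k) $ i)"
    unfolding comb_def by (rule coord_sum_index) (use i specht_basis_nth in auto)
  also have "\<dots> = (\<Sum>k<specht_dim \<nu>. if k = i then v $ i else 0)"
    by (rule sum.cong) (auto simp: rep)
  finally show "coord \<nu> (comb \<nu> v) $ i = v $ i" using i by simp
qed (use assms in \<open>simp add: coord_def\<close>)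

lemma rep_of_dim_specht:
  assumes "sum_list \<nu> = m"
  shows "rep_of_dim m (specht_dim \<nu>) (specht \<nu>)"
proof -
  obtain d where d: "rep_of_dim m d (specht \<nu>)"
    using is_rep_specht[OF assms] is_rep_iff by blast
  have "dim_row (specht \<nu> id) = specht_dim \<nu>" by (simp add: specht_def Let_def specht_dim_def)
  then have "d = specht_dim \<nu>" using rep_of_dimD(2)[OF d] by simp
  with d show ?thesis by simp
qed

lemma specht_coord:
  assumes g: "g \<in> perms (sum_list \<nu>)" and x: "x \<in> specht_module \<nu>"
  shows "specht \<nu> g *\<^sub>v coord \<nu> x = coord \<nu> (translate g x)"
proof (rule eq_vecI)
  let ?n = "specht_dim \<nu>" and ?bs = "specht_basis \<nu>"
  fix i assume "i < dim_vec (coord \<nu> (translate g x))"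
  then have i: "i < ?n" by (simp add: coord_def)
  have x_eq: "x = (\<Sum>k<?n. gscale (coord \<nu> x $ k) (?bs ! k))"
    using comb_coord[OF x] by (simp add: comb_def)
  have "coord \<nu> (translate g x) = coord \<nu> (\<Sum>k<?n. gscale (coord \<nu> x $ k) (translate g (?bs ! k)))"
    by (subst x_eq) (simp only: translate_sum translate_simps)
  then have "coord \<nu> (translate g x) $ i = (\<Sum>k<?n. coord \<nu> x $ k * coord \<nu> (translate g (?bs ! k)) $ i)"
    using coord_sum_index[of "{..<?n}" "\<lambda>k. translate g (?bs ! k)" \<nu> i "\<lambda>k. coord \<nu> x $ k"]
      translate_specht_module[OF perms_permutes[OF g] specht_basis_nth] i by simp
  then show "(specht \<nu> g *\<^sub>v coord \<nu> x) $ i = coord \<nu> (translate g x) $ i"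
    using i by (simp add: specht_def Let_def scalar_prod_def specht_dim_def[symmetric] coord_def
      atLeast0LessThan mult.commute)
qed (simp add: specht_def coord_def Let_def specht_dim_def)

lemma translate_in_specht:
  "g \<in> perms (sum_list \<nu>) \<Longrightarrow> x \<in> specht_module \<nu> \<Longrightarrow> translate g x \<in> specht_module \<nu>"
  by (rule translate_specht_module[OF perms_permutes])

lemma act_specht_coord:
  assumes x: "x \<in> specht_module \<nu>" and m: "sum_list \<nu> = m"
  shows "act m (specht_dim \<nu>) (specht \<nu>) y *\<^sub>v coord \<nu> x = coord \<nu> (conv m y x)"
proof (rule eq_vecI)
  fix i assume "i < dim_vec (coord \<nu> (conv m y x))"
  then have i: "i < specht_dim \<nu>" by (simp add: coord_def)
  have "(act m (specht_dim \<nu>) (specht \<nu>) y *\<^sub>v coord \<nu> x) $ i =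
      (\<Sum>g\<in>perms m. y g * (specht \<nu> g *\<^sub>v coord \<nu> x) $ i)"
    by (rule act_vec[OF rep_of_dim_specht[OF m] coord_carrier i])
  also have "\<dots> = (\<Sum>g\<in>perms m. y g * coord \<nu> (translate g x) $ i)"
    using specht_coord[OF _ x] m by (intro sum.cong) auto
  also have "\<dots> = coord \<nu> (conv m y x) $ i"
    unfolding conv_expand using translate_in_specht[OF _ x] m i
    by (intro coord_sum_index[symmetric]) auto
  finally show "(act m (specht_dim \<nu>) (specht \<nu>) y *\<^sub>v coord \<nu> x) $ i = coord \<nu> (conv m y x) $ i" .
qed (simp add: coord_def)

section \<open>Homomorphisms out of Specht modules\<close>

text \<open>The homomorphism \<open>V\<^sub>\<nu> \<rightarrow> \<rat>\<^sup>d\<close>, \<open>x \<mapsto> x v\<close>, in coordinates.\<close>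

definition specht_map :: "nat \<Rightarrow> nat \<Rightarrow> rep \<Rightarrow> nat list \<Rightarrow> rat vec \<Rightarrow> rat mat" where
  "specht_map m d \<rho> \<nu> v = mat d (specht_dim \<nu>) (\<lambda>(i, j). (act m d \<rho> (specht_basis \<nu> ! j) *\<^sub>v v) $ i)"

lemma specht_map_carrier [simp]: "specht_map m d \<rho> \<nu> v \<in> carrier_mat d (specht_dim \<nu>)"
  by (simp add: specht_map_def)

lemma act_comb_index:
  assumes "v \<in> carrier_vec d" "i < d"
  shows "(act m d \<rho> (\<Sum>k\<in>I. gscale (a k) (f k)) *\<^sub>v v) $ i = (\<Sum>k\<in>I. a k * (act m d \<rho> (f k) *\<^sub>v v) $ i)"
proof (induction I rule: infinite_finite_induct)
  case (insert k I)
  then have eq: "act m d \<rho> (\<Sum>k\<in>insert k I. gscale (a k) (f k)) =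
      a k \<cdot>\<^sub>m act m d \<rho> (f k) + act m d \<rho> (\<Sum>k\<in>I. gscale (a k) (f k))"
    by (simp only: sum.insert act_linear simp_thms)
  show ?case
    unfolding eq using insert assms by (simp add: add_mult_distrib_mat_vec[of _ d d] smult_mat_vec[of _ d _ d])
qed (simp_all only: sum.infinite sum.empty act_linear simp_thms zero_mat_mult_vec[OF assms(1)],
    simp_all add: assms(2))

lemma specht_map_coord:
  assumes x: "x \<in> specht_module \<nu>" and v: "v \<in> carrier_vec d"
  shows "specht_map m d \<rho> \<nu> v *\<^sub>v coord \<nu> x = act m d \<rho> x *\<^sub>v v"
proof (rule eq_vecI)
  fix i assume "i < dim_vec (act m d \<rho> x *\<^sub>v v)"
  then have i: "i < d" by simp
  have "(act m d \<rho> x *\<^sub>v v) $ i = (\<Sum>k<specht_dim \<nu>. coord \<nu> x $ k * (act m d \<rho> (specht_basis \<nu> ! k) *\<^sub>v v) $ i)"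
    using act_comb_index[OF v i, of m \<rho> "\<lambda>k. coord \<nu> x $ k" "\<lambda>k. specht_basis \<nu> ! k" "{..<specht_dim \<nu>}"]
    unfolding comb_def[symmetric] comb_coord[OF x] .
  then show "(specht_map m d \<rho> \<nu> v *\<^sub>v coord \<nu> x) $ i = (act m d \<rho> x *\<^sub>v v) $ i"
    using i by (simp add: specht_map_def scalar_prod_def coord_def atLeast0LessThan mult.commute)
qed (simp add: specht_map_def)

lemma specht_map_intertwines:
  assumes R: "rep_of_dim m d \<rho>" and v: "v \<in> carrier_vec d" and m: "sum_list \<nu> = m" and g: "g \<in> perms m"
  shows "\<rho> g * specht_map m d \<rho> \<nu> v = specht_map m d \<rho> \<nu> v * specht \<nu> g"
proof (rule eq_mat_of_vecs)
  let ?F = "specht_map m d \<rho> \<nu> v" and ?n = "specht_dim \<nu>"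
  have S: "specht \<nu> g \<in> carrier_mat ?n ?n" by (rule rep_of_dimD(1)[OF rep_of_dim_specht[OF m] g])
  have \<rho>: "\<rho> g \<in> carrier_mat d d" by (rule rep_of_dimD(1)[OF R g])
  show "\<rho> g * ?F \<in> carrier_mat d ?n" "?F * specht \<nu> g \<in> carrier_mat d ?n"
    using S \<rho> by (auto intro: mult_carrier_mat specht_map_carrier)
  fix a :: "rat vec" assume a: "a \<in> carrier_vec ?n"
  define x where "x = comb \<nu> a"
  have x: "x \<in> specht_module \<nu>" "a = coord \<nu> x" using comb_in coord_comb[OF a] by (simp_all add: x_def)
  have "(\<rho> g * ?F) *\<^sub>v a = \<rho> g *\<^sub>v (?F *\<^sub>v a)"
    by (rule assoc_mult_mat_vec[OF \<rho> specht_map_carrier a])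
  also have "\<dots> = act m d \<rho> (conv m (delta g) x) *\<^sub>v v"
    using specht_map_coord[OF x(1) v] x(2) by (simp add: act_conv_vec[OF R v] act_delta[OF R g])
  also have "\<dots> = ?F *\<^sub>v coord \<nu> (translate g x)"
    using specht_map_coord[OF translate_in_specht[OF _ x(1)] v, of g] g m by (simp add: conv_delta_left)
  also have "\<dots> = ?F *\<^sub>v (specht \<nu> g *\<^sub>v a)"
    using specht_coord[OF _ x(1), of g] g m x(2) by simp
  also have "\<dots> = (?F * specht \<nu> g) *\<^sub>v a"
    by (rule assoc_mult_mat_vec[OF specht_map_carrier S a, symmetric])
  finally show "(\<rho> g * ?F) *\<^sub>v a = (?F * specht \<nu> g) *\<^sub>v a" .
qed

text \<open>The elements of \<open>V\<^sub>\<nu>\<close> that kill \<open>v\<close> form a left ideal without \<open>c\<^sub>\<nu>\<close>, and \<open>V\<^sub>\<nu>\<close> is irreducible.\<close>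

lemma specht_map_injective:
  assumes R: "rep_of_dim m d \<rho>" and v: "v \<in> carrier_vec d" and \<nu>: "partition_of m \<nu>"
    and nz: "act m d \<rho> (young_symmetrizer \<nu>) *\<^sub>v v \<noteq> 0\<^sub>v d"
    and a: "a \<in> carrier_vec (specht_dim \<nu>)" "specht_map m d \<rho> \<nu> v *\<^sub>v a = 0\<^sub>v d"
  shows "a = 0\<^sub>v (specht_dim \<nu>)"
proof -
  define x where "x = comb \<nu> a"
  have m: "sum_list \<nu> = m" using \<nu> by (simp add: partition_of_def)
  have x: "x \<in> specht_module \<nu>" "a = coord \<nu> x" using comb_in coord_comb[OF a(1)] by (simp_all add: x_def)
  let ?U = "{x\<in>specht_module \<nu>. act m d \<rho> x *\<^sub>v v = 0\<^sub>v d}"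
  have "x = 0"
  proof (rule specht_irreducible[OF \<nu>, of ?U])
    fix z y assume "z \<in> ?U"
    then show "conv m y z \<in> ?U"
      using specht_left_ideal[of z \<nu> y] m R v
      by (simp add: act_conv_vec mult_zero_vec[of _ d d])
  qed (use nz x a specht_map_coord[OF x(1) v] in auto)
  then show ?thesis using x(2) coord_zero by simp
qed

section \<open>Complete reducibility\<close>

lemma wide_matrix_kernel:
  assumes A: "(A :: rat mat) \<in> carrier_mat k n" and "k < n"
  shows "\<exists>v\<in>carrier_vec n. v \<noteq> 0\<^sub>v n \<and> A *\<^sub>v v = 0\<^sub>v k"
proof -
  \<comment> \<open>Zero rows make \<open>A\<close> a singular square matrix.\<close>
  define B where "B = mat n n (\<lambda>(i, j). if i < k then A $$ (i, j) else 0)"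
  have B: "B \<in> carrier_mat n n" by (simp add: B_def)
  have "transpose_mat B *\<^sub>v unit_vec n k = 0\<^sub>v n"
    using \<open>k < n\<close> by (intro eq_vecI) (auto simp: B_def row_def)
  moreover have "unit_vec n k \<noteq> (0\<^sub>v n :: rat vec)"
    using \<open>k < n\<close> by (metis index_unit_vec(1) index_zero_vec(1) zero_neq_one)
  ultimately have "det (transpose_mat B) = 0"
    using det_0_iff_vec_prod_zero_field[of "transpose_mat B" n] B by (metis transpose_carrier_mat unit_vec_carrier)
  then have "det B = 0" using det_transpose[OF B] by simp
  then obtain v where v: "v \<in> carrier_vec n" "v \<noteq> 0\<^sub>v n" "B *\<^sub>v v = 0\<^sub>v n"
    using det_0_iff_vec_prod_zero_field[OF B] by blast
  have "A *\<^sub>v v = 0\<^sub>v k"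
  proof (rule eq_vecI)
    fix i assume "i < dim_vec (0\<^sub>v k :: rat vec)"
    then have i: "i < k" by simp
    then have "(B *\<^sub>v v) $ i = (A *\<^sub>v v) $ i"
      using A v(1) \<open>k < n\<close> by (auto simp: B_def scalar_prod_def)
    then show "(A *\<^sub>v v) $ i = 0\<^sub>v k $ i" using v(3) i \<open>k < n\<close> by simp
  qed (use A in simp)
  with v show ?thesis by blast
qed

text \<open>The Gram matrix of the standard inner product averaged over the group.\<close>

definition invariant_form :: "nat \<Rightarrow> nat \<Rightarrow> rep \<Rightarrow> rat mat" where
  "invariant_form m d \<rho> = mat d d (\<lambda>(i, j). \<Sum>g\<in>perms m. (transpose_mat (\<rho> g) * \<rho> g) $$ (i, j))"

lemma invariant_form_carrier [simp]: "invariant_form m d \<rho> \<in> carrier_mat d d"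
  by (simp add: invariant_form_def)

lemma invariant_form_invariant:
  assumes R: "rep_of_dim m d \<rho>" and h: "h \<in> perms m"
  shows "invariant_form m d \<rho> * \<rho> h = transpose_mat (\<rho> (pinv h)) * invariant_form m d \<rho>"
proof (rule eq_matI)
  note C = rep_of_dimD(1)[OF R]
  have \<rho>: "\<rho> h \<in> carrier_mat d d" "\<rho> (pinv h) \<in> carrier_mat d d"
    using C h by simp_all
  fix i j assume "i < dim_row (transpose_mat (\<rho> (pinv h)) * invariant_form m d \<rho>)"
    "j < dim_col (transpose_mat (\<rho> (pinv h)) * invariant_form m d \<rho>)"
  then have ij: "i < d" "j < d" using \<rho> by (simp_all add: invariant_form_def)
  let ?f = "\<lambda>g. (transpose_mat (\<rho> (g \<circ> pinv h)) * \<rho> g) $$ (i, j)"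
  have "(invariant_form m d \<rho> * \<rho> h) $$ (i, j) =
      (\<Sum>a<d. \<Sum>g\<in>perms m. (transpose_mat (\<rho> g) * \<rho> g) $$ (i, a) * \<rho> h $$ (a, j))"
    using ij \<rho> by (simp add: scalar_prod_def invariant_form_def sum_distrib_right atLeast0LessThan)
  also have "\<dots> = (\<Sum>g\<in>perms m. \<Sum>a<d. (transpose_mat (\<rho> g) * \<rho> g) $$ (i, a) * \<rho> h $$ (a, j))"
    by (rule sum.swap)
  also have "\<dots> = (\<Sum>g\<in>perms m. ?f (g \<circ> h))"
  proof (rule sum.cong[OF refl])
    fix g assume g: "g \<in> perms m"
    have "transpose_mat (\<rho> g) * \<rho> (g \<circ> h) = (transpose_mat (\<rho> g) * \<rho> g) * \<rho> h"
      using C g h by (simp add: rep_of_dimD(3)[OF R] assoc_mult_mat[of _ d d _ d _ d])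
    moreover have "((transpose_mat (\<rho> g) * \<rho> g) * \<rho> h) $$ (i, j) =
        (\<Sum>a<d. (transpose_mat (\<rho> g) * \<rho> g) $$ (i, a) * \<rho> h $$ (a, j))"
      using C[OF g] by (intro mult_mat_index[OF mult_carrier_mat[OF transpose_carrier_mat[THEN iffD2]] \<rho>(1) ij]) auto
    ultimately show "(\<Sum>a<d. (transpose_mat (\<rho> g) * \<rho> g) $$ (i, a) * \<rho> h $$ (a, j)) = ?f (g \<circ> h)"
      using h by simp
  qed
  also have "\<dots> = (\<Sum>g\<in>perms m. ?f g)" by (rule sum_perms_right[OF h])
  also have "\<dots> = (\<Sum>g\<in>perms m. \<Sum>a<d. transpose_mat (\<rho> (pinv h)) $$ (i, a) * (transpose_mat (\<rho> g) * \<rho> g) $$ (a, j))"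
  proof (rule sum.cong[OF refl])
    fix g assume g: "g \<in> perms m"
    have "transpose_mat (\<rho> (g \<circ> pinv h)) * \<rho> g = transpose_mat (\<rho> (pinv h)) * (transpose_mat (\<rho> g) * \<rho> g)"
      using C g h by (simp add: rep_of_dimD(3)[OF R] transpose_mult[of _ d d _ d] assoc_mult_mat[of _ d d _ d _ d])
    moreover have "(transpose_mat (\<rho> (pinv h)) * (transpose_mat (\<rho> g) * \<rho> g)) $$ (i, j) =
        (\<Sum>a<d. transpose_mat (\<rho> (pinv h)) $$ (i, a) * (transpose_mat (\<rho> g) * \<rho> g) $$ (a, j))"
      using C[OF g] \<rho>(2) by (intro mult_mat_index[OF _ mult_carrier_mat[OF transpose_carrier_mat[THEN iffD2]] ij]) auto
    ultimately show "?f g = (\<Sum>a<d. transpose_mat (\<rho> (pinv h)) $$ (i, a) * (transpose_mat (\<rho> g) * \<rho> g) $$ (a, j))"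
      by simp
  qed
  also have "\<dots> = (\<Sum>a<d. \<Sum>g\<in>perms m. transpose_mat (\<rho> (pinv h)) $$ (i, a) * (transpose_mat (\<rho> g) * \<rho> g) $$ (a, j))"
    by (rule sum.swap)
  also have "\<dots> = (transpose_mat (\<rho> (pinv h)) * invariant_form m d \<rho>) $$ (i, j)"
    using ij \<rho> by (simp add: scalar_prod_def invariant_form_def sum_distrib_left atLeast0LessThan)
  finally show "(invariant_form m d \<rho> * \<rho> h) $$ (i, j) = (transpose_mat (\<rho> (pinv h)) * invariant_form m d \<rho>) $$ (i, j)" .
qed (use carrier_matD[OF rep_of_dimD(1)[OF R h]] carrier_matD[OF rep_of_dimD(1)[OF R perms_inv[OF h]]] in
  \<open>simp_all add: invariant_form_def\<close>)

lemma invariant_form_positive: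
  assumes R: "rep_of_dim m d \<rho>" and v: "v \<in> carrier_vec d"
    and zero: "v \<bullet> (invariant_form m d \<rho> *\<^sub>v v) = 0"
  shows "v = 0\<^sub>v d"
proof -
  note C = rep_of_dimD(1)[OF R]
  have "v \<bullet> (invariant_form m d \<rho> *\<^sub>v v) =
      (\<Sum>i<d. \<Sum>j<d. \<Sum>g\<in>perms m. v $ i * (transpose_mat (\<rho> g) * \<rho> g) $$ (i, j) * v $ j)"
    using v by (simp add: scalar_prod_def invariant_form_def sum_distrib_left sum_distrib_right
        atLeast0LessThan mult.assoc)
  also have "\<dots> = (\<Sum>i<d. \<Sum>g\<in>perms m. \<Sum>j<d. v $ i * (transpose_mat (\<rho> g) * \<rho> g) $$ (i, j) * v $ j)"
    by (rule sum.cong[OF refl], rule sum.swap)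
  also have "\<dots> = (\<Sum>g\<in>perms m. \<Sum>i<d. \<Sum>j<d. v $ i * (transpose_mat (\<rho> g) * \<rho> g) $$ (i, j) * v $ j)"
    by (rule sum.swap)
  also have "\<dots> = (\<Sum>g\<in>perms m. \<Sum>k<d. ((\<rho> g *\<^sub>v v) $ k)\<^sup>2)"
  proof (rule sum.cong[OF refl])
    fix g assume g: "g \<in> perms m"
    have "(\<Sum>i<d. \<Sum>j<d. v $ i * (transpose_mat (\<rho> g) * \<rho> g) $$ (i, j) * v $ j) =
        (\<Sum>i<d. \<Sum>j<d. \<Sum>k<d. (\<rho> g $$ (k, i) * v $ i) * (\<rho> g $$ (k, j) * v $ j))"
      using C[OF g] by (intro sum.cong refl)
        (simp add: scalar_prod_def atLeast0LessThan sum_distrib_left sum_distrib_right mult_ac)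
    also have "\<dots> = (\<Sum>i<d. \<Sum>k<d. \<Sum>j<d. (\<rho> g $$ (k, i) * v $ i) * (\<rho> g $$ (k, j) * v $ j))"
      by (rule sum.cong[OF refl], rule sum.swap)
    also have "\<dots> = (\<Sum>k<d. \<Sum>i<d. \<Sum>j<d. (\<rho> g $$ (k, i) * v $ i) * (\<rho> g $$ (k, j) * v $ j))"
      by (rule sum.swap)
    also have "\<dots> = (\<Sum>k<d. ((\<rho> g *\<^sub>v v) $ k)\<^sup>2)"
      using C[OF g] v by (intro sum.cong refl)
        (simp add: power2_eq_square sum_product scalar_prod_def atLeast0LessThan)
    finally show "(\<Sum>i<d. \<Sum>j<d. v $ i * (transpose_mat (\<rho> g) * \<rho> g) $$ (i, j) * v $ j) =
      (\<Sum>k<d. ((\<rho> g *\<^sub>v v) $ k)\<^sup>2)" .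
  qed
  finally have "(\<Sum>g\<in>perms m. \<Sum>k<d. ((\<rho> g *\<^sub>v v) $ k)\<^sup>2) = 0" using zero by simp
  then have "\<forall>g\<in>perms m. (\<Sum>k<d. ((\<rho> g *\<^sub>v v) $ k)\<^sup>2) = 0"
    by (subst (asm) sum_nonneg_eq_0_iff) (auto intro: sum_nonneg)
  then have "(\<Sum>k<d. ((\<rho> id *\<^sub>v v) $ k)\<^sup>2) = 0" by simp
  then have "\<forall>k<d. v $ k = 0"
    using v rep_of_dimD(2)[OF R] by (subst (asm) sum_nonneg_eq_0_iff) auto
  with v show ?thesis by (intro eq_vecI) auto
qed

abbreviation specht_sum :: "nat list list \<Rightarrow> rep" where
  "specht_sum \<mu>s \<equiv> direct_sum (map specht \<mu>s)"

definition specht_sum_dim :: "nat list list \<Rightarrow> nat" where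
  "specht_sum_dim \<mu>s = sum_list (map specht_dim \<mu>s)"

lemma specht_carrier [simp]: "specht \<nu> g \<in> carrier_mat (specht_dim \<nu>) (specht_dim \<nu>)"
  by (simp add: specht_def Let_def specht_dim_def)

lemma specht_sum_carrier [simp]: "specht_sum \<mu>s g \<in> carrier_mat (specht_sum_dim \<mu>s) (specht_sum_dim \<mu>s)"
  by (rule carrier_matI)
    (simp_all add: direct_sum_def dim_diag_block_mat specht_sum_dim_def comp_def carrier_matD[OF specht_carrier])

lemma specht_sum_Cons:
  "specht_sum (\<nu> # \<mu>s) g = four_block_mat (specht \<nu> g)
     (0\<^sub>m (specht_dim \<nu>) (specht_sum_dim \<mu>s)) (0\<^sub>m (specht_sum_dim \<mu>s) (specht_dim \<nu>)) (specht_sum \<mu>s g)"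
  unfolding direct_sum_def list.map diag_block_mat.simps Let_def
    carrier_matD[OF specht_carrier] carrier_matD[OF specht_sum_carrier[unfolded direct_sum_def]] ..

lemma specht_sum_dim_Cons [simp]: "specht_sum_dim (\<nu> # \<mu>s) = specht_dim \<nu> + specht_sum_dim \<mu>s"
  by (simp add: specht_sum_dim_def)

text \<open>The block matrix \<open>(A B)\<close>, by which two maps into the same space are combined to a map on the sum.\<close>

definition hcat :: "rat mat \<Rightarrow> rat mat \<Rightarrow> rat mat" where
  "hcat A B = mat (dim_row A) (dim_col A + dim_col B)
     (\<lambda>(i, j). if j < dim_col A then A $$ (i, j) else B $$ (i, j - dim_col A))"

lemma hcat_carrier: "A \<in> carrier_mat d n \<Longrightarrow> B \<in> carrier_mat d k \<Longrightarrow> hcat A B \<in> carrier_mat d (n + k)"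
  by (rule carrier_matI) (auto simp: hcat_def)

lemma hcat_mult_vec:
  assumes A: "A \<in> carrier_mat d n" and B: "B \<in> carrier_mat d k"
    and a: "a \<in> carrier_vec n" and b: "b \<in> carrier_vec k"
  shows "hcat A B *\<^sub>v (a @\<^sub>v b) = A *\<^sub>v a + B *\<^sub>v b"
proof (rule eq_vecI)
  fix i assume "i < dim_vec (A *\<^sub>v a + B *\<^sub>v b)"
  then have i: "i < d" using B by simp
  have "row (hcat A B) i = row A i @\<^sub>v row B i"
    using A B i by (intro eq_vecI) (auto simp: hcat_def row_def)
  then show "(hcat A B *\<^sub>v (a @\<^sub>v b)) $ i = (A *\<^sub>v a + B *\<^sub>v b) $ i"
    using A B a b i scalar_prod_append[of "row A i" n "row B i" k a b]
    by (simp add: carrier_matD[OF hcat_carrier[OF A B]])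
qed (use A B in \<open>simp add: hcat_def\<close>)

lemma vec_split:
  assumes "v \<in> carrier_vec (n + k)"
  obtains a b where "a \<in> carrier_vec n" "b \<in> carrier_vec k" "v = a @\<^sub>v b"
  using vec_first_last_append[OF assms] vec_first_carrier[of v n] vec_last_carrier[of v k] by metis

lemma append_zero_vec: "0\<^sub>v n @\<^sub>v 0\<^sub>v k = 0\<^sub>v (n + k)"
  by (rule eq_vecI) auto

text \<open>\<open>P\<close> is the matrix of an injective homomorphism from the sum of the \<open>V\<^sub>\<mu>\<close> to \<open>\<rho>\<close>.\<close>

definition specht_embedding :: "nat \<Rightarrow> nat \<Rightarrow> rep \<Rightarrow> nat list list \<Rightarrow> rat mat \<Rightarrow> bool" where
  "specht_embedding m d \<rho> \<mu>s P \<longleftrightarrow> (\<forall>\<mu>\<in>set \<mu>s. partition_of m \<mu>) \<and>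
     P \<in> carrier_mat d (specht_sum_dim \<mu>s) \<and>
     (\<forall>g\<in>perms m. \<rho> g * P = P * specht_sum \<mu>s g) \<and>
     (\<forall>a\<in>carrier_vec (specht_sum_dim \<mu>s). P *\<^sub>v a = 0\<^sub>v d \<longrightarrow> a = 0\<^sub>v (specht_sum_dim \<mu>s))"

text \<open>Applied to the subrepresentation \<open>ker A\<close>: if all Young symmetrizers acted on it as 0, then so would
  the central elements \<open>central_young m \<nu>\<close>, and with them their combination 1.\<close>

lemma ex_young_symmetrizer_nonzero:
  assumes R: "rep_of_dim m d \<rho>" and A: "A \<in> carrier_mat k d"
    and inv: "\<And>g u. g \<in> perms m \<Longrightarrow> u \<in> carrier_vec d \<Longrightarrow> A *\<^sub>v u = 0\<^sub>v k \<Longrightarrow> A *\<^sub>v (\<rho> g *\<^sub>v u) = 0\<^sub>v k"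
    and u: "u \<in> carrier_vec d" "u \<noteq> 0\<^sub>v d" "A *\<^sub>v u = 0\<^sub>v k"
  shows "\<exists>\<nu> v. partition_of m \<nu> \<and> v \<in> carrier_vec d \<and> A *\<^sub>v v = 0\<^sub>v k \<and>
    act m d \<rho> (young_symmetrizer \<nu>) *\<^sub>v v \<noteq> 0\<^sub>v d"
proof (rule ccontr)
  assume neg: "\<not> ?thesis"
  have act_inv: "A *\<^sub>v (act m d \<rho> x *\<^sub>v w) = 0\<^sub>v k" if "w \<in> carrier_vec d" "A *\<^sub>v w = 0\<^sub>v k" for x w
    using mult_act_vec[OF R A that(1), of _ x] inv[OF _ that] A by (intro eq_vecI) auto
  have "act m d \<rho> (central_young m \<nu>) *\<^sub>v u = 0\<^sub>v d" if \<nu>: "partition_of m \<nu>" for \<nu>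
    unfolding central_young_def
  proof (rule act_sum_vec_zero[OF u(1)])
    fix g assume g: "g \<in> perms m"
    let ?c = "young_symmetrizer \<nu>" and ?y = "conv m (star m (young_symmetrizer \<nu>)) (delta (pinv g))"
    have "act m d \<rho> ?c *\<^sub>v (act m d \<rho> ?y *\<^sub>v u) = 0\<^sub>v d"
      using neg \<nu> act_inv[OF u(1,3), of ?y] mult_mat_vec_carrier[OF act_carrier u(1)] by blast
    then have "act m d \<rho> (conv m ?c ?y) *\<^sub>v u = 0\<^sub>v d" using act_conv_vec[OF R u(1)] by simp
    then show "act m d \<rho> (conv m (delta g) (conv m ?c ?y)) *\<^sub>v u = 0\<^sub>v d"
      using act_conv_vec[OF R u(1)] mult_zero_vec[OF act_carrier] by simp
  qed
  moreover obtain \<alpha> where \<alpha>: "delta id = (\<Sum>\<nu>\<in>{\<nu>. partition_of m \<nu>}. gscale (\<alpha> \<nu>) (central_young m \<nu>))"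
    using one_in_span_central_young by blast
  ultimately have "act m d \<rho> (delta id) *\<^sub>v u = 0\<^sub>v d"
    unfolding \<alpha>
  proof (intro act_sum_vec_zero[OF u(1)])
    fix \<nu> assume zero: "\<And>\<nu>. partition_of m \<nu> \<Longrightarrow> act m d \<rho> (central_young m \<nu>) *\<^sub>v u = 0\<^sub>v d"
      and "\<nu> \<in> {\<nu>. partition_of m \<nu>}"
    then have "act m d \<rho> (gscale (\<alpha> \<nu>) (central_young m \<nu>)) *\<^sub>v u = \<alpha> \<nu> \<cdot>\<^sub>v 0\<^sub>v d"
      by (simp add: act_linear smult_mat_vec[OF u(1) act_carrier])
    then show "act m d \<rho> (gscale (\<alpha> \<nu>) (central_young m \<nu>)) *\<^sub>v u = 0\<^sub>v d"
      by (simp add: vec_eq_iff)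
  qed
  then show False
    using u act_delta[OF R, of id] rep_of_dimD(2)[OF R] by simp
qed

text \<open>The orthogonal complement of the image, for the invariant form, is a nonzero subrepresentation.
  Some \<open>c\<^sub>\<nu>\<close> does not kill it, so it contains a copy of \<open>V\<^sub>\<nu>\<close>.\<close>

lemma specht_embedding_extend:
  assumes R: "rep_of_dim m d \<rho>" and P: "specht_embedding m d \<rho> \<mu>s P"
    and lt: "specht_sum_dim \<mu>s < d"
  shows "\<exists>\<nu> P'. specht_embedding m d \<rho> (\<nu> # \<mu>s) P'"
proof -
  let ?N = "specht_sum_dim \<mu>s" and ?H = "invariant_form m d \<rho>"
  note C = rep_of_dimD(1)[OF R]
  have PC: "P \<in> carrier_mat d ?N" and Peq: "\<And>g. g \<in> perms m \<Longrightarrow> \<rho> g * P = P * specht_sum \<mu>s g"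
    and Pinj: "\<And>a. a \<in> carrier_vec ?N \<Longrightarrow> P *\<^sub>v a = 0\<^sub>v d \<Longrightarrow> a = 0\<^sub>v ?N"
    using P by (auto simp: specht_embedding_def)
  \<comment> \<open>The kernel of \<open>A\<close> is the orthogonal complement of the image of \<open>P\<close>.\<close>
  define A where "A = transpose_mat P * ?H"
  have PT: "transpose_mat P \<in> carrier_mat ?N d" using PC by simp
  have A: "A \<in> carrier_mat ?N d" unfolding A_def using PT by (intro mult_carrier_mat) auto
  have inv: "A *\<^sub>v (\<rho> g *\<^sub>v u) = 0\<^sub>v ?N"
    if g: "g \<in> perms m" and u: "u \<in> carrier_vec d" "A *\<^sub>v u = 0\<^sub>v ?N" for g u
  proof -
    let ?D = "specht_sum \<mu>s (pinv g)"
    have "A * \<rho> g = transpose_mat P * (transpose_mat (\<rho> (pinv g)) * ?H)"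
      unfolding A_def invariant_form_invariant[OF R g, symmetric]
      by (rule assoc_mult_mat[OF PT _ C[OF g]]) simp
    also have "\<dots> = (transpose_mat P * transpose_mat (\<rho> (pinv g))) * ?H"
      using C[OF perms_inv[OF g]] by (intro assoc_mult_mat[OF PT _ invariant_form_carrier, symmetric]) auto
    also have "transpose_mat P * transpose_mat (\<rho> (pinv g)) = transpose_mat (\<rho> (pinv g) * P)"
      by (rule transpose_mult[OF C[OF perms_inv[OF g]] PC, symmetric])
    also have "\<dots> = transpose_mat ?D * transpose_mat P"
      unfolding Peq[OF perms_inv[OF g]] by (rule transpose_mult[OF PC specht_sum_carrier])
    also have "\<dots> * ?H = transpose_mat ?D * A"
      unfolding A_def
      by (rule assoc_mult_mat[OF transpose_carrier_mat[THEN iffD2, OF specht_sum_carrier] PT invariant_form_carrier])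
    finally have *: "A * \<rho> g = transpose_mat ?D * A" .
    have DT: "transpose_mat ?D \<in> carrier_mat ?N ?N" by simp
    have "A *\<^sub>v (\<rho> g *\<^sub>v u) = (A * \<rho> g) *\<^sub>v u" by (rule assoc_mult_mat_vec[OF A C[OF g] u(1), symmetric])
    also have "\<dots> = transpose_mat ?D *\<^sub>v (A *\<^sub>v u)" unfolding * by (rule assoc_mult_mat_vec[OF DT A u(1)])
    also have "\<dots> = 0\<^sub>v ?N" unfolding u(2) by (rule mult_zero_vec[OF DT])
    finally show ?thesis .
  qed
  have APinj: "b = 0\<^sub>v ?N" if b: "b \<in> carrier_vec ?N" and z: "A *\<^sub>v (P *\<^sub>v b) = 0\<^sub>v ?N" for b
  proof -
    have Pb: "P *\<^sub>v b \<in> carrier_vec d" by (rule mult_mat_vec_carrier[OF PC b])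
    have "A *\<^sub>v (P *\<^sub>v b) = transpose_mat P *\<^sub>v (?H *\<^sub>v (P *\<^sub>v b))"
      unfolding A_def by (rule assoc_mult_mat_vec[OF PT _ Pb]) simp
    then have "transpose_mat P *\<^sub>v (?H *\<^sub>v (P *\<^sub>v b)) = 0\<^sub>v ?N" using z by (rule subst)
    then have "b \<bullet> (transpose_mat P *\<^sub>v (?H *\<^sub>v (P *\<^sub>v b))) = 0"
      by (simp only: scalar_prod_right_zero[OF b])
    then have "(P *\<^sub>v b) \<bullet> (?H *\<^sub>v (P *\<^sub>v b)) = 0"
      using transpose_vec_mult_scalar[OF PC b, of "?H *\<^sub>v (P *\<^sub>v b)"]
        comm_scalar_prod[of "?H *\<^sub>v (P *\<^sub>v b)" d "P *\<^sub>v b"]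
        comm_scalar_prod[OF b mult_mat_vec_carrier[OF PT mult_mat_vec_carrier[OF invariant_form_carrier Pb]]]
        Pb mult_mat_vec_carrier[OF invariant_form_carrier Pb] by metis
    then have "P *\<^sub>v b = 0\<^sub>v d" by (rule invariant_form_positive[OF R Pb])
    then show ?thesis by (rule Pinj[OF b])
  qed
  obtain u where u: "u \<in> carrier_vec d" "u \<noteq> 0\<^sub>v d" "A *\<^sub>v u = 0\<^sub>v ?N"
    using wide_matrix_kernel[OF A lt] by blast
  obtain \<nu> v where \<nu>: "partition_of m \<nu>" and v: "v \<in> carrier_vec d" "A *\<^sub>v v = 0\<^sub>v ?N"
    and nz: "act m d \<rho> (young_symmetrizer \<nu>) *\<^sub>v v \<noteq> 0\<^sub>v d"
    using ex_young_symmetrizer_nonzero[OF R A inv u] by blast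
  have m: "sum_list \<nu> = m" using \<nu> by (simp add: partition_of_def)
  let ?F = "specht_map m d \<rho> \<nu> v" and ?n = "specht_dim \<nu>"
  have AF: "A *\<^sub>v (?F *\<^sub>v a) = 0\<^sub>v ?N" if a: "a \<in> carrier_vec ?n" for a
  proof -
    have "?F *\<^sub>v a = act m d \<rho> (comb \<nu> a) *\<^sub>v v"
      using specht_map_coord[OF comb_in v(1), of m \<rho> \<nu> a] coord_comb[OF a] by simp
    then show ?thesis
      using mult_act_vec[OF R A v(1)] inv[OF _ v] A by (intro eq_vecI) auto
  qed
  have PC': "hcat ?F P \<in> carrier_mat d (?n + ?N)" by (rule hcat_carrier[OF specht_map_carrier PC])
  have "specht_embedding m d \<rho> (\<nu> # \<mu>s) (hcat ?F P)"
    unfolding specht_embedding_def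
  proof (intro conjI ballI impI)
    show "hcat ?F P \<in> carrier_mat d (specht_sum_dim (\<nu> # \<mu>s))" using PC' by simp
    show "partition_of m \<mu>" if "\<mu> \<in> set (\<nu> # \<mu>s)" for \<mu>
      using that \<nu> P by (auto simp: specht_embedding_def)
  next
    fix g assume g: "g \<in> perms m"
    show "\<rho> g * hcat ?F P = hcat ?F P * specht_sum (\<nu> # \<mu>s) g"
    proof (rule eq_mat_of_vecs)
      show "\<rho> g * hcat ?F P \<in> carrier_mat d (?n + ?N)" by (rule mult_carrier_mat[OF C[OF g] PC'])
      have DC: "specht_sum (\<nu> # \<mu>s) g \<in> carrier_mat (?n + ?N) (?n + ?N)"
        using specht_sum_carrier[of "\<nu> # \<mu>s" g] by (simp only: specht_sum_dim_Cons)
      show "hcat ?F P * specht_sum (\<nu> # \<mu>s) g \<in> carrier_mat d (?n + ?N)"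
        by (rule mult_carrier_mat[OF PC' DC])
      fix w :: "rat vec" assume w: "w \<in> carrier_vec (?n + ?N)"
      obtain a b where ab: "a \<in> carrier_vec ?n" "b \<in> carrier_vec ?N" "w = a @\<^sub>v b" using vec_split[OF w] .
      have Fa: "?F *\<^sub>v a \<in> carrier_vec d" "P *\<^sub>v b \<in> carrier_vec d"
        using mult_mat_vec_carrier[OF specht_map_carrier ab(1)] mult_mat_vec_carrier[OF PC ab(2)] by auto
      have "(\<rho> g * hcat ?F P) *\<^sub>v w = \<rho> g *\<^sub>v (?F *\<^sub>v a + P *\<^sub>v b)"
        using assoc_mult_mat_vec[OF C[OF g] PC' w] hcat_mult_vec[OF specht_map_carrier PC ab(1,2)] ab(3) by simp
      also have "\<dots> = \<rho> g *\<^sub>v (?F *\<^sub>v a) + \<rho> g *\<^sub>v (P *\<^sub>v b)"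
        by (rule mult_add_distrib_mat_vec[OF C[OF g] Fa])
      also have "\<rho> g *\<^sub>v (?F *\<^sub>v a) = ?F *\<^sub>v (specht \<nu> g *\<^sub>v a)"
        using assoc_mult_mat_vec[OF C[OF g] specht_map_carrier ab(1)]
          assoc_mult_mat_vec[OF specht_map_carrier specht_carrier ab(1)]
          specht_map_intertwines[OF R v(1) m g] by metis
      also have "\<rho> g *\<^sub>v (P *\<^sub>v b) = P *\<^sub>v (specht_sum \<mu>s g *\<^sub>v b)"
        using assoc_mult_mat_vec[OF C[OF g] PC ab(2)]
          assoc_mult_mat_vec[OF PC specht_sum_carrier ab(2)] Peq[OF g] by metis
      also have "?F *\<^sub>v (specht \<nu> g *\<^sub>v a) + P *\<^sub>v (specht_sum \<mu>s g *\<^sub>v b) =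
          hcat ?F P *\<^sub>v (specht \<nu> g *\<^sub>v a @\<^sub>v specht_sum \<mu>s g *\<^sub>v b)"
        by (rule hcat_mult_vec[OF specht_map_carrier PC, symmetric])
          (rule mult_mat_vec_carrier[OF specht_carrier ab(1)], rule mult_mat_vec_carrier[OF specht_sum_carrier ab(2)])
      also have "\<dots> = hcat ?F P *\<^sub>v (specht_sum (\<nu> # \<mu>s) g *\<^sub>v w)"
        unfolding specht_sum_Cons ab(3)
        by (subst mult_mat_vec_split[OF specht_carrier specht_sum_carrier ab(1,2)]) (rule refl)
      also have "\<dots> = (hcat ?F P * specht_sum (\<nu> # \<mu>s) g) *\<^sub>v w"
        by (rule assoc_mult_mat_vec[OF PC' DC w, symmetric])
      finally show "(\<rho> g * hcat ?F P) *\<^sub>v w = (hcat ?F P * specht_sum (\<nu> # \<mu>s) g) *\<^sub>v w" .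
    qed
  next
    fix w :: "rat vec" assume w: "w \<in> carrier_vec (specht_sum_dim (\<nu> # \<mu>s))" "hcat ?F P *\<^sub>v w = 0\<^sub>v d"
    obtain a b where ab: "a \<in> carrier_vec ?n" "b \<in> carrier_vec ?N" "w = a @\<^sub>v b"
      using vec_split[OF w(1)[unfolded specht_sum_dim_Cons]] .
    have Fa: "?F *\<^sub>v a \<in> carrier_vec d" "P *\<^sub>v b \<in> carrier_vec d"
      using mult_mat_vec_carrier[OF specht_map_carrier ab(1)] mult_mat_vec_carrier[OF PC ab(2)] by auto
    have z: "?F *\<^sub>v a + P *\<^sub>v b = 0\<^sub>v d"
      using w(2) hcat_mult_vec[OF specht_map_carrier PC ab(1,2)] ab(3) by simp
    have "A *\<^sub>v (?F *\<^sub>v a + P *\<^sub>v b) = A *\<^sub>v (P *\<^sub>v b)"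
      using mult_add_distrib_mat_vec[OF A Fa] AF[OF ab(1)] mult_mat_vec_carrier[OF A Fa(2)] by simp
    then have "A *\<^sub>v (P *\<^sub>v b) = 0\<^sub>v ?N" using z mult_zero_vec[OF A] by simp
    then have b: "b = 0\<^sub>v ?N" by (rule APinj[OF ab(2)])
    then have "?F *\<^sub>v a = 0\<^sub>v d" using z mult_zero_vec[OF PC] Fa(1) by simp
    then have "a = 0\<^sub>v ?n" by (rule specht_map_injective[OF R v(1) \<nu> nz ab(1)])
    with b ab(3) show "w = 0\<^sub>v (specht_sum_dim (\<nu> # \<mu>s))" by (simp add: append_zero_vec)
  qed
  then show ?thesis by blast
qed

lemma specht_dim_pos: "0 < specht_dim \<nu>"
proof (rule ccontr)
  assume "\<not> ?thesis"
  then have "comb \<nu> (coord \<nu> (young_symmetrizer \<nu>)) = 0" by (simp add: comb_def)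
  then show False using comb_coord[OF young_in_specht] young_nonzero by metis
qed

text \<open>An embedding of a sum of modules \<open>V\<^sub>\<mu>\<close> of the largest possible dimension is surjective, since
  otherwise it could be extended.\<close>

theorem complete_reducibility:
  assumes R: "rep_of_dim m d \<rho>"
  shows "\<exists>\<mu>s. (\<forall>\<mu>\<in>set \<mu>s. partition_of m \<mu>) \<and> rep_iso m \<rho> (specht_sum \<mu>s)"
proof -
  note C = rep_of_dimD(1)[OF R]
  have bound: "specht_sum_dim \<mu>s \<le> d" if "specht_embedding m d \<rho> \<mu>s P" for \<mu>s P
  proof (rule ccontr)
    assume "\<not> specht_sum_dim \<mu>s \<le> d"
    then show False
      using wide_matrix_kernel[of P d "specht_sum_dim \<mu>s"] that unfolding specht_embedding_def by auto
  qed
  have "\<exists>\<mu>s P. specht_embedding m d \<rho> \<mu>s P \<and> specht_sum_dim \<mu>s = d"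
  proof -
    have start: "specht_embedding m d \<rho> [] (0\<^sub>m d 0)"
      unfolding specht_embedding_def
      using C by (auto simp: specht_sum_dim_def direct_sum_def intro!: right_mult_zero_mat)
    let ?S = "{specht_sum_dim \<mu>s | \<mu>s. \<exists>P. specht_embedding m d \<rho> \<mu>s P}"
    have fin: "finite ?S" using bound by (intro finite_subset[of ?S "{..d}"]) auto
    have "Max ?S \<in> ?S" using start fin by (intro Max_in) auto
    then obtain \<mu>s P where P: "specht_embedding m d \<rho> \<mu>s P" "specht_sum_dim \<mu>s = Max ?S" by auto
    have "specht_sum_dim \<mu>s = d"
    proof (rule ccontr)
      assume "specht_sum_dim \<mu>s \<noteq> d"
      then have "specht_sum_dim \<mu>s < d" using bound[OF P(1)] by simp
      then obtain \<nu> P' where P': "specht_embedding m d \<rho> (\<nu> # \<mu>s) P'"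
        using specht_embedding_extend[OF R P(1)] by blast
      then have "specht_sum_dim (\<nu> # \<mu>s) \<in> ?S" by blast
      then have "specht_sum_dim (\<nu> # \<mu>s) \<le> Max ?S" by (rule Max_ge[OF fin])
      with P(2) specht_dim_pos[of \<nu>] show False by simp
    qed
    with P(1) show ?thesis by blast
  qed
  then obtain \<mu>s P where P: "specht_embedding m d \<rho> \<mu>s P" and N: "specht_sum_dim \<mu>s = d" by blast
  have PC: "P \<in> carrier_mat d d" using P N by (simp add: specht_embedding_def)
  have "det P \<noteq> 0"
    using det_0_iff_vec_prod_zero_field[OF PC] P N by (auto simp: specht_embedding_def)
  then obtain Q where Q: "Q \<in> carrier_mat d d" "Q * P = 1\<^sub>m d" "P * Q = 1\<^sub>m d"
    using det_non_zero_imp_unit[OF PC, of "()"] by (auto simp: Units_def ring_mat_def)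
  have "similar_mat_wit (\<rho> g) (specht_sum \<mu>s g) P Q" if g: "g permutes {1..m}" for g
  proof (rule similar_mat_witI[of _ _ d])
    have gp: "g \<in> perms m" using g by (simp add: perms_def)
    have D: "specht_sum \<mu>s g \<in> carrier_mat d d" using specht_sum_carrier[of \<mu>s g] N by simp
    have "P * specht_sum \<mu>s g * Q = \<rho> g * P * Q" using P gp by (simp add: specht_embedding_def)
    also have "\<dots> = \<rho> g" using assoc_mult_mat[OF C[OF gp] PC Q(1)] Q(3) C[OF gp] by simp
    finally show "\<rho> g = P * specht_sum \<mu>s g * Q" by simp
    show "\<rho> g \<in> carrier_mat d d" "specht_sum \<mu>s g \<in> carrier_mat d d" using C[OF gp] D by auto
  qed (use PC Q in auto)
  then have "rep_iso m \<rho> (specht_sum \<mu>s)" unfolding rep_iso_def by blast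
  with P show ?thesis unfolding specht_embedding_def by blast
qed

section \<open>Vectors fixed by large symmetric subgroups\<close>

text \<open>Permutations of \<open>K\<close> fix all points outside \<open>K\<close>, so this is invariance under the subgroup \<open>S\<^sub>K\<close>.\<close>

definition fixed_vec :: "nat \<Rightarrow> rep \<Rightarrow> nat set \<Rightarrow> rat vec \<Rightarrow> bool" where
  "fixed_vec d \<rho> K v \<longleftrightarrow> v \<in> carrier_vec d \<and> (\<forall>g. g permutes K \<longrightarrow> \<rho> g *\<^sub>v v = v)"

text \<open>The vectors fixed by some \<open>S\<^sub>K\<close> with \<open>|K| \<ge> k\<close> span the space. This is expressed dually, through the
  linear forms that vanish on them. For \<open>k > m\<close> there are no such \<open>K\<close>, and only the zero module
  satisfies the condition.\<close>

definition fixed_spanned :: "nat \<Rightarrow> nat \<Rightarrow> rep \<Rightarrow> nat \<Rightarrow> bool" where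
  "fixed_spanned m d \<rho> k \<longleftrightarrow> (\<forall>f\<in>carrier_vec d.
     (\<forall>K v. K \<subseteq> {1..m} \<longrightarrow> k \<le> card K \<longrightarrow> fixed_vec d \<rho> K v \<longrightarrow> f \<bullet> v = 0) \<longrightarrow> f = 0\<^sub>v d)"

lemma fixed_spannedI:
  assumes "\<And>f. f \<in> carrier_vec d \<Longrightarrow>
    (\<And>K v. K \<subseteq> {1..m} \<Longrightarrow> k \<le> card K \<Longrightarrow> fixed_vec d \<rho> K v \<Longrightarrow> f \<bullet> v = 0) \<Longrightarrow> f = 0\<^sub>v d"
  shows "fixed_spanned m d \<rho> k"
  using assms unfolding fixed_spanned_def by blast

lemma fixed_spannedD:
  assumes "fixed_spanned m d \<rho> k" "f \<in> carrier_vec d"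
    and "\<And>K v. K \<subseteq> {1..m} \<Longrightarrow> k \<le> card K \<Longrightarrow> fixed_vec d \<rho> K v \<Longrightarrow> f \<bullet> v = 0"
  shows "f = 0\<^sub>v d"
  using assms unfolding fixed_spanned_def by blast

lemma fixed_spanned_mono: "fixed_spanned m d \<rho> k \<Longrightarrow> k' \<le> k \<Longrightarrow> fixed_spanned m d \<rho> k'"
  unfolding fixed_spanned_def by (meson le_trans)

lemma permutes_perms: "g permutes K \<Longrightarrow> K \<subseteq> {1..m} \<Longrightarrow> g \<in> perms m"
  unfolding perms_def by (auto intro: permutes_subset)

text \<open>A linear form is a matrix with one row.\<close>

lemma scalar_act_vec:
  assumes R: "rep_of_dim m d \<rho>" and f: "f \<in> carrier_vec d" and v: "v \<in> carrier_vec d"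
  shows "f \<bullet> (act m d \<rho> x *\<^sub>v v) = (\<Sum>g\<in>perms m. x g * (f \<bullet> (\<rho> g *\<^sub>v v)))"
proof -
  let ?A = "mat 1 d (\<lambda>(i, j). f $ j)"
  have A: "?A \<in> carrier_mat 1 d" by simp
  have Af: "(?A *\<^sub>v w) $ 0 = f \<bullet> w" if "w \<in> carrier_vec d" for w
    using that f by (simp add: scalar_prod_def)
  have "f \<bullet> (act m d \<rho> x *\<^sub>v v) = (\<Sum>g\<in>perms m. x g * (?A *\<^sub>v (\<rho> g *\<^sub>v v)) $ 0)"
    using mult_act_vec[OF R A v, of 0 x] Af[OF mult_mat_vec_carrier[OF act_carrier v]] by simp
  also have "\<dots> = (\<Sum>g\<in>perms m. x g * (f \<bullet> (\<rho> g *\<^sub>v v)))"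
    by (rule sum.cong[OF refl]) (simp only: Af[OF mult_mat_vec_carrier[OF rep_of_dimD(1)[OF R] v]])
  finally show ?thesis .
qed

definition first_row :: "nat list \<Rightarrow> nat" where
  "first_row \<nu> = (if \<nu> = [] then 0 else hd \<nu>)"

lemma partition_nth_le_first:
  assumes "is_partition \<nu>" "r < length \<nu>"
  shows "\<nu> ! r \<le> first_row \<nu>"
proof (cases r)
  case 0
  with assms show ?thesis by (auto simp: first_row_def hd_conv_nth)
next
  case (Suc r')
  then show ?thesis
    using assms by (auto simp: first_row_def hd_conv_nth is_partition_def sorted_wrt_iff_nth_less)
qed

lemma partition_weight_eq:
  assumes "partition_of m \<nu>"
  shows "partition_weight \<nu> = m - first_row \<nu>" "first_row \<nu> \<le> m"
  using assms by (cases \<nu>; auto simp: partition_of_def partition_weight_def first_row_def)+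

lemma tab_col_range:
  assumes "partition_of m \<nu>" "k \<in> {1..m}"
  shows "tab_col \<nu> k \<in> {1..first_row \<nu>}"
  using tab_row_col_bounds[of k \<nu>] partition_nth_le_first[of \<nu> "tab_row \<nu> k"] assms
  by (auto simp: partition_of_def)

lemma tab_first_row:
  assumes "partition_of m \<nu>"
  shows "k \<in> {1..m} \<Longrightarrow> tab_row \<nu> k = 0 \<longleftrightarrow> k \<le> first_row \<nu>"
proof -
  assume k: "k \<in> {1..m}"
  have ne: "\<nu> \<noteq> []" using k assms by (auto simp: partition_of_def)
  have "k \<in> {1..sum_list \<nu>}" using k assms by (simp add: partition_of_def)
  note b = tab_row_col_bounds[OF this] tableau_entry_determined[OF this]
  show "tab_row \<nu> k = 0 \<longleftrightarrow> k \<le> first_row \<nu>"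
  proof
    assume "tab_row \<nu> k = 0"
    then show "k \<le> first_row \<nu>" using b ne by (auto simp: first_row_def hd_conv_nth)
  next
    assume "k \<le> first_row \<nu>"
    then show "tab_row \<nu> k = 0"
      using tab_entry(2)[of 0 \<nu> k] k ne by (auto simp: first_row_def hd_conv_nth)
  qed
qed

lemma conj_in_label_stabilizer:
  assumes g: "g \<in> perms m" and h: "h \<in> perms m"
    and moved: "\<And>i. i \<in> {1..m} \<Longrightarrow> h i \<noteq> i \<Longrightarrow> k (pinv g i) = c"
  shows "pinv g \<circ> h \<circ> g \<in> label_stabilizer m k"
proof -
  have "k (pinv g (h (g i))) = k i" if i: "i \<in> {1..m}" for i
  proof (cases "h (g i) = g i")
    case True
    then show ?thesis using g by simp
  next
    case False
    have gi: "g i \<in> {1..m}" "h (g i) \<in> {1..m}" using perms_image[OF g i] perms_image[OF h perms_image[OF g i]] .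
    have "h (h (g i)) \<noteq> h (g i)" using False perms_inverses(1)[OF h] by metis
    then show ?thesis using moved[OF gi(1) False] moved[OF gi(2)] g by simp
  qed
  then show ?thesis using g h by (simp add: label_stabilizer_def)
qed

lemma translate_conj:
  assumes g: "g \<in> perms m" and h: "h \<in> perms m" and x: "translate (pinv g \<circ> h \<circ> g) x = x"
  shows "translate h (translate g x) = translate g x"
proof -
  have "translate h (translate g x) = translate (g \<circ> (pinv g \<circ> h \<circ> g)) x"
    using g h translate_comp[OF perms_bij[OF h] perms_bij[OF g], of x] by (simp add: comp_assoc)
  also have "\<dots> = translate g (translate (pinv g \<circ> h \<circ> g) x)"
    by (rule translate_comp) (use g h in \<open>auto intro!: perms_bij[of _ m]\<close>)
  finally show ?thesis using x by simp
qed

text \<open>For every \<open>h\<close> two points \<open>u, v \<in> K\<close> lie in one column of the \<open>h\<close>-translated tableau. The transposition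
  of \<open>u\<close> and \<open>v\<close> fixes \<open>x\<close>, but as a column transposition on the right of \<open>h\<close> it turns the coefficient of \<open>x\<close>
  at \<open>h\<close> into its negative.\<close>

lemma specht_fixed_zero:
  assumes \<nu>: "partition_of m \<nu>" and x: "x \<in> specht_module \<nu>"
    and K: "K \<subseteq> {1..m}" "first_row \<nu> < card K"
    and inv: "\<And>h. h permutes K \<Longrightarrow> translate h x = x"
  shows "x = 0"
proof -
  have m: "sum_list \<nu> = m" using \<nu> by (simp add: partition_of_def)
  have ga: "x \<in> group_algebra m" using specht_group_algebra[OF x] m by simp
  obtain y where y: "x = conv m y (young_symmetrizer \<nu>)" using x specht_module_iff m by auto
  show ?thesis
  proof (rule group_algebra_eqI[OF ga group_algebra_closed(1)])
    fix h assume h: "h \<in> perms m"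
    have "\<not> inj_on (\<lambda>i. tab_col \<nu> (pinv h i)) K"
    proof
      assume "inj_on (\<lambda>i. tab_col \<nu> (pinv h i)) K"
      moreover have "(\<lambda>i. tab_col \<nu> (pinv h i)) ` K \<subseteq> {1..first_row \<nu>}"
        using tab_col_range[OF \<nu> perms_image[OF perms_inv[OF h]]] K(1) by blast
      ultimately have "card K \<le> card {1..first_row \<nu>}" by (intro card_inj_on_le) auto
      with K(2) show False by simp
    qed
    then obtain u v where uv: "u \<in> K" "v \<in> K" "u \<noteq> v" "tab_col \<nu> (pinv h u) = tab_col \<nu> (pinv h v)"
      unfolding inj_on_def by blast
    let ?t = "transpose u v" and ?s = "transpose (pinv h u) (pinv h v)"
    have t: "?t \<in> perms m" using uv K by (auto simp: perms_def intro!: permutes_swap_id)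
    have hu: "pinv h u \<in> {1..m}" "pinv h v \<in> {1..m}" using perms_image[OF perms_inv[OF h]] uv K by blast+
    have ne: "pinv h u \<noteq> pinv h v" using uv(3) h by (metis perms_inverses(2))
    have s: "?s \<in> label_stabilizer m (tab_col \<nu>)" by (rule transpose_in_label_stabilizer[of _ m _ "tab_col \<nu>", OF hu uv(4)])
    have sp: "?s \<in> perms m" by (rule label_stabilizer_perms[OF s])
    have "?t \<circ> h = h \<circ> ?s" using h by (auto simp: fun_eq_iff transpose_def)
    moreover have "translate ?t x (?t \<circ> h) = x h"
      using t perms_cancel(3)[OF t, of h] by (simp add: translate_def)
    moreover have "translate ?t x = x" by (rule inv) (use uv in \<open>simp add: permutes_swap_id\<close>)
    ultimately have 1: "x (h \<circ> ?s) = x h" by simp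
    have "conv m (young_symmetrizer \<nu>) (delta ?s) = gscale (of_int (sign ?s)) (young_symmetrizer \<nu>)"
      using young_col_alternating[of ?s \<nu>] s m by simp
    then have "conv m x (delta ?s) = gscale (of_int (sign ?s)) x"
      unfolding y conv_assoc by (simp only: conv_linear)
    moreover have "conv m x (delta ?s) (h \<circ> ?s) = x h"
      using conv_delta_right[OF sp ga, of "h \<circ> ?s"] perms_cancel(5)[OF sp] by simp
    ultimately have "x h = - x (h \<circ> ?s)" using ne by (simp add: gscale_def sign_swap_id)
    with 1 show "x h = 0 h" by simp
  qed
qed

text \<open>The translate \<open>g c\<^sub>\<nu>\<close> is fixed by the permutations of the \<open>g\<close>-image of the first row, and these translates
  span \<open>V\<^sub>\<nu>\<close>. For \<open>k > \<nu>\<^sub>1\<close> all fixed vectors in question are 0.\<close>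

lemma fixed_spanned_specht:
  assumes \<nu>: "partition_of m \<nu>"
  shows "fixed_spanned m (specht_dim \<nu>) (specht \<nu>) k \<longleftrightarrow> k \<le> first_row \<nu>"
proof
  let ?n = "specht_dim \<nu>" and ?c = "young_symmetrizer \<nu>"
  have m: "sum_list \<nu> = m" using \<nu> by (simp add: partition_of_def)
  note R = rep_of_dim_specht[OF m]
  assume k: "k \<le> first_row \<nu>"
  show "fixed_spanned m ?n (specht \<nu>) k"
  proof (rule fixed_spannedI)
    fix f :: "rat vec" assume f: "f \<in> carrier_vec ?n"
      and van: "\<And>K v. K \<subseteq> {1..m} \<Longrightarrow> k \<le> card K \<Longrightarrow> fixed_vec ?n (specht \<nu>) K v \<Longrightarrow> f \<bullet> v = 0"
    have gc: "f \<bullet> (specht \<nu> g *\<^sub>v coord \<nu> ?c) = 0" if g: "g \<in> perms m" for g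
    proof (rule van[of "g ` {1..first_row \<nu>}"])
      have le: "first_row \<nu> \<le> m" by (rule partition_weight_eq(2)[OF \<nu>])
      show sub: "g ` {1..first_row \<nu>} \<subseteq> {1..m}" using perms_image[OF g] le by fastforce
      have "inj g" using perms_bij[OF g] by (rule bij_is_inj)
      then show "k \<le> card (g ` {1..first_row \<nu>})" using k by (simp add: card_image inj_on_subset)
      have eq: "specht \<nu> g *\<^sub>v coord \<nu> ?c = coord \<nu> (translate g ?c)"
        by (rule specht_coord) (use g m young_in_specht in auto)
      show "fixed_vec ?n (specht \<nu>) (g ` {1..first_row \<nu>}) (specht \<nu> g *\<^sub>v coord \<nu> ?c)"
        unfolding fixed_vec_def eq
      proof (intro conjI allI impI)
        fix h assume h: "h permutes g ` {1..first_row \<nu>}"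
        then have hp: "h \<in> perms m" using sub by (rule permutes_perms)
        have "pinv g \<circ> h \<circ> g \<in> label_stabilizer m (tab_row \<nu>)"
        proof (rule conj_in_label_stabilizer[OF g hp])
          fix i assume "i \<in> {1..m}" "h i \<noteq> i"
          then have "i \<in> g ` {1..first_row \<nu>}" using h permutes_not_in by metis
          then show "tab_row \<nu> (pinv g i) = 0" using tab_first_row[OF \<nu>] le g by auto
        qed
        then have "translate (pinv g \<circ> h \<circ> g) ?c = ?c"
          using young_row_invariant[of "pinv g \<circ> h \<circ> g" \<nu>] m conv_delta_left label_stabilizer_perms by metis
        then show "specht \<nu> h *\<^sub>v coord \<nu> (translate g ?c) = coord \<nu> (translate g ?c)"
          using specht_coord[of h \<nu> "translate g ?c"] translate_in_specht[OF _ young_in_specht] g hp m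
            translate_conj[OF g hp] by simp
      qed simp
    qed
    have fx: "f \<bullet> coord \<nu> x = 0" if x: "x \<in> specht_module \<nu>" for x
    proof -
      obtain y where "x = conv m y ?c" using x specht_module_iff m by auto
      then have "coord \<nu> x = act m ?n (specht \<nu>) y *\<^sub>v coord \<nu> ?c"
        using act_specht_coord[OF young_in_specht m] by simp
      then show ?thesis using scalar_act_vec[OF R f coord_carrier] gc by simp
    qed
    show "f = 0\<^sub>v ?n"
    proof (rule eq_vecI)
      fix i assume "i < dim_vec (0\<^sub>v ?n :: rat vec)"
      then have i: "i < ?n" by simp
      have "f \<bullet> coord \<nu> (comb \<nu> (unit_vec ?n i)) = 0" by (rule fx[OF comb_in])
      then show "f $ i = 0\<^sub>v ?n $ i" using i f by (simp add: coord_comb)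
    qed (use f in simp)
  qed
next
  let ?n = "specht_dim \<nu>" and ?c = "young_symmetrizer \<nu>"
  have m: "sum_list \<nu> = m" using \<nu> by (simp add: partition_of_def)
  assume fs: "fixed_spanned m ?n (specht \<nu>) k"
  show "k \<le> first_row \<nu>"
  proof (rule ccontr)
    assume k: "\<not> k \<le> first_row \<nu>"
    have "coord \<nu> ?c = 0\<^sub>v ?n"
    proof (rule fixed_spannedD[OF fs coord_carrier])
      fix K v assume K: "K \<subseteq> {1..m}" "k \<le> card K" and v: "fixed_vec ?n (specht \<nu>) K v"
      have vc: "v \<in> carrier_vec ?n" using v by (simp add: fixed_vec_def)
      have "comb \<nu> v = 0"
      proof (rule specht_fixed_zero[OF \<nu> comb_in K(1)])
        show "first_row \<nu> < card K" using k K(2) by simp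
        fix h assume h: "h permutes K"
        have hp: "h \<in> perms m" by (rule permutes_perms[OF h K(1)])
        have "coord \<nu> (translate h (comb \<nu> v)) = coord \<nu> (comb \<nu> v)"
          using specht_coord[of h \<nu> "comb \<nu> v"] comb_in hp m coord_comb[OF vc] v h by (simp add: fixed_vec_def)
        then show "translate h (comb \<nu> v) = comb \<nu> v"
          using comb_coord[OF translate_in_specht[OF _ comb_in]] comb_coord[OF comb_in] hp m by metis
      qed
      then have "v = 0\<^sub>v ?n" using coord_comb[OF vc] coord_zero by simp
      then show "coord \<nu> ?c \<bullet> v = 0" by simp
    qed
    then have "?c = comb \<nu> (0\<^sub>v ?n)" using comb_coord[OF young_in_specht] by metis
    also have "\<dots> = comb \<nu> (coord \<nu> 0)" by (simp only: coord_zero)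
    also have "\<dots> = 0" by (rule comb_coord) (rule specht_module_subspace(3))
    finally show False using young_nonzero by blast
  qed
qed

lemma fixed_spanned_block:
  assumes \<rho>: "\<And>g. \<rho> g \<in> carrier_mat d d" and \<sigma>: "\<And>g. \<sigma> g \<in> carrier_mat e e"
    and \<tau>: "\<And>g. \<tau> g = four_block_mat (\<rho> g) (0\<^sub>m d e) (0\<^sub>m e d) (\<sigma> g)"
  shows "fixed_spanned m (d + e) \<tau> k \<longleftrightarrow> fixed_spanned m d \<rho> k \<and> fixed_spanned m e \<sigma> k"
proof -
  have fixed: "fixed_vec (d + e) \<tau> K (a @\<^sub>v b) \<longleftrightarrow> fixed_vec d \<rho> K a \<and> fixed_vec e \<sigma> K b"
    if a: "a \<in> carrier_vec d" and b: "b \<in> carrier_vec e" for K a b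
  proof -
    have "\<tau> g *\<^sub>v (a @\<^sub>v b) = a @\<^sub>v b \<longleftrightarrow> \<rho> g *\<^sub>v a = a \<and> \<sigma> g *\<^sub>v b = b" for g
      unfolding \<tau> mult_mat_vec_split[OF \<rho> \<sigma> a b]
      by (rule append_vec_eq[OF mult_mat_vec_carrier[OF \<rho> a] a])
    then show ?thesis using a b unfolding fixed_vec_def by auto
  qed
  have zero_fixed: "fixed_vec d \<rho> K (0\<^sub>v d)" "fixed_vec e \<sigma> K (0\<^sub>v e)" for K
    by (simp_all add: fixed_vec_def mult_zero_vec[OF \<rho>] mult_zero_vec[OF \<sigma>])
  show ?thesis
  proof (intro iffI conjI)
    assume fs: "fixed_spanned m (d + e) \<tau> k"
    show "fixed_spanned m d \<rho> k"
    proof (rule fixed_spannedI)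
      fix f :: "rat vec" assume f: "f \<in> carrier_vec d"
        and van: "\<And>K v. K \<subseteq> {1..m} \<Longrightarrow> k \<le> card K \<Longrightarrow> fixed_vec d \<rho> K v \<Longrightarrow> f \<bullet> v = 0"
      have "f @\<^sub>v 0\<^sub>v e = 0\<^sub>v (d + e)"
      proof (rule fixed_spannedD[OF fs])
        fix K v assume K: "K \<subseteq> {1..m}" "k \<le> card K" and v: "fixed_vec (d + e) \<tau> K v"
        have "v \<in> carrier_vec (d + e)" using v by (simp add: fixed_vec_def)
        then obtain a b where ab: "a \<in> carrier_vec d" "b \<in> carrier_vec e" "v = a @\<^sub>v b" by (rule vec_split)
        then have "f \<bullet> a = 0" using van[OF K] fixed[OF ab(1,2)] v by simp
        then show "(f @\<^sub>v 0\<^sub>v e) \<bullet> v = 0"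
          unfolding ab(3) by (simp add: scalar_prod_append[OF f zero_carrier_vec ab(1,2)] ab(2))
      qed (use f in simp)
      then show "f = 0\<^sub>v d" using append_vec_eq[OF f zero_carrier_vec] append_zero_vec[of d e] by metis
    qed
    show "fixed_spanned m e \<sigma> k"
    proof (rule fixed_spannedI)
      fix f :: "rat vec" assume f: "f \<in> carrier_vec e"
        and van: "\<And>K v. K \<subseteq> {1..m} \<Longrightarrow> k \<le> card K \<Longrightarrow> fixed_vec e \<sigma> K v \<Longrightarrow> f \<bullet> v = 0"
      have "0\<^sub>v d @\<^sub>v f = 0\<^sub>v (d + e)"
      proof (rule fixed_spannedD[OF fs])
        fix K v assume K: "K \<subseteq> {1..m}" "k \<le> card K" and v: "fixed_vec (d + e) \<tau> K v"
        have "v \<in> carrier_vec (d + e)" using v by (simp add: fixed_vec_def)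
        then obtain a b where ab: "a \<in> carrier_vec d" "b \<in> carrier_vec e" "v = a @\<^sub>v b" by (rule vec_split)
        then have "f \<bullet> b = 0" using van[OF K] fixed[OF ab(1,2)] v by simp
        then show "(0\<^sub>v d @\<^sub>v f) \<bullet> v = 0"
          unfolding ab(3) by (simp add: scalar_prod_append[OF zero_carrier_vec f ab(1,2)] ab(1))
      qed (use f in simp)
      then show "f = 0\<^sub>v e" using append_vec_eq[OF zero_carrier_vec zero_carrier_vec] append_zero_vec[of d e] by metis
    qed
  next
    assume "fixed_spanned m d \<rho> k \<and> fixed_spanned m e \<sigma> k"
    then have fs: "fixed_spanned m d \<rho> k" "fixed_spanned m e \<sigma> k" by auto
    show "fixed_spanned m (d + e) \<tau> k"
    proof (rule fixed_spannedI)
      fix f :: "rat vec" assume f: "f \<in> carrier_vec (d + e)"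
        and van: "\<And>K v. K \<subseteq> {1..m} \<Longrightarrow> k \<le> card K \<Longrightarrow> fixed_vec (d + e) \<tau> K v \<Longrightarrow> f \<bullet> v = 0"
      obtain f1 f2 where f12: "f1 \<in> carrier_vec d" "f2 \<in> carrier_vec e" "f = f1 @\<^sub>v f2" using vec_split[OF f] .
      have "f1 = 0\<^sub>v d"
      proof (rule fixed_spannedD[OF fs(1) f12(1)])
        fix K v assume K: "K \<subseteq> {1..m}" "k \<le> card K" and v: "fixed_vec d \<rho> K v"
        have vc: "v \<in> carrier_vec d" using v by (simp add: fixed_vec_def)
        have "f \<bullet> (v @\<^sub>v 0\<^sub>v e) = 0" by (rule van[OF K]) (simp add: fixed[OF vc] v zero_fixed)
        then show "f1 \<bullet> v = 0" unfolding f12(3) by (simp add: scalar_prod_append[OF f12(1,2) vc] f12(2))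
      qed
      moreover have "f2 = 0\<^sub>v e"
      proof (rule fixed_spannedD[OF fs(2) f12(2)])
        fix K v assume K: "K \<subseteq> {1..m}" "k \<le> card K" and v: "fixed_vec e \<sigma> K v"
        have vc: "v \<in> carrier_vec e" using v by (simp add: fixed_vec_def)
        have "f \<bullet> (0\<^sub>v d @\<^sub>v v) = 0" by (rule van[OF K]) (simp add: fixed[OF _ vc] v zero_fixed)
        then show "f2 \<bullet> v = 0" unfolding f12(3) by (simp add: scalar_prod_append[OF f12(1,2) _ vc] f12(1))
      qed
      ultimately show "f = 0\<^sub>v (d + e)" unfolding f12(3) by (simp add: append_zero_vec)
    qed
  qed
qed

lemma fixed_spanned_specht_sum:
  assumes "\<forall>\<mu>\<in>set \<mu>s. partition_of m \<mu>"
  shows "fixed_spanned m (specht_sum_dim \<mu>s) (specht_sum \<mu>s) k \<longleftrightarrow> (\<forall>\<mu>\<in>set \<mu>s. k \<le> first_row \<mu>)"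
  using assms
proof (induction \<mu>s)
  case Nil
  have "fixed_spanned m 0 \<tau> k" for \<tau> by (rule fixed_spannedI) auto
  then show ?case by (simp add: specht_sum_dim_def)
next
  case (Cons \<nu> \<mu>s)
  have "fixed_spanned m (specht_dim \<nu> + specht_sum_dim \<mu>s) (specht_sum (\<nu> # \<mu>s)) k \<longleftrightarrow>
      fixed_spanned m (specht_dim \<nu>) (specht \<nu>) k \<and> fixed_spanned m (specht_sum_dim \<mu>s) (specht_sum \<mu>s) k"
    by (rule fixed_spanned_block[OF specht_carrier specht_sum_carrier specht_sum_Cons])
  then show ?case using Cons fixed_spanned_specht[of m \<nu> k] by simp
qed

text \<open>A base change \<open>P\<close> carries fixed vectors to fixed vectors; linear forms are pulled back along \<open>P\<close>.\<close>

lemma fixed_spanned_similar: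
  assumes sim: "\<And>g. g \<in> perms m \<Longrightarrow> similar_mat_wit (\<rho> g) (\<sigma> g) P Q"
    and \<rho>: "\<And>g. g \<in> perms m \<Longrightarrow> \<rho> g \<in> carrier_mat d d"
    and fs: "fixed_spanned m d \<sigma> k"
  shows "fixed_spanned m d \<rho> k"
proof (rule fixed_spannedI)
  fix f :: "rat vec" assume f: "f \<in> carrier_vec d"
    and van: "\<And>K v. K \<subseteq> {1..m} \<Longrightarrow> k \<le> card K \<Longrightarrow> fixed_vec d \<rho> K v \<Longrightarrow> f \<bullet> v = 0"
  note W = similar_mat_witD2[OF \<rho> sim]
  have PQ: "P \<in> carrier_mat d d" "Q \<in> carrier_mat d d" "P * Q = 1\<^sub>m d" "Q * P = 1\<^sub>m d"
    using W[OF perms_id perms_id] by auto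
  have adj: "(transpose_mat P *\<^sub>v f) \<bullet> w = f \<bullet> (P *\<^sub>v w)" if w: "w \<in> carrier_vec d" for w
    by (rule transpose_vec_mult_scalar[OF PQ(1) w f])
  have "transpose_mat P *\<^sub>v f = 0\<^sub>v d"
  proof (rule fixed_spannedD[OF fs])
    fix K w assume K: "K \<subseteq> {1..m}" "k \<le> card K" and w: "fixed_vec d \<sigma> K w"
    have wc: "w \<in> carrier_vec d" using w by (simp add: fixed_vec_def)
    have "fixed_vec d \<rho> K (P *\<^sub>v w)"
      unfolding fixed_vec_def
    proof (intro conjI allI impI)
      fix g assume g: "g permutes K"
      have gp: "g \<in> perms m" by (rule permutes_perms[OF g K(1)])
      have S: "\<sigma> g \<in> carrier_mat d d" "\<rho> g = P * \<sigma> g * Q" using W[OF gp gp] by auto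
      have PS: "P * \<sigma> g \<in> carrier_mat d d" by (rule mult_carrier_mat[OF PQ(1) S(1)])
      have "\<rho> g *\<^sub>v (P *\<^sub>v w) = (P * \<sigma> g) *\<^sub>v (Q *\<^sub>v (P *\<^sub>v w))"
        unfolding S(2) by (rule assoc_mult_mat_vec[OF PS PQ(2) mult_mat_vec_carrier[OF PQ(1) wc]])
      also have "Q *\<^sub>v (P *\<^sub>v w) = w"
        using assoc_mult_mat_vec[OF PQ(2,1) wc] PQ(4) wc by simp
      also have "(P * \<sigma> g) *\<^sub>v w = P *\<^sub>v (\<sigma> g *\<^sub>v w)" by (rule assoc_mult_mat_vec[OF PQ(1) S(1) wc])
      also have "\<sigma> g *\<^sub>v w = w" using w g by (simp add: fixed_vec_def)
      finally show "\<rho> g *\<^sub>v (P *\<^sub>v w) = P *\<^sub>v w" .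
    qed (rule mult_mat_vec_carrier[OF PQ(1) wc])
    then show "(transpose_mat P *\<^sub>v f) \<bullet> w = 0" using van[OF K] adj[OF wc] by simp
  qed (rule mult_mat_vec_carrier[OF _ f], simp add: PQ)
  then have zero: "f \<bullet> (P *\<^sub>v w) = 0" if "w \<in> carrier_vec d" for w using adj[OF that] that by simp
  show "f = 0\<^sub>v d"
  proof (rule eq_vecI)
    fix i assume "i < dim_vec (0\<^sub>v d :: rat vec)"
    then have i: "i < d" by simp
    have "P *\<^sub>v (Q *\<^sub>v unit_vec d i) = unit_vec d i"
      using assoc_mult_mat_vec[OF PQ(1,2) unit_vec_carrier] PQ(3) by simp
    then have "f \<bullet> unit_vec d i = 0" using zero[OF mult_mat_vec_carrier[OF PQ(2) unit_vec_carrier]] by metis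
    then show "f $ i = 0\<^sub>v d $ i" using i f by simp
  qed (use f in simp)
qed

section \<open>The weight of a representation\<close>

lemma rep_iso_dim:
  assumes R: "rep_of_dim m d \<rho>" and iso: "rep_iso m \<rho> (specht_sum \<mu>s)"
  obtains P Q where "\<And>g. g \<in> perms m \<Longrightarrow> similar_mat_wit (\<rho> g) (specht_sum \<mu>s g) P Q"
    "specht_sum_dim \<mu>s = d"
proof -
  obtain P Q where PQ: "\<And>g. g \<in> perms m \<Longrightarrow> similar_mat_wit (\<rho> g) (specht_sum \<mu>s g) P Q"
    using iso by (auto simp: rep_iso_def perms_def)
  have "specht_sum \<mu>s id \<in> carrier_mat d d"
    using similar_mat_witD2[OF rep_of_dimD(1)[OF R perms_id] PQ[OF perms_id]] by auto
  then have "specht_sum_dim \<mu>s = d" using specht_sum_carrier[of \<mu>s id] by (metis carrier_matD(1))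
  with PQ show ?thesis by (rule that)
qed

lemma fixed_spanned_decomposition:
  assumes R: "rep_of_dim m d \<rho>" and iso: "rep_iso m \<rho> (specht_sum \<mu>s)" and \<mu>s: "\<forall>\<mu>\<in>set \<mu>s. partition_of m \<mu>"
  shows "fixed_spanned m d \<rho> k \<longleftrightarrow> (\<forall>\<mu>\<in>set \<mu>s. k \<le> first_row \<mu>)"
proof -
  obtain P Q where PQ: "\<And>g. g \<in> perms m \<Longrightarrow> similar_mat_wit (\<rho> g) (specht_sum \<mu>s g) P Q"
    and d: "specht_sum_dim \<mu>s = d"
    by (rule rep_iso_dim[OF R iso]) blast
  have "fixed_spanned m d \<rho> k \<longleftrightarrow> fixed_spanned m d (specht_sum \<mu>s) k"
  proof
    assume fs: "fixed_spanned m d (specht_sum \<mu>s) k"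
    show "fixed_spanned m d \<rho> k"
      by (rule fixed_spanned_similar[of m \<rho> "specht_sum \<mu>s" P Q, OF PQ rep_of_dimD(1)[OF R] fs])
  next
    assume fs: "fixed_spanned m d \<rho> k"
    show "fixed_spanned m d (specht_sum \<mu>s) k"
      by (rule fixed_spanned_similar[of m "specht_sum \<mu>s" \<rho> Q P, OF similar_mat_wit_sym[OF PQ]
        specht_sum_carrier[of \<mu>s, unfolded d] fs])
  qed
  then show ?thesis using fixed_spanned_specht_sum[OF \<mu>s, of k] d by simp
qed

definition decomposition :: "nat \<Rightarrow> rep \<Rightarrow> nat list list \<Rightarrow> bool" where
  "decomposition m \<rho> \<mu>s \<longleftrightarrow> (\<forall>\<mu>\<in>set \<mu>s. partition_of m \<mu>) \<and> rep_iso m \<rho> (specht_sum \<mu>s)"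

lemma rep_weight_decompositions:
  "rep_weight m \<rho> = Sup {ereal (real (partition_weight \<mu>)) | \<mu> \<mu>s. decomposition m \<rho> \<mu>s \<and> \<mu> \<in> set \<mu>s}"
proof -
  have "(\<exists>n. multiplicities m \<rho> n \<and> n \<mu> \<noteq> 0) \<longleftrightarrow> (\<exists>\<mu>s. decomposition m \<rho> \<mu>s \<and> \<mu> \<in> set \<mu>s)" for \<mu>
    unfolding multiplicities_def decomposition_def using count_list_0_iff by metis
  then have sets: "{\<mu>. \<exists>n. multiplicities m \<rho> n \<and> n \<mu> \<noteq> 0} = {\<mu>. \<exists>\<mu>s. decomposition m \<rho> \<mu>s \<and> \<mu> \<in> set \<mu>s}"
    by simp
  have img: "{ereal (real (partition_weight \<mu>)) | \<mu> a. A \<mu> a} =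
      (\<lambda>\<mu>. ereal (real (partition_weight \<mu>))) ` {\<mu>. \<exists>a. A \<mu> a}" for A :: "nat list \<Rightarrow> 'b \<Rightarrow> bool"
    by auto
  show ?thesis unfolding rep_weight_def img sets ..
qed

text \<open>The weight of \<open>V\<^sub>\<mu>\<close> is at most \<open>w\<close> iff \<open>\<mu>\<^sub>1 \<ge> m - w\<close>. As the right-hand side does not mention a
  decomposition, all decompositions yield the same weight.\<close>

lemma rep_weight_le_iff:
  assumes R: "rep_of_dim m d \<rho>"
  shows "rep_weight m \<rho> \<le> ereal (real w) \<longleftrightarrow> fixed_spanned m d \<rho> (m - w)"
proof -
  obtain \<mu>s where \<mu>s: "decomposition m \<rho> \<mu>s"
    using complete_reducibility[OF R] by (auto simp: decomposition_def)
  have eq: "fixed_spanned m d \<rho> (m - w) \<longleftrightarrow> (\<forall>\<mu>\<in>set \<kappa>s. partition_weight \<mu> \<le> w)"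
    if "decomposition m \<rho> \<kappa>s" for \<kappa>s
  proof -
    have "m - w \<le> first_row \<mu> \<longleftrightarrow> partition_weight \<mu> \<le> w" if "partition_of m \<mu>" for \<mu>
      using partition_weight_eq[OF that] by auto
    then show ?thesis
      using fixed_spanned_decomposition[OF R, of \<kappa>s "m - w"] that by (auto simp: decomposition_def)
  qed
  show ?thesis
    unfolding rep_weight_decompositions Sup_le_iff using eq eq[OF \<mu>s] \<mu>s by fastforce
qed

lemma decomposition_dim:
  assumes R: "rep_of_dim m d \<rho>" and "decomposition m \<rho> \<mu>s"
  shows "d = 0 \<longleftrightarrow> \<mu>s = []"
proof -
  have "specht_sum_dim \<mu>s = d"
    using rep_iso_dim[OF R, of \<mu>s] assms(2) unfolding decomposition_def by metis
  then show ?thesis using specht_dim_pos by (cases \<mu>s) (auto simp: specht_sum_dim_def)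
qed

lemma rep_weight_minus_infinity_iff:
  assumes R: "rep_of_dim m d \<rho>"
  shows "rep_weight m \<rho> = - \<infinity> \<longleftrightarrow> d = 0"
proof
  assume "d = 0"
  then have "{ereal (real (partition_weight \<mu>)) | \<mu> \<mu>s. decomposition m \<rho> \<mu>s \<and> \<mu> \<in> set \<mu>s} = {}"
    using decomposition_dim[OF R] by fastforce
  then show "rep_weight m \<rho> = - \<infinity>"
    unfolding rep_weight_decompositions by (simp only: Sup_empty bot_ereal_def)
next
  assume inf: "rep_weight m \<rho> = - \<infinity>"
  obtain \<mu>s where \<mu>s: "decomposition m \<rho> \<mu>s"
    using complete_reducibility[OF R] by (auto simp: decomposition_def)
  have "\<mu>s = []"
  proof (rule ccontr)
    assume "\<mu>s \<noteq> []"
    then have "ereal (real (partition_weight (hd \<mu>s))) \<le> rep_weight m \<rho>"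
      unfolding rep_weight_decompositions using \<mu>s
      by (intro Sup_upper CollectI exI[of _ "hd \<mu>s"] exI[of _ \<mu>s] conjI refl) auto
    with inf show False by simp
  qed
  then show "d = 0" using decomposition_dim[OF R \<mu>s] by simp
qed

lemma rep_weight_attained:
  assumes R: "rep_of_dim m d \<rho>" and "d \<noteq> 0"
  shows "\<exists>\<mu>s \<mu>. decomposition m \<rho> \<mu>s \<and> \<mu> \<in> set \<mu>s \<and> rep_weight m \<rho> = ereal (real (partition_weight \<mu>))"
proof -
  obtain \<mu>s where \<mu>s: "decomposition m \<rho> \<mu>s"
    using complete_reducibility[OF R] by (auto simp: decomposition_def)
  have ne: "\<mu>s \<noteq> []" using decomposition_dim[OF R \<mu>s] assms(2) by simp
  let ?w = "Max (partition_weight ` set \<mu>s)"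
  have "?w \<in> partition_weight ` set \<mu>s" using ne by (intro Max_in) auto
  then obtain \<mu> where \<mu>: "\<mu> \<in> set \<mu>s" "partition_weight \<mu> = ?w" by auto
  have "rep_weight m \<rho> = ereal (real (partition_weight \<mu>))"
  proof (rule antisym)
    have "m - partition_weight \<mu> \<le> first_row \<kappa>" if \<kappa>: "\<kappa> \<in> set \<mu>s" for \<kappa>
    proof -
      have "partition_weight \<kappa> \<le> partition_weight \<mu>" unfolding \<mu>(2) using \<kappa> by (intro Max_ge) auto
      moreover have "partition_of m \<kappa>" using \<mu>s \<kappa> by (simp add: decomposition_def)
      ultimately show ?thesis using partition_weight_eq[of m \<kappa>] by simp
    qed
    then show "rep_weight m \<rho> \<le> ereal (real (partition_weight \<mu>))"
      unfolding rep_weight_le_iff[OF R]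
      using fixed_spanned_decomposition[OF R, of \<mu>s] \<mu>s by (simp add: decomposition_def)
    show "ereal (real (partition_weight \<mu>)) \<le> rep_weight m \<rho>"
      unfolding rep_weight_decompositions using \<mu>s \<mu>(1) by (intro Sup_upper) auto
  qed
  with \<mu>s \<mu> show ?thesis by blast
qed

section \<open>Tensor products\<close>

lemma rep_of_dim_tensor:
  assumes "rep_of_dim m d \<rho>" "rep_of_dim m e \<sigma>"
  shows "rep_of_dim m (d * e) (tensor \<rho> \<sigma>)"
proof -
  obtain n where n: "rep_of_dim m n (tensor \<rho> \<sigma>)"
    using is_rep_tensor[of m \<rho> \<sigma>] assms is_rep_iff by blast
  have "dim_row (tensor \<rho> \<sigma> id) = d * e"
    using rep_of_dimD(2)[OF assms(1)] rep_of_dimD(2)[OF assms(2)] by (simp add: tensor_def kronecker_def)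
  then have "n = d * e" using rep_of_dimD(2)[OF n] by simp
  with n show ?thesis by simp
qed

text \<open>The coordinates of \<open>v \<otimes> w\<close> in the basis for which \<open>kronecker\<close> describes the tensor product of maps.\<close>

definition kron_vec :: "rat vec \<Rightarrow> rat vec \<Rightarrow> rat vec" where
  "kron_vec v w = vec (dim_vec v * dim_vec w) (\<lambda>i. v $ (i div dim_vec w) * w $ (i mod dim_vec w))"

lemma kron_vec_carrier: "v \<in> carrier_vec d \<Longrightarrow> w \<in> carrier_vec e \<Longrightarrow> kron_vec v w \<in> carrier_vec (d * e)"
  by (rule carrier_vecI) (simp add: kron_vec_def carrier_vecD)

lemma sum_div_mod:
  fixes b q :: nat and F :: "nat \<Rightarrow> nat \<Rightarrow> rat"
  shows "(\<Sum>n<b * q. F (n div q) (n mod q)) = (\<Sum>k<b. \<Sum>l<q. F k l)"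
proof -
  have "(\<Sum>k<b. \<Sum>l<q. F k l) = (\<Sum>(k, l) \<in> {..<b} \<times> {..<q}. F k l)"
    by (rule sum.cartesian_product)
  also have "\<dots> = (\<Sum>n < b * q. F (n div q) (n mod q))"
  proof (rule sum.reindex_bij_witness[of _ "\<lambda>n. (n div q, n mod q)" "\<lambda>(k, l). k * q + l"])
    fix n assume n: "n \<in> {..<b * q}"
    then have "q > 0" by (cases q) auto
    with n show "(n div q, n mod q) \<in> {..<b} \<times> {..<q}"
      by (auto simp: less_mult_imp_div_less)
  next
    fix x assume x: "x \<in> {..<b} \<times> {..<q}"
    then obtain k l where kl: "x = (k, l)" "k < b" "l < q" by auto
    then have "k * q + l < Suc k * q" by simp
    also have "\<dots> \<le> b * q" using kl by (intro mult_right_mono) auto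
    finally show "(case x of (k, l) \<Rightarrow> k * q + l) \<in> {..<b * q}" using kl by simp
  qed auto
  finally show ?thesis by simp
qed

lemma kronecker_mult_vec:
  assumes A: "A \<in> carrier_mat d d" and B: "B \<in> carrier_mat e e"
    and v: "v \<in> carrier_vec d" and w: "w \<in> carrier_vec e"
  shows "kronecker A B *\<^sub>v kron_vec v w = kron_vec (A *\<^sub>v v) (B *\<^sub>v w)"
proof (rule eq_vecI)
  fix i assume "i < dim_vec (kron_vec (A *\<^sub>v v) (B *\<^sub>v w))"
  then have i: "i < d * e" using A B by (simp add: kron_vec_def)
  then have e: "e > 0" by (cases e) auto
  have lt: "i div e < d" "i mod e < e" using i e by (auto simp: less_mult_imp_div_less)
  let ?F = "\<lambda>k l. (A $$ (i div e, k) * v $ k) * (B $$ (i mod e, l) * w $ l)"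
  have "(kronecker A B *\<^sub>v kron_vec v w) $ i = (\<Sum>n<d * e. ?F (n div e) (n mod e))"
    using i A B v w by (simp add: kronecker_def kron_vec_def scalar_prod_def atLeast0LessThan mult_ac)
  also have "\<dots> = (\<Sum>k<d. \<Sum>l<e. ?F k l)" by (rule sum_div_mod)
  also have "\<dots> = (A *\<^sub>v v) $ (i div e) * (B *\<^sub>v w) $ (i mod e)"
    using A B v w lt by (simp add: scalar_prod_def sum_product atLeast0LessThan)
  finally show "(kronecker A B *\<^sub>v kron_vec v w) $ i = kron_vec (A *\<^sub>v v) (B *\<^sub>v w) $ i"
    using i A B by (simp add: kron_vec_def)
qed (use A B in \<open>simp add: kronecker_def kron_vec_def\<close>)

lemma tensor_mult_vec:
  assumes "rep_of_dim m d \<rho>" "rep_of_dim m e \<sigma>" "g \<in> perms m" "v \<in> carrier_vec d" "w \<in> carrier_vec e"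
  shows "tensor \<rho> \<sigma> g *\<^sub>v kron_vec v w = kron_vec (\<rho> g *\<^sub>v v) (\<sigma> g *\<^sub>v w)"
  unfolding tensor_def
  by (rule kronecker_mult_vec[OF rep_of_dimD(1)[OF assms(1,3)] rep_of_dimD(1)[OF assms(2,3)] assms(4,5)])

lemma scalar_kron_vec:
  assumes f: "f \<in> carrier_vec (d * e)" and v: "v \<in> carrier_vec d" and w: "w \<in> carrier_vec e"
  shows "f \<bullet> kron_vec v w = (\<Sum>k<d. \<Sum>l<e. f $ (k * e + l) * v $ k * w $ l)"
proof -
  have "f \<bullet> kron_vec v w = (\<Sum>n<d * e. f $ ((n div e) * e + n mod e) * v $ (n div e) * w $ (n mod e))"
    using f v w by (simp add: scalar_prod_def kron_vec_def atLeast0LessThan mult_ac)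
  also have "\<dots> = (\<Sum>k<d. \<Sum>l<e. f $ (k * e + l) * v $ k * w $ l)"
    by (rule sum_div_mod[of "\<lambda>k l. f $ (k * e + l) * v $ k * w $ l"])
  finally show ?thesis .
qed

text \<open>The key to subadditivity: \<open>v \<otimes> w\<close> is fixed by \<open>S\<^sub>K \<inter> S\<^sub>L\<close>, which consists of the permutations of \<open>K \<inter> L\<close>,
  and \<open>|K \<inter> L| \<ge> |K| + |L| - m\<close>. The alternative \<open>k = 0\<close> takes care of truncated subtraction in
  applications.\<close>

lemma fixed_spanned_tensor:
  assumes R: "rep_of_dim m d \<rho>" "rep_of_dim m e \<sigma>"
    and fs: "fixed_spanned m d \<rho> k1" "fixed_spanned m e \<sigma> k2"
    and k: "k = 0 \<or> k + m \<le> k1 + k2"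
  shows "fixed_spanned m (d * e) (tensor \<rho> \<sigma>) k"
proof (rule fixed_spannedI)
  fix f :: "rat vec" assume f: "f \<in> carrier_vec (d * e)"
    and van: "\<And>K v. K \<subseteq> {1..m} \<Longrightarrow> k \<le> card K \<Longrightarrow> fixed_vec (d * e) (tensor \<rho> \<sigma>) K v \<Longrightarrow> f \<bullet> v = 0"
  have van2: "f \<bullet> kron_vec v w = 0"
    if K: "K \<subseteq> {1..m}" "k1 \<le> card K" "fixed_vec d \<rho> K v" and L: "L \<subseteq> {1..m}" "k2 \<le> card L" "fixed_vec e \<sigma> L w" for K L v w
  proof (rule van[of "K \<inter> L"])
    have fin: "finite K" "finite L" using K(1) L(1) finite_subset by blast+
    have "card (K \<union> L) \<le> m" using card_mono[of "{1..m}" "K \<union> L"] K(1) L(1) by simp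
    then show "k \<le> card (K \<inter> L)" using card_Un_Int[OF fin] K(2) L(2) k by linarith
    have vw: "v \<in> carrier_vec d" "w \<in> carrier_vec e" using K L by (simp_all add: fixed_vec_def)
    show "fixed_vec (d * e) (tensor \<rho> \<sigma>) (K \<inter> L) (kron_vec v w)"
      unfolding fixed_vec_def
    proof (intro conjI allI impI)
      fix g assume g: "g permutes K \<inter> L"
      have "g permutes K" "g permutes L" using g by (auto intro: permutes_subset)
      then have "\<rho> g *\<^sub>v v = v" "\<sigma> g *\<^sub>v w = w" using K L by (auto simp: fixed_vec_def)
      moreover have "g \<in> perms m" by (rule permutes_perms[OF g]) (use K in auto)
      ultimately show "tensor \<rho> \<sigma> g *\<^sub>v kron_vec v w = kron_vec v w"
        using tensor_mult_vec[OF R _ vw] by simp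
    qed (rule kron_vec_carrier[OF vw])
  qed (use K in auto)
  have all_v: "f \<bullet> kron_vec v w = 0"
    if v: "v \<in> carrier_vec d" and L: "L \<subseteq> {1..m}" "k2 \<le> card L" "fixed_vec e \<sigma> L w" for v w L
  proof -
    have w: "w \<in> carrier_vec e" using L by (simp add: fixed_vec_def)
    \<comment> \<open>The linear form \<open>u \<mapsto> f (u \<otimes> w)\<close>.\<close>
    let ?f = "vec d (\<lambda>k. \<Sum>l<e. f $ (k * e + l) * w $ l)"
    have eq: "?f \<bullet> u = f \<bullet> kron_vec u w" if u: "u \<in> carrier_vec d" for u
      unfolding scalar_kron_vec[OF f u w] using u
      by (simp add: scalar_prod_def atLeast0LessThan sum_distrib_left sum_distrib_right mult_ac)
    have "?f = 0\<^sub>v d"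
    proof (rule fixed_spannedD[OF fs(1)])
      fix K u assume K: "K \<subseteq> {1..m}" "k1 \<le> card K" "fixed_vec d \<rho> K u"
      then show "?f \<bullet> u = 0" using van2[OF K L] eq[of u] by (simp add: fixed_vec_def)
    qed simp
    then show ?thesis using eq[OF v] v by simp
  qed
  have all_vw: "f \<bullet> kron_vec v w = 0" if v: "v \<in> carrier_vec d" and w: "w \<in> carrier_vec e" for v w
  proof -
    \<comment> \<open>The linear form \<open>u \<mapsto> f (v \<otimes> u)\<close>.\<close>
    let ?f = "vec e (\<lambda>l. \<Sum>k<d. f $ (k * e + l) * v $ k)"
    have eq: "?f \<bullet> u = f \<bullet> kron_vec v u" if u: "u \<in> carrier_vec e" for u
      unfolding scalar_kron_vec[OF f v u] using u
      by (subst sum.swap) (simp add: scalar_prod_def atLeast0LessThan sum_distrib_left sum_distrib_right mult_ac)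
    have "?f = 0\<^sub>v e"
    proof (rule fixed_spannedD[OF fs(2)])
      fix K u assume K: "K \<subseteq> {1..m}" "k2 \<le> card K" "fixed_vec e \<sigma> K u"
      then show "?f \<bullet> u = 0" using all_v[OF v K] eq[of u] by (simp add: fixed_vec_def)
    qed simp
    then show ?thesis using eq[OF w] w by simp
  qed
  show "f = 0\<^sub>v (d * e)"
  proof (rule eq_vecI)
    fix i assume "i < dim_vec (0\<^sub>v (d * e) :: rat vec)"
    then have i: "i < d * e" by simp
    then have "e > 0" by (cases e) auto
    then have lt: "i div e < d" "i mod e < e" using i by (auto simp: less_mult_imp_div_less)
    have "kron_vec (unit_vec d (i div e)) (unit_vec e (i mod e)) = unit_vec (d * e) i"
    proof (rule eq_vecI)
      fix j assume "j < dim_vec (unit_vec (d * e) i :: rat vec)"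
      then have j: "j < d * e" by simp
      then have ltj: "j div e < d" "j mod e < e" using \<open>e > 0\<close> by (auto simp: less_mult_imp_div_less)
      have "j = i \<longleftrightarrow> j div e = i div e \<and> j mod e = i mod e" by (metis div_mult_mod_eq)
      then show "kron_vec (unit_vec d (i div e)) (unit_vec e (i mod e)) $ j = unit_vec (d * e) i $ j"
        using i j lt ltj by (auto simp: kron_vec_def)
    qed (simp add: kron_vec_def)
    then show "f $ i = 0\<^sub>v (d * e) $ i"
      using all_vw[of "unit_vec d (i div e)" "unit_vec e (i mod e)"] f i by simp
  qed (use f in simp)
qed

theorem rep_weight_tensor_le:
  assumes R: "rep_of_dim m d \<rho>" "rep_of_dim m e \<sigma>"
  shows "rep_weight m (tensor \<rho> \<sigma>) \<le> rep_weight m \<rho> + rep_weight m \<sigma>"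
proof (cases "d = 0 \<or> e = 0")
  case True
  then have "rep_weight m (tensor \<rho> \<sigma>) = - \<infinity>"
    using rep_weight_minus_infinity_iff[OF rep_of_dim_tensor[OF R]] by simp
  then show ?thesis by simp
next
  case False
  then have "\<exists>w. rep_weight m \<rho> = ereal (real w)" "\<exists>w. rep_weight m \<sigma> = ereal (real w)"
    using rep_weight_attained[OF R(1)] rep_weight_attained[OF R(2)] by fast+
  then obtain w1 w2 where w: "rep_weight m \<rho> = ereal (real w1)" "rep_weight m \<sigma> = ereal (real w2)"
    by blast
  then have "fixed_spanned m d \<rho> (m - w1)" "fixed_spanned m e \<sigma> (m - w2)"
    using rep_weight_le_iff[OF R(1), of w1] rep_weight_le_iff[OF R(2), of w2] by auto
  then have "fixed_spanned m (d * e) (tensor \<rho> \<sigma>) (m - (w1 + w2))"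
    by (rule fixed_spanned_tensor[OF R]) auto
  then have "rep_weight m (tensor \<rho> \<sigma>) \<le> ereal (real (w1 + w2))"
    using rep_weight_le_iff[OF rep_of_dim_tensor[OF R]] by blast
  then show ?thesis using w by simp
qed

section \<open>Column antisymmetrizers\<close>

text \<open>If \<open>t\<close> fixes \<open>v\<close> and \<open>y t = - y\<close>, then \<open>y v = y t v = - y v\<close>. The rows of the matrix of \<open>y\<close> are linear forms
  that vanish on all the fixed vectors that span the space.\<close>

lemma act_zero_if_alternating:
  assumes R: "rep_of_dim m d \<rho>" and fs: "fixed_spanned m d \<rho> k"
    and alt: "\<And>K. K \<subseteq> {1..m} \<Longrightarrow> k \<le> card K \<Longrightarrow> \<exists>t. t permutes K \<and> conv m y (delta t) = gscale (-1) y"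
  shows "act m d \<rho> y = 0\<^sub>m d d"
proof (rule eq_matI)
  fix i j assume "i < dim_row (0\<^sub>m d d :: rat mat)" "j < dim_col (0\<^sub>m d d :: rat mat)"
  then have ij: "i < d" "j < d" by simp_all
  let ?A = "act m d \<rho> y"
  have "row ?A i = 0\<^sub>v d"
  proof (rule fixed_spannedD[OF fs])
    fix K v assume K: "K \<subseteq> {1..m}" "k \<le> card K" and v: "fixed_vec d \<rho> K v"
    have vc: "v \<in> carrier_vec d" using v by (simp add: fixed_vec_def)
    obtain t where t: "t permutes K" "conv m y (delta t) = gscale (-1) y" using alt[OF K] by blast
    have tp: "t \<in> perms m" by (rule permutes_perms[OF t(1) K(1)])
    have "?A *\<^sub>v v = act m d \<rho> (conv m y (delta t)) *\<^sub>v v"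
      using act_conv_vec[OF R vc] act_delta[OF R tp] v t(1) by (simp add: fixed_vec_def)
    also have "\<dots> = (-1) \<cdot>\<^sub>v (?A *\<^sub>v v)"
      unfolding t(2) act_linear(2) by (rule smult_mat_vec[OF vc act_carrier])
    finally have "(?A *\<^sub>v v) $ i = ((-1) \<cdot>\<^sub>v (?A *\<^sub>v v)) $ i" by (rule arg_cong)
    also have "\<dots> = - (?A *\<^sub>v v) $ i" using ij by (subst index_smult_vec(1)) auto
    finally have "(?A *\<^sub>v v) $ i = 0" by simp
    then show "row ?A i \<bullet> v = 0" using ij by simp
  qed (use ij in simp)
  then have "row ?A i $ j = 0" using ij by simp
  then show "?A $$ (i, j) = 0\<^sub>m d d $$ (i, j)" using ij by simp
qed simp_all

text \<open>The points that are not alone with their label. For column labels these are the points in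
  columns of length at least 2; label-preserving permutations move no other points.\<close>

definition shared :: "nat \<Rightarrow> (nat \<Rightarrow> 'a) \<Rightarrow> nat set" where
  "shared m \<kappa> = {x\<in>{1..m}. \<exists>y\<in>{1..m}. y \<noteq> x \<and> \<kappa> y = \<kappa> x}"

lemma sharedI: "x \<in> {1..m} \<Longrightarrow> y \<in> {1..m} \<Longrightarrow> y \<noteq> x \<Longrightarrow> \<kappa> y = \<kappa> x \<Longrightarrow> x \<in> shared m \<kappa>"
  unfolding shared_def by blast

lemma finite_shared [simp]: "finite (shared m \<kappa>)"
  by (simp add: shared_def)

lemma label_stabilizer_moves:
  assumes "q \<in> label_stabilizer m \<kappa>" "q x \<noteq> x"
  shows "x \<in> shared m \<kappa>" "q x \<in> shared m \<kappa>"
proof -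
  have q: "q \<in> perms m" by (rule label_stabilizer_perms[OF assms(1)])
  have x: "x \<in> {1..m}" using assms(2) permutes_not_in[OF perms_permutes[OF q]] by blast
  then have "q x \<in> {1..m}" "\<kappa> (q x) = \<kappa> x"
    using perms_image[OF q x] assms(1) by (auto simp: label_stabilizer_def)
  with x assms(2) show "x \<in> shared m \<kappa>" "q x \<in> shared m \<kappa>"
    using sharedI[of x m "q x" \<kappa>] sharedI[of "q x" m x \<kappa>] by simp_all
qed

lemma disjoint_stabilizers_commute:
  assumes p: "p \<in> label_stabilizer m \<kappa>" and q: "q \<in> label_stabilizer m \<kappa>'"
    and disj: "shared m \<kappa> \<inter> shared m \<kappa>' = {}"
  shows "p \<circ> q = q \<circ> p"
proof
  fix x
  show "(p \<circ> q) x = (q \<circ> p) x"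
  proof (cases "p x = x")
    case True
    show ?thesis
    proof (cases "q x = x")
      case False
      then have "q x \<in> shared m \<kappa>'" using label_stabilizer_moves[OF q] by blast
      then have "p (q x) = q x" using label_stabilizer_moves(1)[OF p] disj by blast
      with True show ?thesis by simp
    qed (use True in simp)
  next
    case False
    then have "x \<in> shared m \<kappa>" "p x \<in> shared m \<kappa>" using label_stabilizer_moves[OF p] by blast+
    then have "q x = x" "q (p x) = p x" using label_stabilizer_moves(1)[OF q] disj by blast+
    then show ?thesis by simp
  qed
qed

lemma antisymz_commute:
  assumes p: "p \<in> label_stabilizer m \<kappa>" and disj: "shared m \<kappa> \<inter> shared m \<kappa>' = {}"
  shows "conv m (antisymz m \<kappa>') (delta p) = conv m (delta p) (antisymz m \<kappa>')"
proof
  fix h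
  have pp: "p \<in> perms m" by (rule label_stabilizer_perms[OF p])
  have 1: "pinv p \<circ> h = h \<circ> pinv p" if "h \<circ> pinv p \<in> label_stabilizer m \<kappa>'"
  proof -
    have "p \<circ> (h \<circ> pinv p) = (h \<circ> pinv p) \<circ> p" by (rule disjoint_stabilizers_commute[OF p that disj])
    then have "p \<circ> (h \<circ> pinv p) = h" using perms_cancel(6)[OF pp] by simp
    then show ?thesis using perms_cancel(3)[OF pp, of "h \<circ> pinv p"] by simp
  qed
  have 2: "pinv p \<circ> h = h \<circ> pinv p" if "pinv p \<circ> h \<in> label_stabilizer m \<kappa>'"
  proof -
    have "p \<circ> (pinv p \<circ> h) = (pinv p \<circ> h) \<circ> p" by (rule disjoint_stabilizers_commute[OF p that disj])
    then have "h = (pinv p \<circ> h) \<circ> p" using perms_cancel(4)[OF pp] by simp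
    then show ?thesis using perms_cancel(5)[OF pp, of "pinv p \<circ> h"] by simp
  qed
  have "antisymz m \<kappa>' (h \<circ> pinv p) = antisymz m \<kappa>' (pinv p \<circ> h)"
    using 1 2 unfolding antisymz_def by metis
  then show "conv m (antisymz m \<kappa>') (delta p) h = conv m (delta p) (antisymz m \<kappa>') h"
    by (simp add: conv_delta_right[OF pp antisymz_in] conv_delta_left[OF pp] translate_def)
qed

lemma antisymz_conj:
  assumes g: "g \<in> perms m"
  shows "conv m (antisymz m (\<kappa> \<circ> pinv g)) (delta g) = conv m (delta g) (antisymz m \<kappa>)"
proof
  fix h
  have iff: "h \<circ> pinv g \<in> label_stabilizer m (\<kappa> \<circ> pinv g) \<longleftrightarrow> pinv g \<circ> h \<in> label_stabilizer m \<kappa>"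
  proof -
    have "(\<forall>i\<in>{1..m}. \<kappa> (pinv g (h (pinv g i))) = \<kappa> (pinv g i)) \<longleftrightarrow> (\<forall>j\<in>{1..m}. \<kappa> (pinv g (h j)) = \<kappa> j)"
      using perms_image[OF g] perms_image[OF perms_inv[OF g]] perms_inverses[OF g] by metis
    then show ?thesis
      using perms_comp_iff(2)[OF perms_inv[OF g], of h] perms_comp_iff(1)[OF perms_inv[OF g], of h]
      by (simp add: label_stabilizer_def)
  qed
  have sgn: "sign (h \<circ> pinv g) = sign (pinv g \<circ> h)" if "pinv g \<circ> h \<in> perms m"
  proof -
    have h: "h \<in> perms m" using that perms_comp_iff(1)[OF perms_inv[OF g]] by blast
    show ?thesis
      using sign_perms_comp[OF h perms_inv[OF g]] sign_perms_comp[OF perms_inv[OF g] h] by simp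
  qed
  have "antisymz m (\<kappa> \<circ> pinv g) (h \<circ> pinv g) = antisymz m \<kappa> (pinv g \<circ> h)"
    using iff sgn label_stabilizer_perms unfolding antisymz_def by metis
  then show "conv m (antisymz m (\<kappa> \<circ> pinv g)) (delta g) h = conv m (delta g) (antisymz m \<kappa>) h"
    by (simp add: conv_delta_right[OF g antisymz_in] conv_delta_left[OF g] translate_def)
qed

text \<open>Each column has its top in the first row, so the points below the first row lie in columns of
  length at least 2, and there are at most as many such columns as points below the first row.\<close>

lemma lower_rows:
  assumes \<nu>: "partition_of m \<nu>"
  defines "L \<equiv> {x\<in>{1..m}. tab_row \<nu> x \<noteq> 0}"
  shows "card L = partition_weight \<nu>" "L \<subseteq> shared m (tab_col \<nu>)"
    "tab_col \<nu> ` shared m (tab_col \<nu>) = tab_col \<nu> ` (shared m (tab_col \<nu>) - L)"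
    "card (shared m (tab_col \<nu>)) \<le> 2 * partition_weight \<nu>"
proof -
  have m: "sum_list \<nu> = m" using \<nu> by (simp add: partition_of_def)
  let ?S = "shared m (tab_col \<nu>)"
  have fr: "first_row \<nu> \<le> m" by (rule partition_weight_eq(2)[OF \<nu>])
  have "L = {x\<in>{1..m}. \<not> x \<le> first_row \<nu>}" 
    unfolding L_def by (intro Collect_cong conj_cong refl) (simp only: tab_first_row[OF \<nu>])
  also have "\<dots> = {first_row \<nu><..m}" by auto
  finally have L: "L = {first_row \<nu><..m}" .
  show cardL: "card L = partition_weight \<nu>" unfolding L using partition_weight_eq[OF \<nu>] by simp
  have top: "\<exists>y. y \<in> {1..m} - L \<and> tab_col \<nu> y = tab_col \<nu> x" if x: "x \<in> {1..m}" for x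
  proof -
    have j: "tab_col \<nu> x \<in> {1..first_row \<nu>}" by (rule tab_col_range[OF \<nu> x])
    then have ne: "\<nu> \<noteq> []" by (auto simp: first_row_def)
    then have "0 < length \<nu>" "tab_col \<nu> x \<in> {1..\<nu> ! 0}" using j by (auto simp: first_row_def hd_conv_nth)
    note e = tab_entry[OF this]
    then show ?thesis using m unfolding L_def by (intro exI[of _ "sum_list (take 0 \<nu>) + tab_col \<nu> x"]) simp
  qed
  show LS: "L \<subseteq> ?S"
  proof
    fix x assume x: "x \<in> L"
    then have x1: "x \<in> {1..m}" by (simp add: L_def)
    obtain y where y: "y \<in> {1..m} - L" "tab_col \<nu> y = tab_col \<nu> x" using top[OF x1] by blast
    then have "y \<in> {1..m}" "y \<noteq> x" using x by auto
    then show "x \<in> ?S" using y(2) by (rule sharedI[OF x1])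
  qed
  show img: "tab_col \<nu> ` ?S = tab_col \<nu> ` (?S - L)"
  proof
    show "tab_col \<nu> ` ?S \<subseteq> tab_col \<nu> ` (?S - L)"
    proof
      fix j assume "j \<in> tab_col \<nu> ` ?S"
      then obtain x where x: "x \<in> ?S" "j = tab_col \<nu> x" by blast
      show "j \<in> tab_col \<nu> ` (?S - L)"
      proof (cases "x \<in> L")
        case False
        with x show ?thesis by blast
      next
        case True
        then have x1: "x \<in> {1..m}" by (simp add: L_def)
        obtain y where y: "y \<in> {1..m} - L" "tab_col \<nu> y = tab_col \<nu> x" using top[OF x1] by blast
        then have "y \<in> {1..m}" "y \<notin> L" "x \<noteq> y" using True by auto
        then have "y \<in> ?S - L" using sharedI[of y m x "tab_col \<nu>"] x1 y(2) by simp
        then show ?thesis using y(2) x(2) by (metis image_eqI)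
      qed
    qed
  qed blast
  have "card (?S - L) \<le> card L"
  proof -
    have inj: "inj_on (tab_col \<nu>) (?S - L)"
    proof (rule inj_onI)
      fix x y assume x: "x \<in> ?S - L" and y: "y \<in> ?S - L" and eq: "tab_col \<nu> x = tab_col \<nu> y"
      have xy: "x \<in> {1..m}" "y \<in> {1..m}" using x y by (simp_all add: shared_def)
      then have "tab_row \<nu> x = 0" "tab_row \<nu> y = 0" using x y by (simp_all add: L_def)
      then show "x = y"
        using inj_onD[OF bij_betw_imp_inj_on[OF tab_bij[of \<nu>, unfolded m]] _ xy] eq by simp
    qed
    have "tab_col \<nu> ` (?S - L) \<subseteq> tab_col \<nu> ` L"
    proof
      fix j assume "j \<in> tab_col \<nu> ` (?S - L)"
      then obtain x where x: "x \<in> ?S - L" "j = tab_col \<nu> x" by blast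
      then obtain y where y: "y \<in> {1..m}" "y \<noteq> x" "tab_col \<nu> y = tab_col \<nu> x" by (auto simp: shared_def)
      have "y \<in> L"
      proof (rule ccontr)
        assume "y \<notin> L"
        moreover have "x \<in> {1..m}" using x(1) by (simp add: shared_def)
        ultimately have "y \<in> ?S - L" using sharedI[of y m x "tab_col \<nu>"] y by simp
        then show False using inj_onD[OF inj y(3)] x(1) y(2) by blast
      qed
      then show "j \<in> tab_col \<nu> ` L" using x(2) y(3) by (metis image_eqI)
    qed
    then have "card (tab_col \<nu> ` (?S - L)) \<le> card (tab_col \<nu> ` L)"
      by (intro card_mono) (auto simp: L_def)
    also have "\<dots> \<le> card L" by (rule card_image_le) (simp add: L_def)
    finally show ?thesis using card_image[OF inj] by simp
  qed
  moreover have "card ?S = card (?S - L) + card L"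
    using LS card_Diff_subset[OF _ LS] card_mono[OF _ LS] by (simp add: L_def)
  ultimately show "card ?S \<le> 2 * partition_weight \<nu>" using cardL by simp
qed

text \<open>The number of columns of length at least 2 is the number of their points minus the weight, and a
  set without two points in a column contains at most one point of each.\<close>

lemma transversal_misses_shared:
  assumes \<nu>: "partition_of m \<nu>" and K: "K \<subseteq> {1..m}" and inj: "inj_on (tab_col \<nu>) K"
  shows "partition_weight \<nu> \<le> card (shared m (tab_col \<nu>) - K)"
proof -
  let ?S = "shared m (tab_col \<nu>)" and ?L = "{x\<in>{1..m}. tab_row \<nu> x \<noteq> 0}"
  note L = lower_rows[OF \<nu>]
  have "card (K \<inter> ?S) = card (tab_col \<nu> ` (K \<inter> ?S))"
    using inj by (intro card_image[symmetric]) (auto intro: inj_on_subset)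
  also have "\<dots> \<le> card (tab_col \<nu> ` ?S)" by (intro card_mono) auto
  also have "\<dots> \<le> card (?S - ?L)" unfolding L(3) by (rule card_image_le) simp
  also have "\<dots> = card ?S - partition_weight \<nu>"
    using card_Diff_subset[of ?L ?S] L(1,2) by simp
  finally have "card (K \<inter> ?S) \<le> card ?S - partition_weight \<nu>" .
  moreover have "card ?S = card (?S \<inter> K) + card (?S - K)"
    by (metis card_Int_Diff finite_shared)
  moreover have "partition_weight \<nu> \<le> card ?S" using L(1,2) card_mono[of ?S ?L] by simp
  ultimately show ?thesis by (simp add: Int_commute)
qed

section \<open>Constituents as subrepresentations\<close>

definition vcat :: "rat mat \<Rightarrow> rat mat \<Rightarrow> rat mat" where
  "vcat A B = mat (dim_row A + dim_row B) (dim_col A)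
     (\<lambda>(i, j). if i < dim_row A then A $$ (i, j) else B $$ (i - dim_row A, j))"

lemma vcat_carrier: "A \<in> carrier_mat k n \<Longrightarrow> B \<in> carrier_mat l n \<Longrightarrow> vcat A B \<in> carrier_mat (k + l) n"
  by (rule carrier_matI) (auto simp: vcat_def)

lemma vcat_mult_vec:
  assumes "A \<in> carrier_mat k n" "B \<in> carrier_mat l n" "a \<in> carrier_vec n"
  shows "vcat A B *\<^sub>v a = (A *\<^sub>v a) @\<^sub>v (B *\<^sub>v a)"
proof (rule eq_vecI)
  fix i assume "i < dim_vec ((A *\<^sub>v a) @\<^sub>v (B *\<^sub>v a))"
  then have i: "i < k + l" using assms by simp
  show "(vcat A B *\<^sub>v a) $ i = ((A *\<^sub>v a) @\<^sub>v (B *\<^sub>v a)) $ i"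
    using assms i by (cases "i < k") (auto simp: vcat_def scalar_prod_def)
qed (use assms in \<open>simp add: vcat_def\<close>)

lemma specht_sum_inclusion:
  assumes "\<nu> \<in> set \<mu>s"
  shows "\<exists>J\<in>carrier_mat (specht_sum_dim \<mu>s) (specht_dim \<nu>). \<forall>a\<in>carrier_vec (specht_dim \<nu>).
    (\<forall>g. specht_sum \<mu>s g *\<^sub>v (J *\<^sub>v a) = J *\<^sub>v (specht \<nu> g *\<^sub>v a)) \<and>
    (J *\<^sub>v a = 0\<^sub>v (specht_sum_dim \<mu>s) \<longrightarrow> a = 0\<^sub>v (specht_dim \<nu>))"
  using assms
proof (induction \<mu>s)
  case (Cons \<mu> \<mu>s)
  let ?n = "specht_dim \<nu>" and ?k = "specht_dim \<mu>" and ?N = "specht_sum_dim \<mu>s"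
  show ?case
  proof (cases "\<mu> = \<nu>")
    case True
    let ?J = "vcat (1\<^sub>m ?n) (0\<^sub>m ?N ?n)"
    have J: "?J *\<^sub>v a = a @\<^sub>v 0\<^sub>v ?N" if "a \<in> carrier_vec ?n" for a
      using vcat_mult_vec[OF one_carrier_mat zero_carrier_mat that] that
      by (simp add: zero_mat_mult_vec)
    show ?thesis
    proof (intro bexI[of _ ?J] ballI conjI allI impI)
      fix a :: "rat vec" and g :: "nat \<Rightarrow> nat" assume a: "a \<in> carrier_vec ?n"
      have ga: "specht \<nu> g *\<^sub>v a \<in> carrier_vec ?n" by (rule mult_mat_vec_carrier[OF specht_carrier a])
      show "specht_sum (\<mu> # \<mu>s) g *\<^sub>v (?J *\<^sub>v a) = ?J *\<^sub>v (specht \<nu> g *\<^sub>v a)"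
        unfolding True J[OF a] J[OF ga] specht_sum_Cons
          mult_mat_vec_split[OF specht_carrier specht_sum_carrier a zero_carrier_vec]
          mult_zero_vec[OF specht_sum_carrier] ..
    next
      fix a :: "rat vec" assume a: "a \<in> carrier_vec ?n" and z: "?J *\<^sub>v a = 0\<^sub>v (specht_sum_dim (\<mu> # \<mu>s))"
      have "a @\<^sub>v 0\<^sub>v ?N = 0\<^sub>v ?n @\<^sub>v 0\<^sub>v ?N" using z J[OF a] True by (simp add: append_zero_vec)
      then show "a = 0\<^sub>v ?n" using append_vec_eq[OF a zero_carrier_vec] by blast
    next
      show "?J \<in> carrier_mat (specht_sum_dim (\<mu> # \<mu>s)) ?n"
        using vcat_carrier[OF one_carrier_mat zero_carrier_mat] True by simp
    qed
  next
    case False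
    then have "\<nu> \<in> set \<mu>s" using Cons.prems by simp
    then obtain J' where J': "J' \<in> carrier_mat ?N ?n"
      and hom: "\<And>a g. a \<in> carrier_vec ?n \<Longrightarrow> specht_sum \<mu>s g *\<^sub>v (J' *\<^sub>v a) = J' *\<^sub>v (specht \<nu> g *\<^sub>v a)"
      and inj: "\<And>a. a \<in> carrier_vec ?n \<Longrightarrow> J' *\<^sub>v a = 0\<^sub>v ?N \<Longrightarrow> a = 0\<^sub>v ?n"
      using Cons.IH by blast
    let ?J = "vcat (0\<^sub>m ?k ?n) J'"
    have J: "?J *\<^sub>v a = 0\<^sub>v ?k @\<^sub>v (J' *\<^sub>v a)" if "a \<in> carrier_vec ?n" for a
      using vcat_mult_vec[OF zero_carrier_mat J' that] that by (simp add: zero_mat_mult_vec)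
    show ?thesis
    proof (intro bexI[of _ ?J] ballI conjI allI impI)
      fix a :: "rat vec" and g :: "nat \<Rightarrow> nat" assume a: "a \<in> carrier_vec ?n"
      have ga: "specht \<nu> g *\<^sub>v a \<in> carrier_vec ?n" by (rule mult_mat_vec_carrier[OF specht_carrier a])
      have Ja: "J' *\<^sub>v a \<in> carrier_vec ?N" by (rule mult_mat_vec_carrier[OF J' a])
      show "specht_sum (\<mu> # \<mu>s) g *\<^sub>v (?J *\<^sub>v a) = ?J *\<^sub>v (specht \<nu> g *\<^sub>v a)"
        unfolding J[OF a] J[OF ga] specht_sum_Cons
          mult_mat_vec_split[OF specht_carrier specht_sum_carrier zero_carrier_vec Ja]
          mult_zero_vec[OF specht_carrier] hom[OF a] ..
    next
      fix a :: "rat vec" assume a: "a \<in> carrier_vec ?n" and z: "?J *\<^sub>v a = 0\<^sub>v (specht_sum_dim (\<mu> # \<mu>s))"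
      have "0\<^sub>v ?k @\<^sub>v (J' *\<^sub>v a) = 0\<^sub>v ?k @\<^sub>v 0\<^sub>v ?N" using z J[OF a] by (simp add: append_zero_vec)
      then show "a = 0\<^sub>v ?n" using append_vec_eq[OF zero_carrier_vec zero_carrier_vec] inj[OF a] by metis
    next
      show "?J \<in> carrier_mat (specht_sum_dim (\<mu> # \<mu>s)) ?n"
        using vcat_carrier[OF zero_carrier_mat J'] by simp
    qed
  qed
qed simp

text \<open>The inclusion of the summand \<open>V\<^sub>\<nu>\<close>, followed by the isomorphism with \<open>\<rho>\<close>.\<close>

lemma constituent_embedding:
  assumes R: "rep_of_dim m d \<rho>" and \<mu>s: "decomposition m \<rho> \<mu>s" and \<nu>: "\<nu> \<in> set \<mu>s"
  shows "\<exists>F\<in>carrier_mat d (specht_dim \<nu>). \<forall>a\<in>carrier_vec (specht_dim \<nu>).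
    (\<forall>g\<in>perms m. \<rho> g *\<^sub>v (F *\<^sub>v a) = F *\<^sub>v (specht \<nu> g *\<^sub>v a)) \<and>
    (F *\<^sub>v a = 0\<^sub>v d \<longrightarrow> a = 0\<^sub>v (specht_dim \<nu>))"
proof -
  let ?n = "specht_dim \<nu>"
  have iso: "rep_iso m \<rho> (specht_sum \<mu>s)" using \<mu>s by (simp add: decomposition_def)
  obtain P Q where PQ: "\<And>g. g \<in> perms m \<Longrightarrow> similar_mat_wit (\<rho> g) (specht_sum \<mu>s g) P Q"
    and N: "specht_sum_dim \<mu>s = d"
    by (rule rep_iso_dim[OF R iso]) blast
  obtain J where J: "J \<in> carrier_mat d ?n"
    and hom: "\<And>a g. a \<in> carrier_vec ?n \<Longrightarrow> specht_sum \<mu>s g *\<^sub>v (J *\<^sub>v a) = J *\<^sub>v (specht \<nu> g *\<^sub>v a)"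
    and inj: "\<And>a. a \<in> carrier_vec ?n \<Longrightarrow> J *\<^sub>v a = 0\<^sub>v d \<Longrightarrow> a = 0\<^sub>v ?n"
    using specht_sum_inclusion[OF \<nu>] unfolding N by blast
  have W: "P * Q = 1\<^sub>m d" "Q * P = 1\<^sub>m d" "\<rho> g = P * specht_sum \<mu>s g * Q" "specht_sum \<mu>s g \<in> carrier_mat d d"
    "P \<in> carrier_mat d d" "Q \<in> carrier_mat d d" if "g \<in> perms m" for g
    using similar_mat_witD2[OF rep_of_dimD(1)[OF R that] PQ[OF that]] by auto
  note P = W(1,2,5,6)[OF perms_id]
  show ?thesis
  proof (intro bexI[of _ "P * J"] ballI conjI impI)
    show "P * J \<in> carrier_mat d ?n" by (rule mult_carrier_mat[OF P(3) J])
    fix a :: "rat vec" assume a: "a \<in> carrier_vec ?n"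
    have Ja: "J *\<^sub>v a \<in> carrier_vec d" by (rule mult_mat_vec_carrier[OF J a])
    have PJ: "(P * J) *\<^sub>v b = P *\<^sub>v (J *\<^sub>v b)" if "b \<in> carrier_vec ?n" for b
      by (rule assoc_mult_mat_vec[OF P(3) J that])
    have QP: "Q *\<^sub>v (P *\<^sub>v b) = b" if "b \<in> carrier_vec d" for b
      using assoc_mult_mat_vec[OF P(4,3) that] P(2) that by simp
    show "a = 0\<^sub>v ?n" if z: "(P * J) *\<^sub>v a = 0\<^sub>v d"
    proof (rule inj[OF a])
      have "Q *\<^sub>v (P *\<^sub>v (J *\<^sub>v a)) = 0\<^sub>v d" using z PJ[OF a] mult_zero_vec[OF P(4)] by simp
      then show "J *\<^sub>v a = 0\<^sub>v d" using QP[OF Ja] by simp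
    qed
    fix g assume g: "g \<in> perms m"
    have PD: "P * specht_sum \<mu>s g \<in> carrier_mat d d" by (rule mult_carrier_mat[OF P(3) W(4)[OF g]])
    have "\<rho> g *\<^sub>v ((P * J) *\<^sub>v a) = (P * specht_sum \<mu>s g) *\<^sub>v (Q *\<^sub>v (P *\<^sub>v (J *\<^sub>v a)))"
      unfolding W(3)[OF g] PJ[OF a]
      by (rule assoc_mult_mat_vec[OF PD P(4) mult_mat_vec_carrier[OF P(3) Ja]])
    also have "\<dots> = P *\<^sub>v (specht_sum \<mu>s g *\<^sub>v (J *\<^sub>v a))"
      unfolding QP[OF Ja] by (rule assoc_mult_mat_vec[OF P(3) W(4)[OF g] Ja])
    also have "\<dots> = (P * J) *\<^sub>v (specht \<nu> g *\<^sub>v a)"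
      unfolding hom[OF a] by (rule PJ[OF mult_mat_vec_carrier[OF specht_carrier a], symmetric])
    finally show "\<rho> g *\<^sub>v ((P * J) *\<^sub>v a) = (P * J) *\<^sub>v (specht \<nu> g *\<^sub>v a)" .
  qed
qed

lemma intertwiner_act:
  assumes R: "rep_of_dim m d \<rho>" and S: "rep_of_dim m n \<sigma>" and F: "F \<in> carrier_mat d n"
    and hom: "\<And>g. g \<in> perms m \<Longrightarrow> \<rho> g *\<^sub>v (F *\<^sub>v a) = F *\<^sub>v (\<sigma> g *\<^sub>v a)" and a: "a \<in> carrier_vec n"
  shows "act m d \<rho> x *\<^sub>v (F *\<^sub>v a) = F *\<^sub>v (act m n \<sigma> x *\<^sub>v a)"
proof (rule eq_vecI)
  fix i assume "i < dim_vec (F *\<^sub>v (act m n \<sigma> x *\<^sub>v a))"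
  then have i: "i < d" using F by simp
  have "(act m d \<rho> x *\<^sub>v (F *\<^sub>v a)) $ i = (\<Sum>g\<in>perms m. x g * (\<rho> g *\<^sub>v (F *\<^sub>v a)) $ i)"
    by (rule act_vec[OF R mult_mat_vec_carrier[OF F a] i])
  also have "\<dots> = (\<Sum>g\<in>perms m. x g * (F *\<^sub>v (\<sigma> g *\<^sub>v a)) $ i)"
    by (rule sum.cong[OF refl]) (simp only: hom)
  also have "\<dots> = (F *\<^sub>v (act m n \<sigma> x *\<^sub>v a)) $ i" by (rule mult_act_vec[OF S F a i, symmetric])
  finally show "(act m d \<rho> x *\<^sub>v (F *\<^sub>v a)) $ i = (F *\<^sub>v (act m n \<sigma> x *\<^sub>v a)) $ i" .
qed (use F in simp)

section \<open>Lower bound for the weight of a tensor product\<close>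

lemma kron_vec_index:
  assumes "v \<in> carrier_vec d" "w \<in> carrier_vec e" "i < d" "j < e"
  shows "kron_vec v w $ (i * e + j) = v $ i * w $ j"
proof -
  have "i * e + j < Suc i * e" using assms(4) by simp
  also have "\<dots> \<le> d * e" using assms(3) by (intro mult_right_mono) auto
  finally show ?thesis using assms by (simp add: kron_vec_def carrier_vecD)
qed

lemma kron_vec_nonzero:
  assumes v: "v \<in> carrier_vec d" "v \<noteq> 0\<^sub>v d" and w: "w \<in> carrier_vec e" "w \<noteq> 0\<^sub>v e"
  shows "kron_vec v w \<noteq> 0\<^sub>v (d * e)"
proof
  assume z: "kron_vec v w = 0\<^sub>v (d * e)"
  obtain i where i: "i < d" "v $ i \<noteq> 0" using v by (metis carrier_vecD eq_vecI index_zero_vec)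
  obtain j where j: "j < e" "w $ j \<noteq> 0" using w by (metis carrier_vecD eq_vecI index_zero_vec)
  have "i * e + j < Suc i * e" using j by simp
  also have "\<dots> \<le> d * e" using i by (intro mult_right_mono) auto
  finally have "kron_vec v w $ (i * e + j) = 0" using z by simp
  then show False using kron_vec_index[OF v(1) w(1) i(1) j(1)] i j by simp
qed

text \<open>An element supported on permutations that fix \<open>w\<close> acts on \<open>v \<otimes> w\<close> through the first factor.\<close>

lemma act_tensor_left:
  assumes R: "rep_of_dim m d \<rho>" "rep_of_dim m e \<sigma>" and v: "v \<in> carrier_vec d" and w: "w \<in> carrier_vec e"
    and inv: "\<And>g. g \<in> perms m \<Longrightarrow> x g \<noteq> 0 \<Longrightarrow> \<sigma> g *\<^sub>v w = w"
  shows "act m (d * e) (tensor \<rho> \<sigma>) x *\<^sub>v kron_vec v w = kron_vec (act m d \<rho> x *\<^sub>v v) w"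
proof (rule eq_vecI)
  fix i assume "i < dim_vec (kron_vec (act m d \<rho> x *\<^sub>v v) w)"
  then have i: "i < d * e" using w by (simp add: kron_vec_def carrier_vecD)
  then have e: "e > 0" by (cases e) auto
  have lt: "i div e < d" "i mod e < e" using i e by (auto simp: less_mult_imp_div_less)
  have idx: "kron_vec u w' $ i = u $ (i div e) * w' $ (i mod e)"
    if "u \<in> carrier_vec d" "w' \<in> carrier_vec e" for u w'
    using that i by (simp add: kron_vec_def carrier_vecD)
  have "(act m (d * e) (tensor \<rho> \<sigma>) x *\<^sub>v kron_vec v w) $ i =
      (\<Sum>g\<in>perms m. x g * (tensor \<rho> \<sigma> g *\<^sub>v kron_vec v w) $ i)"
    by (rule act_vec[OF rep_of_dim_tensor[OF R] kron_vec_carrier[OF v w] i])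
  also have "\<dots> = (\<Sum>g\<in>perms m. x g * (\<rho> g *\<^sub>v v) $ (i div e) * w $ (i mod e))"
  proof (rule sum.cong[OF refl])
    fix g assume g: "g \<in> perms m"
    have c: "\<rho> g *\<^sub>v v \<in> carrier_vec d" by (rule mult_mat_vec_carrier[OF rep_of_dimD(1)[OF R(1) g] v])
    show "x g * (tensor \<rho> \<sigma> g *\<^sub>v kron_vec v w) $ i = x g * (\<rho> g *\<^sub>v v) $ (i div e) * w $ (i mod e)"
      unfolding tensor_mult_vec[OF R g v w]
      using inv[OF g] idx[OF c w] by (cases "x g = 0") simp_all
  qed
  also have "\<dots> = (act m d \<rho> x *\<^sub>v v) $ (i div e) * w $ (i mod e)"
    unfolding act_vec[OF R(1) v lt(1)] by (simp add: sum_distrib_right)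
  also have "\<dots> = kron_vec (act m d \<rho> x *\<^sub>v v) w $ i"
    by (rule idx[OF mult_mat_vec_carrier[OF act_carrier v] w, symmetric])
  finally show "(act m (d * e) (tensor \<rho> \<sigma>) x *\<^sub>v kron_vec v w) $ i = kron_vec (act m d \<rho> x *\<^sub>v v) w $ i" .
qed (use w in \<open>simp add: kron_vec_def carrier_vecD\<close>)

lemma act_tensor_right:
  assumes R: "rep_of_dim m d \<rho>" "rep_of_dim m e \<sigma>" and v: "v \<in> carrier_vec d" and w: "w \<in> carrier_vec e"
    and inv: "\<And>g. g \<in> perms m \<Longrightarrow> x g \<noteq> 0 \<Longrightarrow> \<rho> g *\<^sub>v v = v"
  shows "act m (d * e) (tensor \<rho> \<sigma>) x *\<^sub>v kron_vec v w = kron_vec v (act m e \<sigma> x *\<^sub>v w)"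
proof (rule eq_vecI)
  fix i assume "i < dim_vec (kron_vec v (act m e \<sigma> x *\<^sub>v w))"
  then have i: "i < d * e" using v by (simp add: kron_vec_def carrier_vecD)
  then have e: "e > 0" by (cases e) auto
  have lt: "i div e < d" "i mod e < e" using i e by (auto simp: less_mult_imp_div_less)
  have idx: "kron_vec u w' $ i = u $ (i div e) * w' $ (i mod e)"
    if "u \<in> carrier_vec d" "w' \<in> carrier_vec e" for u w'
    using that i by (simp add: kron_vec_def carrier_vecD)
  have "(act m (d * e) (tensor \<rho> \<sigma>) x *\<^sub>v kron_vec v w) $ i =
      (\<Sum>g\<in>perms m. x g * (tensor \<rho> \<sigma> g *\<^sub>v kron_vec v w) $ i)"
    by (rule act_vec[OF rep_of_dim_tensor[OF R] kron_vec_carrier[OF v w] i])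
  also have "\<dots> = (\<Sum>g\<in>perms m. v $ (i div e) * (x g * (\<sigma> g *\<^sub>v w) $ (i mod e)))"
  proof (rule sum.cong[OF refl])
    fix g assume g: "g \<in> perms m"
    have c: "\<sigma> g *\<^sub>v w \<in> carrier_vec e" by (rule mult_mat_vec_carrier[OF rep_of_dimD(1)[OF R(2) g] w])
    show "x g * (tensor \<rho> \<sigma> g *\<^sub>v kron_vec v w) $ i = v $ (i div e) * (x g * (\<sigma> g *\<^sub>v w) $ (i mod e))"
      unfolding tensor_mult_vec[OF R g v w]
      using inv[OF g] idx[OF v c] by (cases "x g = 0") simp_all
  qed
  also have "\<dots> = v $ (i div e) * (act m e \<sigma> x *\<^sub>v w) $ (i mod e)"
    unfolding act_vec[OF R(2) w lt(2)] by (simp add: sum_distrib_left)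
  also have "\<dots> = kron_vec v (act m e \<sigma> x *\<^sub>v w) $ i"
    by (rule idx[OF v mult_mat_vec_carrier[OF act_carrier w], symmetric])
  finally show "(act m (d * e) (tensor \<rho> \<sigma>) x *\<^sub>v kron_vec v w) $ i = kron_vec v (act m e \<sigma> x *\<^sub>v w) $ i" .
qed (use v in \<open>simp add: kron_vec_def carrier_vecD\<close>)

lemma ex_perm_avoiding:
  assumes A: "A \<subseteq> {1..m}" and B: "B \<subseteq> {1..m}" and le: "card A + card B \<le> m"
  shows "\<exists>g\<in>perms m. g ` B \<inter> A = {}"
proof -
  have fin: "finite A" "finite B" using A B finite_subset by blast+
  have "card B \<le> card ({1..m} - A)" using A fin le by (simp add: card_Diff_subset)
  then obtain B' where B': "B' \<subseteq> {1..m} - A" "card B' = card B" by (metis obtain_subset_with_card_n)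
  have finB': "finite B'" using B'(1) finite_subset by blast
  obtain h where h: "bij_betw h B B'" using finite_same_card_bij[OF fin(2) finB'] B'(2) by metis
  have "card ({1..m} - B) = card ({1..m} - B')"
    using B B' fin finB' by (simp add: card_Diff_subset subset_eq)
  then obtain h' where h': "bij_betw h' ({1..m} - B) ({1..m} - B')"
    using finite_same_card_bij[of "{1..m} - B" "{1..m} - B'"] by auto
  define g where "g x = (if x \<in> B then h x else if x \<in> {1..m} then h' x else x)" for x
  have 1: "bij_betw g B B'" using h by (rule bij_betw_cong[THEN iffD1, rotated]) (simp add: g_def)
  have 2: "bij_betw g ({1..m} - B) ({1..m} - B')"
    using h' by (rule bij_betw_cong[THEN iffD1, rotated]) (auto simp: g_def)
  have "bij_betw g (B \<union> ({1..m} - B)) (B' \<union> ({1..m} - B'))"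
    by (rule bij_betw_combine[OF 1 2]) blast
  moreover have "B \<union> ({1..m} - B) = {1..m}" "B' \<union> ({1..m} - B') = {1..m}" using B B' by auto
  ultimately have "bij_betw g {1..m} {1..m}" by simp
  then have "g \<in> perms m"
    unfolding perms_def using B by (auto intro!: bij_imp_permutes simp: g_def simp del: atLeastAtMost_iff)
  moreover have "g ` B \<inter> A = {}" using bij_betw_imp_surj_on[OF 1] B'(1) by blast
  ultimately show ?thesis by blast
qed

lemma shared_conj:
  assumes g: "g \<in> perms m"
  shows "shared m (\<kappa> \<circ> pinv g) = g ` shared m \<kappa>"
proof
  show "shared m (\<kappa> \<circ> pinv g) \<subseteq> g ` shared m \<kappa>"
  proof
    fix x assume "x \<in> shared m (\<kappa> \<circ> pinv g)"
    then obtain y where xy: "x \<in> {1..m}" "y \<in> {1..m}" "y \<noteq> x" "\<kappa> (pinv g y) = \<kappa> (pinv g x)"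
      unfolding shared_def by auto
    have "pinv g y \<noteq> pinv g x" using xy(3) perms_inverses(2)[OF g] by metis
    then have "pinv g x \<in> shared m \<kappa>"
      using perms_image[OF perms_inv[OF g]] xy by (intro sharedI[of "pinv g x" m "pinv g y"]) auto
    then have "g (pinv g x) \<in> g ` shared m \<kappa>" by (rule imageI)
    then show "x \<in> g ` shared m \<kappa>" using g by simp
  qed
  show "g ` shared m \<kappa> \<subseteq> shared m (\<kappa> \<circ> pinv g)"
  proof
    fix z assume "z \<in> g ` shared m \<kappa>"
    then obtain x y where xy: "x \<in> {1..m}" "y \<in> {1..m}" "y \<noteq> x" "\<kappa> y = \<kappa> x" "z = g x"
      unfolding shared_def by auto
    have "g y \<noteq> g x" using xy(3) perms_inverses(1)[OF g] by metis
    then show "z \<in> shared m (\<kappa> \<circ> pinv g)"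
      unfolding xy(5) using perms_image[OF g] xy g by (intro sharedI[of "g x" m "g y"]) auto
  qed
qed

text \<open>Let \<open>b\<^sub>1\<close> and \<open>b\<^sub>2\<close> be the column antisymmetrizers of tableaux of shapes \<open>\<nu>\<close> and \<open>\<mu>\<close> whose columns of
  length at least 2 involve disjoint sets of points. A set \<open>K\<close> with at most one point in each column of either
  tableau misses \<open>w(\<nu>)\<close> points of the first set and \<open>w(\<mu>)\<close> points of the second. Larger sets contain a
  column transposition, so \<open>b\<^sub>1 b\<^sub>2\<close> would act as 0 if the claim failed; but it maps \<open>v \<otimes> w\<close> to
  \<open>b\<^sub>1 v \<otimes> b\<^sub>2 w \<noteq> 0\<close> for suitable \<open>v\<close> and \<open>w\<close>.\<close>

lemma tensor_lower_bound:
  assumes R: "rep_of_dim m d \<rho>" "rep_of_dim m e \<sigma>"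
    and \<nu>s: "decomposition m \<rho> \<nu>s" "\<nu> \<in> set \<nu>s" and \<mu>s: "decomposition m \<sigma> \<mu>s" "\<mu> \<in> set \<mu>s"
    and large: "2 * (partition_weight \<nu> + partition_weight \<mu>) \<le> m"
  shows "\<not> fixed_spanned m (d * e) (tensor \<rho> \<sigma>) (m + 1 - (partition_weight \<nu> + partition_weight \<mu>))"
proof
  let ?k = "m + 1 - (partition_weight \<nu> + partition_weight \<mu>)"
  assume fs: "fixed_spanned m (d * e) (tensor \<rho> \<sigma>) ?k"
  have \<nu>: "partition_of m \<nu>" and \<mu>: "partition_of m \<mu>"
    using \<nu>s \<mu>s by (auto simp: decomposition_def)
  have m: "sum_list \<nu> = m" "sum_list \<mu> = m" using \<nu> \<mu> by (simp_all add: partition_of_def)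
  let ?S = "shared m (tab_col \<nu>)" and ?T = "shared m (tab_col \<mu>)"
  have S: "?S \<subseteq> {1..m}" and T: "?T \<subseteq> {1..m}" by (auto simp: shared_def)
  have "card ?S + card ?T \<le> m" using lower_rows(4)[OF \<nu>] lower_rows(4)[OF \<mu>] large[unfolded distrib_left] by linarith
  then obtain g where g: "g \<in> perms m" and gT: "g ` ?T \<inter> ?S = {}" using ex_perm_avoiding[OF S T] by blast
  \<comment> \<open>The column labels of the \<open>g\<close>-translated tableau of \<open>\<mu>\<close>.\<close>
  define \<kappa> where "\<kappa> = tab_col \<mu> \<circ> pinv g"
  have sh\<kappa>: "shared m \<kappa> = g ` ?T" unfolding \<kappa>_def by (rule shared_conj[OF g])
  have disj: "?S \<inter> shared m \<kappa> = {}" "shared m \<kappa> \<inter> ?S = {}" using gT sh\<kappa> by auto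
  define b1 where "b1 = antisymz m (tab_col \<nu>)"
  define b2 where "b2 = antisymz m \<kappa>"
  have zero: "act m (d * e) (tensor \<rho> \<sigma>) (conv m b1 b2) = 0\<^sub>m (d * e) (d * e)"
  proof (rule act_zero_if_alternating[OF rep_of_dim_tensor[OF R] fs])
    fix K assume K: "K \<subseteq> {1..m}" "?k \<le> card K"
    have finK: "finite K" using K(1) finite_subset by blast
    have "\<not> (inj_on (tab_col \<nu>) K \<and> inj_on \<kappa> K)"
    proof
      assume inj: "inj_on (tab_col \<nu>) K \<and> inj_on \<kappa> K"
      have 1: "partition_weight \<nu> \<le> card (?S - K)"
        using transversal_misses_shared[OF \<nu> K(1)] inj by blast
      have ginj: "inj (pinv g)" "inj g" using perms_bij[OF g] perms_bij[OF perms_inv[OF g]] by (auto intro: bij_is_inj)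
      have "pinv g ` K \<subseteq> {1..m}" using perms_image[OF perms_inv[OF g]] K(1) by blast
      moreover have "inj_on (tab_col \<mu>) (pinv g ` K)"
        using inj unfolding \<kappa>_def by (auto simp: inj_on_def)
      ultimately have "partition_weight \<mu> \<le> card (?T - pinv g ` K)"
        by (rule transversal_misses_shared[OF \<mu>])
      also have "\<dots> = card (g ` (?T - pinv g ` K))"
        by (rule card_image[symmetric]) (rule inj_on_subset[OF ginj(2) subset_UNIV])
      also have "g ` (?T - pinv g ` K) = shared m \<kappa> - K"
        unfolding sh\<kappa> image_set_diff[OF ginj(2)] using g by (auto simp: image_image)
      finally have 2: "partition_weight \<mu> \<le> card (shared m \<kappa> - K)" .
      have "card (?S - K) + card (shared m \<kappa> - K) = card ((?S - K) \<union> (shared m \<kappa> - K))"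
        by (rule card_Un_disjoint[symmetric]) (use disj in auto)
      also have "\<dots> \<le> card ({1..m} - K)"
        by (rule card_mono) (auto simp: shared_def)
      also have "\<dots> = m - card K" using K(1) finK by (simp add: card_Diff_subset)
      finally have "partition_weight \<nu> + partition_weight \<mu> \<le> m - card K" using 1 2 by linarith
      moreover have "card K \<le> m" using card_mono[OF _ K(1)] by simp
      ultimately show False using K(2) large by linarith
    qed
    then consider u v where "u \<in> K" "v \<in> K" "u \<noteq> v" "tab_col \<nu> u = tab_col \<nu> v"
      | u v where "u \<in> K" "v \<in> K" "u \<noteq> v" "\<kappa> u = \<kappa> v"
      unfolding inj_on_def by blast
    then show "\<exists>t. t permutes K \<and> conv m (conv m b1 b2) (delta t) = gscale (- 1) (conv m b1 b2)"
    proof cases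
      case (1 u v)
      let ?t = "transpose u v"
      have uv: "u \<in> {1..m}" "v \<in> {1..m}" using 1 K(1) by auto
      have t: "?t \<in> label_stabilizer m (tab_col \<nu>)" by (rule transpose_in_label_stabilizer[of _ _ _ "tab_col \<nu>", OF uv 1(4)])
      have "conv m (conv m b1 b2) (delta ?t) = conv m (conv m b1 (delta ?t)) b2"
        unfolding conv_assoc b2_def antisymz_commute[OF t disj(1)] ..
      also have "conv m b1 (delta ?t) = gscale (-1) b1"
        unfolding b1_def by (rule antisymz_conv_transpose(1)[of _ _ _ "tab_col \<nu>", OF uv 1(3,4)])
      finally have "conv m (conv m b1 b2) (delta ?t) = gscale (-1) (conv m b1 b2)" by (simp only: conv_linear)
      moreover have "?t permutes K" by (rule permutes_swap_id[OF 1(1,2)])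
      ultimately show ?thesis by blast
    next
      case (2 u v)
      let ?t = "transpose u v"
      have uv: "u \<in> {1..m}" "v \<in> {1..m}" using 2 K(1) by auto
      have "conv m b2 (delta ?t) = gscale (-1) b2"
        unfolding b2_def by (rule antisymz_conv_transpose(1)[of _ _ _ \<kappa>, OF uv 2(3,4)])
      then have "conv m (conv m b1 b2) (delta ?t) = gscale (-1) (conv m b1 b2)"
        by (simp only: conv_linear conv_assoc)
      moreover have "?t permutes K" by (rule permutes_swap_id[OF 2(1,2)])
      ultimately show ?thesis by blast
    qed
  qed
  let ?n1 = "specht_dim \<nu>" and ?n2 = "specht_dim \<mu>"
  obtain F where F: "F \<in> carrier_mat d ?n1"
    and Fhom: "\<And>a h. a \<in> carrier_vec ?n1 \<Longrightarrow> h \<in> perms m \<Longrightarrow> \<rho> h *\<^sub>v (F *\<^sub>v a) = F *\<^sub>v (specht \<nu> h *\<^sub>v a)"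
    and Finj: "\<And>a. a \<in> carrier_vec ?n1 \<Longrightarrow> F *\<^sub>v a = 0\<^sub>v d \<Longrightarrow> a = 0\<^sub>v ?n1"
    using constituent_embedding[OF R(1) \<nu>s] by blast
  obtain G where G: "G \<in> carrier_mat e ?n2"
    and Ghom: "\<And>a h. a \<in> carrier_vec ?n2 \<Longrightarrow> h \<in> perms m \<Longrightarrow> \<sigma> h *\<^sub>v (G *\<^sub>v a) = G *\<^sub>v (specht \<mu> h *\<^sub>v a)"
    and Ginj: "\<And>a. a \<in> carrier_vec ?n2 \<Longrightarrow> G *\<^sub>v a = 0\<^sub>v e \<Longrightarrow> a = 0\<^sub>v ?n2"
    using constituent_embedding[OF R(2) \<mu>s] by blast
  \<comment> \<open>The copies of \<open>c\<^sub>\<nu>\<close> and \<open>g c\<^sub>\<mu>\<close> in the two factors. The points moved by \<open>b\<^sub>2\<close> are in the first row for \<open>\<nu>\<close>, and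
    those moved by \<open>b\<^sub>1\<close> in the first row for \<open>\<mu>\<close>; so \<open>b\<^sub>2\<close> acts only on \<open>w\<close>, and \<open>b\<^sub>1\<close> only on \<open>v\<close>.\<close>
  let ?c1 = "young_symmetrizer \<nu>" and ?c2 = "translate g (young_symmetrizer \<mu>)"
  have c: "?c1 \<in> specht_module \<nu>" "?c2 \<in> specht_module \<mu>"
    using young_in_specht translate_in_specht[OF _ young_in_specht, of g \<mu>] g m by auto
  define v where "v = F *\<^sub>v coord \<nu> ?c1"
  define w where "w = G *\<^sub>v coord \<mu> ?c2"
  have v: "v \<in> carrier_vec d" and w: "w \<in> carrier_vec e"
    unfolding v_def w_def by (rule mult_mat_vec_carrier[OF F coord_carrier], rule mult_mat_vec_carrier[OF G coord_carrier])
  have v_fixed: "\<rho> q *\<^sub>v v = v" if q: "q \<in> label_stabilizer m \<kappa>" for q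
  proof -
    have qp: "q \<in> perms m" by (rule label_stabilizer_perms[OF q])
    have row0: "tab_row \<nu> i = 0" if "i \<in> shared m \<kappa>" for i
    proof (rule ccontr)
      assume "tab_row \<nu> i \<noteq> 0"
      moreover have "i \<in> {1..m}" using that by (simp add: shared_def)
      ultimately have "i \<in> ?S" using lower_rows(2)[OF \<nu>] by blast
      with that disj show False by blast
    qed
    have "tab_row \<nu> (q i) = tab_row \<nu> i" for i
      using label_stabilizer_moves[OF q, of i] row0 by (cases "q i = i") simp_all
    then have "q \<in> label_stabilizer m (tab_row \<nu>)" using qp by (simp add: label_stabilizer_def)
    then have "translate q ?c1 = ?c1"
      using young_row_invariant[of q \<nu>] m conv_delta_left[OF qp] by simp
    then show ?thesis
      unfolding v_def Fhom[OF coord_carrier qp] using specht_coord[of q \<nu>, OF _ c(1)] qp m by simp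
  qed
  have w_fixed: "\<sigma> p *\<^sub>v w = w" if p: "p \<in> label_stabilizer m (tab_col \<nu>)" for p
  proof -
    have pp: "p \<in> perms m" by (rule label_stabilizer_perms[OF p])
    have "pinv g \<circ> p \<circ> g \<in> label_stabilizer m (tab_row \<mu>)"
    proof (rule conj_in_label_stabilizer[OF g pp])
      fix i assume i: "i \<in> {1..m}" "p i \<noteq> i"
      show "tab_row \<mu> (pinv g i) = 0"
      proof (rule ccontr)
        assume "tab_row \<mu> (pinv g i) \<noteq> 0"
        then have "pinv g i \<in> ?T" using lower_rows(2)[OF \<mu>] perms_image[OF perms_inv[OF g] i(1)] by blast
        then have "g (pinv g i) \<in> g ` ?T" by (rule imageI)
        then have "i \<in> g ` ?T" using g by simp
        moreover have "i \<in> ?S" by (rule label_stabilizer_moves(1)[OF p i(2)])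
        ultimately show False using gT by blast
      qed
    qed
    then have "translate (pinv g \<circ> p \<circ> g) (young_symmetrizer \<mu>) = young_symmetrizer \<mu>"
      using young_row_invariant[of "pinv g \<circ> p \<circ> g" \<mu>] m conv_delta_left label_stabilizer_perms by metis
    then have "translate p ?c2 = ?c2" by (rule translate_conj[OF g pp])
    then show ?thesis
      unfolding w_def Ghom[OF coord_carrier pp] using specht_coord[of p \<mu>, OF _ c(2)] pp m by simp
  qed
  define w' where "w' = act m e \<sigma> b2 *\<^sub>v w"
  have w': "w' \<in> carrier_vec e" unfolding w'_def by (rule mult_mat_vec_carrier[OF act_carrier w])
  have w'_fixed: "\<sigma> p *\<^sub>v w' = w'" if p: "p \<in> label_stabilizer m (tab_col \<nu>)" for p
  proof -
    have pp: "p \<in> perms m" by (rule label_stabilizer_perms[OF p])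
    have "\<sigma> p *\<^sub>v w' = act m e \<sigma> (conv m (delta p) b2) *\<^sub>v w"
      unfolding w'_def act_conv_vec[OF R(2) w] act_delta[OF R(2) pp] ..
    also have "\<dots> = act m e \<sigma> (conv m b2 (delta p)) *\<^sub>v w"
      unfolding b2_def antisymz_commute[OF p disj(1)] ..
    also have "\<dots> = w'"
      unfolding act_conv_vec[OF R(2) w] act_delta[OF R(2) pp] w_fixed[OF p] w'_def ..
    finally show ?thesis .
  qed
  have nz1: "act m d \<rho> b1 *\<^sub>v v \<noteq> 0\<^sub>v d"
  proof
    assume z: "act m d \<rho> b1 *\<^sub>v v = 0\<^sub>v d"
    have "act m d \<rho> b1 *\<^sub>v v = F *\<^sub>v (act m ?n1 (specht \<nu>) b1 *\<^sub>v coord \<nu> ?c1)"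
      unfolding v_def by (rule intertwiner_act[OF R(1) rep_of_dim_specht[OF m(1)] F Fhom[OF coord_carrier] coord_carrier])
    also have "\<dots> = F *\<^sub>v coord \<nu> (conv m b1 ?c1)" by (simp only: act_specht_coord[OF c(1) m(1)])
    finally have "coord \<nu> (conv m b1 ?c1) = 0\<^sub>v ?n1" using Finj[OF coord_carrier] z by simp
    moreover have "conv m b1 ?c1 \<in> specht_module \<nu>" using specht_left_ideal[OF c(1)] m by simp
    ultimately have "conv m b1 ?c1 = comb \<nu> (coord \<nu> 0)" using comb_coord coord_zero by metis
    also have "\<dots> = 0" by (rule comb_coord[OF specht_module_subspace(3)])
    finally show False using col_row_col_nonzero[of \<nu>] m by (simp add: b1_def)
  qed
  have nz2: "w' \<noteq> 0\<^sub>v e"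
  proof
    assume z: "w' = 0\<^sub>v e"
    have "w' = G *\<^sub>v (act m ?n2 (specht \<mu>) b2 *\<^sub>v coord \<mu> ?c2)"
      unfolding w'_def w_def by (rule intertwiner_act[OF R(2) rep_of_dim_specht[OF m(2)] G Ghom[OF coord_carrier] coord_carrier])
    also have "\<dots> = G *\<^sub>v coord \<mu> (conv m b2 ?c2)" by (simp only: act_specht_coord[OF c(2) m(2)])
    finally have "coord \<mu> (conv m b2 ?c2) = 0\<^sub>v ?n2" using Ginj[OF coord_carrier] z by simp
    moreover have "conv m b2 ?c2 \<in> specht_module \<mu>" using specht_left_ideal[OF c(2)] m by simp
    ultimately have "conv m b2 ?c2 = comb \<mu> (coord \<mu> 0)" using comb_coord coord_zero by metis
    also have "\<dots> = 0" by (rule comb_coord[OF specht_module_subspace(3)])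
    finally have 0: "conv m b2 ?c2 = 0" .
    have "conv m b2 ?c2 = conv m (conv m b2 (delta g)) (young_symmetrizer \<mu>)"
      by (simp only: conv_assoc conv_delta_left[OF g])
    also have "\<dots> = conv m (delta g) (conv m (antisymz m (tab_col \<mu>)) (young_symmetrizer \<mu>))"
      unfolding b2_def \<kappa>_def antisymz_conj[OF g] conv_assoc ..
    finally have "conv m (delta (pinv g)) (conv m (delta g) (conv m (antisymz m (tab_col \<mu>)) (young_symmetrizer \<mu>))) = 0"
      using 0 by (simp only: conv_linear)
    then have "conv m (antisymz m (tab_col \<mu>)) (young_symmetrizer \<mu>) = 0"
      using g conv_delta_delta[OF perms_inv[OF g] g] by (simp flip: conv_assoc)
    then show False using col_row_col_nonzero[of \<mu>] m by simp
  qed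
  have "act m (d * e) (tensor \<rho> \<sigma>) (conv m b1 b2) *\<^sub>v kron_vec v w =
      act m (d * e) (tensor \<rho> \<sigma>) b1 *\<^sub>v (act m (d * e) (tensor \<rho> \<sigma>) b2 *\<^sub>v kron_vec v w)"
    by (rule act_conv_vec[OF rep_of_dim_tensor[OF R] kron_vec_carrier[OF v w]])
  also have "act m (d * e) (tensor \<rho> \<sigma>) b2 *\<^sub>v kron_vec v w = kron_vec v w'"
    unfolding w'_def by (rule act_tensor_right[OF R v w]) (auto simp: b2_def antisymz_def v_fixed split: if_splits)
  also have "act m (d * e) (tensor \<rho> \<sigma>) b1 *\<^sub>v kron_vec v w' = kron_vec (act m d \<rho> b1 *\<^sub>v v) w'"
    by (rule act_tensor_left[OF R v w']) (auto simp: b1_def antisymz_def w'_fixed split: if_splits)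
  finally have "kron_vec (act m d \<rho> b1 *\<^sub>v v) w' = 0\<^sub>v (d * e)"
    unfolding zero zero_mat_mult_vec[OF kron_vec_carrier[OF v w]] by simp
  then show False
    using kron_vec_nonzero[OF mult_mat_vec_carrier[OF act_carrier v] nz1 w' nz2] by blast
qed

text \<open>Constituents of maximal weight in the two factors give the lower bound.\<close>

theorem rep_weight_tensor_eq:
  assumes R: "rep_of_dim m d \<rho>" "rep_of_dim m e \<sigma>"
    and large: "2 * (rep_weight m \<rho> + rep_weight m \<sigma>) \<le> ereal (real m)"
  shows "rep_weight m (tensor \<rho> \<sigma>) = rep_weight m \<rho> + rep_weight m \<sigma>"
proof (cases "d = 0 \<or> e = 0")
  case True
  then have t: "rep_weight m (tensor \<rho> \<sigma>) = - \<infinity>"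
    using rep_weight_minus_infinity_iff[OF rep_of_dim_tensor[OF R]] by simp
  have fin: "rep_weight m \<rho> \<noteq> \<infinity>" "rep_weight m \<sigma> \<noteq> \<infinity>"
    using rep_weight_attained[OF R(1)] rep_weight_minus_infinity_iff[OF R(1)]
      rep_weight_attained[OF R(2)] rep_weight_minus_infinity_iff[OF R(2)] by force+
  have "rep_weight m \<rho> = - \<infinity> \<or> rep_weight m \<sigma> = - \<infinity>"
    using True rep_weight_minus_infinity_iff[OF R(1)] rep_weight_minus_infinity_iff[OF R(2)] by blast
  then show ?thesis using t fin by auto
next
  case False
  then have ne: "d \<noteq> 0" "e \<noteq> 0" by auto
  obtain \<nu>s \<nu> where \<nu>: "decomposition m \<rho> \<nu>s" "\<nu> \<in> set \<nu>s" "rep_weight m \<rho> = ereal (real (partition_weight \<nu>))"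
    using rep_weight_attained[OF R(1) ne(1)] by blast
  obtain \<mu>s \<mu> where \<mu>: "decomposition m \<sigma> \<mu>s" "\<mu> \<in> set \<mu>s" "rep_weight m \<sigma> = ereal (real (partition_weight \<mu>))"
    using rep_weight_attained[OF R(2) ne(2)] by blast
  let ?w = "partition_weight \<nu> + partition_weight \<mu>"
  have "ereal (real (2 * ?w)) \<le> ereal (real m)" using large \<nu>(3) \<mu>(3) by simp
  then have le: "2 * ?w \<le> m" by (simp only: ereal_less_eq of_nat_le_iff)
  note nfs = tensor_lower_bound[OF R \<nu>(1,2) \<mu>(1,2) le]
  note Rt = rep_of_dim_tensor[OF R]
  obtain w where w: "rep_weight m (tensor \<rho> \<sigma>) = ereal (real w)"
    using rep_weight_attained[OF Rt] ne by auto
  have "?w \<le> w"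
  proof (rule ccontr)
    assume "\<not> ?w \<le> w"
    then have "m + 1 - ?w \<le> m - w" using le by linarith
    moreover have "fixed_spanned m (d * e) (tensor \<rho> \<sigma>) (m - w)"
      using rep_weight_le_iff[OF Rt, of w] w by simp
    ultimately show False using nfs fixed_spanned_mono by blast
  qed
  moreover have "ereal (real w) \<le> ereal (real ?w)"
    using rep_weight_tensor_le[OF R] w \<nu>(3) \<mu>(3) by simp
  then have "w \<le> ?w" by (simp only: ereal_less_eq of_nat_le_iff)
  ultimately show ?thesis using w \<nu>(3) \<mu>(3) by simp
qed

lemma rep_weight_specht:
  assumes \<nu>: "partition_of m \<nu>"
  shows "rep_weight m (specht \<nu>) = ereal (real (partition_weight \<nu>))"
proof (rule antisym)
  have R: "rep_of_dim m (specht_dim \<nu>) (specht \<nu>)" using \<nu> by (intro rep_of_dim_specht) (simp add: partition_of_def)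
  show "rep_weight m (specht \<nu>) \<le> ereal (real (partition_weight \<nu>))"
    unfolding rep_weight_le_iff[OF R] fixed_spanned_specht[OF \<nu>] using partition_weight_eq[OF \<nu>] by simp
  have "similar_mat_wit (specht \<nu> g) (specht_sum [\<nu>] g) (1\<^sub>m (specht_dim \<nu>)) (1\<^sub>m (specht_dim \<nu>))" for g
    unfolding direct_sum_def list.map diag_block_mat_singleton by (rule similar_mat_wit_refl[OF specht_carrier])
  then have "rep_iso m (specht \<nu>) (specht_sum [\<nu>])" unfolding rep_iso_def by blast
  then have "decomposition m (specht \<nu>) [\<nu>]" using \<nu> by (simp add: decomposition_def)
  then show "ereal (real (partition_weight \<nu>)) \<le> rep_weight m (specht \<nu>)"
    unfolding rep_weight_decompositions
    by (intro Sup_upper CollectI exI[of _ \<nu>] exI[of _ "[\<nu>]"] conjI refl) auto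
qed

lemma rep_weight_tensor_specht_padded:
  assumes "is_partition \<nu>" "is_partition \<mu>" "m \<ge> 2 * (sum_list \<nu> + sum_list \<mu>)"
  shows "rep_weight m (tensor (specht (padded \<nu> m)) (specht (padded \<mu> m))) = ereal (real (sum_list \<nu> + sum_list \<mu>))"
proof -
  have hd_le: "(if \<kappa> = [] then 0 else hd \<kappa>) \<le> sum_list \<kappa>" for \<kappa> :: "nat list"
    by (cases \<kappa>) auto
  have ge: "m \<ge> sum_list \<nu> + (if \<nu> = [] then 0 else hd \<nu>)" "m \<ge> sum_list \<mu> + (if \<mu> = [] then 0 else hd \<mu>)"
    using hd_le[of \<nu>] hd_le[of \<mu>] assms(3)[unfolded distrib_left] by linarith+
  note p = partition_of_padded[OF assms(1) ge(1)] partition_of_padded[OF assms(2) ge(2)]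
  note w = rep_weight_specht[OF p(1), unfolded partition_weight_padded[OF assms(1) ge(1)]]
    rep_weight_specht[OF p(2), unfolded partition_weight_padded[OF assms(2) ge(2)]]
  have "rep_weight m (tensor (specht (padded \<nu> m)) (specht (padded \<mu> m))) =
      rep_weight m (specht (padded \<nu> m)) + rep_weight m (specht (padded \<mu> m))"
  proof (rule rep_weight_tensor_eq)
    show "rep_of_dim m (specht_dim (padded \<nu> m)) (specht (padded \<nu> m))"
      "rep_of_dim m (specht_dim (padded \<mu> m)) (specht (padded \<mu> m))"
      using p by (auto intro!: rep_of_dim_specht simp: partition_of_def)
    have "ereal (real (2 * (sum_list \<nu> + sum_list \<mu>))) \<le> ereal (real m)"
      using assms(3) by (simp only: ereal_less_eq of_nat_le_iff)
    then show "2 * (rep_weight m (specht (padded \<nu> m)) + rep_weight m (specht (padded \<mu> m))) \<le> ereal (real m)"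
      unfolding w by simp
  qed
  then show ?thesis unfolding w by simp
qed

section \<open>Traces\<close>

definition trace_of :: "nat \<Rightarrow> rat mat \<Rightarrow> rat" where
  "trace_of d A = (\<Sum>i<d. A $$ (i, i))"

lemma character_eq_trace: "\<rho> g \<in> carrier_mat d d \<Longrightarrow> character \<rho> g = trace_of d (\<rho> g)"
  by (simp add: character_def trace_of_def carrier_matD)

lemma trace_mult_commute:
  assumes "A \<in> carrier_mat d e" "B \<in> carrier_mat e d"
  shows "trace_of d (A * B) = trace_of e (B * A)"
proof -
  have "trace_of d (A * B) = (\<Sum>i<d. \<Sum>k<e. A $$ (i, k) * B $$ (k, i))"
    unfolding trace_of_def by (rule sum.cong) (use mult_mat_index[OF assms] in auto)
  also have "\<dots> = (\<Sum>k<e. \<Sum>i<d. B $$ (k, i) * A $$ (i, k))"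
    by (subst sum.swap) (simp only: mult.commute)
  also have "\<dots> = trace_of e (B * A)"
    unfolding trace_of_def by (rule sum.cong) (use mult_mat_index[OF assms(2,1)] in auto)
  finally show ?thesis .
qed

lemma trace_act:
  assumes R: "rep_of_dim m d \<rho>"
  shows "trace_of d (act m d \<rho> x) = (\<Sum>g\<in>perms m. x g * character \<rho> g)"
proof -
  have "trace_of d (act m d \<rho> x) = (\<Sum>i<d. \<Sum>g\<in>perms m. x g * \<rho> g $$ (i, i))"
    by (simp add: trace_of_def act_def)
  also have "\<dots> = (\<Sum>g\<in>perms m. \<Sum>i<d. x g * \<rho> g $$ (i, i))" by (rule sum.swap)
  also have "\<dots> = (\<Sum>g\<in>perms m. x g * character \<rho> g)"
    by (rule sum.cong[OF refl])
      (simp add: character_eq_trace[OF rep_of_dimD(1)[OF R]] trace_of_def sum_distrib_left)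
  finally show ?thesis .
qed

lemma sum_lessThan_add: "(\<Sum>i<n + k. f i) = (\<Sum>i<n. f i) + (\<Sum>i<k. (f (n + i) :: rat))"
  for n k :: nat
  by (induction k) (simp_all add: add.assoc)

lemma character_specht_sum: "character (specht_sum \<mu>s) g = (\<Sum>\<mu>\<leftarrow>\<mu>s. character (specht \<mu>) g)"
proof (induction \<mu>s)
  case Nil
  show ?case by (simp add: character_def direct_sum_def)
next
  case (Cons \<nu> \<mu>s)
  let ?n = "specht_dim \<nu>" and ?N = "specht_sum_dim \<mu>s"
  have C: "specht \<nu> g \<in> carrier_mat ?n ?n" "specht_sum \<mu>s g \<in> carrier_mat ?N ?N"
    by (rule specht_carrier, rule specht_sum_carrier)
  have "character (specht_sum (\<nu> # \<mu>s)) g = trace_of (?n + ?N) (specht_sum (\<nu> # \<mu>s) g)"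
    by (rule character_eq_trace) (use specht_sum_carrier[of "\<nu> # \<mu>s" g] in \<open>simp only: specht_sum_dim_Cons\<close>)
  also have "\<dots> = (\<Sum>i<?n + ?N. if i < ?n then specht \<nu> g $$ (i, i) else specht_sum \<mu>s g $$ (i - ?n, i - ?n))"
    unfolding trace_of_def specht_sum_Cons
    by (rule sum.cong[OF refl]) (subst index_mat_four_block; simp add: carrier_matD[OF C(1)] carrier_matD[OF C(2)])
  also have "\<dots> = (\<Sum>i<?n. specht \<nu> g $$ (i, i)) + (\<Sum>i<?N. specht_sum \<mu>s g $$ (i, i))"
    by (subst sum_lessThan_add) simp
  also have "\<dots> = character (specht \<nu>) g + character (specht_sum \<mu>s) g"
    by (simp only: character_eq_trace[of "specht \<nu>" g, OF C(1)] character_eq_trace[of "specht_sum \<mu>s" g, OF C(2)] trace_of_def)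
  finally show ?case using Cons.IH by simp
qed

lemma character_decomposition:
  assumes R: "rep_of_dim m d \<rho>" and \<mu>s: "decomposition m \<rho> \<mu>s" and g: "g \<in> perms m"
  shows "character \<rho> g = (\<Sum>\<mu>\<leftarrow>\<mu>s. character (specht \<mu>) g)"
proof -
  have iso: "rep_iso m \<rho> (specht_sum \<mu>s)" using \<mu>s by (simp add: decomposition_def)
  obtain P Q where PQ: "\<And>g. g \<in> perms m \<Longrightarrow> similar_mat_wit (\<rho> g) (specht_sum \<mu>s g) P Q"
    by (rule rep_iso_dim[OF R iso]) blast
  have W: "Q * P = 1\<^sub>m d" "\<rho> g = P * specht_sum \<mu>s g * Q" "specht_sum \<mu>s g \<in> carrier_mat d d"
    "P \<in> carrier_mat d d" "Q \<in> carrier_mat d d"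
    using similar_mat_witD2[OF rep_of_dimD(1)[OF R g] PQ[OF g]] by auto
  have "trace_of d (\<rho> g) = trace_of d (Q * (P * specht_sum \<mu>s g))"
    unfolding W(2) by (rule trace_mult_commute[OF mult_carrier_mat[OF W(4,3)] W(5)])
  also have "Q * (P * specht_sum \<mu>s g) = specht_sum \<mu>s g"
    using assoc_mult_mat[OF W(5,4,3)] W(1,3) by simp
  finally show ?thesis
    using character_eq_trace[of \<rho> g d, OF rep_of_dimD(1)[OF R g]] character_eq_trace[of "specht_sum \<mu>s" g d, OF W(3)]
      character_specht_sum[of \<mu>s g] by simp
qed

lemma young_character_diff:
  assumes "partition_of m \<nu>" "partition_of m \<mu>" "\<nu> \<noteq> \<mu>"
  shows "(\<Sum>g\<in>perms m. young_symmetrizer \<nu> g * character (specht \<mu>) g) = 0"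
proof -
  let ?n = "specht_dim \<mu>" and ?c = "young_symmetrizer \<nu>"
  have m: "sum_list \<mu> = m" using assms by (simp add: partition_of_def)
  have "act m ?n (specht \<mu>) ?c = 0\<^sub>m ?n ?n"
  proof (rule eq_mat_of_vecs[OF act_carrier zero_carrier_mat])
    fix v :: "rat vec" assume v: "v \<in> carrier_vec ?n"
    obtain y where y: "comb \<mu> v = conv m y (young_symmetrizer \<mu>)"
      using comb_in[of \<mu> v] specht_module_iff m by auto
    have "act m ?n (specht \<mu>) ?c *\<^sub>v v = coord \<mu> (conv m ?c (comb \<mu> v))"
      using act_specht_coord[OF comb_in m, of ?c v] coord_comb[OF v] by simp
    also have "\<dots> = 0\<^sub>v ?n" unfolding y young_conv_diff[OF assms] by (rule coord_zero)
    finally show "act m ?n (specht \<mu>) ?c *\<^sub>v v = 0\<^sub>m ?n ?n *\<^sub>v v" using zero_mat_mult_vec[OF v] by simp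
  qed
  then have "trace_of ?n (act m ?n (specht \<mu>) ?c) = 0" by (simp add: trace_of_def)
  then show ?thesis using trace_act[OF rep_of_dim_specht[OF m]] by simp
qed

text \<open>The image of \<open>c\<^sub>\<nu>\<close> on \<open>V\<^sub>\<nu>\<close> is the line spanned by \<open>c\<^sub>\<nu>\<close>, hence its trace is the nonzero scalar \<open>s\<close> with
  \<open>c\<^sub>\<nu> c\<^sub>\<nu> = s c\<^sub>\<nu>\<close>.\<close>

lemma young_character_same:
  assumes \<nu>: "partition_of m \<nu>"
  shows "(\<Sum>g\<in>perms m. young_symmetrizer \<nu> g * character (specht \<nu>) g) \<noteq> 0"
proof -
  let ?n = "specht_dim \<nu>" and ?c = "young_symmetrizer \<nu>" and ?b = "\<lambda>j. specht_basis \<nu> ! j"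
  have m: "sum_list \<nu> = m" using \<nu> by (simp add: partition_of_def)
  have "\<exists>s. conv m ?c x = gscale s ?c" if "x \<in> specht_module \<nu>" for x
    using that young_conv_young[OF \<nu>] specht_module_iff[of x \<nu>] m by auto
  then obtain s where s: "\<And>x. x \<in> specht_module \<nu> \<Longrightarrow> conv m ?c x = gscale (s x) ?c" by metis
  have col: "act m ?n (specht \<nu>) ?c $$ (j, j) = s (?b j) * coord \<nu> ?c $ j" if j: "j < ?n" for j
  proof -
    have b: "?b j \<in> specht_module \<nu>" by (rule specht_basis_nth[OF j])
    have unit: "coord \<nu> (?b j) = unit_vec ?n j"
      using j specht_basis[of \<nu>]
      by (intro eq_vecI) (auto simp: coord_def galg.representation_basis specht_dim_def nth_eq_iff_index_eq)
    have "act m ?n (specht \<nu>) ?c *\<^sub>v unit_vec ?n j = s (?b j) \<cdot>\<^sub>v coord \<nu> ?c"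
      using act_specht_coord[OF b m, of ?c] s[OF b] coord_linear(2)[OF young_in_specht young_in_specht] unit by simp
    then have "(act m ?n (specht \<nu>) ?c *\<^sub>v unit_vec ?n j) $ j = s (?b j) * coord \<nu> ?c $ j"
      using j by (simp add: carrier_vecD[OF coord_carrier])
    then show ?thesis using j by simp
  qed
  obtain t where t: "t \<noteq> 0" "conv m ?c ?c = gscale t ?c" using young_square[OF \<nu>] by blast
  have "conv m ?c ?c = conv m ?c (\<Sum>j<?n. gscale (coord \<nu> ?c $ j) (?b j))"
    using comb_coord[OF young_in_specht, of \<nu>] by (simp add: comb_def)
  also have "\<dots> = (\<Sum>j<?n. gscale (coord \<nu> ?c $ j * s (?b j)) ?c)"
    unfolding conv_sum by (rule sum.cong[OF refl]) (simp add: conv_linear s[OF specht_basis_nth] gscale_simps(1))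
  also have "\<dots> = gscale (\<Sum>j<?n. coord \<nu> ?c $ j * s (?b j)) ?c" by (simp add: galg.scale_sum_left)
  finally have "gscale t ?c = gscale (\<Sum>j<?n. coord \<nu> ?c $ j * s (?b j)) ?c" unfolding t(2) .
  from fun_cong[OF this, of id] have "t = (\<Sum>j<?n. coord \<nu> ?c $ j * s (?b j))"
    by (simp add: gscale_def young_symmetrizer_id)
  also have "\<dots> = trace_of ?n (act m ?n (specht \<nu>) ?c)"
    unfolding trace_of_def by (rule sum.cong[OF refl]) (simp add: col mult.commute)
  finally show ?thesis using t(1) trace_act[OF rep_of_dim_specht[OF m], of ?c] by simp
qed

text \<open>The trace of \<open>c\<^sub>\<nu>\<close> is additive over the constituents, vanishes on \<open>V\<^sub>\<mu>\<close> for \<open>\<mu> \<noteq> \<nu>\<close>, and is the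
  same nonzero number on each copy of \<open>V\<^sub>\<nu>\<close>.\<close>

lemma young_character_constituent:
  assumes R: "rep_of_dim m d \<rho>" and \<mu>s: "decomposition m \<rho> \<mu>s" and \<nu>: "\<nu> \<in> set \<mu>s"
  shows "(\<Sum>g\<in>perms m. young_symmetrizer \<nu> g * character \<rho> g) \<noteq> 0"
proof -
  let ?s = "\<Sum>g\<in>perms m. young_symmetrizer \<nu> g * character (specht \<nu>) g"
  have p: "partition_of m \<mu>" if "\<mu> \<in> set \<mu>s" for \<mu> using \<mu>s that by (simp add: decomposition_def)
  have "(\<Sum>g\<in>perms m. young_symmetrizer \<nu> g * character \<rho> g) =
      (\<Sum>g\<in>perms m. \<Sum>\<mu>\<leftarrow>\<mu>s. young_symmetrizer \<nu> g * character (specht \<mu>) g)"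
    by (rule sum.cong[OF refl]) (simp add: character_decomposition[OF R \<mu>s] sum_list_const_mult)
  also have "\<dots> = (\<Sum>\<mu>\<leftarrow>\<mu>s. \<Sum>g\<in>perms m. young_symmetrizer \<nu> g * character (specht \<mu>) g)"
    by (induction \<mu>s) (simp_all add: sum.distrib)
  also have "\<dots> = (\<Sum>\<mu>\<leftarrow>\<mu>s. if \<mu> = \<nu> then ?s else 0)"
    using young_character_diff[OF p[OF \<nu>] p] by (intro arg_cong[of _ _ sum_list] map_cong) auto
  also have "\<dots> = of_nat (count_list \<mu>s \<nu>) * ?s"
    by (induction \<mu>s) (simp_all add: algebra_simps)
  finally show ?thesis
    using young_character_same[OF p[OF \<nu>]] \<nu> count_list_0_iff[of \<mu>s \<nu>] by simp
qed

section \<open>Cycles as relations\<close>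

definition graph_on :: "nat set \<Rightarrow> (nat \<Rightarrow> nat) \<Rightarrow> (nat \<times> nat) set" where
  "graph_on A g = (\<lambda>x. (x, g x)) ` A"

text \<open>A cycle of length \<open>i\<close> on points of \<open>{1..m}\<close>, as the set of pairs of a point and its image. That \<open>L\<close> is a
  cycle of \<open>g\<close> then means \<open>agrees L g\<close>, a condition on the values of \<open>g\<close> at \<open>i\<close> points.\<close>

definition cycle_graphs :: "nat \<Rightarrow> nat \<Rightarrow> (nat \<times> nat) set set" where
  "cycle_graphs m i = {graph_on (orbit p x) p | p x. p \<in> perms m \<and> x \<in> {1..m} \<and> card (orbit p x) = i}"

definition agrees :: "(nat \<times> nat) set \<Rightarrow> (nat \<Rightarrow> nat) \<Rightarrow> bool" where
  "agrees L g \<longleftrightarrow> (\<forall>(x, y)\<in>L. g x = y)"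

lemma graph_on_fst [simp]: "fst ` graph_on A g = A"
  by (force simp: graph_on_def)

lemma graph_on_inj: "graph_on A g = graph_on B g' \<Longrightarrow> A = B"
  by (metis graph_on_fst)

lemma card_graph_on: "card (graph_on A g) = card A"
  unfolding graph_on_def by (rule card_image) (auto simp: inj_on_def)

lemma orbit_image:
  assumes "p \<in> perms m"
  shows "p ` orbit p x = orbit p x"
proof
  show "p ` orbit p x \<subseteq> orbit p x" by (auto intro: orbit.step)
  show "orbit p x \<subseteq> p ` orbit p x"
  proof
    fix y assume "y \<in> orbit p x"
    then show "y \<in> p ` orbit p x"
      by (cases rule: orbit.cases) (use perms_self_in_orbit[OF assms] in auto)
  qed
qed

lemma cycle_graph_facts:
  assumes "L \<in> cycle_graphs m i"
  shows "card L = i" "snd ` L = fst ` L" "fst ` L \<subseteq> {1..m}" "finite L"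
proof -
  obtain p x where px: "L = graph_on (orbit p x) p" "p \<in> perms m" "x \<in> {1..m}" "card (orbit p x) = i"
    using assms by (auto simp: cycle_graphs_def)
  show "card L = i" using px by (simp add: card_graph_on)
  have "snd ` L = p ` orbit p x" unfolding px(1) graph_on_def by (simp add: image_image)
  then show "snd ` L = fst ` L" using orbit_image[OF px(2)] px(1) by simp
  show sub: "fst ` L \<subseteq> {1..m}" using perms_orbit_subset[OF px(2,3)] px(1) by simp
  then have "finite (orbit p x)" using px(1) finite_subset by auto
  then show "finite L" unfolding px(1) graph_on_def by simp
qed

lemma finite_cycle_graphs [simp]: "finite (cycle_graphs m i)"
proof (rule finite_subset)
  show "cycle_graphs m i \<subseteq> Pow ({1..m} \<times> {1..m})"
  proof
    fix L assume L: "L \<in> cycle_graphs m i"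
    have "L \<subseteq> fst ` L \<times> snd ` L" by force
    then show "L \<in> Pow ({1..m} \<times> {1..m})" using cycle_graph_facts(2,3)[OF L] by blast
  qed
qed simp

lemma agreeing_cycle_graph:
  assumes L: "L \<in> cycle_graphs m i" and ag: "agrees L g"
  shows "\<exists>x\<in>{1..m}. L = graph_on (orbit g x) g"
proof -
  obtain p x where px: "L = graph_on (orbit p x) p" "p \<in> perms m" "x \<in> {1..m}"
    using L by (auto simp: cycle_graphs_def)
  have eq: "g y = p y" if "y \<in> orbit p x" for y
    using ag that unfolding px(1) agrees_def graph_on_def by auto
  have "orbit g x = orbit p x" by (rule orbit_cong[OF perms_self_in_orbit[OF px(2)] eq])
  moreover have "graph_on (orbit p x) p = graph_on (orbit p x) g" unfolding graph_on_def using eq by auto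
  ultimately have "L = graph_on (orbit g x) g" using px(1) by simp
  then show ?thesis using px(3) by blast
qed

lemma cycle_count_eq:
  assumes g: "g \<in> perms m"
  shows "of_nat (cycle_count m g i) = (\<Sum>L\<in>cycle_graphs m i. if agrees L g then 1 else (0::rat))"
proof -
  have "bij_betw (\<lambda>C. graph_on C g) {C \<in> orbit g ` {1..m}. card C = i} {L\<in>cycle_graphs m i. agrees L g}"
    unfolding bij_betw_def
  proof
    show "inj_on (\<lambda>C. graph_on C g) {C \<in> orbit g ` {1..m}. card C = i}"
      by (rule inj_onI) (rule graph_on_inj)
    show "(\<lambda>C. graph_on C g) ` {C \<in> orbit g ` {1..m}. card C = i} = {L\<in>cycle_graphs m i. agrees L g}"
    proof
      show "(\<lambda>C. graph_on C g) ` {C \<in> orbit g ` {1..m}. card C = i} \<subseteq> {L\<in>cycle_graphs m i. agrees L g}"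
      proof
        fix L assume "L \<in> (\<lambda>C. graph_on C g) ` {C \<in> orbit g ` {1..m}. card C = i}"
        then obtain x where x: "x \<in> {1..m}" "card (orbit g x) = i" "L = graph_on (orbit g x) g" by blast
        then have "L \<in> cycle_graphs m i" unfolding cycle_graphs_def using g by blast
        moreover have "agrees L g" unfolding x(3) agrees_def graph_on_def by auto
        ultimately show "L \<in> {L\<in>cycle_graphs m i. agrees L g}" by blast
      qed
      show "{L\<in>cycle_graphs m i. agrees L g} \<subseteq> (\<lambda>C. graph_on C g) ` {C \<in> orbit g ` {1..m}. card C = i}"
      proof
        fix L assume "L \<in> {L\<in>cycle_graphs m i. agrees L g}"
        then have L: "L \<in> cycle_graphs m i" "agrees L g" by auto
        obtain x where "x \<in> {1..m}" "L = graph_on (orbit g x) g" using agreeing_cycle_graph[OF L] by blast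
        moreover then have "card (orbit g x) = i" using cycle_graph_facts(1)[OF L(1)] card_graph_on by metis
        ultimately show "L \<in> (\<lambda>C. graph_on C g) ` {C \<in> orbit g ` {1..m}. card C = i}" by blast
      qed
    qed
  qed
  then have "cycle_count m g i = card {L\<in>cycle_graphs m i. agrees L g}"
    unfolding cycle_count_def by (rule bij_betw_same_card)
  moreover have "(\<Sum>L\<in>cycle_graphs m i. if agrees L g then 1 else (0::rat)) = of_nat (card {L\<in>cycle_graphs m i. agrees L g})"
    by (simp add: sum.If_cases Int_def)
  ultimately show ?thesis by simp
qed

text \<open>Lists of cycles with prescribed lengths. The cycles may coincide or overlap, as they must in the
  expansion of a product of cycle counts.\<close>

abbreviation cycle_families :: "nat \<Rightarrow> nat list \<Rightarrow> (nat \<times> nat) set list set" where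
  "cycle_families m ks \<equiv> listset (map (cycle_graphs m) ks)"

lemma set_Cons_image: "set_Cons A X = (\<lambda>(x, xs). x # xs) ` (A \<times> X)"
  by (auto simp: set_Cons_def)

lemma sum_set_Cons: "(\<Sum>zs\<in>set_Cons A X. F zs) = (\<Sum>x\<in>A. \<Sum>xs\<in>X. (F (x # xs) :: rat))"
proof -
  have "inj_on (\<lambda>(x, xs). x # xs) (A \<times> X)" by (auto simp: inj_on_def)
  then have "(\<Sum>zs\<in>set_Cons A X. F zs) = (\<Sum>(x, xs)\<in>A \<times> X. F (x # xs))"
    unfolding set_Cons_image by (subst sum.reindex) (simp_all add: case_prod_unfold)
  then show ?thesis by (simp add: sum.cartesian_product)
qed

lemma finite_cycle_families [simp]: "finite (cycle_families m ks)"
  by (induction ks) (simp_all add: set_Cons_image)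

lemma cycle_families_map_card: "Ls \<in> cycle_families m ks \<Longrightarrow> map card Ls = ks"
  by (induction ks arbitrary: Ls) (auto simp: set_Cons_def cycle_graph_facts(1))

lemma cycle_families_member: "Ls \<in> cycle_families m ks \<Longrightarrow> L \<in> set Ls \<Longrightarrow> \<exists>k. L \<in> cycle_graphs m k"
  by (induction ks arbitrary: Ls) (auto simp: set_Cons_def)

lemma prod_cycle_count:
  assumes g: "g \<in> perms m"
  shows "(\<Prod>k\<leftarrow>ks. of_nat (cycle_count m g k)) =
    (\<Sum>Ls\<in>cycle_families m ks. if agrees (\<Union>(set Ls)) g then 1 else (0::rat))"
proof (induction ks)
  case Nil
  show ?case by (simp add: agrees_def)
next
  case (Cons k ks)
  have ag: "agrees (L \<union> U) g \<longleftrightarrow> agrees L g \<and> agrees U g" for L U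
    unfolding agrees_def by (rule ball_Un)
  have "(\<Sum>Ls\<in>cycle_families m (k # ks). if agrees (\<Union>(set Ls)) g then 1 else (0::rat)) =
      (\<Sum>L\<in>cycle_graphs m k. \<Sum>Ls\<in>cycle_families m ks. if agrees (\<Union>(set (L # Ls))) g then 1 else 0)"
    by (simp only: list.map listset.simps sum_set_Cons)
  also have "\<dots> = (\<Sum>L\<in>cycle_graphs m k. \<Sum>Ls\<in>cycle_families m ks.
      (if agrees L g then 1 else 0) * (if agrees (\<Union>(set Ls)) g then 1 else 0))"
    by (intro sum.cong refl) (simp add: ag)
  also have "\<dots> = (\<Sum>L\<in>cycle_graphs m k. if agrees L g then 1 else 0) *
      (\<Sum>Ls\<in>cycle_families m ks. if agrees (\<Union>(set Ls)) g then 1 else 0)"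
    by (simp only: sum_product)
  finally show ?case using Cons.IH cycle_count_eq[OF g, of k] by simp
qed

section \<open>Monomials as lists of cycle lengths\<close>

text \<open>A monomial as the list of the indices of its variables, with repetition: the exponent at \<open>i\<close> belongs
  to \<open>X\<^bsub>i+1\<^esub>\<close>, which counts the cycles of length \<open>i + 1\<close>.\<close>

definition cycle_lengths :: "(nat \<Rightarrow>\<^sub>0 nat) \<Rightarrow> nat list" where
  "cycle_lengths t = concat (map (\<lambda>i. replicate (Poly_Mapping.lookup t i) (Suc i))
     (sorted_list_of_set (Poly_Mapping.keys t)))"

lemma prod_cycle_lengths:
  "(\<Prod>k\<leftarrow>cycle_lengths t. (x k :: rat)) = (\<Prod>i\<in>Poly_Mapping.keys t. x (Suc i) ^ Poly_Mapping.lookup t i)"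
proof -
  have "(\<Prod>k\<leftarrow>concat (map (\<lambda>i. replicate (f i) (Suc i)) js). x k) = (\<Prod>i\<leftarrow>js. x (Suc i) ^ f i)" for f js
    by (induction js) (simp_all add: prod_list_replicate map_replicate)
  then have "(\<Prod>k\<leftarrow>cycle_lengths t. x k) =
      (\<Prod>i\<leftarrow>sorted_list_of_set (Poly_Mapping.keys t). x (Suc i) ^ Poly_Mapping.lookup t i)"
    by (simp add: cycle_lengths_def)
  also have "\<dots> = (\<Prod>i\<in>set (sorted_list_of_set (Poly_Mapping.keys t)). x (Suc i) ^ Poly_Mapping.lookup t i)"
    by (rule prod.distinct_set_conv_list[symmetric]) simp
  finally show ?thesis by simp
qed

lemma count_cycle_lengths: "count (mset (cycle_lengths t)) (Suc i) = Poly_Mapping.lookup t i"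
proof -
  have "count (mset (concat (map (\<lambda>i. replicate (f i) (Suc i)) js))) (Suc i) = (if i \<in> set js then f i else 0)"
    if "distinct js" for f js
    using that by (induction js) auto
  then show ?thesis by (simp add: cycle_lengths_def in_keys_iff)
qed

lemma cycle_lengths_inj: "mset (cycle_lengths t) = mset (cycle_lengths t') \<Longrightarrow> t = t'"
  by (metis count_cycle_lengths poly_mapping_eqI)

lemma cycle_lengths_pos: "k \<in> set (cycle_lengths t) \<Longrightarrow> 0 < k"
  by (auto simp: cycle_lengths_def)

text \<open>The degree for which \<open>X\<^sub>i\<close> has degree \<open>i\<close>.\<close>

definition weighted_degree :: "(nat \<Rightarrow>\<^sub>0 nat) \<Rightarrow> nat" where
  "weighted_degree t = sum_list (cycle_lengths t)"

text \<open>A product of cycle counts of \<open>g\<close> is the number of lists of cycles of \<open>g\<close> of the given lengths.\<close>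

lemma eval_cpoly_cycle_count:
  assumes g: "g \<in> perms m"
  shows "eval_cpoly P (\<lambda>i. of_nat (cycle_count m g (Suc i))) =
    (\<Sum>t\<in>Poly_Mapping.keys P. Poly_Mapping.lookup P t *
      (\<Sum>Ls\<in>cycle_families m (cycle_lengths t). if agrees (\<Union>(set Ls)) g then 1 else 0))"
  unfolding eval_cpoly_def
  using prod_cycle_lengths[of "\<lambda>k. of_nat (cycle_count m g k)"] prod_cycle_count[OF g] by simp

lemma card_Union_cycle_family:
  assumes "Ls \<in> cycle_families m ks"
  shows "card (\<Union>(set Ls)) \<le> sum_list ks" "finite (\<Union>(set Ls))"
    "snd ` \<Union>(set Ls) = fst ` \<Union>(set Ls)" "fst ` \<Union>(set Ls) \<subseteq> {1..m}"
proof -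
  note mem = cycle_families_member[OF assms]
  have "card (\<Union>(set Ls)) \<le> sum_list (map card Ls)"
  proof (induction Ls)
    case (Cons L Ls)
    then show ?case using card_Un_le[of L "\<Union>(set Ls)"] by simp
  qed simp
  then show "card (\<Union>(set Ls)) \<le> sum_list ks" using cycle_families_map_card[OF assms] by simp
  show "finite (\<Union>(set Ls))" using mem cycle_graph_facts(4) by blast
  show "snd ` \<Union>(set Ls) = fst ` \<Union>(set Ls)"
    unfolding image_Union by (rule SUP_cong[OF refl]) (use mem cycle_graph_facts(2) in blast)
  show "fst ` \<Union>(set Ls) \<subseteq> {1..m}" using mem cycle_graph_facts(3) by blast
qed

section \<open>Upper bound for the weight\<close>

text \<open>If \<open>V\<^sub>\<nu>\<close> occurs, then \<open>c\<^sub>\<nu>\<close> has nonzero trace. The character is a combination of indicator functions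
  that constrain the values at no more than \<open>D\<close> points. For \<open>w(\<nu>) > D\<close> there remain more than \<open>\<nu>\<^sub>1\<close>
  unconstrained points, two of which lie in one column; exchanging them changes the sign of the
  coefficients of \<open>c\<^sub>\<nu>\<close> but not the indicator function.\<close>

lemma poly_character_upper:
  assumes R: "rep_of_dim m d \<rho>"
    and char: "\<And>g. g \<in> perms m \<Longrightarrow> character \<rho> g = eval_cpoly P (\<lambda>i. of_nat (cycle_count m g (Suc i)))"
    and deg: "\<And>t. t \<in> Poly_Mapping.keys P \<Longrightarrow> weighted_degree t \<le> D"
    and \<mu>s: "decomposition m \<rho> \<mu>s" and \<nu>s: "\<nu> \<in> set \<mu>s"
  shows "partition_weight \<nu> \<le> D"
proof (rule ccontr)
  assume lt: "\<not> partition_weight \<nu> \<le> D"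
  have \<nu>: "partition_of m \<nu>" using \<mu>s \<nu>s by (simp add: decomposition_def)
  have m: "sum_list \<nu> = m" using \<nu> by (simp add: partition_of_def)
  let ?c = "young_symmetrizer \<nu>"
  have c: "?c \<in> group_algebra m" using young_group_algebra[of \<nu>] m by simp
  have zero: "(\<Sum>g\<in>perms m. ?c g * (if agrees (\<Union>(set Ls)) g then 1 else 0)) = 0"
    if t: "t \<in> Poly_Mapping.keys P" and Ls: "Ls \<in> cycle_families m (cycle_lengths t)" for t Ls
  proof -
    let ?L = "\<Union>(set Ls)" and ?K = "{1..m} - fst ` \<Union>(set Ls)"
    note F = card_Union_cycle_family[OF Ls]
    have "card (fst ` ?L) \<le> D"
      using card_image_le[OF F(2), of fst] F(1) deg[OF t] by (simp add: weighted_degree_def)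
    moreover have "card ?K = m - card (fst ` ?L)" using F(2,4) by (simp add: card_Diff_subset)
    ultimately have "first_row \<nu> < card ?K" using lt partition_weight_eq[OF \<nu>] by linarith
    moreover have "tab_col \<nu> ` ?K \<subseteq> {1..first_row \<nu>}" using tab_col_range[OF \<nu>] by blast
    then have "card (tab_col \<nu> ` ?K) \<le> first_row \<nu>" using card_mono[of "{1..first_row \<nu>}"] by fastforce
    ultimately have "\<not> inj_on (tab_col \<nu>) ?K" using card_image[of "tab_col \<nu>" ?K] by linarith
    then obtain u v where uv: "u \<in> ?K" "v \<in> ?K" "u \<noteq> v" "tab_col \<nu> u = tab_col \<nu> v"
      unfolding inj_on_def by blast
    let ?t = "transpose u v"
    have st: "?t \<in> label_stabilizer m (tab_col \<nu>)"
      by (rule transpose_in_label_stabilizer[of u m v "tab_col \<nu>"]) (use uv in auto)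
    have tp: "?t \<in> perms m" by (rule label_stabilizer_perms[OF st])
    have alt: "?c (g \<circ> ?t) = - ?c g" for g
    proof -
      have "conv m ?c (delta ?t) = gscale (of_int (sign ?t)) ?c" using young_col_alternating[of ?t \<nu>] st m by simp
      from fun_cong[OF this, of g] have "?c (g \<circ> pinv ?t) = - ?c g"
        using uv(3) by (simp add: conv_delta_right[OF tp c] gscale_def sign_swap_id)
      moreover have "pinv ?t = ?t" by simp
      ultimately show ?thesis by simp
    qed
    have ag: "agrees ?L (g \<circ> ?t) \<longleftrightarrow> agrees ?L g" for g
    proof -
      have "(g \<circ> ?t) (fst z) = g (fst z)" if "z \<in> ?L" for z
      proof -
        have "fst z \<in> fst ` ?L" using that by (rule imageI)
        then have "fst z \<noteq> u" "fst z \<noteq> v" using uv by auto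
        then show ?thesis by (simp add: transpose_def)
      qed
      then show ?thesis unfolding agrees_def by (simp add: case_prod_unfold)
    qed
    let ?f = "\<lambda>g. ?c g * (if agrees ?L g then 1 else 0)"
    have "(\<Sum>g\<in>perms m. ?f g) = (\<Sum>g\<in>perms m. ?f (g \<circ> ?t))" by (rule sum_perms_right[OF tp, symmetric])
    also have "\<dots> = (\<Sum>g\<in>perms m. - ?f g)" by (rule sum.cong[OF refl]) (simp only: alt ag mult_minus_left)
    also have "\<dots> = - (\<Sum>g\<in>perms m. ?f g)" by (rule sum_negf)
    finally show ?thesis by simp
  qed
  have "(\<Sum>g\<in>perms m. ?c g * character \<rho> g) =
      (\<Sum>g\<in>perms m. \<Sum>t\<in>Poly_Mapping.keys P. \<Sum>Ls\<in>cycle_families m (cycle_lengths t).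
        Poly_Mapping.lookup P t * (?c g * (if agrees (\<Union>(set Ls)) g then 1 else 0)))"
    by (intro sum.cong refl)
      (simp only: char eval_cpoly_cycle_count sum_distrib_left mult.left_commute)
  also have "\<dots> = (\<Sum>t\<in>Poly_Mapping.keys P. \<Sum>g\<in>perms m. \<Sum>Ls\<in>cycle_families m (cycle_lengths t).
        Poly_Mapping.lookup P t * (?c g * (if agrees (\<Union>(set Ls)) g then 1 else 0)))"
    by (rule sum.swap)
  also have "\<dots> = (\<Sum>t\<in>Poly_Mapping.keys P. \<Sum>Ls\<in>cycle_families m (cycle_lengths t). \<Sum>g\<in>perms m.
        Poly_Mapping.lookup P t * (?c g * (if agrees (\<Union>(set Ls)) g then 1 else 0)))"
    by (rule sum.cong[OF refl], rule sum.swap)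
  also have "\<dots> = 0"
    by (rule sum.neutral, rule ballI, rule sum.neutral, rule ballI)
      (simp only: sum_distrib_left[symmetric] zero mult_zero_right)
  finally show False using young_character_constituent[OF R \<mu>s \<nu>s] by blast
qed

section \<open>Extracting the top coefficients\<close>

text \<open>The cycles in the list cover the \<open>D\<close> points, and their lengths sum up to \<open>D\<close>; so each cycle of \<open>f\<close>
  occurs exactly once.\<close>

lemma cycle_family_determines_type:
  assumes f: "f \<in> perms D" and Ls: "Ls \<in> cycle_families m ks"
    and U: "\<Union>(set Ls) = graph_on {1..D} f" and sum: "sum_list ks = D"
  shows "mset ks = orbit_sizes D f"
proof -
  let ?O = "orbit f ` {1..D}" and ?G = "\<lambda>C. graph_on C f"
  have inj: "inj_on ?G ?O" by (rule inj_onI) (rule graph_on_inj)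
  have sub: "L \<in> ?G ` ?O" if L: "L \<in> set Ls" for L
  proof -
    obtain k where k: "L \<in> cycle_graphs m k" using cycle_families_member[OF Ls L] by blast
    have LU: "L \<subseteq> graph_on {1..D} f" using L U by blast
    then have "agrees L f" unfolding agrees_def graph_on_def by auto
    then obtain x where x: "L = graph_on (orbit f x) f" using agreeing_cycle_graph[OF k] by blast
    have "x \<in> fst ` L" using x perms_self_in_orbit[OF f] by simp
    also have "\<dots> \<subseteq> fst ` graph_on {1..D} f" using LU by (rule image_mono)
    finally have "x \<in> {1..D}" by simp
    with x show ?thesis by blast
  qed
  have "?G C \<in> set Ls" if C: "C \<in> ?O" for C
  proof -
    obtain x where x: "x \<in> {1..D}" "C = orbit f x" using C by blast
    have "(x, f x) \<in> \<Union>(set Ls)" unfolding U graph_on_def using x(1) by blast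
    then obtain L where L: "L \<in> set Ls" "(x, f x) \<in> L" by blast
    obtain y where y: "L = graph_on (orbit f y) f" using sub[OF L(1)] by blast
    have "x \<in> fst ` L" using L(2) by force
    then have "x \<in> orbit f y" using y by simp
    then have "orbit f x = orbit f y" by (rule perms_orbit_eq[OF f])
    then show ?thesis using x y L(1) by simp
  qed
  then have set: "set Ls = ?G ` ?O" using sub by blast
  have part: "\<Union>?O = {1..D}" using perms_orbit_subset[OF f] perms_self_in_orbit[OF f] by blast
  have disj: "pairwise disjnt ?O"
    unfolding pairwise_def disjnt_def using perms_orbit_eq[OF f] by blast
  have finO: "finite C" if "C \<in> ?O" for C using that perms_orbit_subset[OF f] finite_subset by blast
  have "(\<Sum>L\<in>set Ls. card L) = (\<Sum>C\<in>?O. card C)"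
    unfolding set sum.reindex[OF inj] comp_def card_graph_on ..
  also have "\<dots> = card (\<Union>?O)" by (rule card_Union_disjoint[symmetric, OF disj finO])
  also have "\<dots> = D" unfolding part by simp
  finally have total: "(\<Sum>L\<in>set Ls. card L) = D" .
  have le: "mset_set (set Ls) \<subseteq># mset Ls"
    by (metis mset_set_set_mset_msubset set_mset_mset)
  have "mset Ls - mset_set (set Ls) = {#}"
  proof (rule ccontr)
    let ?M = "mset Ls - mset_set (set Ls)"
    assume "?M \<noteq> {#}"
    then obtain L where L: "L \<in># ?M" by blast
    then have "L \<in> set Ls" by (metis in_diffD set_mset_mset)
    then obtain C where C: "C \<in> ?O" "L = ?G C" using set by blast
    then have pos: "card L > 0" using finO[OF C(1)] orbit_nonempty[of f] by (auto simp: card_graph_on card_gt_0_iff)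
    have "(\<Sum>L\<in>#mset Ls. card L) = (\<Sum>L\<in>#mset_set (set Ls) + ?M. card L)" using le by simp
    also have "\<dots> = D + (\<Sum>L\<in>#?M. card L)" using total by (simp add: sum_unfold_sum_mset)
    finally have "sum_list (map card Ls) = D + (\<Sum>L\<in>#?M. card L)" by (simp add: sum_mset_sum_list flip: mset_map)
    then have "(\<Sum>L\<in>#?M. card L) = 0" using cycle_families_map_card[OF Ls] sum by simp
    with L pos show False by auto
  qed
  then have eqm: "mset Ls = mset_set (set Ls)" using le by (metis add_0 subset_mset.diff_add)
  have "mset ks = image_mset card (mset Ls)"
    using cycle_families_map_card[OF Ls] by (metis mset_map)
  also have "\<dots> = image_mset card (image_mset ?G (mset_set ?O))"
    unfolding eqm set image_mset_mset_set[OF inj] ..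
  also have "\<dots> = orbit_sizes D f"
    by (simp add: orbit_sizes_def image_mset.compositionality comp_def card_graph_on)
  finally show ?thesis .
qed

text \<open>One block of consecutive integers for each cycle.\<close>

lemma ex_perm_of_type:
  assumes "\<forall>k\<in>set ks. 0 < k" "sum_list ks \<le> m"
  shows "\<exists>f\<in>perms (sum_list ks). \<exists>Ls\<in>cycle_families m ks. \<Union>(set Ls) = graph_on {1..sum_list ks} f"
  using assms
proof (induction ks)
  case Nil
  then show ?case by (intro bexI[of _ id] bexI[of _ "[]"]) (simp_all add: graph_on_def)
next
  case (Cons k ks)
  let ?n = "sum_list ks"
  obtain f Ls where f: "f \<in> perms ?n" and Ls: "Ls \<in> cycle_families m ks"
    and U: "\<Union>(set Ls) = graph_on {1..?n} f" using Cons by auto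
  have k: "0 < k" using Cons.prems by simp
  define c where "c x = (if ?n < x \<and> x < ?n + k then Suc x else if x = ?n + k then Suc ?n else x)" for x
  let ?B = "{Suc ?n..?n + k}"
  have cB: "c permutes ?B"
  proof (rule inj_imp_permutes)
    show "inj_on c ?B" by (auto simp: inj_on_def c_def split: if_splits)
    show "c x \<in> ?B" if "x \<in> ?B" for x using that k by (auto simp: c_def)
    show "c x = x" if "x \<notin> ?B" for x using that k by (auto simp: c_def)
  qed simp
  have cp: "c \<in> perms (?n + k)" "c \<in> perms m"
    using Cons.prems(2) unfolding perms_def by (auto intro!: permutes_subset[OF cB])
  have pow: "(c ^^ j) (Suc ?n) = Suc ?n + j" if "j < k" for j
    using that by (induction j) (auto simp: c_def)
  have orb: "orbit c (Suc ?n) = ?B"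
  proof
    show "orbit c (Suc ?n) \<subseteq> ?B" by (rule permutes_orbit_subset[OF cB]) (use k in simp)
    show "?B \<subseteq> orbit c (Suc ?n)"
    proof
      fix x assume x: "x \<in> ?B"
      have "(c ^^ (x - Suc ?n)) (Suc ?n) \<in> orbit c (Suc ?n)"
        by (rule funpow_in_orbit[OF perms_self_in_orbit[OF cp(1)]])
      moreover have "x - Suc ?n < k" using x by auto
      ultimately show "x \<in> orbit c (Suc ?n)" using pow[of "x - Suc ?n"] x by simp
    qed
  qed
  have L: "graph_on ?B c \<in> cycle_graphs m k"
    unfolding cycle_graphs_def
  proof (intro CollectI exI[of _ c] exI[of _ "Suc ?n"] conjI)
    show "graph_on ?B c = graph_on (orbit c (Suc ?n)) c" using orb by simp
    show "Suc ?n \<in> {1..m}" using Cons.prems(2) k by simp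
    show "card (orbit c (Suc ?n)) = k" unfolding orb by simp
  qed (rule cp(2))
  have "f \<in> perms (?n + k)" using f unfolding perms_def by (auto intro: permutes_subset)
  then have fc: "f \<circ> c \<in> perms (sum_list (k # ks))" using perms_comp cp(1) by (simp add: add.commute)
  have fixes_f: "f x = x" if "x \<notin> {1..?n}" for x using f that unfolding perms_def by (auto intro: permutes_not_in)
  have 1: "graph_on ?B (f \<circ> c) = graph_on ?B c"
    unfolding graph_on_def
  proof (rule image_cong[OF refl])
    fix x assume "x \<in> ?B"
    then have "c x \<in> ?B" using permutes_in_image[OF cB] by blast
    then show "(x, (f \<circ> c) x) = (x, c x)" using fixes_f[of "c x"] by simp
  qed
  have 2: "graph_on {1..?n} (f \<circ> c) = graph_on {1..?n} f"
    unfolding graph_on_def by (rule image_cong[OF refl]) (use k in \<open>auto simp: c_def\<close>)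
  have "{1..sum_list (k # ks)} = ?B \<union> {1..?n}" by auto
  then have "graph_on {1..sum_list (k # ks)} (f \<circ> c) = graph_on ?B c \<union> graph_on {1..?n} f"
    using 1 2 by (simp only: graph_on_def image_Un)
  then have "\<Union>(set (graph_on ?B c # Ls)) = graph_on {1..sum_list (k # ks)} (f \<circ> c)" using U by simp
  moreover have "graph_on ?B c # Ls \<in> cycle_families m (k # ks)" using L Ls by (auto simp: set_Cons_def)
  ultimately show ?case using fc by blast
qed

text \<open>The labelling whose classes with more than one element are the pairs \<open>{i, i + D}\<close> for \<open>1 \<le> i \<le> D\<close>. Its
  antisymmetrizer is the product of \<open>1 - t\<close> over \<open>D\<close> disjoint transpositions.\<close>

definition pair_label :: "nat \<Rightarrow> nat \<Rightarrow> nat" where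
  "pair_label D x = (if D < x \<and> x \<le> 2 * D then x - D else x)"

text \<open>\<open>f\<close> on the first elements of the pairs; the second elements are exchanged with points outside the
  pairs, so that they cannot lie on a cycle inside the pairs.\<close>

definition pair_extension :: "nat \<Rightarrow> (nat \<Rightarrow> nat) \<Rightarrow> nat \<Rightarrow> nat" where
  "pair_extension D f x = (if x \<le> D then f x else if x \<le> 2 * D then x + D else if x \<le> 3 * D then x - D else x)"

lemma pair_extension_perms:
  assumes f: "f \<in> perms D" and "3 * D \<le> m"
  shows "pair_extension D f \<in> perms m"
proof -
  define s where "s x = (if x \<le> D then x else if x \<le> 2 * D then x + D else if x \<le> 3 * D then x - D else x)" for x
  have "s (s x) = x" for x by (auto simp: s_def)
  then have "inj_on s {1..m}" by (intro inj_on_inverseI[of _ s])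
  moreover have "s x \<in> {1..m}" if "x \<in> {1..m}" for x using that assms(2) by (auto simp: s_def)
  moreover have "s x = x" if "x \<notin> {1..m}" for x using that assms(2) by (auto simp: s_def)
  ultimately have "s permutes {1..m}" by (intro inj_imp_permutes) auto
  then have s: "s \<in> perms m" by (simp add: perms_def)
  have fm: "f \<in> perms m" using f assms(2) unfolding perms_def by (auto intro: permutes_subset)
  have "f x = x" if "\<not> x \<le> D" for x using f that unfolding perms_def by (auto intro: permutes_not_in)
  then have "pair_extension D f = f \<circ> s" by (auto simp: pair_extension_def s_def fun_eq_iff)
  then show ?thesis using perms_comp[OF fm s] by simp
qed

lemma pair_label_fixes:
  assumes q: "q \<in> label_stabilizer m (pair_label D)" and x: "2 * D < x"
  shows "q x = x"
proof (cases "x \<in> {1..m}")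
  case True
  have "pair_label D (q x) = x" using q True x by (simp add: label_stabilizer_def pair_label_def)
  then show ?thesis using x by (auto simp: pair_label_def split: if_splits)
next
  case False
  then show ?thesis using permutes_not_in[OF perms_permutes[OF label_stabilizer_perms[OF q]]] by blast
qed

lemma pair_label_cases:
  assumes "pair_label D y = j" "1 \<le> j" "j \<le> D"
  shows "y = j \<or> y = j + D"
  using assms by (auto simp: pair_label_def split: if_splits)

text \<open>As \<open>L\<close> has at most \<open>D\<close> elements, its range contains exactly one element of each pair and nothing
  else, and the same holds for its domain. Second elements of pairs are excluded because the
  extension moves them out of the pairs, to points fixed by \<open>q\<close>.\<close>

lemma agrees_pair_extension:
  assumes f: "f \<in> perms D" and le: "3 * D \<le> m"
    and q: "q \<in> label_stabilizer m (pair_label D)"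
    and L: "finite L" "snd ` L = fst ` L" "card L \<le> D"
    and hit: "\<And>i. i \<in> {1..D} \<Longrightarrow> i \<in> snd ` L \<or> i + D \<in> snd ` L"
    and ag: "agrees L (q \<circ> pair_extension D f)"
  shows "L = graph_on {1..D} f"
proof -
  let ?I = "snd ` L"
  have finI: "finite ?I" using L(1) by simp
  have "{1..D} \<subseteq> pair_label D ` ?I"
  proof
    fix i assume i: "i \<in> {1..D}"
    then have "pair_label D i = i" "pair_label D (i + D) = i" by (auto simp: pair_label_def)
    then show "i \<in> pair_label D ` ?I" using hit[OF i] by (metis image_eqI)
  qed
  moreover have cI: "card (pair_label D ` ?I) \<le> card ?I" by (rule card_image_le[OF finI])
  moreover have cL: "card ?I \<le> D" using card_image_le[OF L(1), of snd] L(3) by simp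
  ultimately have img: "pair_label D ` ?I = {1..D}"
    using card_seteq[of "pair_label D ` ?I" "{1..D}"] finI by simp
  then have "card (pair_label D ` ?I) = card ?I" using cI cL by simp
  then have injI: "inj_on (pair_label D) ?I" by (rule eq_card_imp_inj_on[OF finI])
  have range: "x \<in> {1..2 * D}" if "x \<in> ?I" for x
  proof -
    have "pair_label D x \<in> {1..D}" using img that by blast
    then show ?thesis by (auto simp: pair_label_def split: if_splits)
  qed
  have val: "q (pair_extension D f x) = z" if "(x, z) \<in> L" for x z
    using ag that unfolding agrees_def by auto
  have low: "x \<le> D" if x: "x \<in> ?I" for x
  proof (rule ccontr)
    assume "\<not> x \<le> D"
    then have xr: "D < x" "x \<le> 2 * D" using range[OF x] by auto
    obtain z where z: "(x, z) \<in> L" using x L(2) by force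
    have "q (x + D) = x + D" by (rule pair_label_fixes[OF q]) (use xr in simp)
    then have "z = x + D" using val[OF z] xr by (simp add: pair_extension_def)
    moreover have "z \<in> ?I" using z by force
    ultimately show False using range[of z] xr by auto
  qed
  have I: "?I = {1..D}"
  proof
    show "?I \<subseteq> {1..D}"
    proof
      fix b assume "b \<in> ?I"
      then show "b \<in> {1..D}" using low[of b] range[of b] by simp
    qed
    show "{1..D} \<subseteq> ?I"
    proof
      fix i assume i: "i \<in> {1..D}"
      have "i + D \<notin> ?I" using low[of "i + D"] i by auto
      then show "i \<in> ?I" using hit[OF i] by blast
    qed
  qed
  have pair: "z = f x" if xz: "(x, z) \<in> L" for x z
  proof -
    have "x \<in> fst ` L" "z \<in> snd ` L" using xz by force+
    then have x: "x \<in> {1..D}" and z: "z \<in> {1..D}" using I L(2) by auto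
    have fx: "f x \<in> {1..D}" using perms_image[OF f x] .
    have "pair_label D (q (f x)) = pair_label D (f x)" using q fx le by (simp add: label_stabilizer_def)
    then have "pair_label D (q (f x)) = f x" using fx by (simp add: pair_label_def)
    then have "q (f x) = f x \<or> q (f x) = f x + D" by (rule pair_label_cases) (use fx in auto)
    moreover have "q (f x) = z" using val[OF xz] x by (simp add: pair_extension_def)
    ultimately show ?thesis using z fx by auto
  qed
  show ?thesis
  proof
    show "L \<subseteq> graph_on {1..D} f"
    proof
      fix y assume y: "y \<in> L"
      then have "fst y \<in> {1..D}" using I L(2) by blast
      moreover have "y = (fst y, f (fst y))" using pair[of "fst y" "snd y"] y by (simp add: prod_eq_iff)
      ultimately show "y \<in> graph_on {1..D} f" unfolding graph_on_def by blast
    qed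
    show "graph_on {1..D} f \<subseteq> L"
    proof
      fix y assume "y \<in> graph_on {1..D} f"
      then obtain x where x: "x \<in> {1..D}" "y = (x, f x)" unfolding graph_on_def by blast
      then have "x \<in> fst ` L" using I L(2) by simp
      then obtain z where z: "(x, z) \<in> L" by force
      then show "y \<in> L" using pair[OF z] x(2) by simp
    qed
  qed
qed

text \<open>The alternating sum detects a single relation \<open>L\<close> among those with at most \<open>D\<close> elements: if the
  range of \<open>L\<close> misses a pair, then the terms cancel along the transposition of this pair; otherwise
  \<open>L\<close> is the graph of \<open>f\<close>, and only \<open>q = id\<close> contributes.\<close>

lemma alternating_sum_agrees:
  assumes f: "f \<in> perms D" and le: "3 * D \<le> m"
    and L: "finite L" "snd ` L = fst ` L" "card L \<le> D"
  shows "(\<Sum>q\<in>perms m. antisymz m (pair_label D) q * (if agrees L (q \<circ> pair_extension D f) then 1 else 0)) =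
    (if L = graph_on {1..D} f then 1 else (0::rat))"
proof -
  let ?y = "antisymz m (pair_label D)" and ?h = "pair_extension D f" and ?S = "label_stabilizer m (pair_label D)"
  let ?F = "\<lambda>q. ?y q * (if agrees L (q \<circ> ?h) then 1 else 0)"
  show ?thesis
  proof (cases "\<exists>i\<in>{1..D}. i \<notin> snd ` L \<and> i + D \<notin> snd ` L")
    case True
    then obtain i where i: "i \<in> {1..D}" "i \<notin> snd ` L" "i + D \<notin> snd ` L" by blast
    let ?t = "transpose i (i + D)"
    have t: "?t \<in> ?S"
      by (rule transpose_in_label_stabilizer) (use i(1) le in \<open>auto simp: pair_label_def\<close>)
    have tp: "?t \<in> perms m" by (rule label_stabilizer_perms[OF t])
    have alt: "?y (?t \<circ> q) = - ?y q" for q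
    proof -
      have "conv m (delta ?t) ?y = gscale (-1) ?y"
        by (rule antisymz_conv_transpose(2)) (use i(1) le in \<open>auto simp: pair_label_def\<close>)
      from fun_cong[OF this, of q] show ?thesis
        by (simp add: conv_delta_left[OF tp] translate_def gscale_def)
    qed
    have ag: "agrees L (?t \<circ> q \<circ> ?h) \<longleftrightarrow> agrees L (q \<circ> ?h)" for q
    proof -
      have "?t (q (?h (fst z))) = snd z \<longleftrightarrow> q (?h (fst z)) = snd z" if "z \<in> L" for z
      proof -
        have "snd z \<in> snd ` L" using that by (rule imageI)
        then have "snd z \<noteq> i" "snd z \<noteq> i + D" using i(2,3) by metis+
        then show ?thesis by (auto simp: transpose_def)
      qed
      then show ?thesis unfolding agrees_def by (simp add: case_prod_unfold)
    qed
    have "(\<Sum>q\<in>perms m. ?F q) = (\<Sum>q\<in>perms m. ?F (?t \<circ> q))" by (rule sum_perms_left[OF tp, symmetric])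
    also have "\<dots> = (\<Sum>q\<in>perms m. - ?F q)" by (rule sum.cong[OF refl]) (simp only: alt ag mult_minus_left)
    also have "\<dots> = - (\<Sum>q\<in>perms m. ?F q)" by (rule sum_negf)
    finally have "(\<Sum>q\<in>perms m. ?F q) = 0" by simp
    moreover have "L \<noteq> graph_on {1..D} f"
    proof
      assume "L = graph_on {1..D} f"
      then have "snd ` L = {1..D}" using L(2) by simp
      with i show False by blast
    qed
    ultimately show ?thesis by simp
  next
    case False
    then have hit: "i \<in> snd ` L \<or> i + D \<in> snd ` L" if "i \<in> {1..D}" for i using that by blast
    have only_graph: "L = graph_on {1..D} f" if "q \<in> ?S" "agrees L (q \<circ> ?h)" for q
      by (rule agrees_pair_extension[OF f le that(1) L hit that(2)])
    show ?thesis
    proof (cases "L = graph_on {1..D} f")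
      case False
      then have "?F q = 0" for q using only_graph[of q] by (auto simp: antisymz_def)
      then have "(\<Sum>q\<in>perms m. ?F q) = 0" by (intro sum.neutral ballI)
      then show ?thesis by (simp only: False if_False)
    next
      case True
      have ag: "agrees L (q \<circ> ?h) \<longleftrightarrow> (\<forall>x\<in>{1..D}. q (f x) = f x)" for q
        unfolding True agrees_def graph_on_def by (auto simp: pair_extension_def)
      have id: "q = id" if q: "q \<in> ?S" and a: "agrees L (q \<circ> ?h)" for q
      proof -
        have qp: "q \<in> perms m" by (rule label_stabilizer_perms[OF q])
        have fixD: "q j = j" if j: "j \<in> {1..D}" for j
        proof -
          have "pinv f j \<in> {1..D}" by (rule perms_image[OF perms_inv[OF f] j])
          then have "q (f (pinv f j)) = f (pinv f j)" using a ag by blast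
          then show ?thesis using f by simp
        qed
        have "q x = x" for x
        proof (cases "D < x \<and> x \<le> 2 * D")
          case True
          then have "x \<in> {1..m}" using le by auto
          then have "pair_label D (q x) = x - D" using q True by (simp add: label_stabilizer_def pair_label_def)
          then have "q x = x - D \<or> q x = x - D + D" using True by (intro pair_label_cases) auto
          moreover have "q x \<noteq> x - D"
          proof
            assume "q x = x - D"
            moreover have "q (x - D) = x - D" by (rule fixD) (use True in auto)
            ultimately have "q x = q (x - D)" by simp
            then have "x = x - D" using perms_inverses(1)[OF qp] by metis
            then show False using True by linarith
          qed
          ultimately show ?thesis using True by simp
        next
          case False
          show ?thesis
          proof (cases "x \<in> {1..D}")
            case True then show ?thesis by (rule fixD)
          next
            case nD: False
            show ?thesis
            proof (cases "x = 0")
              case True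
              then show ?thesis using permutes_not_in[OF perms_permutes[OF qp]] by simp
            next
              case False
              then have "2 * D < x" using nD \<open>\<not> (D < x \<and> x \<le> 2 * D)\<close> by auto
              then show ?thesis by (rule pair_label_fixes[OF q])
            qed
          qed
        qed
        then show ?thesis by auto
      qed
      have ag_id: "agrees L (id \<circ> ?h)" unfolding ag by simp
      have "?F q = (if q = id then 1 else 0)" for q
      proof (cases "q = id")
        case True
        then show ?thesis using ag_id by (simp add: antisymz_def label_stabilizer_id)
      next
        case False
        then show ?thesis using id[of q] by (auto simp: antisymz_def)
      qed
      then have "(\<Sum>q\<in>perms m. ?F q) = (\<Sum>q\<in>perms m. if q = id then 1 else 0)"
        by (intro sum.cong refl)
      also have "\<dots> = 1" by simp
      finally show ?thesis by (simp only: True if_True simp_thms)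
    qed
  qed
qed

text \<open>If the weight were smaller than \<open>D\<close>, then the product of \<open>1 - t\<close> over \<open>D\<close> disjoint transpositions
  would act as 0. Let \<open>f\<close> have the cycle type of a monomial \<open>t0\<close> of degree \<open>D\<close>. The trace of the
  product with the extension of \<open>f\<close> counts the lists of cycles whose union is the graph of \<open>f\<close>,
  weighted by the coefficients of the polynomial; only \<open>t0\<close> has such lists.\<close>

lemma poly_character_lower:
  assumes R: "rep_of_dim m d \<rho>"
    and char: "\<And>g. g \<in> perms m \<Longrightarrow> character \<rho> g = eval_cpoly P (\<lambda>i. of_nat (cycle_count m g (Suc i)))"
    and deg: "\<And>t. t \<in> Poly_Mapping.keys P \<Longrightarrow> weighted_degree t \<le> D"
    and t0: "t0 \<in> Poly_Mapping.keys P" "weighted_degree t0 = D"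
    and le: "3 * D \<le> m"
  shows "\<not> fixed_spanned m d \<rho> (m + 1 - D)"
proof
  assume fs: "fixed_spanned m d \<rho> (m + 1 - D)"
  let ?y = "antisymz m (pair_label D)"
  have sD: "sum_list (cycle_lengths t0) = D" using t0(2) by (simp add: weighted_degree_def)
  have pos: "\<forall>k\<in>set (cycle_lengths t0). 0 < k" using cycle_lengths_pos by blast
  have "sum_list (cycle_lengths t0) \<le> m" unfolding sD using le by linarith
  from ex_perm_of_type[OF pos this]
  obtain f Ls0 where f: "f \<in> perms D" and Ls0: "Ls0 \<in> cycle_families m (cycle_lengths t0)"
    and U0: "\<Union>(set Ls0) = graph_on {1..D} f"
    unfolding sD by blast
  let ?h = "pair_extension D f"
  have h: "?h \<in> perms m" by (rule pair_extension_perms[OF f le])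
  have "act m d \<rho> ?y = 0\<^sub>m d d"
  proof (rule act_zero_if_alternating[OF R fs])
    fix K assume K: "K \<subseteq> {1..m}" "m + 1 - D \<le> card K"
    \<comment> \<open>There are only \<open>m - D\<close> labels, so two points of \<open>K\<close> share one.\<close>
    have "pair_label D ` K \<subseteq> {1..m} - {D<..2 * D}"
    proof
      fix j assume "j \<in> pair_label D ` K"
      then obtain x where x: "x \<in> K" "j = pair_label D x" by blast
      then have "x \<in> {1..m}" using K(1) by blast
      then show "j \<in> {1..m} - {D<..2 * D}" unfolding x(2) by (auto simp: pair_label_def)
    qed
    then have "card (pair_label D ` K) \<le> card ({1..m} - {D<..2 * D})" by (intro card_mono) auto
    also have "\<dots> = m - D" using le by (subst card_Diff_subset) auto
    finally have "\<not> inj_on (pair_label D) K" using K(2) le card_image[of "pair_label D" K] by linarith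
    then obtain u v where uv: "u \<in> K" "v \<in> K" "u \<noteq> v" "pair_label D u = pair_label D v"
      unfolding inj_on_def by blast
    show "\<exists>t. t permutes K \<and> conv m ?y (delta t) = gscale (- 1) ?y"
    proof (intro exI conjI)
      show "transpose u v permutes K" by (rule permutes_swap_id[OF uv(1,2)])
      show "conv m ?y (delta (transpose u v)) = gscale (- 1) ?y"
        by (rule antisymz_conv_transpose(1)) (use uv K(1) in auto)
    qed
  qed
  then have "act m d \<rho> (conv m ?y (delta ?h)) = 0\<^sub>m d d"
    unfolding act_conv[OF R] by (simp add: left_mult_zero_mat[OF act_carrier])
  then have "trace_of d (act m d \<rho> (conv m ?y (delta ?h))) = 0" by (simp add: trace_of_def)
  then have "0 = (\<Sum>k\<in>perms m. ?y (k \<circ> pinv ?h) * character \<rho> k)"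
    unfolding trace_act[OF R] by (simp add: conv_delta_right[OF h antisymz_in])
  also have "\<dots> = (\<Sum>q\<in>perms m. ?y (q \<circ> ?h \<circ> pinv ?h) * character \<rho> (q \<circ> ?h))"
    by (rule sum_perms_right[OF h, symmetric])
  also have "\<dots> = (\<Sum>q\<in>perms m. \<Sum>t\<in>Poly_Mapping.keys P. \<Sum>Ls\<in>cycle_families m (cycle_lengths t).
        Poly_Mapping.lookup P t * (?y q * (if agrees (\<Union>(set Ls)) (q \<circ> ?h) then 1 else 0)))"
    by (intro sum.cong refl)
      (simp only: perms_cancel(5)[OF h] char[OF perms_comp[OF _ h]] eval_cpoly_cycle_count[OF perms_comp[OF _ h]]
        sum_distrib_left mult.left_commute)
  also have "\<dots> = (\<Sum>t\<in>Poly_Mapping.keys P. \<Sum>q\<in>perms m. \<Sum>Ls\<in>cycle_families m (cycle_lengths t).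
        Poly_Mapping.lookup P t * (?y q * (if agrees (\<Union>(set Ls)) (q \<circ> ?h) then 1 else 0)))"
    by (rule sum.swap)
  also have "\<dots> = (\<Sum>t\<in>Poly_Mapping.keys P. \<Sum>Ls\<in>cycle_families m (cycle_lengths t). \<Sum>q\<in>perms m.
        Poly_Mapping.lookup P t * (?y q * (if agrees (\<Union>(set Ls)) (q \<circ> ?h) then 1 else 0)))"
    by (rule sum.cong[OF refl], rule sum.swap)
  also have "\<dots> = (\<Sum>t\<in>Poly_Mapping.keys P. \<Sum>Ls\<in>cycle_families m (cycle_lengths t).
        Poly_Mapping.lookup P t * (if \<Union>(set Ls) = graph_on {1..D} f then 1 else 0))"
  proof (rule sum.cong[OF refl], rule sum.cong[OF refl])
    fix t Ls assume t: "t \<in> Poly_Mapping.keys P" and Ls: "Ls \<in> cycle_families m (cycle_lengths t)"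
    note F = card_Union_cycle_family[OF Ls]
    have "card (\<Union>(set Ls)) \<le> D" using F(1) deg[OF t] by (simp add: weighted_degree_def)
    then show "(\<Sum>q\<in>perms m. Poly_Mapping.lookup P t * (?y q * (if agrees (\<Union>(set Ls)) (q \<circ> ?h) then 1 else 0))) =
        Poly_Mapping.lookup P t * (if \<Union>(set Ls) = graph_on {1..D} f then 1 else 0)"
      unfolding sum_distrib_left[symmetric] by (subst alternating_sum_agrees[OF f le F(2,3)]) simp_all
  qed
  also have "\<dots> = (\<Sum>t\<in>Poly_Mapping.keys P. if t = t0 then
      \<Sum>Ls\<in>cycle_families m (cycle_lengths t0). Poly_Mapping.lookup P t0 * (if \<Union>(set Ls) = graph_on {1..D} f then 1 else 0) else 0)"
  proof (rule sum.cong[OF refl])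
    fix t assume t: "t \<in> Poly_Mapping.keys P"
    have "\<Union>(set Ls) \<noteq> graph_on {1..D} f" if ne: "t \<noteq> t0" and Ls: "Ls \<in> cycle_families m (cycle_lengths t)" for Ls
    proof
      assume U: "\<Union>(set Ls) = graph_on {1..D} f"
      have "D \<le> weighted_degree t"
        using card_Union_cycle_family(1)[OF Ls] unfolding U card_graph_on weighted_degree_def by simp
      then have "sum_list (cycle_lengths t) = D" using deg[OF t] by (simp add: weighted_degree_def)
      then have "mset (cycle_lengths t) = orbit_sizes D f" by (rule cycle_family_determines_type[OF f Ls U])
      moreover have "mset (cycle_lengths t0) = orbit_sizes D f"
        by (rule cycle_family_determines_type[OF f Ls0 U0]) (use t0(2) in \<open>simp add: weighted_degree_def\<close>)
      ultimately have "t = t0" by (intro cycle_lengths_inj) simp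
      with ne show False by blast
    qed
    then show "(\<Sum>Ls\<in>cycle_families m (cycle_lengths t). Poly_Mapping.lookup P t * (if \<Union>(set Ls) = graph_on {1..D} f then 1 else 0)) =
      (if t = t0 then \<Sum>Ls\<in>cycle_families m (cycle_lengths t0). Poly_Mapping.lookup P t0 * (if \<Union>(set Ls) = graph_on {1..D} f then 1 else 0) else 0)"
      by (cases "t = t0") (simp_all add: sum.neutral)
  qed
  also have "\<dots> = Poly_Mapping.lookup P t0 *
      (\<Sum>Ls\<in>cycle_families m (cycle_lengths t0). if \<Union>(set Ls) = graph_on {1..D} f then 1 else 0)"
    using t0(1) by (simp add: sum_distrib_left)
  finally have "(\<Sum>Ls\<in>cycle_families m (cycle_lengths t0). if \<Union>(set Ls) = graph_on {1..D} f then 1 else (0::rat)) = 0"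
    using t0(1) by (simp add: in_keys_iff)
  then have "\<forall>Ls\<in>cycle_families m (cycle_lengths t0). (if \<Union>(set Ls) = graph_on {1..D} f then 1 else (0::rat)) = 0"
    by (subst (asm) sum_nonneg_eq_0_iff) auto
  then show False using Ls0 U0 by auto
qed

section \<open>Stable weights of polynomial characters\<close>

text \<open>The polynomial is either 0, and then the dimension, which is the character at the identity, is 0;
  or its weighted degree is the weight for all large \<open>m\<close>.\<close>

theorem poly_character_weight:
  assumes FB: "is_FB_module W" and PC: "poly_character_from N W"
  shows "(\<forall>m\<ge>N. rep_weight m (W m) = - \<infinity>) \<or>
    (\<exists>D M. (\<forall>m\<ge>N. rep_weight m (W m) \<le> ereal (real D)) \<and> (\<forall>m\<ge>M. rep_weight m (W m) = ereal (real D)))"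
proof -
  obtain P :: cpoly where P: "\<And>m g. N \<le> m \<Longrightarrow> g \<in> perms m \<Longrightarrow>
      character (W m) g = eval_cpoly P (\<lambda>i. of_nat (cycle_count m g (Suc i)))"
    using PC by (auto simp: poly_character_from_def perms_def)
  have "\<forall>m. \<exists>d. rep_of_dim m d (W m)" using FB by (simp add: is_FB_module_def is_rep_iff)
  then obtain d where R: "\<And>m. rep_of_dim m (d m) (W m)" by metis
  show ?thesis
  proof (cases "Poly_Mapping.keys P = {}")
    case True
    have "rep_weight m (W m) = - \<infinity>" if m: "N \<le> m" for m
    proof -
      have "character (W m) id = 0" using P[OF m perms_id] True by (simp add: eval_cpoly_def)
      moreover have "character (W m) id = of_nat (d m)"
        using rep_of_dimD(2)[OF R[of m]] by (simp add: character_def)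
      ultimately show ?thesis using rep_weight_minus_infinity_iff[OF R] by simp
    qed
    then show ?thesis by blast
  next
    case False
    let ?D = "Max (weighted_degree ` Poly_Mapping.keys P)"
    have deg: "weighted_degree t \<le> ?D" if "t \<in> Poly_Mapping.keys P" for t
      using that by (intro Max_ge) auto
    have "?D \<in> weighted_degree ` Poly_Mapping.keys P" using False by (intro Max_in) auto
    then obtain t0 where t0: "t0 \<in> Poly_Mapping.keys P" "weighted_degree t0 = ?D" by force
    have upper: "rep_weight m (W m) \<le> ereal (real ?D)" if m: "N \<le> m" for m
    proof (cases "d m = 0")
      case True
      then show ?thesis using rep_weight_minus_infinity_iff[OF R[of m]] by simp
    next
      case False
      obtain \<mu>s \<mu> where \<mu>: "decomposition m (W m) \<mu>s" "\<mu> \<in> set \<mu>s"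
        "rep_weight m (W m) = ereal (real (partition_weight \<mu>))"
        using rep_weight_attained[OF R False] by blast
      have "partition_weight \<mu> \<le> ?D" by (rule poly_character_upper[OF R P[OF m] deg \<mu>(1,2)])
      then show ?thesis unfolding \<mu>(3) by simp
    qed
    have eq: "rep_weight m (W m) = ereal (real ?D)" if m: "max N (3 * ?D) \<le> m" for m
    proof -
      have mN: "N \<le> m" and m3: "3 * ?D \<le> m" using m by simp_all
      have nfs: "\<not> fixed_spanned m (d m) (W m) (m + 1 - ?D)"
        by (rule poly_character_lower[OF R P[OF mN] deg t0 m3])
      have "d m \<noteq> 0"
      proof
        assume "d m = 0"
        then have "fixed_spanned m (d m) (W m) (m + 1 - ?D)" by (intro fixed_spannedI) auto
        with nfs show False by blast
      qed
      then obtain w where w: "rep_weight m (W m) = ereal (real w)" using rep_weight_attained[OF R[of m]] by blast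
      have "w \<le> ?D" using upper[OF mN] unfolding w by simp
      moreover have "?D \<le> w"
      proof (rule ccontr)
        assume "\<not> ?D \<le> w"
        then have "m + 1 - ?D \<le> m - w" using m3 by linarith
        moreover have "fixed_spanned m (d m) (W m) (m - w)"
          using rep_weight_le_iff[OF R[of m], of w] w by simp
        ultimately show False using nfs fixed_spanned_mono by blast
      qed
      ultimately show ?thesis using w by simp
    qed
    show ?thesis using upper eq by blast
  qed
qed

lemma rep_weight_zero_rep: "rep_weight m zero_rep = - \<infinity>"
proof -
  have "rep_of_dim m 0 zero_rep" by (auto simp: rep_of_dim_def zero_rep_def)
  then show ?thesis using rep_weight_minus_infinity_iff by blast
qed

lemma FB_weight_truncate:
  "FB_weight (FB_truncate N W) = (SUP m\<in>{N..}. rep_weight m (W m))"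
proof (rule antisym)
  show "FB_weight (FB_truncate N W) \<le> (SUP m\<in>{N..}. rep_weight m (W m))"
    unfolding FB_weight_def FB_truncate_def
    by (rule SUP_least) (auto simp: rep_weight_zero_rep intro: SUP_upper)
  show "(SUP m\<in>{N..}. rep_weight m (W m)) \<le> FB_weight (FB_truncate N W)"
    unfolding FB_weight_def
  proof (rule SUP_least)
    fix m assume "m \<in> {N..}"
    then have "rep_weight m (W m) = rep_weight m (FB_truncate N W m)" by (simp add: FB_truncate_def)
    also have "\<dots> \<le> (SUP m. rep_weight m (FB_truncate N W m))" by (rule SUP_upper) simp
    finally show "rep_weight m (W m) \<le> (SUP m. rep_weight m (FB_truncate N W m))" .
  qed
qed

lemma FB_weight_truncate_minus_infinity:
  assumes "\<And>m. N \<le> m \<Longrightarrow> rep_weight m (W m) = - \<infinity>"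
  shows "FB_weight (FB_truncate N W) = - \<infinity>"
proof -
  have "FB_weight (FB_truncate N W) \<le> - \<infinity>"
    unfolding FB_weight_truncate by (rule SUP_least) (simp add: assms)
  then show ?thesis by simp
qed

lemma FB_weight_truncate_eq:
  assumes "\<And>m. N \<le> m \<Longrightarrow> rep_weight m (W m) \<le> w" "\<And>m. M \<le> m \<Longrightarrow> rep_weight m (W m) = w"
  shows "FB_weight (FB_truncate N W) = w"
proof (rule antisym)
  show "FB_weight (FB_truncate N W) \<le> w"
    unfolding FB_weight_truncate by (rule SUP_least) (simp add: assms(1))
  have "w = rep_weight (max N M) (W (max N M))" by (rule assms(2)[symmetric]) simp
  also have "\<dots> \<le> FB_weight (FB_truncate N W)"
    unfolding FB_weight_truncate by (rule SUP_upper) simp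
  finally show "w \<le> FB_weight (FB_truncate N W)" .
qed

text \<open>The two families reach their stable weights at a common \<open>m\<close>, where the weights add up.\<close>

theorem FB_weight_tensor:
  assumes FB: "is_FB_module W1" "is_FB_module W2" and PC: "poly_character_from N W1" "poly_character_from N W2"
  shows "FB_weight (FB_truncate N (FB_tensor W1 W2)) =
    FB_weight (FB_truncate N W1) + FB_weight (FB_truncate N W2)"
proof -
  have "\<forall>m. \<exists>d. rep_of_dim m d (W1 m)" using FB(1) by (simp add: is_FB_module_def is_rep_iff)
  then obtain d where d: "\<And>m. rep_of_dim m (d m) (W1 m)" by metis
  have "\<forall>m. \<exists>e. rep_of_dim m e (W2 m)" using FB(2) by (simp add: is_FB_module_def is_rep_iff)
  then obtain e where e: "\<And>m. rep_of_dim m (e m) (W2 m)" by metis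
  note R = d e
  have vanish: "rep_weight m (FB_tensor W1 W2 m) = - \<infinity>"
    if "rep_weight m (W1 m) = - \<infinity> \<or> rep_weight m (W2 m) = - \<infinity>" for m
  proof -
    have "d m = 0 \<or> e m = 0"
      using that rep_weight_minus_infinity_iff[OF R(1)[of m]] rep_weight_minus_infinity_iff[OF R(2)[of m]] by simp
    then have "d m * e m = 0" by simp
    then show ?thesis
      using rep_weight_minus_infinity_iff[OF rep_of_dim_tensor[OF R(1)[of m] R(2)[of m]]]
      by (simp add: FB_tensor_def)
  qed
  consider "\<forall>m\<ge>N. rep_weight m (W1 m) = - \<infinity>" | "\<forall>m\<ge>N. rep_weight m (W2 m) = - \<infinity>"
    | D1 M1 D2 M2 where
      "\<forall>m\<ge>N. rep_weight m (W1 m) \<le> ereal (real D1)" "\<forall>m\<ge>M1. rep_weight m (W1 m) = ereal (real D1)"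
      "\<forall>m\<ge>N. rep_weight m (W2 m) \<le> ereal (real D2)" "\<forall>m\<ge>M2. rep_weight m (W2 m) = ereal (real D2)"
    using poly_character_weight[OF FB(1) PC(1)] poly_character_weight[OF FB(2) PC(2)] by blast
  then show ?thesis
  proof cases
    case 1
    have "FB_weight (FB_truncate N W2) \<noteq> \<infinity>"
      using poly_character_weight[OF FB(2) PC(2)] FB_weight_truncate_minus_infinity[of N W2]
        FB_weight_truncate_eq[of N W2] by (metis MInfty_neq_PInfty(1) PInfty_neq_ereal(1))
    then show ?thesis
      using FB_weight_truncate_minus_infinity[of N W1] 1
        FB_weight_truncate_minus_infinity[of N "FB_tensor W1 W2"] vanish by simp
  next
    case 2
    have "FB_weight (FB_truncate N W1) \<noteq> \<infinity>"
      using poly_character_weight[OF FB(1) PC(1)] FB_weight_truncate_minus_infinity[of N W1]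
        FB_weight_truncate_eq[of N W1] by (metis MInfty_neq_PInfty(1) PInfty_neq_ereal(1))
    then show ?thesis
      using FB_weight_truncate_minus_infinity[of N W2] 2
        FB_weight_truncate_minus_infinity[of N "FB_tensor W1 W2"] vanish by simp
  next
    case (3 D1 M1 D2 M2)
    have "FB_weight (FB_truncate N (FB_tensor W1 W2)) = ereal (real D1) + ereal (real D2)"
    proof (rule FB_weight_truncate_eq[of _ _ _ "max (max M1 M2) (2 * (D1 + D2))"])
      fix m assume "N \<le> m"
      then have "rep_weight m (W1 m) + rep_weight m (W2 m) \<le> ereal (real D1) + ereal (real D2)"
        using 3 by (intro add_mono) auto
      then show "rep_weight m (FB_tensor W1 W2 m) \<le> ereal (real D1) + ereal (real D2)"
        unfolding FB_tensor_def using rep_weight_tensor_le[OF R(1)[of m] R(2)[of m]] order_trans by blast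
    next
      fix m assume m: "max (max M1 M2) (2 * (D1 + D2)) \<le> m"
      then have w: "rep_weight m (W1 m) = ereal (real D1)" "rep_weight m (W2 m) = ereal (real D2)"
        using 3 by auto
      have "real (2 * (D1 + D2)) \<le> real m" using m by (intro of_nat_mono) simp
      then have "2 * (rep_weight m (W1 m) + rep_weight m (W2 m)) \<le> ereal (real m)"
        unfolding w by simp
      then have "rep_weight m (tensor (W1 m) (W2 m)) = rep_weight m (W1 m) + rep_weight m (W2 m)"
        by (rule rep_weight_tensor_eq[OF R(1)[of m] R(2)[of m]])
      then show "rep_weight m (FB_tensor W1 W2 m) = ereal (real D1) + ereal (real D2)"
        unfolding FB_tensor_def w .
    qed
    moreover have "FB_weight (FB_truncate N W1) = ereal (real D1)"
      by (rule FB_weight_truncate_eq[of _ _ _ M1]) (use 3 in auto)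
    moreover have "FB_weight (FB_truncate N W2) = ereal (real D2)"
      by (rule FB_weight_truncate_eq[of _ _ _ M2]) (use 3 in auto)
    ultimately show ?thesis by simp
  qed
qed

theorem proposition5p2p1:
  shows
    "(\<forall>(m :: nat) (\<rho> :: rep) (\<sigma> :: rep). is_rep m \<rho> \<longrightarrow> is_rep m \<sigma> \<longrightarrow>
        rep_weight m (tensor \<rho> \<sigma>) \<le> rep_weight m \<rho> + rep_weight m \<sigma>) \<and>
     (\<forall>(N :: nat) (W1 :: nat \<Rightarrow> rep) (W2 :: nat \<Rightarrow> rep).
        is_FB_module W1 \<longrightarrow> is_FB_module W2 \<longrightarrow>
        poly_character_from N W1 \<longrightarrow> poly_character_from N W2 \<longrightarrow>
        (\<forall>m :: nat. 2 * (rep_weight m (W1 m) + rep_weight m (W2 m)) \<le> ereal (real m) \<longrightarrow>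
           rep_weight m (tensor (W1 m) (W2 m)) = rep_weight m (W1 m) + rep_weight m (W2 m)) \<and>
        FB_weight (FB_truncate N (FB_tensor W1 W2)) =
          FB_weight (FB_truncate N W1) + FB_weight (FB_truncate N W2)) \<and>
     (\<forall>(\<nu> :: nat list) (\<mu> :: nat list) (m :: nat).
        is_partition \<nu> \<longrightarrow> is_partition \<mu> \<longrightarrow> m \<ge> 2 * (sum_list \<nu> + sum_list \<mu>) \<longrightarrow>
        rep_weight m (tensor (specht (padded \<nu> m)) (specht (padded \<mu> m))) =
          ereal (real (sum_list \<nu> + sum_list \<mu>)))"
proof (intro conjI allI impI)
  fix m \<rho> \<sigma> assume "is_rep m \<rho>" "is_rep m \<sigma>"
  then show "rep_weight m (tensor \<rho> \<sigma>) \<le> rep_weight m \<rho> + rep_weight m \<sigma>"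
    using rep_weight_tensor_le is_rep_iff by blast
next
  fix N W1 W2 and m :: nat
  assume FB: "is_FB_module W1" "is_FB_module W2"
    and le: "2 * (rep_weight m (W1 m) + rep_weight m (W2 m)) \<le> ereal (real m)"
  obtain d e where "rep_of_dim m d (W1 m)" "rep_of_dim m e (W2 m)"
    using FB is_rep_iff unfolding is_FB_module_def by blast
  then show "rep_weight m (tensor (W1 m) (W2 m)) = rep_weight m (W1 m) + rep_weight m (W2 m)"
    by (rule rep_weight_tensor_eq[OF _ _ le])
qed (fact FB_weight_tensor, fact rep_weight_tensor_specht_padded)

end
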